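(* Let $\Delta$ be an irreducible simply-laced root system (not of type $E_8$), $\varpi_k$ a minuscule fundamental weight, $J=I\setminus\{k\}$, $x\in W^J$, and $\lambda=x\varpi_k$ (an arbitrary minuscule weight). Put $l=\ell(x)$, $n=\ell(\lfloor w_\circ\rfloor)$, and let $(\eta_1,\dots,\eta_n)$ and $\mathbf{QW}_{\lambda,w}$ be as in the context. Let $\varrho_0'(Y^\lambda)=\lim_{\mathsf{v}\to0}\varkappa(\varrho(Y^\lambda))$ be the entrywise limit defined in the context. Then for any $w\in W$, the row of this matrix indexed by $w$ is $$\varrho_0'(Y^{\lambda})_{w,\bullet}=\sum_{\mathbf{w}=(w_1,\dots,w_n)\in\mathbf{QW}_{\lambda,w}}g^-_{\mathbf{w}}\,t_{w_l^{-1}\lambda}\,g^+_{\mathbf{w}}\,e_{w_n},$$ where (with $w_0=w$) $$g^-_{\mathbf{w}}=\prod_{1\le t\le l}\begin{cases}1-X^{-w_{t-1}^{-1}\eta_t}&\text{if }w_t=w_{t-1}\text{ and }(\rho,w_{t-1}^{-1}\eta_t)=1\\ -X^{w_{t-1}^{-1}\eta_t}&\text{if }w_t<w_{t-1}\\ 1&\text{otherwise,}\end{cases}$$ $$g^+_{\mathbf{w}}=\prod_{l<t\le n}\begin{cases}1-X^{w_{t-1}^{-1}\eta_t}&\text{if }w_t=w_{t-1}\text{ and }(\rho,w_{t-1}^{-1}\eta_t)=-1\\ X^{w_{t-1}^{-1}\eta_t}&\text{if }w_t<w_{t-1}\\ -1&\text{if }w_t>w_{t-1}\\ 1&\text{o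therwise.}\end{cases}$$
   Context: **Root data.** $\Delta$ is an irreducible simply-laced root system with positive roots $\Delta^+$, simple roots $\{\alpha_i\}_{i\in I}$, highest root $\theta$, fundamental weights $\varpi_i$, weight lattice $P$, root lattice $Q$, half-sum of positive roots $\rho$, and Weyl group $W=\langle s_i\mid i\in I\rangle$ with length $\ell$, Bruhat order $<$ and longest element $w_\circ$. $(\cdot,\cdot)$ is the $W$-invariant form with $(\alpha,\alpha)=2$ for $\alpha\in\Delta$. A weight $\lambda$ is minuscule if $(\lambda,\alpha)\in\{0,\pm1\}$ for all $\alpha\in\Delta$. For a minuscule fundamental weight $\varpi_k$: $J=I\setminus\{k\}$, $W_J=\langle s_j\mid j\in J\rangle$, $W^J$ is the set of minimal-length representatives of $W/W_J$, and $\lfloor w\rfloor\in W^J$ is the minimal representative of $wW_J$. **Root sequence.** For $x\in W^J$ let $y\in W$ be the unique element with $\lfloor w_\circ\rfloor=yx$; then $\ell(\lfloor w_\circ\rfloor)=\ell(y)+\ell(x)$. Put $l=\ell(x)$, $m=\ell(y)$, $n=l+m$. Fix reduced expressions $x=s_{j_l}\cdots s_{j_1}$, $y=s_{i_1}\cdots s_{i_m}$; set $\beta_r=s_{j_l}\cdots s_{j_{r+1}}(\alpha_{j_r})$ ($1\le r\le l$), $\gamma_s=s_{i_m}\cdots s_{i_{s+1}}(\alpha_{i_s})$ ($1\le s\le m$), and $(\eta_1,\dots,\eta_n)=(\beta_l,\dots,\beta_1,\gamma_1,\dots,\gamma_m)$. **Quantum walks.** The quantum Bruhat graph $\mathrm{QBG}(W)$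 has vertex set $W$ and directed edges $u\to us_\alpha$ ($\alpha\in\Delta^+$) whenever $\ell(us_\alpha)=\ell(u)+1$ or $\ell(us_\alpha)=\ell(u)-2(\rho,\alpha)+1$. For $w\in W$, $\mathbf{QW}_{\lambda,w}$ is the set of sequences $(w_1,\dots,w_n)$ in $W$ such that, with $w_0=w$, for every $1\le t\le n$ either $w_t=w_{t-1}$, or $w_t=s_{\eta_t}w_{t-1}$ and $w_{t-1}\to w_t$ is an edge of $\mathrm{QBG}(W)$. **Extended affine Weyl group.** $W_{\mathrm{ex}}=W\ltimes P$ with translations $t_\mu$, $\mu\in P$. Let $e$ be the smallest positive integer with $e\cdot(P,P)\subset\mathbb{Z}$. $W_{\mathrm{ex}}$ acts on $P\oplus\mathbb{Z}\frac{\delta}{e}$ by $wt_\mu(\lambda)=w(\lambda)-(\mu,\lambda)\delta$, $wt_\mu(\delta)=\delta$. Let $I_{\mathrm{af}}=I\sqcup\{0\}$, $\alpha_0=-\theta+\delta$, $s_0=s_{\alpha_0}\in W\ltimes Q$, and $\Pi\cong P/Q$ the subgroup of length-zero elements of $W_{\mathrm{ex}}$. **DAHA and polynomial representation.** $\mathbb{K}_0=\mathbb{Q}(\mathsf{q}^{1/e},\mathsf{v})$ with $\mathsf{q}^{1/e},\mathsf{v}$ independent parameters, and $\mathsf{t}=\mathsf{v}^2$. $\mathbb{K}_0[P]$ is the group algebra with basis $X^\nu$ ($\nu\in P$), $\mathbb{K}_0(P)$ its fraction field, and $X^{\delta/e}=\mathsf{q}^{1/e}$. $W_{\mathrm{ex}}$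 acts by automorphisms: $t_\mu w(X^\nu)=\mathsf{q}^{-(\mu,w\nu)}X^{w\nu}$. The smash product $\mathbb{K}_0(P)\rtimes W_{\mathrm{ex}}$ is the algebra of difference-reflection operators, with elements uniquely sums of $f\,t_\mu u$ ($f\in\mathbb{K}_0(P)$, $\mu\in P$, $u\in W$). The double affine Hecke algebra (generated by $T_i$ ($i\in I_{\mathrm{af}}$), $X^\nu$ ($\nu\in P$), $\pi\in\Pi$) acts faithfully on $\mathbb{K}_0[P]$ by the polynomial representation $\varrho$: $X^\nu$ acts by multiplication, $\pi=t_\mu w\in\Pi\subset W_{\mathrm{ex}}$ ($\mu\in P$, $w\in W$) by the automorphism $X^\nu\mapsto\mathsf{q}^{-(\mu,w\nu)}X^{w\nu}$, and $$\varrho(T_i)=\frac{\mathsf{t}X^{\alpha_i}-1}{X^{\alpha_i}-1}s_i+\frac{1-\mathsf{t}}{X^{\alpha_i}-1}\qquad(i\in I_{\mathrm{af}}).$$ The $T_i$ satisfy the braid relations and $(T_i-\mathsf{t})(T_i+1)=0$. For $\nu\in P$ with reduced expression $t_\nu=\pi s_{i_1}\cdots s_{i_\ell}$ ($\pi\in\Pi$, $i_k\in I_{\mathrm{af}}$), $Y^\nu=\mathsf{v}^{-\sum_{k}\epsilon_k}\pi T_{i_1}^{\epsilon_1}\cdots T_{i_\ell}^{\epsilon_\ell}$, where $\epsilon_k=+1$ if $\pi s_{i_1}\cdots s_{i_{k-1}}(\alpha_{i_k})\in-\Delta^++\mathbb{Z}\delta$ and $\epsilon_k=-1$ if it lies in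 $\Delta^++\mathbb{Z}\delta$; this is independent of the reduced expression. **Limit.** For a ring $R$, $\mathrm{Mat}_W(R)$ denotes $W\times W$ matrices over $R$; for $A\in\mathrm{Mat}_W(R)$, $A_{w,\bullet}=\sum_{v\in W}A_{w,v}e_v$ is the row indexed by $w$, where $\{e_v\}$ is the standard basis of $R^{|W|}$. The homomorphism $\varkappa:\mathbb{K}_0(P)\rtimes W_{\mathrm{ex}}\to\mathrm{Mat}_W(\mathbb{K}_0(P)\rtimes P)$ (where $P$ stands for the translations $t_\mu$) is $$\varkappa(f t_\mu u)_{vw}=\begin{cases}(v^{-1}\cdot f)\big|_{X^\nu\mapsto\mathsf{t}^{-(\rho,\nu)}X^\nu}\ \mathsf{t}^{(\rho,v^{-1}\mu)}\,t_{v^{-1}(\mu)}&\text{if }v=uw\\ 0&\text{otherwise.}\end{cases}$$ For $\mathsf{v}\to0$, rational-function coefficients are expanded as Laurent series in $\mathsf{v}$ with coefficients in $\mathbb{Z}[\mathsf{q}^{\pm1/e}][P]$, and $\varrho'_0(Y^\lambda):=\lim_{\mathsf{v}\to0}\varkappa(\varrho(Y^\lambda))$ is the entrywise limit (it exists for all $\lambda\in P$, by a theorem of Cherednik–Orr). Its entries lie in the $q$-Heisenberg algebra generated by $X^\nu$, $t_\mu$ ($\nu,\mu\in P$) with $X^\lambda X^\nu=X^{\lambda+\nu}$, $t_\mu t_\xi=t_{\mu+\xi}$, $X^0=t_0=1$, $X^\nu t_\mu=\mathsf{q}^{(\mu,\nu)}t_\mu X^\nu$. *)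

theory Defs
  imports
    "HOL-Analysis.Analysis"
    "HOL-Library.Poly_Mapping"
    "HOL-Computational_Algebra.Computational_Algebra"
begin

section \<open>Root systems and Weyl groups\<close>

definition refl :: "'a::euclidean_space \<Rightarrow> 'a \<Rightarrow> 'a" where
  "refl a x = x - (2 * (x \<bullet> a) / (a \<bullet> a)) *\<^sub>R a"

text \<open>Reduced crystallographic root systems.\<close>

definition root_system :: "'a::euclidean_space set \<Rightarrow> bool" where
  "root_system \<Delta> \<longleftrightarrow>
     finite \<Delta> \<and> span \<Delta> = UNIV \<and> 0 \<notin> \<Delta> \<and>
     (\<forall>a\<in>\<Delta>. refl a ` \<Delta> = \<Delta>) \<and>
     (\<forall>a\<in>\<Delta>. \<forall>b\<in>\<Delta>. 2 * (a \<bullet> b) / (b \<bullet> b) \<in> \<int>) \<and>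
     (\<forall>a\<in>\<Delta>. \<forall>c. c *\<^sub>R a \<in> \<Delta> \<longrightarrow> c = 1 \<or> c = -1)"

definition irreducible_roots :: "'a::euclidean_space set \<Rightarrow> bool" where
  "irreducible_roots \<Delta> \<longleftrightarrow> \<Delta> \<noteq> {} \<and>
     \<not> (\<exists>A B. A \<noteq> {} \<and> B \<noteq> {} \<and> A \<inter> B = {} \<and> A \<union> B = \<Delta> \<and> (\<forall>a\<in>A. \<forall>b\<in>B. a \<bullet> b = 0))"

text \<open>
  Simply-laced, with the inner product of the ambient space normalised to be the invariant form
  for which all roots have square length 2. Roots and coroots are then identified.
\<close>

definition simply_laced :: "'a::euclidean_space set \<Rightarrow> bool" where
  "simply_laced \<Delta> \<longleftrightarrow> (\<forall>a\<in>\<Delta>. a \<bullet> a = 2)"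

text \<open>
  The index set \<open>I\<close> of the simple roots is the type \<open>'i\<close>. Its linear order is arbitrary and carries
  no mathematical content; it makes the group algebra of \<open>\<int>\<^sup>I\<close> an instance of \<^class>\<open>idom\<close>.
\<close>

definition nonneg_span :: "('i::{finite,linorder} \<Rightarrow> 'a::euclidean_space) \<Rightarrow> 'a set" where
  "nonneg_span \<alpha> = {\<Sum>i\<in>UNIV. of_nat (c i) *\<^sub>R \<alpha> i | c :: 'i \<Rightarrow> nat. True}"

definition simple_system :: "'a::euclidean_space set \<Rightarrow> ('i::{finite,linorder} \<Rightarrow> 'a) \<Rightarrow> bool" where
  "simple_system \<Delta> \<alpha> \<longleftrightarrow> inj \<alpha> \<and> range \<alpha> \<subseteq> \<Delta> \<and> independent (range \<alpha>) \<and>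
     (\<forall>b\<in>\<Delta>. b \<in> nonneg_span \<alpha> \<or> - b \<in> nonneg_span \<alpha>)"

definition E8_edges :: "(nat \<times> nat) set" where
  "E8_edges = {(1,3), (3,4), (4,5), (5,6), (6,7), (7,8), (2,4)}"

definition type_E8 :: "('i::{finite,linorder} \<Rightarrow> 'a::euclidean_space) \<Rightarrow> bool" where
  "type_E8 \<alpha> \<longleftrightarrow> (\<exists>f. bij_betw f {1..8::nat} (UNIV :: 'i set) \<and>
     (\<forall>a\<in>{1..8}. \<forall>b\<in>{1..8}. \<alpha> (f a) \<bullet> \<alpha> (f b) =
        (if a = b then 2 else if (a, b) \<in> E8_edges \<or> (b, a) \<in> E8_edges then -1 else 0)))"

context
  fixes \<Delta> :: "'a::euclidean_space set" and \<alpha> :: "'i::{finite,linorder} \<Rightarrow> 'a"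
begin

definition pos_roots :: "'a set" where
  "pos_roots = \<Delta> \<inter> nonneg_span \<alpha>"

definition highest_root :: "'a" where
  "highest_root = (THE \<theta>. \<theta> \<in> \<Delta> \<and> (\<forall>b\<in>\<Delta>. \<theta> - b \<in> nonneg_span \<alpha>))"

definition half_sum :: "'a" where
  "half_sum = (1/2) *\<^sub>R (\<Sum>a\<in>pos_roots. a)"

text \<open>The basis dual to the simple coroots, which here are the simple roots.\<close>

definition fund_weight :: "'i \<Rightarrow> 'a" where
  "fund_weight k = (THE \<nu>. \<forall>i. \<nu> \<bullet> \<alpha> i = (if i = k then 1 else 0))"

definition weight_lattice :: "'a set" where
  "weight_lattice = {\<Sum>i\<in>UNIV. of_int (c i) *\<^sub>R fund_weight i | c :: 'i \<Rightarrow> int. True}"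

definition minuscule :: "'a \<Rightarrow> bool" where
  "minuscule \<nu> \<longleftrightarrow> \<nu> \<in> weight_lattice \<and> (\<forall>a\<in>\<Delta>. \<nu> \<bullet> a \<in> {0, 1, -1})"

text \<open>Elements of \<open>W\<close> are maps on the ambient space; \<open>word_prod [i\<^sub>1,\<dots>,i\<^sub>r]\<close> is \<open>s\<^bsub>i\<^sub>1\<^esub> \<cdots> s\<^bsub>i\<^sub>r\<^esub>\<close>.\<close>

definition word_prod :: "'i list \<Rightarrow> 'a \<Rightarrow> 'a" where
  "word_prod js = foldr (\<lambda>j u. refl (\<alpha> j) \<circ> u) js id"

definition parabolic :: "'i set \<Rightarrow> ('a \<Rightarrow> 'a) set" where
  "parabolic J = word_prod ` lists J"

definition weyl :: "('a \<Rightarrow> 'a) set" where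
  "weyl = parabolic UNIV"

definition len :: "('a \<Rightarrow> 'a) \<Rightarrow> nat" where
  "len u = (LEAST r. \<exists>js. length js = r \<and> word_prod js = u)"

definition longest :: "'a \<Rightarrow> 'a" where
  "longest = (THE u. u \<in> weyl \<and> (\<forall>u'\<in>weyl. len u' \<le> len u))"

definition min_reps :: "'i set \<Rightarrow> ('a \<Rightarrow> 'a) set" where
  "min_reps J = {u \<in> weyl. \<forall>u'\<in>parabolic J. len u \<le> len (u \<circ> u')}"

definition min_rep :: "'i set \<Rightarrow> ('a \<Rightarrow> 'a) \<Rightarrow> 'a \<Rightarrow> 'a" where
  "min_rep J u = (THE u'. u' \<in> min_reps J \<and> u' \<in> (\<lambda>p. u \<circ> p) ` parabolic J)"

definition bruhat_less :: "('a \<Rightarrow> 'a) \<Rightarrow> ('a \<Rightarrow> 'a) \<Rightarrow> bool" where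
  "bruhat_less = tranclp (\<lambda>u u'. u \<in> weyl \<and> (\<exists>a\<in>pos_roots. u' = u \<circ> refl a) \<and> len u < len u')"

definition qbg_edge :: "('a \<Rightarrow> 'a) \<Rightarrow> ('a \<Rightarrow> 'a) \<Rightarrow> bool" where
  "qbg_edge u u' \<longleftrightarrow> u \<in> weyl \<and> (\<exists>a\<in>pos_roots. u' = u \<circ> refl a \<and>
     (len u' = len u + 1 \<or> real (len u') = real (len u) - 2 * (half_sum \<bullet> a) + 1))"

section \<open>Root sequences and quantum walks\<close>

text \<open>
  For \<open>x = s\<^bsub>j l\<^esub> \<cdots> s\<^bsub>j 1\<^esub>\<close> and \<open>y = s\<^bsub>i 1\<^esub> \<cdots> s\<^bsub>i m\<^esub>\<close>. The list of roots is indexed from 0, so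
  \<open>\<eta>\<^sub>t\<close> is entry \<open>t - 1\<close>.
\<close>

definition root_beta :: "nat \<Rightarrow> (nat \<Rightarrow> 'i) \<Rightarrow> nat \<Rightarrow> 'a" where
  "root_beta l j r = word_prod (map j (rev [r+1..<l+1])) (\<alpha> (j r))"

definition root_gamma :: "nat \<Rightarrow> (nat \<Rightarrow> 'i) \<Rightarrow> nat \<Rightarrow> 'a" where
  "root_gamma m i s = word_prod (map i (rev [s+1..<m+1])) (\<alpha> (i s))"

definition root_seq :: "nat \<Rightarrow> (nat \<Rightarrow> 'i) \<Rightarrow> nat \<Rightarrow> (nat \<Rightarrow> 'i) \<Rightarrow> nat \<Rightarrow> 'a" where
  "root_seq l j m i t =
     (map (root_beta l j) (rev [1..<l+1]) @ map (root_gamma m i) [1..<m+1]) ! (t - 1)"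

text \<open>A walk \<open>(w\<^sub>1,\<dots>,w\<^sub>n)\<close> from \<open>w\<close> is a list \<open>ws\<close>, and \<open>(w # ws) ! t\<close> is \<open>w\<^sub>t\<close> with \<open>w\<^sub>0 = w\<close>.\<close>

definition quantum_walks :: "nat \<Rightarrow> (nat \<Rightarrow> 'a) \<Rightarrow> ('a \<Rightarrow> 'a) \<Rightarrow> ('a \<Rightarrow> 'a) list set" where
  "quantum_walks n \<eta> w = {ws. length ws = n \<and> set ws \<subseteq> weyl \<and>
     (\<forall>t\<in>{1..n}. (w # ws) ! t = (w # ws) ! (t - 1) \<or>
        ((w # ws) ! t = refl (\<eta> t) \<circ> (w # ws) ! (t - 1) \<and>
         qbg_edge ((w # ws) ! (t - 1)) ((w # ws) ! t)))}"

section \<open>The extended affine Weyl group\<close>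

definition form_denom :: nat where
  "form_denom = (LEAST e. e > 0 \<and> (\<forall>\<mu>\<in>weight_lattice. \<forall>\<nu>\<in>weight_lattice. real e * (\<mu> \<bullet> \<nu>) \<in> \<int>))"

text \<open>The pair \<open>(\<mu>, u)\<close> stands for \<open>t\<^sub>\<mu> u\<close>, and the affine weight \<open>\<nu> + c\<delta>\<close> is the pair \<open>(\<nu>, c)\<close>.\<close>

definition wex :: "('a \<times> ('a \<Rightarrow> 'a)) set" where
  "wex = weight_lattice \<times> weyl"

definition wex_one :: "'a \<times> ('a \<Rightarrow> 'a)" where
  "wex_one = (0, id)"

definition wex_mult :: "'a \<times> ('a \<Rightarrow> 'a) \<Rightarrow> 'a \<times> ('a \<Rightarrow> 'a) \<Rightarrow> 'a \<times> ('a \<Rightarrow> 'a)" where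
  "wex_mult g h = (fst g + snd g (fst h), snd g \<circ> snd h)"

text \<open>From \<open>u t\<^sub>\<mu>(\<nu>) = u \<nu> - (\<mu>,\<nu>)\<delta>\<close> and \<open>t\<^sub>\<mu> u = u t\<^bsub>u\<^sup>-\<^sup>1\<mu>\<^esub>\<close>.\<close>

definition wex_act :: "'a \<times> ('a \<Rightarrow> 'a) \<Rightarrow> 'a \<times> real \<Rightarrow> 'a \<times> real" where
  "wex_act g \<nu> = (snd g (fst \<nu>), snd \<nu> - fst g \<bullet> snd g (fst \<nu>))"

text \<open>The affine index set is \<^typ>\<open>'i option\<close>, with \<^const>\<open>None\<close> as the node 0.\<close>

definition aff_simple :: "'i option \<Rightarrow> 'a \<times> real" where
  "aff_simple i = (case i of None \<Rightarrow> (- highest_root, 1) | Some i' \<Rightarrow> (\<alpha> i', 0))"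

text \<open>The reflection in \<open>a + c\<delta>\<close> sends \<open>\<nu>\<close> to \<open>\<nu> - (\<nu>,a)(a + c\<delta>)\<close> and is \<open>t\<^bsub>-ca\<^esub> s\<^sub>a\<close>.\<close>

definition aff_refl :: "'a \<times> real \<Rightarrow> 'a \<times> ('a \<Rightarrow> 'a)" where
  "aff_refl b = (- snd b *\<^sub>R fst b, refl (fst b))"

definition aff_pos_roots :: "('a \<times> real) set" where
  "aff_pos_roots = {(a, of_int c) | a c. a \<in> \<Delta> \<and> (c > 0 \<or> c = 0 \<and> a \<in> pos_roots)}"

definition wex_len :: "'a \<times> ('a \<Rightarrow> 'a) \<Rightarrow> nat" where
  "wex_len g = card {b \<in> aff_pos_roots. - wex_act g b \<in> aff_pos_roots}"

definition wex_Pi :: "('a \<times> ('a \<Rightarrow> 'a)) set" where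
  "wex_Pi = {g \<in> wex. wex_len g = 0}"

definition aff_word_prod :: "'i option list \<Rightarrow> 'a \<times> ('a \<Rightarrow> 'a)" where
  "aff_word_prod js = foldr (\<lambda>j g. wex_mult (aff_refl (aff_simple j)) g) js wex_one"

definition wex_reduced_expr ::
  "'a \<times> ('a \<Rightarrow> 'a) \<Rightarrow> 'a \<times> ('a \<Rightarrow> 'a) \<Rightarrow> 'i option list \<Rightarrow> bool" where
  "wex_reduced_expr g p js \<longleftrightarrow>
     p \<in> wex_Pi \<and> g = wex_mult p (aff_word_prod js) \<and> length js = wex_len g"

end

section \<open>The coefficient field and the function field\<close>

text \<open>
  \<open>\<rat>(q\<^bsup>1/e\<^esup>, v)\<close> as the fraction field of \<open>\<rat>[q\<^bsup>1/e\<^esup>][v]\<close>. Weights enter the group algebra through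
  their coordinates in the basis of fundamental weights.
\<close>

type_synonym K0 = "rat poly poly fract"
type_synonym 'i wt = "'i \<Rightarrow>\<^sub>0 int"
type_synonym 'i K0P = "'i wt \<Rightarrow>\<^sub>0 K0"
type_synonym 'i K0Pf = "'i K0P fract"

definition q_root :: K0 where "q_root = Fract [:[:0, 1:]:] 1"
definition v_par :: K0 where "v_par = Fract [:0, 1:] 1"
definition t_par :: K0 where "t_par = v_par ^ 2"

text \<open>Extension of an injective ring endomorphism of a domain to its fraction field.\<close>

definition fract_ext :: "('b::idom \<Rightarrow> 'b) \<Rightarrow> 'b fract \<Rightarrow> 'b fract" where
  "fract_ext \<phi> z = (THE y. \<forall>a b. b \<noteq> 0 \<longrightarrow> z = Fract a b \<longrightarrow> y = Fract (\<phi> a) (\<phi> b))"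

definition scalar :: "K0 \<Rightarrow> 'i::{finite,linorder} K0Pf" where
  "scalar c = Fract (Poly_Mapping.single 0 c) 1"

text \<open>
  Difference-reflection operators: \<open>\<Sum> f t\<^sub>\<mu> u\<close> has coefficient \<open>f\<close> at \<open>(\<mu>, u)\<close>. The algebra
  \<open>\<bbbK>\<^sub>0(P) \<rtimes> W\<^sub>e\<^sub>x\<close> consists of the elements supported in \<open>wex\<close>.
  The entries of matrices over \<open>\<bbbK>\<^sub>0(P) \<rtimes> P\<close> have coefficient \<open>f\<close> at \<open>\<mu>\<close> for \<open>f t\<^sub>\<mu>\<close>.
\<close>

type_synonym ('a, 'i) smash = "('a \<times> ('a \<Rightarrow> 'a)) \<Rightarrow>\<^sub>0 'i K0Pf"
type_synonym ('a, 'i) qtorus = "'a \<Rightarrow>\<^sub>0 'i K0Pf"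

text \<open>
  \<open>\<int>[q\<^bsup>\<plusminus>1/e\<^esup>][P]\<close>, the first \<open>int\<close> being the exponent of \<open>q\<^bsup>1/e\<^esup>\<close>, and the \<open>q\<close>-Heisenberg algebra in
  normally ordered form \<open>\<Sum> f t\<^sub>\<mu>\<close>.
\<close>

type_synonym 'i laur = "'i wt \<Rightarrow>\<^sub>0 (int \<Rightarrow>\<^sub>0 int)"
type_synonym ('a, 'i) heis = "'a \<Rightarrow>\<^sub>0 'i laur"

section \<open>Limits of rational functions as \<open>v \<rightarrow> 0\<close>\<close>

definition laur_embed :: "'i::{finite,linorder} laur \<Rightarrow> 'i K0P" where
  "laur_embed r = (\<Sum>n\<in>Poly_Mapping.keys r. Poly_Mapping.single n
     (\<Sum>c\<in>Poly_Mapping.keys (Poly_Mapping.lookup r n).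
        of_int (Poly_Mapping.lookup (Poly_Mapping.lookup r n) c) * q_root powi c))"

definition laur_poly_embed :: "'i::{finite,linorder} laur poly \<Rightarrow> 'i K0P" where
  "laur_poly_embed A =
     (\<Sum>r\<le>Polynomial.degree A. Poly_Mapping.single 0 (v_par ^ r) * laur_embed (poly.coeff A r))"

text \<open>\<open>F\<close> is the expansion at \<open>v = 0\<close> of the rational function \<open>f\<close>; such \<open>F\<close> is unique.\<close>

definition v_expansion :: "'i::{finite,linorder} K0Pf \<Rightarrow> 'i laur fls \<Rightarrow> bool" where
  "v_expansion f F \<longleftrightarrow> (\<exists>A B. B \<noteq> 0 \<and> f = Fract (laur_poly_embed A) (laur_poly_embed B) \<and>
     fps_to_fls (fps_of_poly B) * F = fps_to_fls (fps_of_poly A))"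

definition has_v_limit :: "'i::{finite,linorder} K0Pf \<Rightarrow> 'i laur \<Rightarrow> bool" where
  "has_v_limit f L \<longleftrightarrow> (\<exists>F. v_expansion f F \<and> fls_subdegree F \<ge> 0 \<and> L = fls_nth F 0)"

definition entry_has_v_limit :: "('a, 'i::{finite,linorder}) qtorus \<Rightarrow> ('a, 'i) heis \<Rightarrow> bool" where
  "entry_has_v_limit a h \<longleftrightarrow>
     (\<forall>\<mu>. has_v_limit (Poly_Mapping.lookup a \<mu>) (Poly_Mapping.lookup h \<mu>))"

context
  fixes \<Delta> :: "'a::euclidean_space set" and \<alpha> :: "'i::{finite,linorder} \<Rightarrow> 'a"
begin

definition wt_of :: "'a \<Rightarrow> 'i wt" where
  "wt_of \<nu> = (\<Sum>i\<in>UNIV. Poly_Mapping.single i \<lfloor>\<nu> \<bullet> \<alpha> i\<rfloor>)"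

definition vec_of :: "'i wt \<Rightarrow> 'a" where
  "vec_of c = (\<Sum>i\<in>UNIV. of_int (Poly_Mapping.lookup c i) *\<^sub>R fund_weight \<alpha> i)"

text \<open>\<open>q\<^sup>c\<close> for \<open>c \<in> (1/e)\<int>\<close>, as an integral power of \<open>q\<^bsup>1/e\<^esup>\<close>; \<open>q_exp\<close> is the exponent.\<close>

definition q_exp :: "real \<Rightarrow> int" where
  "q_exp c = \<lfloor>real (form_denom \<alpha>) * c\<rfloor>"

definition q_pow :: "real \<Rightarrow> K0" where
  "q_pow c = q_root powi q_exp c"

text \<open>\<open>t\<^sup>c = v\<^sup>2\<^sup>c\<close> for \<open>c \<in> (1/2)\<int>\<close>.\<close>

definition t_pow :: "real \<Rightarrow> K0" where
  "t_pow c = v_par powi \<lfloor>2 * c\<rfloor>"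

definition X_aff :: "'a \<times> real \<Rightarrow> 'i K0Pf" where
  "X_aff b = Fract (Poly_Mapping.single (wt_of (fst b)) (q_pow (snd b))) 1"

subsection \<open>The smash product\<close>

definition wex_act_poly :: "'a \<times> ('a \<Rightarrow> 'a) \<Rightarrow> 'i K0P \<Rightarrow> 'i K0P" where
  "wex_act_poly g f = (\<Sum>n\<in>Poly_Mapping.keys f.
     Poly_Mapping.single (wt_of (snd g (vec_of n)))
       (Poly_Mapping.lookup f n * q_pow (- (fst g \<bullet> snd g (vec_of n)))))"

definition wex_act_fun :: "'a \<times> ('a \<Rightarrow> 'a) \<Rightarrow> 'i K0Pf \<Rightarrow> 'i K0Pf" where
  "wex_act_fun g = fract_ext (wex_act_poly g)"

definition smash_one :: "('a, 'i) smash" where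
  "smash_one = Poly_Mapping.single wex_one 1"

definition smash_mult :: "('a, 'i) smash \<Rightarrow> ('a, 'i) smash \<Rightarrow> ('a, 'i) smash" where
  "smash_mult A B = (\<Sum>g\<in>Poly_Mapping.keys A. \<Sum>h\<in>Poly_Mapping.keys B.
     Poly_Mapping.single (wex_mult g h)
       (Poly_Mapping.lookup A g * wex_act_fun g (Poly_Mapping.lookup B h)))"

definition smash_inverse :: "('a, 'i) smash \<Rightarrow> ('a, 'i) smash" where
  "smash_inverse A = (THE B. Poly_Mapping.keys B \<subseteq> wex \<alpha> \<and>
     smash_mult A B = smash_one \<and> smash_mult B A = smash_one)"

definition smash_scalar :: "K0 \<Rightarrow> ('a, 'i) smash" where
  "smash_scalar c = Poly_Mapping.single wex_one (scalar c)"

subsection \<open>The polynomial representation\<close>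

text \<open>
  The representation is faithful, so its image in the smash product is used in place of the
  double affine Hecke algebra.
\<close>

definition rho_T :: "'i option \<Rightarrow> ('a, 'i) smash" where
  "rho_T i = (let X = X_aff (aff_simple \<Delta> \<alpha> i) in
     Poly_Mapping.single (aff_refl (aff_simple \<Delta> \<alpha> i)) ((scalar t_par * X - 1) / (X - 1)) +
     Poly_Mapping.single wex_one ((1 - scalar t_par) / (X - 1)))"

definition rho_Pi :: "'a \<times> ('a \<Rightarrow> 'a) \<Rightarrow> ('a, 'i) smash" where
  "rho_Pi p = Poly_Mapping.single p 1"

text \<open>
  The \<open>k\<close>-th sign, counting from 0: the affine root \<open>\<pi> s\<^bsub>i\<^sub>1\<^esub> \<cdots> s\<^bsub>i\<^sub>k\<^esub>(\<alpha>\<^bsub>i\<^sub>k\<^sub>+\<^sub>1\<^esub>)\<close> has a finite part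
  in \<open>\<Delta>\<close>, which is either positive or negative.
\<close>

definition Y_sign :: "'a \<times> ('a \<Rightarrow> 'a) \<Rightarrow> 'i option list \<Rightarrow> nat \<Rightarrow> int" where
  "Y_sign p js k =
     (if - fst (wex_act (wex_mult p (aff_word_prod \<Delta> \<alpha> (take k js))) (aff_simple \<Delta> \<alpha> (js ! k)))
           \<in> pos_roots \<Delta> \<alpha>
      then 1 else -1)"

definition rho_Y_word :: "'a \<times> ('a \<Rightarrow> 'a) \<Rightarrow> 'i option list \<Rightarrow> ('a, 'i) smash" where
  "rho_Y_word p js =
     smash_mult (smash_scalar (v_par powi (- (\<Sum>k<length js. Y_sign p js k))))
       (smash_mult (rho_Pi p)
         (foldr smash_mult
           (map (\<lambda>k. if Y_sign p js k = 1 then rho_T (js ! k) else smash_inverse (rho_T (js ! k)))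
             [0..<length js])
           smash_one))"

text \<open>Independent of the choice of the reduced expression \<open>t\<^sub>\<nu> = \<pi> s\<^bsub>i\<^sub>1\<^esub> \<cdots> s\<^bsub>i\<^sub>r\<^esub>\<close>.\<close>

definition rho_Y :: "'a \<Rightarrow> ('a, 'i) smash" where
  "rho_Y \<nu> = (let c = (SOME c. wex_reduced_expr \<Delta> \<alpha> (\<nu>, id) (fst c) (snd c))
     in rho_Y_word (fst c) (snd c))"

subsection \<open>The matrix representation and its limit\<close>

definition rho_shift_poly :: "'i K0P \<Rightarrow> 'i K0P" where
  "rho_shift_poly f = (\<Sum>n\<in>Poly_Mapping.keys f.
     Poly_Mapping.single n (Poly_Mapping.lookup f n * t_pow (- (half_sum \<Delta> \<alpha> \<bullet> vec_of n))))"

definition kappa :: "('a, 'i) smash \<Rightarrow> ('a \<Rightarrow> 'a) \<Rightarrow> ('a \<Rightarrow> 'a) \<Rightarrow> ('a, 'i) qtorus" where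
  "kappa A v w = (\<Sum>(\<mu>, u)\<in>Poly_Mapping.keys A. if v = u \<circ> w
     then Poly_Mapping.single (inv v \<mu>)
       (fract_ext rho_shift_poly (wex_act_fun (0, inv v) (Poly_Mapping.lookup A (\<mu>, u))) *
        scalar (t_pow (half_sum \<Delta> \<alpha> \<bullet> inv v \<mu>)))
     else 0)"

definition rho0_Y :: "'a \<Rightarrow> ('a \<Rightarrow> 'a) \<Rightarrow> ('a \<Rightarrow> 'a) \<Rightarrow> ('a, 'i) heis" where
  "rho0_Y \<nu> v w = (THE h. entry_has_v_limit (kappa (rho_Y \<nu>) v w) h)"

text \<open>The row \<open>\<Sum>\<^sub>v A\<^bsub>w,v\<^esub> e\<^sub>v\<close>, where \<open>a e\<^sub>v\<close> is \<open>Poly_Mapping.single v a\<close>.\<close>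

definition matrix_row ::
  "(('a \<Rightarrow> 'a) \<Rightarrow> ('a \<Rightarrow> 'a) \<Rightarrow> ('a, 'i) heis) \<Rightarrow> ('a \<Rightarrow> 'a) \<Rightarrow> (('a \<Rightarrow> 'a) \<Rightarrow>\<^sub>0 ('a, 'i) heis)" where
  "matrix_row A w = (\<Sum>v\<in>weyl \<alpha>. Poly_Mapping.single v (A w v))"

subsection \<open>The \<open>q\<close>-Heisenberg algebra\<close>

definition laur_X :: "'a \<Rightarrow> 'i laur" where
  "laur_X \<nu> = Poly_Mapping.single (wt_of \<nu>) 1"

text \<open>\<open>t\<^sub>\<mu> f = (t\<^sub>\<mu> \<cdot> f) t\<^sub>\<mu>\<close> with \<open>t\<^sub>\<mu> \<cdot> X\<^sup>\<nu> = q\<^bsup>-(\<mu>,\<nu>)\<^esup> X\<^sup>\<nu>\<close>, that is \<open>X\<^sup>\<nu> t\<^sub>\<mu> = q\<^bsup>(\<mu>,\<nu>)\<^esup> t\<^sub>\<mu> X\<^sup>\<nu>\<close>.\<close>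

definition trans_act :: "'a \<Rightarrow> 'i laur \<Rightarrow> 'i laur" where
  "trans_act \<mu> f = (\<Sum>n\<in>Poly_Mapping.keys f. Poly_Mapping.single n
     (Poly_Mapping.lookup f n * Poly_Mapping.single (q_exp (- (\<mu> \<bullet> vec_of n))) 1))"

definition heis_mult :: "('a, 'i) heis \<Rightarrow> ('a, 'i) heis \<Rightarrow> ('a, 'i) heis" where
  "heis_mult A B = (\<Sum>\<mu>\<in>Poly_Mapping.keys A. \<Sum>\<xi>\<in>Poly_Mapping.keys B.
     Poly_Mapping.single (\<mu> + \<xi>)
       (Poly_Mapping.lookup A \<mu> * trans_act \<mu> (Poly_Mapping.lookup B \<xi>)))"

definition heis_fun :: "'i laur \<Rightarrow> ('a, 'i) heis" where
  "heis_fun f = Poly_Mapping.single 0 f"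

definition heis_t :: "'a \<Rightarrow> ('a, 'i) heis" where
  "heis_t \<mu> = Poly_Mapping.single \<mu> 1"

subsection \<open>The coefficients attached to a walk\<close>

definition g_minus :: "nat \<Rightarrow> (nat \<Rightarrow> 'a) \<Rightarrow> ('a \<Rightarrow> 'a) \<Rightarrow> ('a \<Rightarrow> 'a) list \<Rightarrow> 'i laur" where
  "g_minus l \<eta> w ws = (\<Prod>t\<in>{1..l}.
     let w' = (w # ws) ! (t - 1); w'' = (w # ws) ! t; b = inv w' (\<eta> t) in
     if w'' = w' \<and> half_sum \<Delta> \<alpha> \<bullet> b = 1 then 1 - laur_X (- b)
     else if bruhat_less \<Delta> \<alpha> w'' w' then - laur_X b
     else 1)"

definition g_plus :: "nat \<Rightarrow> nat \<Rightarrow> (nat \<Rightarrow> 'a) \<Rightarrow> ('a \<Rightarrow> 'a) \<Rightarrow> ('a \<Rightarrow> 'a) list \<Rightarrow> 'i laur" where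
  "g_plus l n \<eta> w ws = (\<Prod>t\<in>{l<..n}.
     let w' = (w # ws) ! (t - 1); w'' = (w # ws) ! t; b = inv w' (\<eta> t) in
     if w'' = w' \<and> half_sum \<Delta> \<alpha> \<bullet> b = -1 then 1 - laur_X b
     else if bruhat_less \<Delta> \<alpha> w'' w' then laur_X b
     else if bruhat_less \<Delta> \<alpha> w' w'' then -1
     else 1)"

end

end

theory Submission
  imports Defs
begin

text \<open>
  The operator \<open>Y\<^sup>\<lambda>\<close> is a product of generators \<open>T\<^sub>i\<^sup>\<plusminus>\<^sup>1\<close> along a reduced expression of \<open>t\<^sub>\<lambda>\<close>. Up to a
  power of \<open>v\<close> each generator is an operator \<open>R\<^sub>b\<^sup>\<plusminus>\<close> times the reflection in the affine simple root
  \<open>b\<close>, and \<open>R\<^sub>b\<^sup>\<plusminus>\<close> makes sense for all affine roots \<open>b\<close> and is equivariant. Collecting the reflections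
  on the right turns \<open>Y\<^sup>\<lambda>\<close> into a product of the \<open>R\<^sub>b\<^sup>\<plusminus>\<close> over the walls that a gallery to \<open>t\<^sub>\<lambda>\<close> crosses,
  followed by \<open>t\<^sub>\<lambda>\<close> (lemma \<open>rho_Y_word_eq\<close>).

  For minuscule \<open>\<lambda>\<close> these walls are \<open>\<beta>\<close> with \<open>(\<lambda>,\<beta>) = -1\<close> and \<open>\<delta> - \<gamma>\<close> with \<open>(\<lambda>,\<gamma>) = 1\<close>, where \<open>\<beta>\<close> and \<open>\<gamma>\<close>
  are positive. A reduced gallery crosses two of them that are not orthogonal in the order of
  their heights (\<open>walls_ascending\<close>), and the operators of orthogonal roots commute. The product
  is therefore the same for every order with this property (\<open>rho_Y_ascending\<close>). One such order
  is \<open>\<beta>\<^sub>l, \<dots>, \<beta>\<^sub>1, \<delta> - \<gamma>\<^sub>1, \<dots>, \<delta> - \<gamma>\<^sub>m\<close>, because the \<open>\<beta>\<^sub>r\<close> and \<open>\<gamma>\<^sub>s\<close> are the inversions of \<open>x\<^sup>-\<^sup>1\<close> and of \<open>y\<close>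
  (\<open>minuscule_levels\<close>). Pulling \<open>t\<^sub>\<lambda>\<close> to the left of the second part removes \<open>\<delta>\<close>, and \<open>Y\<^sup>\<lambda>\<close> becomes a
  product of the \<open>R\<^sub>\<beta>\<^sup>-\<close>, then \<open>t\<^sub>\<lambda>\<close>, then the \<open>R\<^bsub>-\<gamma>\<^esub>\<^sup>+\<close> (\<open>rho_Y_canonical\<close>).

  Row \<open>v\<close> of the matrix of \<open>R\<^sub>b\<^sup>\<plusminus>\<close> has entries only at \<open>v\<close> and at \<open>s\<^sub>bv\<close>. Multiplying out gives a sum
  over all walks that in each step stay or move by \<open>s\<^sub>b\<close>. A single entry need not converge as
  \<open>v \<rightarrow> 0\<close>, so a power of \<open>v\<close> is carried along (\<open>walk_limit\<close>) whose exponent is a sum of the signs of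
  the roots \<open>v\<^sup>-\<^sup>1c\<close>, with \<open>c\<close> in the part of the root sequence that has been passed, for the \<open>\<beta>\<^sub>r\<close>, or
  is still to come, for the \<open>\<gamma>\<^sub>s\<close>. If the walk stays, the exponent changes as the leading term of
  the diagonal entry requires. If it moves, the exponent changes by \<open>\<ell>(s\<^sub>bv) - \<ell>(v)\<close>: this length
  difference counts with signs \<open>b\<close> and the pairs of positive roots with sum \<open>b\<close>, and exactly one
  root of each pair lies on the level of \<open>b\<close> for \<open>\<lambda>\<close>, on the correct side of \<open>b\<close> in the sequence
  since it has smaller height (\<open>step_set_sign\<close>, \<open>sorted_step_set\<close>). Compared with the leading term
  of the off-diagonal entry this leaves the power \<open>v\<^sup>d\<close> with \<open>d = \<ell>(s\<^sub>bv) - \<ell>(v) - 1\<close> if \<open>v\<^sup>-\<^sup>1b\<close> is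
  positive and \<open>d = \<ell>(s\<^sub>bv) - \<ell>(v) - 1 - 2(\<rho>,v\<^sup>-\<^sup>1b)\<close> otherwise. In both cases \<open>d \<ge> 0\<close>, with equality
  exactly on the edges of the quantum Bruhat graph (\<open>move_exponent\<close>). So only quantum walks
  survive in the limit, and their coefficients are the factors of \<open>g\<^sup>-\<close> and \<open>g\<^sup>+\<close>.

  At the translation the two exponents have to be matched. Their difference is absorbed by the
  power of \<open>v\<close> with exponent \<open>2(\<rho>,v\<^sup>-\<^sup>1\<lambda>)\<close> that the matrix representation attaches to \<open>t\<^sub>\<lambda>\<close>, because
  this number is the sum of \<open>(\<lambda>,c)\<close> over the roots \<open>c\<close> in \<open>v\<Delta>\<^sup>+\<close> (\<open>two_rho_sign\<close>).
\<close>

section \<open>Simply-laced root systems and their Weyl groups\<close>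

locale sl_roots =
  fixes \<Delta> :: "'a::euclidean_space set" and \<alpha> :: "'i::{finite,linorder} \<Rightarrow> 'a"
  assumes root_sys: "root_system \<Delta>" and irreducible: "irreducible_roots \<Delta>"
    and laced: "simply_laced \<Delta>" and simple_sys: "simple_system \<Delta> \<alpha>"
begin

abbreviation pos :: "'a set" where "pos \<equiv> pos_roots \<Delta> \<alpha>"
abbreviation W :: "('a \<Rightarrow> 'a) set" where "W \<equiv> weyl \<alpha>"
abbreviation \<rho> :: 'a where "\<rho> \<equiv> half_sum \<Delta> \<alpha>"
abbreviation P :: "'a set" where "P \<equiv> weight_lattice \<alpha>"
abbreviation \<omega> :: "'i \<Rightarrow> 'a" where "\<omega> \<equiv> fund_weight \<alpha>"

lemma root_norm: "a \<in> \<Delta> \<Longrightarrow> a \<bullet> a = 2"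
  using laced by (simp add: simply_laced_def)

lemma refl_root: "a \<in> \<Delta> \<Longrightarrow> refl a x = x - (x \<bullet> a) *\<^sub>R a"
  by (simp add: refl_def root_norm)

lemma refl_in: "a \<in> \<Delta> \<Longrightarrow> b \<in> \<Delta> \<Longrightarrow> refl a b \<in> \<Delta>"
  using root_sys by (auto simp: root_system_def)

lemma finite_roots: "finite \<Delta>"
  using root_sys by (simp add: root_system_def)

lemma zero_not_root: "0 \<notin> \<Delta>"
  using root_sys by (simp add: root_system_def)

lemma neg_root: "a \<in> \<Delta> \<Longrightarrow> - a \<in> \<Delta>"
  using refl_in[of a a] by (simp add: refl_root root_norm scaleR_2)

lemma neg_root_iff [simp]: "- a \<in> \<Delta> \<longleftrightarrow> a \<in> \<Delta>"
  using neg_root[of a] neg_root[of "-a"] by auto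

lemma inner_root_Ints: "a \<in> \<Delta> \<Longrightarrow> b \<in> \<Delta> \<Longrightarrow> a \<bullet> b \<in> \<int>"
  using root_sys by (fastforce simp: root_system_def root_norm)

lemma inner_root_eq_2: "a \<in> \<Delta> \<Longrightarrow> b \<in> \<Delta> \<Longrightarrow> a \<bullet> b = 2 \<Longrightarrow> a = b"
proof -
  assume "a \<in> \<Delta>" "b \<in> \<Delta>" "a \<bullet> b = 2"
  then have "(a - b) \<bullet> (a - b) = 0"
    by (simp add: inner_diff_left inner_diff_right root_norm inner_commute)
  then show "a = b" by simp
qed

text \<open>
  By the Cauchy-Schwarz inequality the inner product of two roots is an integer between \<open>-2\<close> and
  \<open>2\<close>, and the extreme values force the roots to be equal or opposite.
\<close>

lemma inner_root_cases:
  assumes "a \<in> \<Delta>" "b \<in> \<Delta>"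
  obtains "b = a" | "a \<bullet> b = 1" | "a \<bullet> b = 0" | "a \<bullet> b = -1" | "b = - a"
proof -
  obtain n :: int where n: "a \<bullet> b = of_int n"
    using inner_root_Ints[OF assms] by (auto elim: Ints_cases)
  have "(a \<bullet> b)\<^sup>2 \<le> 4"
    using Cauchy_Schwarz_ineq[of a b] assms by (simp add: root_norm)
  then have "\<bar>a \<bullet> b\<bar> \<le> 2"
    using abs_le_square_iff[of "a \<bullet> b" 2] by simp
  then have "n \<in> {-2,-1,0,1,2}" using n by auto
  moreover have "n = 2 \<Longrightarrow> b = a" using inner_root_eq_2[of a b] assms n by simp
  moreover have "n = -2 \<Longrightarrow> b = - a" using inner_root_eq_2[of a "-b"] assms n by force
  ultimately show thesis using that n by auto
qed

lemma diff_root: "a \<in> \<Delta> \<Longrightarrow> b \<in> \<Delta> \<Longrightarrow> a \<bullet> b = 1 \<Longrightarrow> a - b \<in> \<Delta>"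
  using refl_in[of b a] by (simp add: refl_root)

lemma add_root: "a \<in> \<Delta> \<Longrightarrow> b \<in> \<Delta> \<Longrightarrow> a \<bullet> b = -1 \<Longrightarrow> a + b \<in> \<Delta>"
  using refl_in[of b a] by (simp add: refl_root)

lemma diff_root_inner: "a \<in> \<Delta> \<Longrightarrow> b \<in> \<Delta> \<Longrightarrow> a - b \<in> \<Delta> \<Longrightarrow> a \<bullet> b = 1"
  using root_norm[of "a-b"] root_norm[of a] root_norm[of b]
  by (simp add: inner_diff_left inner_diff_right inner_commute)

lemma refl_linear: "linear (refl a)"
  by (rule linearI) (simp_all add: refl_def inner_add_left algebra_simps add_divide_distrib scaleR_add_left)

lemma refl_isom: "a \<in> \<Delta> \<Longrightarrow> refl a x \<bullet> refl a y = x \<bullet> y"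
  by (simp add: refl_root inner_diff_left inner_diff_right root_norm inner_commute algebra_simps)

lemma refl_inv: "a \<in> \<Delta> \<Longrightarrow> refl a (refl a x) = x"
  by (simp add: refl_root inner_diff_left root_norm algebra_simps)

lemma refl_inv_comp: "a \<in> \<Delta> \<Longrightarrow> refl a \<circ> refl a = id"
  by (auto simp: refl_inv)

lemma refl_neg: "refl (- a) = refl a"
  by (rule ext) (simp add: refl_def)

subsection \<open>Fundamental weights\<close>

lemma simple_root: "\<alpha> i \<in> \<Delta>"
  using simple_sys by (auto simp: simple_system_def)

lemma simple_inj: "\<alpha> i = \<alpha> j \<longleftrightarrow> i = j"
  using simple_sys by (auto simp: simple_system_def dest: injD)

lemma root_nonneg_span: "b \<in> \<Delta> \<Longrightarrow> b \<in> nonneg_span \<alpha> \<or> - b \<in> nonneg_span \<alpha>"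
  using simple_sys by (auto simp: simple_system_def)

lemma nonneg_spanE:
  assumes "x \<in> nonneg_span \<alpha>"
  obtains c :: "'i \<Rightarrow> nat" where "x = (\<Sum>i\<in>UNIV. of_nat (c i) *\<^sub>R \<alpha> i)"
  using assms unfolding nonneg_span_def by blast

lemma span_simple: "span (range \<alpha>) = UNIV"
proof -
  have *: "x \<in> span (range \<alpha>)" if "x \<in> nonneg_span \<alpha>" for x
  proof -
    obtain c :: "'i \<Rightarrow> nat" where "x = (\<Sum>i\<in>UNIV. of_nat (c i) *\<^sub>R \<alpha> i)" using nonneg_spanE[OF \<open>x \<in> nonneg_span \<alpha>\<close>] by blast
    then show ?thesis by (simp add: span_sum span_scale span_base)
  qed
  have "\<Delta> \<subseteq> span (range \<alpha>)"
    using root_nonneg_span * by (metis span_neg subsetI minus_minus)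
  then have "span \<Delta> \<subseteq> span (range \<alpha>)" by (simp add: span_minimal)
  then show ?thesis using root_sys by (auto simp: root_system_def)
qed

lemma eq_if_inner_simple: "(\<And>i. x \<bullet> \<alpha> i = y \<bullet> \<alpha> i) \<Longrightarrow> x = y"
proof -
  assume *: "\<And>i. x \<bullet> \<alpha> i = y \<bullet> \<alpha> i"
  have "(x - y) \<bullet> z = 0" for z
  proof -
    have "z \<in> span (range \<alpha>)" by (simp add: span_simple)
    then show ?thesis
      by (induction rule: span_induct_alt)
         (auto simp: inner_add_right inner_diff_left *)
  qed
  from this[of "x - y"] show ?thesis by simp
qed

text \<open>
  The functional that is 1 on one simple root and 0 on the others is represented by a vector,
  which is unique because the simple roots span.
\<close>

lemma fund_weight_inner: "\<omega> k \<bullet> \<alpha> i = (if i = k then 1 else 0)"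
proof -
  have indep: "independent (range \<alpha>)" using simple_sys by (simp add: simple_system_def)
  obtain g :: "'a \<Rightarrow> real" where g: "linear g" "\<forall>x\<in>range \<alpha>. g x = (if x = \<alpha> k then 1 else 0)"
    using linear_independent_extend[OF indep, of "\<lambda>x. if x = \<alpha> k then 1 else (0::real)"] by blast
  define \<nu> where "\<nu> = (\<Sum>b\<in>Basis. g b *\<^sub>R b)"
  have "\<nu> \<bullet> x = g x" for x
  proof -
    have "g x = g (\<Sum>b\<in>Basis. (x \<bullet> b) *\<^sub>R b)" by (simp add: euclidean_representation)
    also have "\<dots> = (\<Sum>b\<in>Basis. (x \<bullet> b) * g b)"
      by (simp add: linear_sum[OF g(1)] linear_cmul[OF g(1)])
    finally show ?thesis
      by (simp add: \<nu>_def inner_sum_left inner_commute[of x] mult.commute)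
  qed
  then have ex: "\<forall>i. \<nu> \<bullet> \<alpha> i = (if i = k then 1 else 0)" using g(2) by (auto simp: simple_inj)
  have "\<forall>i. \<omega> k \<bullet> \<alpha> i = (if i = k then 1 else 0)"
    unfolding fund_weight_def
    by (rule theI[of _ \<nu>]) (use ex in \<open>auto intro!: eq_if_inner_simple\<close>)
  then show ?thesis by simp
qed

lemma fund_weight_expand: "x = (\<Sum>i\<in>UNIV. (x \<bullet> \<alpha> i) *\<^sub>R \<omega> i)"
  by (rule eq_if_inner_simple) (simp add: inner_sum_left fund_weight_inner if_distrib cong: if_cong)

lemma weight_lattice_iff: "x \<in> P \<longleftrightarrow> (\<forall>i. x \<bullet> \<alpha> i \<in> \<int>)"
proof
  assume "x \<in> P"
  then obtain c where "x = (\<Sum>i\<in>UNIV. of_int (c i) *\<^sub>R \<omega> i)" unfolding weight_lattice_def by blast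
  then show "\<forall>i. x \<bullet> \<alpha> i \<in> \<int>"
    by (simp add: inner_sum_left fund_weight_inner if_distrib cong: if_cong)
next
  assume *: "\<forall>i. x \<bullet> \<alpha> i \<in> \<int>"
  define c where "c i = \<lfloor>x \<bullet> \<alpha> i\<rfloor>" for i
  have "x \<bullet> \<alpha> i = of_int (c i)" for i using * by (simp add: c_def)
  then have "(\<Sum>i\<in>UNIV. (x \<bullet> \<alpha> i) *\<^sub>R \<omega> i) = (\<Sum>i\<in>UNIV. of_int (c i) *\<^sub>R \<omega> i)" by simp
  then have "x = (\<Sum>i\<in>UNIV. of_int (c i) *\<^sub>R \<omega> i)" by (rule trans[OF fund_weight_expand])
  then show "x \<in> P" unfolding weight_lattice_def by blast
qed

lemma fund_weight_in_P: "\<omega> k \<in> P"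
  by (simp add: weight_lattice_iff fund_weight_inner)

lemma root_in_P: "a \<in> \<Delta> \<Longrightarrow> a \<in> P"
  by (simp add: weight_lattice_iff inner_root_Ints simple_root)

lemma P_closed: "0 \<in> P" "x \<in> P \<Longrightarrow> y \<in> P \<Longrightarrow> x + y \<in> P" "x \<in> P \<Longrightarrow> - x \<in> P"
  "x \<in> P \<Longrightarrow> y \<in> P \<Longrightarrow> x - y \<in> P" "x \<in> P \<Longrightarrow> of_int z *\<^sub>R x \<in> P"
  by (auto simp: weight_lattice_iff inner_add_left inner_diff_left)

lemma inner_P_root_span: "x \<in> P \<Longrightarrow> b \<in> nonneg_span \<alpha> \<Longrightarrow> x \<bullet> b \<in> \<int>"
  by (erule nonneg_spanE) (simp add: inner_sum_right weight_lattice_iff Ints_sum Ints_mult)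

lemma inner_P_root: "x \<in> P \<Longrightarrow> b \<in> \<Delta> \<Longrightarrow> x \<bullet> b \<in> \<int>"
  using inner_P_root_span[of x b] inner_P_root_span[of x "- b"] root_nonneg_span[of b]
  by (auto simp: minus_in_Ints_iff)

subsection \<open>The height functional is \<open>\<rho>\<close>\<close>

text \<open>
  This vector turns out to be \<open>\<rho>\<close>. Its inner product with every simple root is 1 by
  construction, which gives the linear test for positivity that the computation of \<open>(\<rho>,\<alpha>\<^sub>i)\<close>
  relies on.
\<close>

definition hv :: 'a where "hv = (\<Sum>k\<in>UNIV. \<omega> k)"

lemma hv_simple: "hv \<bullet> \<alpha> i = 1"
  by (simp add: hv_def inner_sum_left fund_weight_inner)

lemma nonneg_span_hv: "x \<in> nonneg_span \<alpha> \<Longrightarrow> x \<noteq> 0 \<Longrightarrow> hv \<bullet> x \<ge> 1"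
proof -
  assume "x \<in> nonneg_span \<alpha>" and "x \<noteq> 0"
  from \<open>x \<in> nonneg_span \<alpha>\<close> obtain c :: "'i \<Rightarrow> nat"
    where c: "x = (\<Sum>i\<in>UNIV. of_nat (c i) *\<^sub>R \<alpha> i)" by (rule nonneg_spanE)
  have "\<exists>i. c i \<noteq> 0"
  proof (rule ccontr)
    assume "\<nexists>i. c i \<noteq> 0"
    then have "x = 0" unfolding c by simp
    with \<open>x \<noteq> 0\<close> show False by simp
  qed
  then obtain i where "c i \<noteq> 0" by blast
  then have "sum c UNIV \<noteq> 0" by auto
  then have "real (sum c UNIV) \<ge> 1" by linarith
  then show ?thesis by (simp add: c inner_sum_right hv_simple)
qed

lemma pos_iff_hv: "b \<in> \<Delta> \<Longrightarrow> b \<in> pos \<longleftrightarrow> hv \<bullet> b > 0"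
  and hv_neq_0: "b \<in> \<Delta> \<Longrightarrow> hv \<bullet> b \<noteq> 0"
proof -
  assume b: "b \<in> \<Delta>"
  then have "b \<noteq> 0" using zero_not_root by auto
  then have "b \<in> nonneg_span \<alpha> \<Longrightarrow> hv \<bullet> b \<ge> 1" "- b \<in> nonneg_span \<alpha> \<Longrightarrow> hv \<bullet> b \<le> -1"
    using nonneg_span_hv[of b] nonneg_span_hv[of "-b"] by auto
  with root_nonneg_span[OF b] b show "b \<in> pos \<longleftrightarrow> hv \<bullet> b > 0" "hv \<bullet> b \<noteq> 0"
    by (auto simp: pos_roots_def)
qed

lemma hv_in_P: "hv \<in> P"
  by (simp add: weight_lattice_iff hv_simple)

lemma hv_Ints: "b \<in> \<Delta> \<Longrightarrow> hv \<bullet> b \<in> \<int>"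
  by (rule inner_P_root[OF hv_in_P])

lemma pos_sub: "b \<in> pos \<Longrightarrow> b \<in> \<Delta>"
  by (simp add: pos_roots_def)

lemma finite_pos: "finite pos"
  using finite_roots by (simp add: pos_roots_def)

lemma simple_pos: "\<alpha> i \<in> pos"
  by (simp add: pos_iff_hv simple_root hv_simple)

lemma pos_neg: "b \<in> \<Delta> \<Longrightarrow> - b \<in> pos \<longleftrightarrow> b \<notin> pos"
  using pos_iff_hv[of b] pos_iff_hv[of "-b"] hv_neq_0[of b] by auto

text \<open>
  The reflection lowers the height of \<open>b\<close> by at most 1 unless \<open>b = \<alpha>\<^sub>i\<close>. So the new height is still
  nonnegative, and no root has height 0.
\<close>

lemma refl_simple_pos: "b \<in> pos \<Longrightarrow> b \<noteq> \<alpha> i \<Longrightarrow> refl (\<alpha> i) b \<in> pos"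
proof -
  assume b: "b \<in> pos" "b \<noteq> \<alpha> i"
  then have bD: "b \<in> \<Delta>" and hb: "hv \<bullet> b > 0" using pos_sub pos_iff_hv by auto
  have rD: "refl (\<alpha> i) b \<in> \<Delta>" using refl_in bD simple_root by blast
  have hr: "hv \<bullet> refl (\<alpha> i) b = hv \<bullet> b - b \<bullet> \<alpha> i"
    by (simp add: refl_root simple_root inner_diff_right hv_simple)
  have "hv \<bullet> refl (\<alpha> i) b \<ge> 0"
  proof (cases rule: inner_root_cases[OF bD simple_root[of i]])
    case 2
    obtain n :: int where "hv \<bullet> b = of_int n" using hv_Ints[OF bD] by (auto elim: Ints_cases)
    then show ?thesis using hb hr 2 by auto
  next
    case 5
    then have "b = - \<alpha> i" by simp
    then show ?thesis using hb hv_simple[of i] by simp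
  qed (use b hb hr in auto)
  then show ?thesis using hv_neq_0[OF rD] pos_iff_hv[OF rD] by linarith
qed

text \<open>
  The reflection \<open>s\<^sub>i\<close> permutes the positive roots other than \<open>\<alpha>\<^sub>i\<close>, so the sum of these is
  orthogonal to \<open>\<alpha>\<^sub>i\<close>.
\<close>

lemma rho_simple: "\<rho> \<bullet> \<alpha> i = 1"
proof -
  let ?s = "refl (\<alpha> i)"
  have ai: "\<alpha> i \<in> \<Delta>" by (rule simple_root)
  have bij: "bij_betw ?s (pos - {\<alpha> i}) (pos - {\<alpha> i})"
  proof (rule bij_betwI[of _ _ _ ?s])
    have "refl (\<alpha> i) b \<noteq> \<alpha> i" if "b \<in> pos" for b
    proof
      assume "refl (\<alpha> i) b = \<alpha> i"
      then have "b = refl (\<alpha> i) (\<alpha> i)" using refl_inv[OF ai, of b] by simp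
      then have "b = - \<alpha> i" by (simp add: refl_root ai root_norm scaleR_2)
      then show False using that pos_neg[OF ai] simple_pos by simp
    qed
    then show "?s \<in> pos - {\<alpha> i} \<rightarrow> pos - {\<alpha> i}" "?s \<in> pos - {\<alpha> i} \<rightarrow> pos - {\<alpha> i}" using refl_simple_pos by auto
  qed (simp_all add: refl_inv ai)
  define S where "S = (\<Sum>a\<in>pos - {\<alpha> i}. a)"
  have "?s S = (\<Sum>a\<in>pos - {\<alpha> i}. ?s a)" by (simp add: S_def linear_sum[OF refl_linear])
  also have "\<dots> = S" unfolding S_def using sum.reindex_bij_betw[OF bij, of "\<lambda>a. a"] by simp
  finally have "(S \<bullet> \<alpha> i) *\<^sub>R \<alpha> i = 0" by (simp add: refl_root ai)
  then have "S \<bullet> \<alpha> i = 0" using zero_not_root ai by auto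
  moreover have "(\<Sum>a\<in>pos. a) = \<alpha> i + S"
    unfolding S_def by (rule sum.remove) (simp_all add: finite_pos simple_pos)
  ultimately show ?thesis by (simp add: half_sum_def inner_add_left root_norm ai)
qed

lemma rho_hv: "\<rho> = hv"
  by (rule eq_if_inner_simple) (simp add: rho_simple hv_simple)

lemmas pos_iff = pos_iff_hv[folded rho_hv]
lemmas rho_neq_0 = hv_neq_0[folded rho_hv]
lemmas rho_Ints = hv_Ints[folded rho_hv]

lemma pos_height: "b \<in> pos \<Longrightarrow> \<rho> \<bullet> b \<ge> 1"
  using pos_iff[of b] rho_Ints[of b] pos_sub[of b] by (auto elim!: Ints_cases)

subsection \<open>The Weyl group\<close>

lemma word_prod_Nil [simp]: "word_prod \<alpha> [] = id"
  and word_prod_Cons [simp]: "word_prod \<alpha> (j # js) = refl (\<alpha> j) \<circ> word_prod \<alpha> js"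
  by (simp_all add: word_prod_def)

lemma word_prod_append: "word_prod \<alpha> (js @ ks) = word_prod \<alpha> js \<circ> word_prod \<alpha> ks"
  by (induction js) (simp_all add: comp_assoc)

lemma word_prod_rev: "word_prod \<alpha> (rev js) \<circ> word_prod \<alpha> js = id"
proof (induction js)
  case (Cons j js)
  then show ?case
    by (simp add: word_prod_append fun_eq_iff refl_inv simple_root)
qed simp

lemma W_eq: "W = range (word_prod \<alpha>)"
  by (simp add: weyl_def parabolic_def)

lemma W_cases: assumes "u \<in> W" obtains js where "u = word_prod \<alpha> js"
  using assms by (auto simp: W_eq)

lemma word_in_W [simp]: "word_prod \<alpha> js \<in> W"
  by (simp add: W_eq)

lemma id_in_W [simp]: "id \<in> W"
  using word_in_W[of "[]"] by simp

lemma simple_refl_in_W: "refl (\<alpha> i) \<in> W"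
  using word_in_W[of "[i]"] by simp

lemma W_comp: "u \<in> W \<Longrightarrow> u' \<in> W \<Longrightarrow> u \<circ> u' \<in> W"
  by (metis W_cases word_in_W word_prod_append)

lemma W_linear: "u \<in> W \<Longrightarrow> linear u"
proof -
  have "linear (word_prod \<alpha> js)" for js
  proof (induction js)
    case Nil
    show ?case by (rule linearI) simp_all
  next
    case (Cons j js)
    show ?case unfolding word_prod_Cons by (rule linear_compose[OF Cons refl_linear])
  qed
  then show "u \<in> W \<Longrightarrow> linear u" by (metis W_cases)
qed

lemma W_isom: "u \<in> W \<Longrightarrow> u x \<bullet> u y = x \<bullet> y"
proof -
  have "word_prod \<alpha> js x \<bullet> word_prod \<alpha> js y = x \<bullet> y" for js
    by (induction js) (simp_all add: refl_isom simple_root)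
  then show "u \<in> W \<Longrightarrow> ?thesis" by (metis W_cases)
qed

lemma W_root: "u \<in> W \<Longrightarrow> a \<in> \<Delta> \<Longrightarrow> u a \<in> \<Delta>"
proof -
  have "a \<in> \<Delta> \<Longrightarrow> word_prod \<alpha> js a \<in> \<Delta>" for js
    by (induction js) (simp_all add: refl_in simple_root)
  then show "u \<in> W \<Longrightarrow> a \<in> \<Delta> \<Longrightarrow> ?thesis" by (metis W_cases)
qed

lemma W_inverse:
  assumes "u \<in> W"
  shows "inv u \<in> W" "u (inv u x) = x" "inv u (u x) = x" "bij u"
proof -
  obtain js where js: "u = word_prod \<alpha> js" using assms by (rule W_cases)
  have 1: "word_prod \<alpha> (rev js) \<circ> u = id" and 2: "u \<circ> word_prod \<alpha> (rev js) = id"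
    using word_prod_rev[of js] word_prod_rev[of "rev js"] js by simp_all
  have "inv u = word_prod \<alpha> (rev js)" by (rule inv_unique_comp[OF 2 1])
  then show "inv u \<in> W" "u (inv u x) = x" "inv u (u x) = x" using 1 2 by (simp_all add: fun_eq_iff[of "_ \<circ> _"])
  show "bij u" using 1 2 o_bij by blast
qed

lemma W_inv_comp: "u \<in> W \<Longrightarrow> u \<circ> inv u = id" "u \<in> W \<Longrightarrow> inv u \<circ> u = id"
  by (auto simp: W_inverse)

lemma W_inv_prod: "u \<in> W \<Longrightarrow> u' \<in> W \<Longrightarrow> inv (u \<circ> u') = inv u' \<circ> inv u"
  by (simp add: W_inverse(4) o_inv_distrib)

lemma W_adjoint: "u \<in> W \<Longrightarrow> u x \<bullet> y = x \<bullet> inv u y"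
  using W_isom[of "inv u" "u x" y] by (simp add: W_inverse)

lemma W_lin: assumes "u \<in> W"
  shows "u (x + y) = u x + u y" "u (x - y) = u x - u y" "u (- x) = - u x" "u (c *\<^sub>R x) = c *\<^sub>R u x" "u 0 = 0"
  using W_linear[OF assms] by (simp_all add: linear_add linear_diff linear_neg linear_cmul linear_0)

lemma W_refl_conj: "u \<in> W \<Longrightarrow> a \<in> \<Delta> \<Longrightarrow> refl (u a) \<circ> u = u \<circ> refl a"
  by (rule ext) (simp add: refl_root W_root W_lin W_isom)

lemma W_P: assumes "u \<in> W" "x \<in> P" shows "u x \<in> P"
  using assms by (simp add: weight_lattice_iff W_adjoint inner_P_root W_root W_inverse simple_root)

subsection \<open>Coordinates and the highest root\<close>

lemma simple_expand: "x = (\<Sum>i\<in>UNIV. (\<omega> i \<bullet> x) *\<^sub>R \<alpha> i)"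
proof -
  have "x \<in> span (range \<alpha>)" by (simp add: span_simple)
  then have "\<exists>c. x = (\<Sum>i\<in>UNIV. c i *\<^sub>R \<alpha> i)"
  proof (induction rule: span_induct_alt)
    case base
    show ?case by (rule exI[of _ "\<lambda>_. 0"]) simp
  next
    case (step r y z)
    then obtain c j where c: "z = (\<Sum>i\<in>UNIV. c i *\<^sub>R \<alpha> i)" and j: "y = \<alpha> j" by blast
    have "r *\<^sub>R \<alpha> j = (\<Sum>i\<in>UNIV. (if i = j then r else 0) *\<^sub>R \<alpha> i)"
      by (simp add: if_distrib[of "\<lambda>t. t *\<^sub>R _"] cong: if_cong)
    then have "r *\<^sub>R y + z = (\<Sum>i\<in>UNIV. ((if i = j then r else 0) + c i) *\<^sub>R \<alpha> i)"
      by (simp only: c j scaleR_add_left sum.distrib)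
    then show ?case by (rule exI[of _ "\<lambda>i. (if i = j then r else 0) + c i"])
  qed
  then obtain c where c: "x = (\<Sum>i\<in>UNIV. c i *\<^sub>R \<alpha> i)" by blast
  have "\<omega> i \<bullet> x = c i" for i
    unfolding c by (simp add: inner_sum_right fund_weight_inner if_distrib cong: if_cong)
  with c show ?thesis by simp
qed

lemma nonneg_span_iff: "x \<in> nonneg_span \<alpha> \<longleftrightarrow> (\<forall>i. \<omega> i \<bullet> x \<in> \<nat>)"
proof
  assume "x \<in> nonneg_span \<alpha>"
  then obtain c :: "'i \<Rightarrow> nat" where c: "x = (\<Sum>i\<in>UNIV. of_nat (c i) *\<^sub>R \<alpha> i)" by (rule nonneg_spanE)
  have "\<omega> i \<bullet> x = of_nat (c i)" for i
    unfolding c by (simp add: inner_sum_right fund_weight_inner if_distrib cong: if_cong)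
  then show "\<forall>i. \<omega> i \<bullet> x \<in> \<nat>" by simp
next
  assume *: "\<forall>i. \<omega> i \<bullet> x \<in> \<nat>"
  define c where "c i = nat \<lfloor>\<omega> i \<bullet> x\<rfloor>" for i
  have "\<omega> i \<bullet> x = of_nat (c i)" for i using *[rule_format, of i] by (auto simp: c_def elim!: Nats_cases)
  then have "(\<Sum>i\<in>UNIV. (\<omega> i \<bullet> x) *\<^sub>R \<alpha> i) = (\<Sum>i\<in>UNIV. of_nat (c i) *\<^sub>R \<alpha> i)" by simp
  then have "x = (\<Sum>i\<in>UNIV. of_nat (c i) *\<^sub>R \<alpha> i)" by (rule trans[OF simple_expand])
  then show "x \<in> nonneg_span \<alpha>" unfolding nonneg_span_def by blast
qed

lemma nonneg_span_add: "x \<in> nonneg_span \<alpha> \<Longrightarrow> y \<in> nonneg_span \<alpha> \<Longrightarrow> x + y \<in> nonneg_span \<alpha>"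
  by (simp add: nonneg_span_iff inner_add_right)

lemma nonneg_span_scale: "x \<in> nonneg_span \<alpha> \<Longrightarrow> of_nat n *\<^sub>R x \<in> nonneg_span \<alpha>"
  by (simp add: nonneg_span_iff)

lemma nonneg_span_functional:
  assumes "linear (f :: 'a \<Rightarrow> real)" "\<And>i. f (\<alpha> i) \<ge> 0" "x \<in> nonneg_span \<alpha>"
  shows "f x \<ge> 0"
  using assms(3)
proof (rule nonneg_spanE)
  fix c :: "'i \<Rightarrow> nat" assume c: "x = (\<Sum>i\<in>UNIV. of_nat (c i) *\<^sub>R \<alpha> i)"
  show ?thesis unfolding c using assms(2)
    by (simp add: linear_sum[OF assms(1)] linear_cmul[OF assms(1)] sum_nonneg)
qed

lemma pos_in_nonneg_span: "b \<in> pos \<Longrightarrow> b \<in> nonneg_span \<alpha>"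
  by (simp add: pos_roots_def)

lemma simple_inner_nonpos: "i \<noteq> j \<Longrightarrow> \<alpha> i \<bullet> \<alpha> j \<le> 0"
proof (rule ccontr)
  assume ij: "i \<noteq> j" and "\<not> \<alpha> i \<bullet> \<alpha> j \<le> 0"
  then have "\<alpha> i \<bullet> \<alpha> j = 1 \<or> \<alpha> j = \<alpha> i"
    using root_norm[OF simple_root[of i]]
    by (cases rule: inner_root_cases[OF simple_root[of i] simple_root[of j]]) auto
  then have "\<alpha> i - \<alpha> j \<in> \<Delta>" using ij diff_root simple_root simple_inj by metis
  then show False using rho_neq_0[of "\<alpha> i - \<alpha> j"] by (simp add: inner_diff_right rho_simple)
qed

text \<open>
  A positive root has positive inner product with some simple root, since otherwise its square
  length would be at most 0. If it is not simple, reflecting it in that root lowers the height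
  and keeps it positive.
\<close>

lemma pos_root_induct [consumes 1, case_names simple step]:
  assumes "b \<in> pos" and simp: "\<And>i. Q (\<alpha> i)"
    and step: "\<And>b i. b \<in> pos \<Longrightarrow> Q b \<Longrightarrow> Q (refl (\<alpha> i) b)"
  shows "Q b"
  using assms(1)
proof (induction "nat \<lfloor>\<rho> \<bullet> b\<rfloor>" arbitrary: b rule: less_induct)
  case less
  then have bD: "b \<in> \<Delta>" by (simp add: pos_sub)
  show ?case
  proof (cases "b \<in> range \<alpha>")
    case True then show ?thesis using simp by auto
  next
    case False
    obtain i where i: "b \<bullet> \<alpha> i > 0"
    proof (rule ccontr)
      assume "\<not> thesis"
      then have *: "0 \<le> - (b \<bullet> \<alpha> i)" for i using that[of i] by linarith
      have "linear (\<lambda>x. - (b \<bullet> x))"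
        by (rule linearI) (simp_all add: inner_add_right)
      then have "0 \<le> - (b \<bullet> b)"
        by (rule nonneg_span_functional[of "\<lambda>x. - (b \<bullet> x)" b, OF _ * pos_in_nonneg_span[OF less.prems]])
      then show False using bD root_norm by force
    qed
    let ?b = "refl (\<alpha> i) b"
    have p: "?b \<in> pos" using False less.prems by (auto intro: refl_simple_pos)
    have "\<rho> \<bullet> ?b < \<rho> \<bullet> b" using i by (simp add: refl_root simple_root inner_diff_right rho_simple)
    moreover have "\<rho> \<bullet> ?b \<in> \<int>" "\<rho> \<bullet> b \<in> \<int>" "\<rho> \<bullet> ?b > 0" using p bD by (auto simp: pos_sub rho_Ints pos_iff[symmetric])
    ultimately have "nat \<lfloor>\<rho> \<bullet> ?b\<rfloor> < nat \<lfloor>\<rho> \<bullet> b\<rfloor>" by (auto elim!: Ints_cases)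
    then have "Q ?b" using less.hyps p by blast
    then have "Q (refl (\<alpha> i) ?b)" using step p by blast
    then show ?thesis by (simp add: refl_inv simple_root)
  qed
qed

lemma refl_in_W: "b \<in> \<Delta> \<Longrightarrow> refl b \<in> W"
proof -
  have *: "b \<in> pos \<Longrightarrow> refl b \<in> W" for b
  proof (induction rule: pos_root_induct)
    case (simple i) show ?case by (rule simple_refl_in_W)
  next
    case (step b i)
    have "refl (refl (\<alpha> i) b) \<circ> refl (\<alpha> i) = refl (\<alpha> i) \<circ> refl b"
      by (rule W_refl_conj[OF simple_refl_in_W]) (simp add: step pos_sub)
    then have "refl (refl (\<alpha> i) b) = refl (\<alpha> i) \<circ> refl b \<circ> refl (\<alpha> i)"
      using refl_inv_comp[OF simple_root[of i]] by (metis comp_assoc comp_id)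
    then show ?case using step simple_refl_in_W W_comp by metis
  qed
  then show "b \<in> \<Delta> \<Longrightarrow> refl b \<in> W" using pos_neg refl_neg by metis
qed

text \<open>
  If the simple roots split into two orthogonal parts, then by induction every positive root
  is orthogonal to one of the parts, and this would split \<open>\<Delta>\<close>.
\<close>

lemma simple_roots_connected:
  assumes "\<And>i j. i \<in> S \<Longrightarrow> j \<notin> S \<Longrightarrow> \<alpha> i \<bullet> \<alpha> j = 0" "i0 \<in> S" "j0 \<notin> S"
  shows False
proof -
  define A where "A = {a\<in>\<Delta>. \<forall>i\<in>S. a \<bullet> \<alpha> i = 0}"
  define B where "B = {a\<in>\<Delta>. \<forall>j. j \<notin> S \<longrightarrow> a \<bullet> \<alpha> j = 0}"
  have "b \<in> A \<union> B" if "b \<in> pos" for b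
    using that
  proof (induction rule: pos_root_induct)
    case (simple i)
    then show ?case using assms(1)[of _ i] assms(1)[of i]
      by (cases "i \<in> S") (auto simp: A_def B_def simple_root inner_commute)
  next
    case (step b i)
    have r: "refl (\<alpha> i) b = b - (b \<bullet> \<alpha> i) *\<^sub>R \<alpha> i" by (simp add: refl_root simple_root)
    have rD: "refl (\<alpha> i) b \<in> \<Delta>" using step pos_sub refl_in simple_root by blast
    show ?case
    proof (cases "b \<bullet> \<alpha> i = 0")
      case True then show ?thesis using step r by simp
    next
      case False
      have "\<alpha> i \<bullet> \<alpha> j = 0" if "i \<notin> S" "j \<in> S" for j
        using assms(1)[OF that(2,1)] by (simp add: inner_commute)
      then show ?thesis using False step.IH rD assms(1)[of i]
        by (cases "i \<in> S") (auto simp: A_def B_def r inner_diff_left)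
    qed
  qed
  then have "b \<in> A \<union> B" if "b \<in> \<Delta>" for b
    using that pos_neg[of b] by (cases "b \<in> pos") (fastforce simp: A_def B_def)+
  then have "A \<union> B = \<Delta>" by (auto simp: A_def B_def)
  moreover have "A \<inter> B = {}"
  proof -
    have "a = 0" if "a \<in> A" "a \<in> B" for a
      by (rule eq_if_inner_simple) (use that in \<open>auto simp: A_def B_def\<close>)
    moreover have "0 \<notin> A" using zero_not_root by (simp add: A_def)
    ultimately show ?thesis by auto
  qed
  moreover have "\<alpha> j0 \<in> A" "\<alpha> i0 \<in> B" using assms by (auto simp: A_def B_def simple_root inner_commute[of "\<alpha> j0"])
  moreover have "a \<bullet> b = 0" if "a \<in> A" "b \<in> B" for a b
  proof -
    define b1 where "b1 = (\<Sum>i\<in>S. (\<omega> i \<bullet> b) *\<^sub>R \<alpha> i)"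
    define b2 where "b2 = (\<Sum>i\<in>-S. (\<omega> i \<bullet> b) *\<^sub>R \<alpha> i)"
    have b: "b = b1 + b2"
      unfolding b1_def b2_def by (subst simple_expand, subst sum.union_disjoint[symmetric]) (auto simp: Compl_partition)
    have "b1 \<bullet> \<alpha> j = 0" if "j \<notin> S" for j
      using that assms(1) by (simp add: b1_def inner_sum_left)
    then have "b2 \<bullet> \<alpha> j = 0" if "j \<notin> S" for j
      using that \<open>b \<in> B\<close> b by (simp add: B_def inner_add_left)
    then have "b2 \<bullet> b2 = 0" by (subst (2) b2_def) (simp add: inner_sum_right)
    then have "b = b1" using b by simp
    have "a \<bullet> b1 = 0" using \<open>a \<in> A\<close> by (simp add: b1_def A_def inner_sum_right)
    then show ?thesis using \<open>b = b1\<close> by simp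
  qed
  ultimately show False using irreducible unfolding irreducible_roots_def by (metis empty_iff)
qed

abbreviation \<theta> :: 'a where "\<theta> \<equiv> highest_root \<Delta> \<alpha>"

text \<open>
  A root that is maximal in the order given by \<open>nonneg_span\<close> is dominant, and has full support
  because the simple roots are connected. Two dominant roots of full support have positive
  inner product. If they are different, then their difference is a root, hence they are
  comparable, which maximality excludes.
\<close>

lemma highest_root:
  shows highest_root_in: "\<theta> \<in> \<Delta>" and highest_root_max: "\<And>b. b \<in> \<Delta> \<Longrightarrow> \<theta> - b \<in> nonneg_span \<alpha>"
proof -
  define mx where "mx b \<longleftrightarrow> b \<in> \<Delta> \<and> (\<forall>b'\<in>\<Delta>. b' - b \<in> nonneg_span \<alpha> \<longrightarrow> b' = b)" for b
  \<comment> \<open>If \<open>-b\<close> were positive, \<open>-b\<close> would be larger than \<open>b\<close>.\<close>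
  have mx_pos: "b \<in> pos" if "mx b" for b
  proof (rule ccontr)
    assume "b \<notin> pos"
    then have "- b \<in> nonneg_span \<alpha>" using that pos_neg[of b] by (auto simp: mx_def pos_roots_def)
    then have "- b - b \<in> nonneg_span \<alpha>" using nonneg_span_add[of "-b" "-b"] by simp
    then have "- b = b" using that by (auto simp: mx_def)
    then have "b \<bullet> b = - (b \<bullet> b)" by (metis inner_minus_left)
    then show False using that root_norm[of b] by (simp add: mx_def)
  qed
  have al_ns: "\<alpha> i \<in> nonneg_span \<alpha>" for i using simple_pos pos_in_nonneg_span by blast
  have mx_dom: "b \<bullet> \<alpha> i \<ge> 0" if "mx b" for b i
  proof (rule ccontr)
    assume neg: "\<not> b \<bullet> \<alpha> i \<ge> 0"
    have bD: "b \<in> \<Delta>" using that by (simp add: mx_def)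
    have "b \<bullet> \<alpha> i = -1"
    proof (cases rule: inner_root_cases[OF bD simple_root[of i]])
      case 5
      then have "- b \<in> pos" using simple_pos[of i] by simp
      then show ?thesis using mx_pos[OF that] pos_neg[OF bD] by simp
    qed (use neg root_norm[OF bD] in auto)
    then have "b + \<alpha> i \<in> \<Delta>" using add_root bD simple_root by blast
    then have "b + \<alpha> i = b" using that al_ns[of i] by (auto simp: mx_def)
    then show False using simple_root[of i] zero_not_root by simp
  qed
  have mx_full: "\<omega> i \<bullet> b > 0" if "mx b" for b i
  proof (rule ccontr)
    have nn: "\<omega> j \<bullet> b \<ge> 0" for j
      using pos_in_nonneg_span[OF mx_pos[OF that]] by (simp add: nonneg_span_iff Nats_def) (metis imageE of_nat_0_le_iff)
    define S where "S = {j. \<omega> j \<bullet> b = 0}"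
    assume "\<not> \<omega> i \<bullet> b > 0"
    then have iS: "i \<in> S" using nn[of i] by (simp add: S_def)
    have "\<exists>j. j \<notin> S"
    proof (rule ccontr)
      assume "\<nexists>j. j \<notin> S"
      then have "b = 0" using simple_expand[of b] by (simp add: S_def)
      then show False using that zero_not_root by (simp add: mx_def)
    qed
    then obtain j where "j \<notin> S" by blast
    have "\<alpha> i' \<bullet> \<alpha> j' = 0" if i': "i' \<in> S" and j': "j' \<notin> S" for i' j'
    proof -
      have e: "b \<bullet> \<alpha> i' = (\<Sum>k\<in>UNIV. (\<omega> k \<bullet> b) * (\<alpha> k \<bullet> \<alpha> i'))"
        by (subst simple_expand[of b]) (simp add: inner_sum_left)
      have np: "(\<omega> k \<bullet> b) * (\<alpha> k \<bullet> \<alpha> i') \<le> 0" for k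
        using nn[of k] simple_inner_nonpos[of k i'] i' by (cases "k = i'") (auto simp: S_def mult_nonneg_nonpos)
      have "(\<Sum>k\<in>UNIV. - ((\<omega> k \<bullet> b) * (\<alpha> k \<bullet> \<alpha> i'))) \<le> 0"
        using mx_dom[OF \<open>mx b\<close>, of i'] e by (simp add: sum_negf)
      then have "(\<Sum>k\<in>UNIV. - ((\<omega> k \<bullet> b) * (\<alpha> k \<bullet> \<alpha> i'))) = 0"
        using np by (intro antisym sum_nonneg) (auto simp: le_minus_iff)
      then have "\<forall>k\<in>UNIV. - ((\<omega> k \<bullet> b) * (\<alpha> k \<bullet> \<alpha> i')) = 0"
        using np by (subst (asm) sum_nonneg_eq_0_iff) (auto simp: le_minus_iff)
      then show ?thesis using j' by (auto simp: S_def inner_commute)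
    qed
    then show False using simple_roots_connected[of S i j] iS \<open>j \<notin> S\<close> by blast
  qed
  have mx_unique: "b = b'" if "mx b" "mx b'" for b b'
  proof -
    have D: "b \<in> \<Delta>" "b' \<in> \<Delta>" using that by (auto simp: mx_def)
    have e: "b \<bullet> b' = (\<Sum>k\<in>UNIV. (\<omega> k \<bullet> b) * (b' \<bullet> \<alpha> k))"
      by (subst simple_expand[of b]) (simp add: inner_sum_left inner_commute[of b'])
    have "\<exists>k. b' \<bullet> \<alpha> k \<noteq> 0"
      using eq_if_inner_simple[of b' 0] D zero_not_root by (metis inner_zero_left)
    then obtain k where "b' \<bullet> \<alpha> k > 0" using mx_dom[OF \<open>mx b'\<close>] by (metis order_le_less)
    then have "b \<bullet> b' > 0"
      unfolding e using mx_full[OF that(1)] mx_dom[OF that(2)]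
      by (intro sum_pos2[of _ k]) (auto simp: less_imp_le)
    then consider "b' = b" | "b \<bullet> b' = 1"
      using root_norm[OF D(1)] by (cases rule: inner_root_cases[OF D]) auto
    then show ?thesis
    proof cases
      case 2
      then have "b - b' \<in> \<Delta>" using diff_root D by blast
      then have "b - b' \<in> nonneg_span \<alpha> \<or> b' - b \<in> nonneg_span \<alpha>" using root_nonneg_span by fastforce
      then show ?thesis using that by (auto simp: mx_def)
    qed simp
  qed
  have ex: "\<exists>b. mx b \<and> b - c \<in> nonneg_span \<alpha>" if "c \<in> \<Delta>" for c
  proof -
    define M where "M = {b\<in>\<Delta>. b - c \<in> nonneg_span \<alpha>}"
    have fM: "finite M" "M \<noteq> {}" using finite_roots that by (auto simp: M_def nonneg_span_iff)
    obtain b where bM: "b \<in> M" and bmax: "\<And>b'. b' \<in> M \<Longrightarrow> \<rho> \<bullet> b' \<le> \<rho> \<bullet> b"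
      using ex_is_arg_min_if_finite[OF fM, of "\<lambda>b. - (\<rho> \<bullet> b)"] by (auto simp: is_arg_min_linorder)
    have "b' = b" if "b' \<in> \<Delta>" "b' - b \<in> nonneg_span \<alpha>" for b'
    proof (rule ccontr)
      assume "b' \<noteq> b"
      then have "hv \<bullet> (b' - b) \<ge> 1" using nonneg_span_hv that by simp
      moreover have "b' \<in> M" using that bM nonneg_span_add[of "b' - b" "b - c"] by (simp add: M_def)
      ultimately show False using bmax[of b'] by (simp add: rho_hv inner_diff_right)
    qed
    then show ?thesis using bM by (auto simp: M_def mx_def)
  qed
  obtain c where "c \<in> \<Delta>" using simple_root by blast
  then obtain t where t: "mx t" using ex by blast
  have tmax: "t - b \<in> nonneg_span \<alpha>" if "b \<in> \<Delta>" for b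
    using ex[OF that] mx_unique[OF t] by blast
  have "\<theta> = t" unfolding highest_root_def
  proof (rule the_equality)
    show "t \<in> \<Delta> \<and> (\<forall>b\<in>\<Delta>. t - b \<in> nonneg_span \<alpha>)" using t tmax by (simp add: mx_def)
    show "t' = t" if "t' \<in> \<Delta> \<and> (\<forall>b\<in>\<Delta>. t' - b \<in> nonneg_span \<alpha>)" for t'
      using that t by (auto simp: mx_def)
  qed
  then show "\<theta> \<in> \<Delta>" "\<And>b. b \<in> \<Delta> \<Longrightarrow> \<theta> - b \<in> nonneg_span \<alpha>" using t tmax by (auto simp: mx_def)
qed

lemma rho_le_highest: "b \<in> \<Delta> \<Longrightarrow> \<rho> \<bullet> b \<le> \<rho> \<bullet> \<theta>"
  using nonneg_span_functional[of "\<lambda>x. \<rho> \<bullet> x" "\<theta> - b"] highest_root_max[of b]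
  by (simp add: rho_simple inner_diff_right linearI inner_add_right)

subsection \<open>Length and inversions in the Weyl group\<close>

definition invs :: "('a \<Rightarrow> 'a) \<Rightarrow> 'a set" where
  "invs u = {a\<in>pos. u a \<notin> pos}"

lemma finite_invs: "finite (invs u)"
  by (simp add: invs_def finite_pos)

lemma refl_simple_self: "refl (\<alpha> i) (\<alpha> i) = - \<alpha> i"
  by (simp add: refl_root simple_root root_norm scaleR_2)

lemma invs_comp_simple:
  assumes u: "u \<in> W" and p: "u (\<alpha> i) \<in> pos"
  shows "invs (u \<circ> refl (\<alpha> i)) = insert (\<alpha> i) (refl (\<alpha> i) ` invs u)" and "\<alpha> i \<notin> refl (\<alpha> i) ` invs u"
proof -
  let ?s = "refl (\<alpha> i)"
  have ss: "?s (?s b) = b" for b by (simp add: refl_inv simple_root)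
  have n: "\<alpha> i \<notin> invs u" using p by (simp add: invs_def)
  have sp: "?s b \<in> pos \<and> ?s b \<noteq> \<alpha> i" if "b \<in> pos" "b \<noteq> \<alpha> i" for b
  proof
    show "?s b \<in> pos" using that by (rule refl_simple_pos)
    show "?s b \<noteq> \<alpha> i"
    proof
      assume "?s b = \<alpha> i"
      then have "b = - \<alpha> i" using ss[of b] refl_simple_self by simp
      then show False using that(1) pos_neg[OF simple_root] simple_pos by simp
    qed
  qed
  show "\<alpha> i \<notin> ?s ` invs u" using sp n by (force simp: invs_def)
  show "invs (u \<circ> ?s) = insert (\<alpha> i) (?s ` invs u)"
  proof (intro subset_antisym subsetI)
    fix b assume b: "b \<in> invs (u \<circ> ?s)"
    show "b \<in> insert (\<alpha> i) (?s ` invs u)"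
    proof (cases "b = \<alpha> i")
      case False
      then have "?s b \<in> invs u" using b sp[of b] by (simp add: invs_def)
      then show ?thesis using ss[of b] by (metis imageI insertI2)
    qed simp
  next
    fix b assume "b \<in> insert (\<alpha> i) (?s ` invs u)"
    then consider "b = \<alpha> i" | c where "c \<in> invs u" "b = ?s c" by blast
    then show "b \<in> invs (u \<circ> ?s)"
    proof cases
      case 1
      then show ?thesis using p W_root[OF u simple_root] pos_neg[of "u (\<alpha> i)"]
        by (simp add: invs_def simple_pos refl_simple_self W_lin[OF u])
    next
      case 2
      then have "c \<in> pos" "c \<noteq> \<alpha> i" using n by (auto simp: invs_def)
      then show ?thesis using 2 sp[of c] ss by (simp add: invs_def)
    qed
  qed
qed

lemma inj_refl: "a \<in> \<Delta> \<Longrightarrow> inj_on (refl a) S"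
  by (rule inj_onI) (metis refl_inv)

lemma card_invs_simple_pos:
  "u \<in> W \<Longrightarrow> u (\<alpha> i) \<in> pos \<Longrightarrow> card (invs (u \<circ> refl (\<alpha> i))) = Suc (card (invs u))"
  using invs_comp_simple[of u i] by (simp add: finite_invs card_image inj_refl simple_root)

lemma card_invs_simple_neg:
  assumes "u \<in> W" "u (\<alpha> i) \<notin> pos"
  shows "card (invs u) = Suc (card (invs (u \<circ> refl (\<alpha> i))))"
proof -
  have "(u \<circ> refl (\<alpha> i)) (\<alpha> i) \<in> pos"
    using assms pos_neg[OF W_root[OF assms(1) simple_root]] by (simp add: refl_simple_self W_lin)
  from card_invs_simple_pos[OF W_comp[OF assms(1) simple_refl_in_W] this]
  show ?thesis unfolding comp_assoc refl_inv_comp[OF simple_root] comp_id .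
qed

text \<open>
  When the word makes \<open>\<alpha>\<^sub>i\<close> negative, some letter \<open>s\<^sub>j\<close> meets the root \<open>\<alpha>\<^sub>j\<close> on the way. The letters to
  the right of it conjugate \<open>s\<^sub>i\<close> into \<open>s\<^sub>j\<close>, so that appending \<open>s\<^sub>i\<close> to the word cancels this letter.
\<close>

lemma word_deletion:
  "word_prod \<alpha> js (\<alpha> i) \<notin> pos \<Longrightarrow>
   \<exists>ks. Suc (length ks) = length js \<and> set ks \<subseteq> set js \<and> word_prod \<alpha> ks = word_prod \<alpha> js \<circ> refl (\<alpha> i)"
proof (induction js)
  case Nil
  then show ?case by (simp add: simple_pos)
next
  case (Cons j js)
  let ?u = "word_prod \<alpha> js"
  show ?case
  proof (cases "?u (\<alpha> i) \<in> pos")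
    case False
    then obtain ks where ks: "Suc (length ks) = length js" "set ks \<subseteq> set js" "word_prod \<alpha> ks = ?u \<circ> refl (\<alpha> i)"
      using Cons.IH by blast
    show ?thesis by (rule exI[of _ "j # ks"]) (use ks in \<open>auto simp: comp_assoc\<close>)
  next
    case True
    then have e: "?u (\<alpha> i) = \<alpha> j" using Cons.prems refl_simple_pos[of "?u (\<alpha> i)" j] by auto
    have "refl (\<alpha> j) \<circ> ?u = ?u \<circ> refl (\<alpha> i)"
      using W_refl_conj[OF word_in_W[of js] simple_root[of i]] e by simp
    then have "?u = word_prod \<alpha> (j # js) \<circ> refl (\<alpha> i)"
      unfolding word_prod_Cons by (simp only: comp_assoc refl_inv_comp[OF simple_root] comp_id)
    then show ?thesis by (intro exI[of _ js] conjI) (simp, force, assumption)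
  qed
qed

lemma reduced_word_exists:
  "\<exists>ks. set ks \<subseteq> set js \<and> word_prod \<alpha> ks = word_prod \<alpha> js \<and> length ks = card (invs (word_prod \<alpha> js))"
proof (induction js rule: rev_induct)
  case Nil
  show ?case by (rule exI[of _ "[]"]) (simp add: invs_def)
next
  case (snoc j js)
  then obtain ks where ks: "set ks \<subseteq> set js" "word_prod \<alpha> ks = word_prod \<alpha> js"
    "length ks = card (invs (word_prod \<alpha> js))" by blast
  have e: "word_prod \<alpha> (js @ [j]) = word_prod \<alpha> ks \<circ> refl (\<alpha> j)" using ks by (simp add: word_prod_append)
  show ?case
  proof (cases "word_prod \<alpha> ks (\<alpha> j) \<in> pos")
    case True
    have e': "word_prod \<alpha> (ks @ [j]) = word_prod \<alpha> (js @ [j])"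
      unfolding e by (simp only: word_prod_append word_prod_Cons word_prod_Nil comp_id)
    have "card (invs (word_prod \<alpha> (js @ [j]))) = Suc (card (invs (word_prod \<alpha> ks)))"
      unfolding e by (rule card_invs_simple_pos[OF word_in_W True])
    then have "length (ks @ [j]) = card (invs (word_prod \<alpha> (js @ [j])))" using ks by simp
    moreover have "set (ks @ [j]) \<subseteq> set (js @ [j])" using ks(1) by auto
    ultimately show ?thesis using e' by blast
  next
    case False
    then obtain ms where "Suc (length ms) = length ks" "set ms \<subseteq> set ks" "word_prod \<alpha> ms = word_prod \<alpha> ks \<circ> refl (\<alpha> j)"
      using word_deletion by blast
    note ms = this
    have "card (invs (word_prod \<alpha> ks)) = Suc (card (invs (word_prod \<alpha> (js @ [j]))))"
      unfolding e by (rule card_invs_simple_neg[OF word_in_W False])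
    then have "length ms = card (invs (word_prod \<alpha> (js @ [j])))" using ks ms by simp
    moreover have "set ms \<subseteq> set (js @ [j])" using ks(1) ms(2) by auto
    moreover have "word_prod \<alpha> ms = word_prod \<alpha> (js @ [j])" unfolding e by (rule ms(3))
    ultimately show ?thesis by blast
  qed
qed

lemma card_invs_le_word: "card (invs (word_prod \<alpha> js)) \<le> length js"
proof (induction js rule: rev_induct)
  case (snoc j js)
  have "card (invs (word_prod \<alpha> js \<circ> refl (\<alpha> j))) \<le> Suc (card (invs (word_prod \<alpha> js)))"
    using card_invs_simple_pos[of "word_prod \<alpha> js" j] card_invs_simple_neg[of "word_prod \<alpha> js" j]
    by (cases "word_prod \<alpha> js (\<alpha> j) \<in> pos") auto
  then have "card (invs (word_prod \<alpha> (js @ [j]))) \<le> Suc (card (invs (word_prod \<alpha> js)))"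
    unfolding word_prod_append word_prod_Cons word_prod_Nil comp_id .
  then show ?case using snoc by simp
qed (simp add: invs_def)

lemma len_invs: "u \<in> W \<Longrightarrow> len \<alpha> u = card (invs u)"
proof -
  assume "u \<in> W"
  then obtain js where js: "u = word_prod \<alpha> js" by (rule W_cases)
  obtain ks where "word_prod \<alpha> ks = u" "length ks = card (invs u)" using reduced_word_exists[of js] js by blast
  then show ?thesis unfolding len_def
    using card_invs_le_word by (intro Least_equality) metis+
qed

lemma len_le: "len \<alpha> (word_prod \<alpha> js) \<le> length js"
  using card_invs_le_word len_invs by simp

lemma len_word: "u \<in> W \<Longrightarrow> \<exists>js. word_prod \<alpha> js = u \<and> length js = len \<alpha> u"
  using reduced_word_exists len_invs by (metis W_cases)

lemma len_comp_le: "u \<in> W \<Longrightarrow> u' \<in> W \<Longrightarrow> len \<alpha> (u \<circ> u') \<le> len \<alpha> u + len \<alpha> u'"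
  using len_word[of u] len_word[of u'] len_le by (metis length_append word_prod_append)

lemma word_ends_negative:
  assumes "word_prod \<alpha> js \<noteq> id"
  shows "\<exists>i\<in>set js. word_prod \<alpha> js (\<alpha> i) \<notin> pos"
proof -
  obtain ks where ks: "set ks \<subseteq> set js" "word_prod \<alpha> ks = word_prod \<alpha> js" "length ks = card (invs (word_prod \<alpha> js))"
    using reduced_word_exists by blast
  have "ks \<noteq> []" using assms ks by auto
  then obtain ms i where i: "ks = ms @ [i]" by (metis rev_exhaust)
  have e: "word_prod \<alpha> js \<circ> refl (\<alpha> i) = word_prod \<alpha> ms"
    using ks(2) by (simp add: i word_prod_append comp_assoc refl_inv_comp simple_root flip: ks(2))
  have "card (invs (word_prod \<alpha> ms)) \<le> length ms" by (rule card_invs_le_word)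
  then have "word_prod \<alpha> js (\<alpha> i) \<notin> pos"
    using card_invs_simple_pos[OF word_in_W, of js i] e ks(3) i by auto
  then show ?thesis using ks i by auto
qed

lemma W_pos_id: assumes "u \<in> W" "\<And>a. a \<in> pos \<Longrightarrow> u a \<in> pos" shows "u = id"
proof -
  obtain js where "u = word_prod \<alpha> js" using assms(1) by (rule W_cases)
  then show ?thesis using word_ends_negative[of js] assms(2) simple_pos by blast
qed

lemma finite_W: "finite W"
proof (rule finite_subset)
  show "W \<subseteq> word_prod \<alpha> ` {js. set js \<subseteq> UNIV \<and> length js \<le> card pos}"
  proof
    fix u assume u: "u \<in> W"
    obtain js where js: "word_prod \<alpha> js = u" "length js = len \<alpha> u" using len_word[OF u] by blast
    have "len \<alpha> u \<le> card pos" unfolding len_invs[OF u] by (rule card_mono[OF finite_pos]) (simp add: invs_def)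
    then show "u \<in> word_prod \<alpha> ` {js. set js \<subseteq> UNIV \<and> length js \<le> card pos}" using js by (intro image_eqI[of _ _ js]) simp_all
  qed
qed (intro finite_imageI finite_lists_length_le finite)

section \<open>The extended affine Weyl group\<close>

abbreviation apos :: "('a \<times> real) set" where "apos \<equiv> aff_pos_roots \<Delta> \<alpha>"
abbreviation asim :: "'i option \<Rightarrow> 'a \<times> real" where "asim \<equiv> aff_simple \<Delta> \<alpha>"
abbreviation Wex :: "('a \<times> ('a \<Rightarrow> 'a)) set" where "Wex \<equiv> wex \<alpha>"

definition aroots :: "('a \<times> real) set" where "aroots = \<Delta> \<times> \<int>"

text \<open>With this height of \<open>\<delta>\<close> all affine simple roots have height 1.\<close>

definition aht :: "'a \<times> real \<Rightarrow> real" where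
  "aht b = \<rho> \<bullet> fst b + (\<rho> \<bullet> \<theta> + 1) * snd b"

lemma aht_lin: "aht (b + c) = aht b + aht c" "aht (b - c) = aht b - aht c" "aht (- b) = - aht b"
  "aht (r *\<^sub>R b) = r * aht b"
  by (simp_all add: aht_def inner_add_right inner_diff_right algebra_simps)

lemma aroots_neg: "b \<in> aroots \<Longrightarrow> - b \<in> aroots"
  by (cases b) (simp add: aroots_def)

text \<open>
  The height of \<open>\<delta>\<close> exceeds \<open>\<bar>(\<rho>,a)\<bar>\<close> for every root \<open>a\<close>, so the sign of the height is that of the
  coefficient of \<open>\<delta>\<close> unless this is 0.
\<close>

lemma aht_bounds:
  assumes "b \<in> aroots"
  shows "aht b \<in> \<int>" "aht b \<noteq> 0" "b \<in> apos \<longleftrightarrow> aht b > 0"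
proof -
  obtain a r where b: "b = (a, r)" by (cases b)
  then have aD: "a \<in> \<Delta>" and "r \<in> \<int>" using assms by (auto simp: aroots_def)
  then obtain c where c: "r = of_int c" by (auto elim: Ints_cases)
  show "aht b \<in> \<int>" using aD rho_Ints[OF aD] rho_Ints[OF highest_root_in] \<open>r \<in> \<int>\<close>
    by (simp add: aht_def b)
  have le: "\<rho> \<bullet> a \<le> \<rho> \<bullet> \<theta>" "- (\<rho> \<bullet> a) \<le> \<rho> \<bullet> \<theta>"
    using rho_le_highest[OF aD] rho_le_highest[OF neg_root[OF aD]] by auto
  then have th: "\<rho> \<bullet> \<theta> \<ge> 0" by linarith
  define M where "M = (\<rho> \<bullet> \<theta> + 1) * real_of_int c"
  have hb: "aht b = \<rho> \<bullet> a + M" by (simp add: aht_def b c M_def)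
  have mem: "b \<in> apos \<longleftrightarrow> c > 0 \<or> c = 0 \<and> a \<in> pos"
    by (auto simp: aff_pos_roots_def b c aD)
  consider "c > 0" | "c = 0" | "c < 0" by linarith
  then have "aht b \<noteq> 0 \<and> (b \<in> apos \<longleftrightarrow> aht b > 0)"
  proof cases
    case 1
    then have "(\<rho> \<bullet> \<theta> + 1) * 1 \<le> (\<rho> \<bullet> \<theta> + 1) * real_of_int c"
      using th by (intro mult_left_mono) auto
    then have "\<rho> \<bullet> \<theta> + 1 \<le> M" by (simp only: M_def[symmetric] mult_1_right)
    then have "aht b > 0" using le hb by linarith
    then show ?thesis using mem 1 by simp
  next
    case 2
    then show ?thesis using mem pos_iff[OF aD] rho_neq_0[OF aD] by (simp add: aht_def b c)
  next
    case 3
    then have "(\<rho> \<bullet> \<theta> + 1) * real_of_int c \<le> (\<rho> \<bullet> \<theta> + 1) * (- 1)"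
      using th by (intro mult_left_mono) auto
    then have "M \<le> - (\<rho> \<bullet> \<theta> + 1)" by (simp only: M_def[symmetric] mult_minus1_right)
    then have "aht b < 0" using le hb by linarith
    then show ?thesis using mem 3 by simp
  qed
  then show "aht b \<noteq> 0" "b \<in> apos \<longleftrightarrow> aht b > 0" by auto
qed

lemma apos_aroots: "b \<in> apos \<Longrightarrow> b \<in> aroots"
  by (auto simp: aff_pos_roots_def aroots_def)

lemma apos_neg: "b \<in> aroots \<Longrightarrow> - b \<in> apos \<longleftrightarrow> b \<notin> apos"
  using aht_bounds[of b] aht_bounds(3)[OF aroots_neg[of b]] by (auto simp: aht_lin)

lemma asim_aroots: "asim i \<in> aroots"
  by (cases i) (simp_all add: aff_simple_def aroots_def simple_root highest_root_in)

lemma aht_asim: "aht (asim i) = 1"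
  by (cases i) (simp_all add: aff_simple_def aht_def rho_simple)

lemma asim_apos: "asim i \<in> apos"
  using aht_bounds(3)[OF asim_aroots] aht_asim by simp

subsection \<open>Group structure and action\<close>

lemma wexD: "g \<in> Wex \<Longrightarrow> fst g \<in> P" "g \<in> Wex \<Longrightarrow> snd g \<in> W"
  by (auto simp: wex_def)

lemma wexI: "\<mu> \<in> P \<Longrightarrow> u \<in> W \<Longrightarrow> (\<mu>, u) \<in> Wex"
  by (simp add: wex_def)

lemma wex_one_in [simp]: "wex_one \<in> Wex"
  using id_in_W by (simp add: wex_one_def wex_def P_closed)

lemma wex_mult_in: "g \<in> Wex \<Longrightarrow> h \<in> Wex \<Longrightarrow> wex_mult g h \<in> Wex"
  unfolding wex_mult_def by (rule wexI) (simp_all add: wexD P_closed W_P W_comp)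

lemma wex_mult_one [simp]: "wex_mult g wex_one = g \<or> g \<notin> Wex" "wex_mult wex_one g = g"
  by (auto simp: wex_mult_def wex_one_def W_lin wexD prod_eq_iff)

lemma wex_mult_one_right: "g \<in> Wex \<Longrightarrow> wex_mult g wex_one = g"
  using wex_mult_one by blast

lemma wex_mult_assoc: "g \<in> Wex \<Longrightarrow> wex_mult (wex_mult g h) k = wex_mult g (wex_mult h k)"
  by (simp add: wex_mult_def W_lin wexD comp_assoc)

definition winv :: "'a \<times> ('a \<Rightarrow> 'a) \<Rightarrow> 'a \<times> ('a \<Rightarrow> 'a)" where
  "winv g = (- inv (snd g) (fst g), inv (snd g))"

lemma winv_in: "g \<in> Wex \<Longrightarrow> winv g \<in> Wex"
  unfolding winv_def by (rule wexI) (simp_all add: wexD P_closed W_P W_inverse)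

lemma winv_mult: "g \<in> Wex \<Longrightarrow> wex_mult (winv g) g = wex_one" "g \<in> Wex \<Longrightarrow> wex_mult g (winv g) = wex_one"
  by (simp_all add: wex_mult_def winv_def wex_one_def wexD W_inverse W_inv_comp W_lin)

lemma wex_act_mult: "g \<in> Wex \<Longrightarrow> wex_act (wex_mult g h) b = wex_act g (wex_act h b)"
  by (simp add: wex_act_def wex_mult_def W_lin inner_add_left W_isom wexD)

lemma wex_act_one [simp]: "wex_act wex_one b = b"
  by (simp add: wex_act_def wex_one_def)

lemma wex_act_winv: "g \<in> Wex \<Longrightarrow> wex_act (winv g) (wex_act g b) = b" "g \<in> Wex \<Longrightarrow> wex_act g (wex_act (winv g) b) = b"
  using wex_act_mult[of "winv g" g b] wex_act_mult[of g "winv g" b] by (simp_all add: winv_in winv_mult)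

lemma wex_act_lin: assumes "g \<in> Wex"
  shows "wex_act g (b + c) = wex_act g b + wex_act g c" "wex_act g (b - c) = wex_act g b - wex_act g c"
   "wex_act g (- b) = - wex_act g b" "wex_act g (r *\<^sub>R b) = r *\<^sub>R wex_act g b"
  using wexD[OF assms] by (simp_all add: wex_act_def W_lin inner_add_right inner_diff_right prod_eq_iff algebra_simps)

lemma wex_act_aroots: "g \<in> Wex \<Longrightarrow> b \<in> aroots \<Longrightarrow> wex_act g b \<in> aroots"
  by (auto simp: wex_act_def aroots_def W_root wexD inner_P_root)

lemma aff_refl_act: "b \<in> aroots \<Longrightarrow> wex_act (aff_refl b) c = c - (fst c \<bullet> fst b) *\<^sub>R b"
  by (cases b, cases c)
     (auto simp: wex_act_def aff_refl_def aroots_def refl_root inner_diff_right root_norm inner_commute algebra_simps)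

lemma aff_refl_in: "b \<in> aroots \<Longrightarrow> aff_refl b \<in> Wex"
proof -
  assume b: "b \<in> aroots"
  then obtain c where c: "snd b = of_int c" by (auto simp: aroots_def elim: Ints_cases)
  have "of_int (- c) *\<^sub>R fst b \<in> P" using b by (intro P_closed root_in_P) (auto simp: aroots_def)
  then show ?thesis unfolding aff_refl_def by (intro wexI) (use b c in \<open>auto simp: aroots_def refl_in_W\<close>)
qed

lemma aff_refl_conj:
  assumes "g \<in> Wex" "b \<in> aroots"
  shows "wex_mult (aff_refl (wex_act g b)) g = wex_mult g (aff_refl b)"
proof -
  obtain a r where b: "b = (a, r)" "a \<in> \<Delta>" using assms(2) by (auto simp: aroots_def)
  obtain \<mu> u where g: "g = (\<mu>, u)" "u \<in> W" using assms(1) by (auto simp: wex_def)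
  have "refl (u a) \<circ> u = u \<circ> refl a" by (rule W_refl_conj[OF g(2) b(2)])
  then show ?thesis
    using b g by (simp add: wex_mult_def aff_refl_def wex_act_def refl_root W_root W_lin algebra_simps)
qed

lemma aff_refl_sq: "b \<in> aroots \<Longrightarrow> wex_mult (aff_refl b) (aff_refl b) = wex_one"
proof -
  assume "b \<in> aroots"
  then have D: "fst b \<in> \<Delta>" by (auto simp: aroots_def)
  have "refl (fst b) (- snd b *\<^sub>R fst b) = snd b *\<^sub>R fst b"
    by (simp add: refl_root D root_norm flip: scaleR_left_diff_distrib)
  then show ?thesis by (simp add: wex_mult_def aff_refl_def wex_one_def refl_inv_comp D)
qed

abbreviation asr :: "'i option \<Rightarrow> 'a \<times> ('a \<Rightarrow> 'a)" where "asr i \<equiv> aff_refl (asim i)"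

lemma asr_in: "asr i \<in> Wex"
  by (simp add: aff_refl_in asim_aroots)

lemma asr_self: "wex_act (asr i) (asim i) = - asim i"
proof -
  have "fst (asim i) \<bullet> fst (asim i) = 2" using asim_aroots[of i] by (auto simp: aroots_def root_norm)
  then show ?thesis by (simp add: aff_refl_act asim_aroots scaleR_2)
qed

lemma asr_invol: "wex_act (asr i) (wex_act (asr i) b) = b"
  using wex_act_mult[OF asr_in, of i "asr i" b] by (simp add: aff_refl_sq asim_aroots)

lemma asr_apos:
  assumes b: "b \<in> apos" and ne: "b \<noteq> asim i"
  shows "wex_act (asr i) b \<in> apos"
proof -
  have bA: "b \<in> aroots" and hb: "aht b > 0" using apos_aroots[OF b] aht_bounds(3)[OF apos_aroots[OF b]] b by simp_all
  obtain h :: int where h: "aht b = of_int h" using aht_bounds(1)[OF bA] by (auto elim: Ints_cases)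
  let ?c = "fst b \<bullet> fst (asim i)"
  have D: "fst b \<in> \<Delta>" "fst (asim i) \<in> \<Delta>" using bA asim_aroots[of i] by (auto simp: aroots_def)
  have rA: "wex_act (asr i) b \<in> aroots" using wex_act_aroots asr_in bA by blast
  have hr: "aht (wex_act (asr i) b) = aht b - ?c"
    by (simp add: aff_refl_act asim_aroots aht_lin aht_asim)
  have "aht (wex_act (asr i) b) \<ge> 0"
  proof (cases rule: inner_root_cases[OF D])
    case 1
    define d where "d = snd b - snd (asim i)"
    have "d \<in> \<int>" using bA asim_aroots[of i] by (auto simp: aroots_def d_def)
    then obtain z where z: "d = of_int z" by (auto elim: Ints_cases)
    have bd: "b = asim i + (0, d)" using 1 by (simp add: d_def prod_eq_iff)
    have N: "\<rho> \<bullet> \<theta> + 1 \<ge> 2"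
      using rho_le_highest[OF simple_root] rho_simple by (metis add.commute add_left_mono one_add_one)
    define M where "M = (\<rho> \<bullet> \<theta> + 1) * d"
    have hb': "aht b = 1 + M" unfolding bd aht_lin aht_asim by (simp add: aht_def M_def)
    have "z > 0"
    proof (rule ccontr)
      assume "\<not> z > 0"
      moreover have "z \<noteq> 0" using ne bd z by (auto simp: zero_prod_def[symmetric])
      ultimately have "(\<rho> \<bullet> \<theta> + 1) * d \<le> (\<rho> \<bullet> \<theta> + 1) * (-1)" using N z by (intro mult_left_mono) auto
      then have "M \<le> - (\<rho> \<bullet> \<theta> + 1)" by (simp only: M_def[symmetric] mult_minus1_right)
      then show False using hb hb' N by linarith
    qed
    then have "(\<rho> \<bullet> \<theta> + 1) * 1 \<le> (\<rho> \<bullet> \<theta> + 1) * d" using N z by (intro mult_left_mono) auto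
    then have "\<rho> \<bullet> \<theta> + 1 \<le> M" by (simp only: M_def[symmetric] mult_1_right)
    moreover have "?c = 2" using 1 D root_norm by simp
    ultimately show ?thesis using hr hb' N by linarith
  next
    case 2
    then show ?thesis using hr hb h by auto
  next
    case 5
    then have "?c = -2" using root_norm[OF D(1)] by simp
    then show ?thesis using hr hb by simp
  qed (use hr hb in auto)
  then show ?thesis using aht_bounds(2,3)[OF rA] by auto
qed

subsection \<open>Reduced expressions\<close>

definition ainvs :: "'a \<times> ('a \<Rightarrow> 'a) \<Rightarrow> ('a \<times> real) set" where
  "ainvs g = {b \<in> apos. - wex_act g b \<in> apos}"

lemma wex_len_ainvs: "wex_len \<Delta> \<alpha> g = card (ainvs g)"
  by (simp add: wex_len_def ainvs_def)

lemma finite_ainvs: "finite (ainvs g)"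
proof -
  have "ainvs g \<subseteq> (\<Union>a\<in>\<Delta>. (\<lambda>c. (a, of_int c)) ` {0..\<lceil>fst g \<bullet> snd g a\<rceil>})"
  proof
    fix b assume b: "b \<in> ainvs g"
    then obtain a c where ac: "b = (a, of_int c)" "a \<in> \<Delta>" "c \<ge> 0" by (auto simp: ainvs_def aff_pos_roots_def)
    from b have "- wex_act g b \<in> apos" by (simp add: ainvs_def)
    then obtain z where "- (of_int c - fst g \<bullet> snd g a) = real_of_int z" "z \<ge> 0"
      by (auto simp: aff_pos_roots_def ac wex_act_def)
    then have "real_of_int c \<le> fst g \<bullet> snd g a" by linarith
    then have "c \<le> \<lceil>fst g \<bullet> snd g a\<rceil>" by linarith
    then show "b \<in> (\<Union>a\<in>\<Delta>. (\<lambda>c. (a, of_int c)) ` {0..\<lceil>fst g \<bullet> snd g a\<rceil>})"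
      using ac by (intro UN_I[of a]) auto
  qed
  then show ?thesis by (rule finite_subset) (auto simp: finite_roots)
qed

lemma card_ainvs_winv: "g \<in> Wex \<Longrightarrow> card (ainvs (winv g)) = card (ainvs g)"
  by (rule bij_betw_same_card[of "\<lambda>b. - wex_act (winv g) b"],
      rule bij_betwI[of _ _ _ "\<lambda>b. - wex_act g b"])
     (auto simp: ainvs_def wex_act_lin wex_act_winv winv_in)

lemma ainvs_step:
  assumes g: "g \<in> Wex" and n: "wex_act g (asim i) \<notin> apos"
  shows "card (ainvs g) = Suc (card (ainvs (wex_mult g (asr i))))"
proof -
  let ?s = "wex_act (asr i)"
  have act: "wex_act (wex_mult g (asr i)) b = wex_act g (?s b)" for b by (simp add: wex_act_mult g)
  have ne: "?s b \<in> apos \<and> ?s b \<noteq> asim i" if "b \<in> apos" "b \<noteq> asim i" for b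
  proof
    show "?s b \<in> apos" using asr_apos that by blast
    show "?s b \<noteq> asim i"
    proof
      assume "?s b = asim i"
      then have "b = - asim i" using asr_invol[of i b] asr_self[of i] by simp
      then show False using that(1) apos_neg[OF asim_aroots] asim_apos by simp
    qed
  qed
  have gi: "- wex_act g (asim i) \<in> apos"
    using n apos_neg[OF wex_act_aroots[OF g asim_aroots]] by simp
  then have ai: "asim i \<in> ainvs g" by (simp add: ainvs_def asim_apos)
  have nai: "asim i \<notin> ainvs (wex_mult g (asr i))"
    using n by (simp add: ainvs_def act asr_self wex_act_lin[OF g])
  have "bij_betw ?s (ainvs (wex_mult g (asr i))) (ainvs g - {asim i})"
  proof (rule bij_betwI[of _ _ _ ?s])
    show "?s \<in> ainvs (wex_mult g (asr i)) \<rightarrow> ainvs g - {asim i}"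
    proof
      fix b assume b: "b \<in> ainvs (wex_mult g (asr i))"
      then have "b \<in> apos" "b \<noteq> asim i" using nai by (auto simp: ainvs_def)
      then show "?s b \<in> ainvs g - {asim i}" using b ne[of b] by (simp add: ainvs_def act)
    qed
    show "?s \<in> ainvs g - {asim i} \<rightarrow> ainvs (wex_mult g (asr i))"
    proof
      fix b assume b: "b \<in> ainvs g - {asim i}"
      then have "b \<in> apos" "b \<noteq> asim i" by (auto simp: ainvs_def)
      then show "?s b \<in> ainvs (wex_mult g (asr i))" using b ne[of b] by (simp add: ainvs_def act asr_invol)
    qed
  qed (simp_all add: asr_invol)
  then have "card (ainvs (wex_mult g (asr i))) = card (ainvs g - {asim i})" by (rule bij_betw_same_card)
  moreover have "card (ainvs g) = Suc (card (ainvs g - {asim i}))"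
    using ai finite_ainvs by (rule card.remove[rotated])
  ultimately show ?thesis by simp
qed

text \<open>
  Positive affine roots are combinations of affine simple roots with nonnegative coefficients,
  so \<open>g\<close> maps them to roots of nonnegative height.
\<close>

lemma ainvs_empty:
  assumes g: "g \<in> Wex" and p: "\<And>i. wex_act g (asim i) \<in> apos"
  shows "ainvs g = {}"
proof -
  define f where "f b = aht (wex_act g b)" for b
  have fl: "f (b + c) = f b + f c" "f (r *\<^sub>R b) = r * f b" for b c r
    by (simp_all add: f_def wex_act_lin[OF g] aht_lin)
  have f1: "f (asim i) > 0" for i
    using p[of i] aht_bounds(3)[OF wex_act_aroots[OF g asim_aroots]] by (simp add: f_def)
  have fn: "f (x, 0) \<ge> 0" if "x \<in> nonneg_span \<alpha>" for x
  proof (rule nonneg_span_functional[OF _ _ that, of "\<lambda>x. f (x, 0)"])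
    show "linear (\<lambda>x. f (x, 0))"
    proof (rule linearI)
      show "f (x + y, 0) = f (x, 0) + f (y, 0)" for x y using fl(1)[of "(x,0)" "(y,0)"] by simp
      show "f (r *\<^sub>R x, 0) = r *\<^sub>R f (x, 0)" for r x using fl(2)[of r "(x,0)"] by simp
    qed
    show "0 \<le> f (\<alpha> i, 0)" for i using f1[of "Some i"] by (simp add: aff_simple_def)
  qed
  have "wex_act g b \<in> apos" if "b \<in> apos" for b
  proof -
    obtain a c where b: "b = (a, of_int c)" "a \<in> \<Delta>" and c: "c > 0 \<or> c = 0 \<and> a \<in> pos"
      using \<open>b \<in> apos\<close> unfolding aff_pos_roots_def by blast
    have "f b \<ge> 0"
    proof (cases "c > 0")
      case True
      \<comment> \<open>\<open>a + c\<delta> = c\<alpha>\<^sub>0 + (c - 1)\<theta> + (\<theta> + a)\<close>, and \<open>\<theta> + a\<close> is a nonnegative combination of simple roots.\<close>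
      define n where "n = nat (c - 1)"
      have cn: "c = 1 + int n" using True by (simp add: n_def)
      have "of_nat n *\<^sub>R \<theta> + (\<theta> - (- a)) \<in> nonneg_span \<alpha>"
      proof (intro nonneg_span_add nonneg_span_scale highest_root_max)
        show "\<theta> \<in> nonneg_span \<alpha>"
        proof (cases "- \<theta> \<in> nonneg_span \<alpha>")
          case True
          then have "\<theta> - - \<theta> + - \<theta> \<in> nonneg_span \<alpha>"
            using highest_root_max[OF neg_root[OF highest_root_in]] nonneg_span_add by blast
          then show ?thesis by simp
        next
          case False
          then show ?thesis using root_nonneg_span[OF highest_root_in] by blast
        qed
      qed (use b in simp)
      then have "f (of_nat n *\<^sub>R \<theta> + (\<theta> - (- a)), 0) \<ge> 0" by (rule fn)
      moreover have "b = of_int c *\<^sub>R asim None + (of_nat n *\<^sub>R \<theta> + (\<theta> - (- a)), 0)"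
        by (simp add: b aff_simple_def cn scaleR_add_left)
      moreover have "of_int c * f (asim None) \<ge> 0" using True f1[of None] by simp
      ultimately show ?thesis by (simp only: fl)
    next
      case False
      then show ?thesis using c fn pos_in_nonneg_span b by auto
    qed
    then show ?thesis
      using aht_bounds[OF wex_act_aroots[OF g apos_aroots[OF that]]] by (simp add: f_def)
  qed
  then show ?thesis
    using apos_neg[OF wex_act_aroots[OF g]] apos_aroots by (auto simp: ainvs_def)
qed

abbreviation aword :: "'i option list \<Rightarrow> 'a \<times> ('a \<Rightarrow> 'a)" where "aword \<equiv> aff_word_prod \<Delta> \<alpha>"

lemma aword_Nil: "aword [] = wex_one" and aword_Cons: "aword (j # js) = wex_mult (asr j) (aword js)"
  by (simp_all add: aff_word_prod_def)

lemma aword_in [simp]: "aword js \<in> Wex"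
  by (induction js) (simp_all add: aword_Nil aword_Cons wex_mult_in asr_in)

lemma aword_append: "aword (js @ ks) = wex_mult (aword js) (aword ks)"
  by (induction js) (simp_all add: aword_Nil aword_Cons wex_mult_assoc asr_in)

text \<open>
  As long as some affine simple root is made negative, the length drops under multiplication
  by its reflection; an element that makes none of them negative has length 0.
\<close>

lemma reduced_expr_exists: "g \<in> Wex \<Longrightarrow> \<exists>p js. wex_reduced_expr \<Delta> \<alpha> g p js"
proof (induction "card (ainvs g)" arbitrary: g rule: less_induct)
  case less
  show ?case
  proof (cases "\<forall>i. wex_act g (asim i) \<in> apos")
    case True
    then have "wex_len \<Delta> \<alpha> g = 0" using ainvs_empty[OF less.prems] by (simp add: wex_len_ainvs)
    then have "wex_reduced_expr \<Delta> \<alpha> g g []"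
      using less.prems by (simp add: wex_reduced_expr_def wex_Pi_def aword_Nil wex_mult_one_right)
    then show ?thesis by blast
  next
    case False
    then obtain i where i: "wex_act g (asim i) \<notin> apos" by blast
    let ?h = "wex_mult g (asr i)"
    have hW: "?h \<in> Wex" using less.prems wex_mult_in asr_in by blast
    have c: "card (ainvs g) = Suc (card (ainvs ?h))" using ainvs_step less.prems i by blast
    then obtain p js where pj: "wex_reduced_expr \<Delta> \<alpha> ?h p js" using less.hyps[of ?h] hW by auto
    then have pW: "p \<in> Wex" by (simp add: wex_reduced_expr_def wex_Pi_def)
    have "g = wex_mult ?h (asr i)"
      by (simp add: wex_mult_assoc less.prems aff_refl_sq asim_aroots wex_mult_one_right)
    also have "?h = wex_mult p (aword js)" using pj by (simp add: wex_reduced_expr_def)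
    also have "wex_mult (wex_mult p (aword js)) (asr i) = wex_mult p (aword (js @ [i]))"
      by (simp add: aword_append aword_Cons aword_Nil wex_mult_one_right asr_in wex_mult_assoc pW)
    finally have "wex_reduced_expr \<Delta> \<alpha> g p (js @ [i])"
      using pj c by (simp add: wex_reduced_expr_def wex_len_ainvs)
    then show ?thesis by blast
  qed
qed

subsection \<open>The roots crossed by a word\<close>

text \<open>The roots \<open>g\<alpha>\<^bsub>j\<^sub>1\<^esub>, g s\<^bsub>j\<^sub>1\<^esub>\<alpha>\<^bsub>j\<^sub>2\<^esub>, \<dots>\<close> of the walls met by the gallery of type \<open>j\<^sub>1 j\<^sub>2 \<dots>\<close> that starts at \<open>g\<close>.\<close>

fun walls :: "'a \<times> ('a \<Rightarrow> 'a) \<Rightarrow> 'i option list \<Rightarrow> ('a \<times> real) list" where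
  "walls g [] = []"
| "walls g (j # js) = wex_act g (asim j) # walls (wex_mult g (asr j)) js"

lemma length_walls [simp]: "length (walls g js) = length js"
  by (induction js arbitrary: g) auto

lemma walls_append: "g \<in> Wex \<Longrightarrow> walls g (js @ ks) = walls g js @ walls (wex_mult g (aword js)) ks"
  by (induction js arbitrary: g)
     (simp_all add: aword_Nil aword_Cons wex_mult_one_right wex_mult_in asr_in wex_mult_assoc)

lemma walls_nth:
  "g \<in> Wex \<Longrightarrow> k < length js \<Longrightarrow> walls g js ! k = wex_act (wex_mult g (aword (take k js))) (asim (js ! k))"
proof (induction js arbitrary: g k)
  case (Cons j js)
  then show ?case
    by (cases k) (simp_all add: aword_Nil aword_Cons wex_mult_one_right wex_mult_in asr_in wex_mult_assoc)
qed simp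

lemma winv_step:
  "g \<in> Wex \<Longrightarrow> wex_act (winv (wex_mult g (asr j))) b = wex_act (asr j) (wex_act (winv g) b)"
proof -
  assume g: "g \<in> Wex"
  define c where "c = wex_act (winv g) b"
  have b: "b = wex_act g c" by (simp add: c_def wex_act_winv g)
  have "b = wex_act (wex_mult g (asr j)) (wex_act (asr j) c)"
    by (simp add: b wex_act_mult g asr_invol)
  then have "wex_act (winv (wex_mult g (asr j))) b = wex_act (asr j) c"
    by (simp only: wex_act_winv(1)[OF wex_mult_in[OF g asr_in]])
  then show ?thesis by (simp only: c_def)
qed

text \<open>
  A simple reflection \<open>s\<^sub>j\<close> changes the sign of no roots but \<open>\<plusminus>\<alpha>\<^sub>j\<close>. So \<open>b\<close> changes its sign at the
  letter that crosses the wall of \<open>b\<close>.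
\<close>

lemma sign_change_in_walls:
  assumes "g \<in> Wex" "b \<in> aroots"
    and "wex_act (winv g) b \<in> apos" "wex_act (winv (wex_mult g (aword js))) b \<notin> apos"
  shows "b \<in> set (walls g js)"
  using assms
proof (induction js arbitrary: g)
  case Nil
  then show ?case by (simp add: aword_Nil wex_mult_one_right)
next
  case (Cons j js)
  let ?h = "wex_mult g (asr j)"
  have hW: "?h \<in> Wex" using Cons.prems wex_mult_in asr_in by blast
  show ?case
  proof (cases "wex_act (winv ?h) b \<in> apos")
    case True
    have "wex_mult g (aword (j # js)) = wex_mult ?h (aword js)"
      using Cons.prems(1) by (simp add: aword_Cons wex_mult_assoc)
    then show ?thesis using Cons.IH[OF hW Cons.prems(2) True] Cons.prems(4) by simp
  next
    case False
    then have "wex_act (winv g) b = asim j"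
      using asr_apos[of "wex_act (winv g) b" j] Cons.prems winv_step by metis
    then have "b = wex_act g (asim j)" using wex_act_winv(2)[OF Cons.prems(1), of b] by simp
    then show ?thesis by simp
  qed
qed

lemma winv_neg: "g \<in> Wex \<Longrightarrow> b \<in> aroots \<Longrightarrow> wex_act (winv g) (- b) \<in> apos \<longleftrightarrow> wex_act (winv g) b \<notin> apos"
  using apos_neg[OF wex_act_aroots[of "winv g" b]] by (simp add: wex_act_lin winv_in)

lemma Pi_winv_apos:
  assumes "p \<in> wex_Pi \<Delta> \<alpha>" "b \<in> apos"
  shows "wex_act (winv p) b \<in> apos"
proof (rule ccontr)
  assume n: "wex_act (winv p) b \<notin> apos"
  have p: "p \<in> Wex" "ainvs p = {}"
    using assms(1) finite_ainvs by (auto simp: wex_Pi_def wex_len_ainvs)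
  let ?c = "- wex_act (winv p) b"
  have "?c \<in> apos" using n apos_neg[OF wex_act_aroots[OF winv_in[OF p(1)] apos_aroots[OF assms(2)]]] by simp
  moreover have "wex_act p ?c = - b" by (simp add: wex_act_lin p wex_act_winv)
  ultimately have "?c \<in> ainvs p" using assms(2) by (simp add: ainvs_def)
  then show False using p by simp
qed

text \<open>
  Every inversion of \<open>g\<^sup>-\<^sup>1\<close> changes its sign along the gallery, so its wall is crossed. The
  length of a reduced gallery is the number of these inversions, which leaves no room for
  other walls or for repetitions.
\<close>

lemma reduced_walls:
  assumes "wex_reduced_expr \<Delta> \<alpha> g p js"
  shows "distinct (walls p js)" and "set (walls p js) = ainvs (winv g)"
proof -
  have p: "p \<in> Wex" "p \<in> wex_Pi \<Delta> \<alpha>" and g: "g = wex_mult p (aword js)" and l: "length js = card (ainvs g)"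
    using assms by (auto simp: wex_reduced_expr_def wex_Pi_def wex_len_ainvs)
  have gW: "g \<in> Wex" using g p wex_mult_in by simp
  have sub: "ainvs (winv g) \<subseteq> set (walls p js)"
  proof
    fix b assume b: "b \<in> ainvs (winv g)"
    then have bp: "b \<in> apos" "- wex_act (winv g) b \<in> apos" by (auto simp: ainvs_def)
    have "wex_act (winv g) b \<notin> apos"
      using bp(2) apos_neg[OF wex_act_aroots[OF winv_in[OF gW] apos_aroots[OF bp(1)]]] by simp
    then show "b \<in> set (walls p js)"
      using sign_change_in_walls[OF p(1) apos_aroots[OF bp(1)] Pi_winv_apos[OF p(2) bp(1)]] g by simp
  qed
  have "card (ainvs (winv g)) = length (walls p js)" using l card_ainvs_winv[OF gW] by simp
  moreover have "card (set (walls p js)) \<le> length (walls p js)" by (rule card_length)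
  moreover have "card (ainvs (winv g)) \<le> card (set (walls p js))" by (rule card_mono[OF _ sub]) simp
  ultimately have c: "card (set (walls p js)) = length (walls p js)" "card (ainvs (winv g)) = card (set (walls p js))" by auto
  show "distinct (walls p js)" by (rule card_distinct[OF c(1)])
  show "set (walls p js) = ainvs (winv g)" using card_subset_eq[OF _ sub c(2)] by simp
qed

text \<open>
  If the wall of \<open>c + d\<close> is crossed before that of \<open>c\<close>, then the positive root \<open>d\<close> has changed its
  sign by then, so its wall has been crossed as well.
\<close>

lemma walls_convex:
  assumes p: "p \<in> Wex" "p \<in> wex_Pi \<Delta> \<alpha>" and pos: "set (walls p js) \<subseteq> apos"
    and km: "k < m" "m < length js"
    and d: "walls p js ! k - walls p js ! m \<in> apos"
  shows "walls p js ! k - walls p js ! m \<in> set (walls p js)"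
proof -
  let ?b = "walls p js ! k" and ?c = "walls p js ! m"
  let ?h = "wex_mult p (aword (take k js))"
  let ?g = "wex_mult p (aword (take (Suc k) js))"
  let ?g' = "wex_mult p (aword (take m js))"
  have W: "?h \<in> Wex" "?g \<in> Wex" "?g' \<in> Wex" using p wex_mult_in by simp_all
  have kl: "k < length js" using km by simp
  have gh: "?g = wex_mult ?h (asr (js ! k))"
    using kl p by (simp add: take_Suc_conv_app_nth aword_append aword_Cons aword_Nil wex_mult_one_right asr_in wex_mult_assoc)
  have b: "?b = wex_act ?h (asim (js ! k))" by (rule walls_nth[OF p(1) kl])
  have c: "?c = wex_act ?g' (asim (js ! m))" by (rule walls_nth[OF p(1) km(2)])
  have cA: "?c \<in> apos" using pos km by (metis length_walls nth_mem subsetD)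
  have b1: "wex_act (winv ?g) ?b = - asim (js ! k)"
    unfolding gh winv_step[OF W(1)] b wex_act_winv(1)[OF W(1)] by (rule asr_self)
  have c1: "wex_act (winv ?g) ?c \<in> apos"
  proof (rule ccontr)
    assume "wex_act (winv ?g) ?c \<notin> apos"
    then have n: "wex_act (winv ?g) (- ?c) \<in> apos" using winv_neg[OF W(2) apos_aroots[OF cA]] by simp
    define ks where "ks = take (m - Suc k) (drop (Suc k) js)"
    have t: "take m js = take (Suc k) js @ ks"
      unfolding ks_def using km by (metis Suc_leI le_add_diff_inverse take_add)
    have g': "?g' = wex_mult ?g (aword ks)" unfolding t aword_append using p by (simp add: wex_mult_assoc)
    have "wex_act (winv ?g') ?c = asim (js ! m)" unfolding c by (rule wex_act_winv(1)[OF W(3)])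
    then have "wex_act (winv ?g') (- ?c) \<notin> apos"
      using winv_neg[OF W(3) apos_aroots[OF cA]] asim_apos by simp
    then have "- ?c \<in> set (walls ?g ks)"
      using sign_change_in_walls[OF W(2) aroots_neg[OF apos_aroots[OF cA]] n] g' by simp
    moreover have "js = take (Suc k) js @ ks @ drop m js" using t by (metis append_assoc append_take_drop_id)
    then have "set (walls ?g ks) \<subseteq> set (walls p js)"
      using walls_append[OF p(1), of "take (Suc k) js" "ks @ drop m js"] walls_append[OF W(2), of ks "drop m js"]
      by (metis Un_subset_iff order_refl set_append)
    ultimately have "- ?c \<in> apos" using pos by blast
    then show False using cA apos_neg[OF apos_aroots[OF cA]] by simp
  qed
  have dA: "?b - ?c \<in> aroots" using d by (rule apos_aroots)
  have "aht (wex_act (winv ?g) (?b - ?c)) < 0"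
    unfolding wex_act_lin(2)[OF winv_in[OF W(2)]] b1 aht_lin aht_asim
    using c1 aht_bounds(3)[OF apos_aroots[OF c1]] by simp
  then have "wex_act (winv ?g) (?b - ?c) \<notin> apos"
    using aht_bounds(3)[OF wex_act_aroots[OF winv_in[OF W(2)] dA]] by simp
  then have "?b - ?c \<in> set (walls p (take (Suc k) js))"
    using sign_change_in_walls[OF p(1) dA Pi_winv_apos[OF p(2) d]] by simp
  then show ?thesis
    using walls_append[OF p(1), of "take (Suc k) js" "drop (Suc k) js"] by simp
qed

text \<open>Roots with inner product 0, whose reflections commute, may come in either order.\<close>

definition ascending :: "('a \<times> real) list \<Rightarrow> bool" where
  "ascending bs \<longleftrightarrow> sorted_wrt (\<lambda>b c. fst b \<bullet> fst c = 0 \<or> (fst b \<bullet> fst c = 1 \<and> aht b < aht c)) bs"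

lemma aroots_diff:
  assumes "b \<in> aroots" "c \<in> aroots" "fst b \<bullet> fst c = 1" shows "b - c \<in> aroots"
  using assms by (auto simp: aroots_def diff_root)

text \<open>
  Let \<open>b\<close> be crossed before \<open>c\<close>. If \<open>(b,c) = 1\<close> then \<open>b - c\<close> is a root on level 0 of \<open>\<lambda>\<close>, hence it is
  not crossed, and by convexity it is not positive. If \<open>(b,c) = -1\<close> then \<open>b + c\<close> would be a root
  on level \<open>2\<kappa>\<close>.
\<close>

lemma walls_ascending:
  assumes p: "p \<in> wex_Pi \<Delta> \<alpha>" and pos: "set (walls p js) \<subseteq> apos" and dist: "distinct (walls p js)"
    and lam: "\<And>a. a \<in> \<Delta> \<Longrightarrow> lam \<bullet> a \<in> {0,1,-1}"
    and lev: "\<And>b. b \<in> set (walls p js) \<Longrightarrow> lam \<bullet> fst b = \<kappa>" and \<kappa>: "\<kappa> = 1 \<or> \<kappa> = -1"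
    and fin: "\<And>b c. b \<in> set (walls p js) \<Longrightarrow> c \<in> set (walls p js) \<Longrightarrow> fst b = fst c \<Longrightarrow> b = c"
  shows "ascending (walls p js)"
  unfolding ascending_def sorted_wrt_iff_nth_less
proof (intro allI impI)
  fix k m assume km: "k < m" "m < length (walls p js)"
  let ?b = "walls p js ! k" and ?c = "walls p js ! m"
  have pW: "p \<in> Wex" using p by (simp add: wex_Pi_def)
  have mem: "?b \<in> set (walls p js)" "?c \<in> set (walls p js)" using km by (auto intro: nth_mem)
  then have A: "?b \<in> aroots" "?c \<in> aroots" using pos apos_aroots by blast+
  then have D: "fst ?b \<in> \<Delta>" "fst ?c \<in> \<Delta>" by (auto simp: aroots_def)
  have ne: "?b \<noteq> ?c" using dist km by (simp add: nth_eq_iff_index_eq)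
  show "fst ?b \<bullet> fst ?c = 0 \<or> (fst ?b \<bullet> fst ?c = 1 \<and> aht ?b < aht ?c)"
  proof (cases rule: inner_root_cases[OF D])
    case 1
    then show ?thesis using fin[OF mem] ne by simp
  next
    case 2
    have dA: "?b - ?c \<in> aroots" by (rule aroots_diff[OF A 2])
    have "?b - ?c \<notin> apos"
    proof
      assume "?b - ?c \<in> apos"
      then have "?b - ?c \<in> set (walls p js)" using walls_convex[OF pW p pos km(1) _] km(2) by simp
      then have "lam \<bullet> fst (?b - ?c) = \<kappa>" by (rule lev)
      then show False using lev[OF mem(1)] lev[OF mem(2)] \<kappa> by (simp add: inner_diff_right)
    qed
    then show ?thesis using 2 aht_bounds(2,3)[OF dA] by (auto simp: aht_lin)
  next
    case 4
    then have "fst ?b + fst ?c \<in> \<Delta>" using add_root D by blast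
    then show ?thesis using lam[of "fst ?b + fst ?c"] lev[OF mem(1)] lev[OF mem(2)] \<kappa>
      by (auto simp: inner_add_right)
  next
    case 5
    then show ?thesis using lev[OF mem(1)] lev[OF mem(2)] \<kappa> by auto
  qed simp
qed

end

section \<open>Monomial substitutions and fraction fields\<close>

lemma poly_mapping_sum_single: "(\<Sum>k\<in>Poly_Mapping.keys f. Poly_Mapping.single k (Poly_Mapping.lookup f k)) = f"
  by (rule poly_mapping_eqI) (simp add: lookup_sum lookup_single when_def in_keys_iff)

lemma poly_mapping_induct_single [case_names single add]:
  assumes s: "\<And>k c. Q (Poly_Mapping.single k c)" and a: "\<And>f g. Q f \<Longrightarrow> Q g \<Longrightarrow> Q (f + g)"
  shows "Q (f :: 'k \<Rightarrow>\<^sub>0 'c::comm_monoid_add)"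
proof -
  have "finite S \<Longrightarrow> Q (\<Sum>k\<in>S. Poly_Mapping.single k (Poly_Mapping.lookup f k))" for S
  proof (induction rule: finite_induct)
    case empty
    show ?case using s[of undefined 0] by simp
  qed (simp add: s a)
  from this[OF finite_keys[of f]] show ?thesis by (simp add: poly_mapping_sum_single)
qed

text \<open>
  The substitution \<open>X\<^sup>n \<mapsto> \<zeta>(n)X\<^bsup>\<phi>(n)\<^esup>\<close>. The actions of \<open>W\<^sub>e\<^sub>x\<close> on the group algebra and of the
  translations on its Laurent form, and the substitution \<open>X\<^sup>\<nu> \<mapsto> t\<^bsup>-(\<rho>,\<nu>)\<^esup>X\<^sup>\<nu>\<close>, all have this shape.
\<close>

definition mono_map :: "('n::comm_monoid_add \<Rightarrow> 'n) \<Rightarrow> ('n \<Rightarrow> 'c::comm_ring_1) \<Rightarrow> ('n \<Rightarrow>\<^sub>0 'c) \<Rightarrow> ('n \<Rightarrow>\<^sub>0 'c)" where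
  "mono_map \<phi> \<zeta> f = (\<Sum>n\<in>Poly_Mapping.keys f. Poly_Mapping.single (\<phi> n) (Poly_Mapping.lookup f n * \<zeta> n))"

lemma mono_map_single: "mono_map \<phi> \<zeta> (Poly_Mapping.single n c) = Poly_Mapping.single (\<phi> n) (c * \<zeta> n)"
  by (simp add: mono_map_def)

lemma mono_map_add: "mono_map \<phi> \<zeta> (f + g) = mono_map \<phi> \<zeta> f + mono_map \<phi> \<zeta> g"
  unfolding mono_map_def
  by (rule setsum_keys_plus_distrib[of "\<lambda>n c. Poly_Mapping.single (\<phi> n) (c * \<zeta> n)"])
     (simp_all add: distrib_right single_add)

lemma mono_map_mult:
  assumes "\<And>m n. \<phi> (m + n) = \<phi> m + \<phi> n" "\<And>m n. \<zeta> (m + n) = \<zeta> m * \<zeta> n"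
  shows "mono_map \<phi> \<zeta> (f * g) = mono_map \<phi> \<zeta> f * mono_map \<phi> \<zeta> g"
proof (induction f rule: poly_mapping_induct_single)
  case (single k c)
  show ?case
  proof (induction g rule: poly_mapping_induct_single)
    case (single m d)
    show ?case by (simp add: mult_single mono_map_single assms mult_ac)
  qed (simp add: distrib_left mono_map_add)
qed (simp add: distrib_right mono_map_add)

lemma mono_map_comp: "mono_map \<phi> \<zeta> (mono_map \<psi> \<xi> f) = mono_map (\<lambda>n. \<phi> (\<psi> n)) (\<lambda>n. \<xi> n * \<zeta> (\<psi> n)) f"
  by (induction f rule: poly_mapping_induct_single) (simp_all add: mono_map_single mono_map_add mult_ac)

lemma lookup_mono_map:
  assumes "inj \<phi>"
  shows "Poly_Mapping.lookup (mono_map \<phi> \<zeta> f) (\<phi> n) = Poly_Mapping.lookup f n * \<zeta> n"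
  by (induction f rule: poly_mapping_induct_single)
     (auto simp: mono_map_single mono_map_add lookup_single when_def lookup_add distrib_right dest: injD[OF assms])

text \<open>
  The maps for which \<open>fract_ext\<close> is well defined, because they keep denominators different from
  0.
\<close>

definition ring_inj :: "('b::idom \<Rightarrow> 'b) \<Rightarrow> bool" where
  "ring_inj \<phi> \<longleftrightarrow> \<phi> 1 = 1 \<and> (\<forall>a b. \<phi> (a + b) = \<phi> a + \<phi> b) \<and> (\<forall>a b. \<phi> (a * b) = \<phi> a * \<phi> b) \<and> (\<forall>a. \<phi> a = 0 \<longrightarrow> a = 0)"

lemma ring_injD:
  assumes "ring_inj \<phi>"
  shows "\<phi> 1 = 1" "\<phi> (a + b) = \<phi> a + \<phi> b" "\<phi> (a * b) = \<phi> a * \<phi> b" "\<phi> a = 0 \<longleftrightarrow> a = 0"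
proof -
  show add: "\<phi> (a + b) = \<phi> a + \<phi> b" for a b using assms by (simp add: ring_inj_def)
  show "\<phi> 1 = 1" "\<phi> (a * b) = \<phi> a * \<phi> b" using assms by (simp_all add: ring_inj_def)
  have "\<phi> 0 + \<phi> 0 = \<phi> 0 + 0" using add[of 0 0] by (simp only: add_0_right)
  then have "\<phi> 0 = 0" by (simp only: add_left_cancel)
  then show "\<phi> a = 0 \<longleftrightarrow> a = 0" using assms by (auto simp: ring_inj_def)
qed

lemma fract_ext_Fract:
  assumes \<phi>: "ring_inj \<phi>" and b: "b \<noteq> 0"
  shows "fract_ext \<phi> (Fract a b) = Fract (\<phi> a) (\<phi> b)"
  unfolding fract_ext_def
proof (rule the_equality)
  show "\<forall>a' b'. b' \<noteq> 0 \<longrightarrow> Fract a b = Fract a' b' \<longrightarrow> Fract (\<phi> a) (\<phi> b) = Fract (\<phi> a') (\<phi> b')"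
    using b by (auto simp: eq_fract ring_injD[OF \<phi>] simp flip: ring_injD(3)[OF \<phi>])
  show "y = Fract (\<phi> a) (\<phi> b)"
    if "\<forall>a' b'. b' \<noteq> 0 \<longrightarrow> Fract a b = Fract a' b' \<longrightarrow> y = Fract (\<phi> a') (\<phi> b')" for y
    using that b by blast
qed

lemma fract_ext_hom:
  assumes \<phi>: "ring_inj \<phi>"
  shows "fract_ext \<phi> (y + z) = fract_ext \<phi> y + fract_ext \<phi> z"
    and "fract_ext \<phi> (y * z) = fract_ext \<phi> y * fract_ext \<phi> z"
    and "fract_ext \<phi> 1 = 1" and "fract_ext \<phi> 0 = 0" and "fract_ext \<phi> (- z) = - fract_ext \<phi> z"
    and "fract_ext \<phi> (y - z) = fract_ext \<phi> y - fract_ext \<phi> z"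
    and "fract_ext \<phi> (inverse z) = inverse (fract_ext \<phi> z)"
    and "fract_ext \<phi> (y / z) = fract_ext \<phi> y / fract_ext \<phi> z"
proof -
  note [simp] = ring_injD[OF \<phi>] fract_ext_Fract[OF \<phi>]
  have z0 [simp]: "\<phi> 0 = 0" by (simp only: ring_injD(4)[OF \<phi>])
  show add: "fract_ext \<phi> (y + z) = fract_ext \<phi> y + fract_ext \<phi> z" for y z
    by (induct y, induct z) simp
  show mult: "fract_ext \<phi> (y * z) = fract_ext \<phi> y * fract_ext \<phi> z" for y z
    by (induct y, induct z) simp
  show one: "fract_ext \<phi> 1 = 1" by (simp add: One_fract_def)
  show zero: "fract_ext \<phi> 0 = 0" by (simp add: Zero_fract_def)
  show minus: "fract_ext \<phi> (- z) = - fract_ext \<phi> z" for z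
    using add[of z "- z"] zero by (simp add: eq_neg_iff_add_eq_0 add.commute)
  show "fract_ext \<phi> (y - z) = fract_ext \<phi> y - fract_ext \<phi> z" using add[of y "- z"] minus by simp
  show inv: "fract_ext \<phi> (inverse z) = inverse (fract_ext \<phi> z)" for z
  proof (cases "z = 0")
    case False
    then have "fract_ext \<phi> z * fract_ext \<phi> (inverse z) = 1" using mult[of z "inverse z"] one by simp
    then show ?thesis by (metis inverse_unique)
  qed (simp add: zero)
  show "fract_ext \<phi> (y / z) = fract_ext \<phi> y / fract_ext \<phi> z" by (simp only: divide_inverse mult inv)
qed

lemma fract_ext_comp:
  assumes \<phi>: "ring_inj \<phi>" and \<psi>: "ring_inj \<psi>" and \<xi>: "ring_inj \<xi>" and e: "\<And>a. \<phi> (\<psi> a) = \<xi> a"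
  shows "fract_ext \<phi> (fract_ext \<psi> z) = fract_ext \<xi> z"
  by (induct z) (simp add: fract_ext_Fract \<phi> \<psi> \<xi> e ring_injD)

lemma mono_map_ring_inj:
  fixes \<zeta> :: "'n::{ordered_cancel_comm_monoid_add, linorder} \<Rightarrow> 'c::idom"
  assumes "\<And>m n. \<phi> (m + n) = \<phi> m + \<phi> n" "\<And>m n. \<zeta> (m + n) = \<zeta> m * \<zeta> n"
    and "inj \<phi>" "\<And>n. \<zeta> n \<noteq> 0"
  shows "ring_inj (mono_map \<phi> \<zeta>)"
  unfolding ring_inj_def
proof (intro conjI allI impI)
  have "\<phi> 0 + \<phi> 0 = 0 + \<phi> 0" using assms(1)[of 0 0] by simp
  then have p0: "\<phi> 0 = 0" by (simp only: add_right_cancel)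
  have "\<zeta> 0 * \<zeta> 0 = 1 * \<zeta> 0" using assms(2)[of 0 0] by simp
  then have c0: "\<zeta> 0 = 1" using assms(4)[of 0] by simp
  show "mono_map \<phi> \<zeta> 1 = 1" using mono_map_single[of \<phi> \<zeta> 0 1] p0 c0 by simp
  show "mono_map \<phi> \<zeta> (a + b) = mono_map \<phi> \<zeta> a + mono_map \<phi> \<zeta> b" for a b by (rule mono_map_add)
  show "mono_map \<phi> \<zeta> (a * b) = mono_map \<phi> \<zeta> a * mono_map \<phi> \<zeta> b" for a b by (rule mono_map_mult[OF assms(1,2)])
  show "a = 0" if "mono_map \<phi> \<zeta> a = 0" for a
  proof (rule poly_mapping_eqI)
    fix n
    show "Poly_Mapping.lookup a n = Poly_Mapping.lookup 0 n"
      using lookup_mono_map[OF assms(3), of \<zeta> a n] that assms(4)[of n] by simp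
  qed
qed

lemma q_root_neq_0: "q_root \<noteq> 0"
  by (simp add: q_root_def Zero_fract_def eq_fract)

lemma v_par_neq_0: "v_par \<noteq> 0"
  by (simp add: v_par_def Zero_fract_def eq_fract)

lemma scalar_hom: "scalar (a + b) = scalar a + scalar b" "scalar (a * b) = scalar a * scalar b"
  "scalar 0 = 0" "scalar 1 = 1" "scalar (- a) = - scalar a" "scalar (a - b) = scalar a - scalar b"
  by (simp_all add: scalar_def single_add single_diff single_uminus mult_single fract_collapse)

lemma scalar_eq_0: "scalar a = 0 \<longleftrightarrow> a = 0"
proof -
  have "Poly_Mapping.single (0 :: 'a wt) a = 0 \<longleftrightarrow> a = 0"
    by (metis lookup_single_eq lookup_zero single_zero)
  then show ?thesis by (simp add: scalar_def Zero_fract_def eq_fract)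
qed

lemma scalar_inverse: "scalar (inverse a) = inverse (scalar a)"
proof (cases "a = 0")
  case False
  then have "scalar a * scalar (inverse a) = 1" by (simp flip: scalar_hom(2,4))
  then show ?thesis by (metis inverse_unique)
qed (simp add: scalar_hom)

lemma scalar_power: "scalar (a ^ n) = scalar a ^ n"
  by (induction n) (simp_all add: scalar_hom)

lemma scalar_powi: "scalar (a powi n) = scalar a powi n"
  by (simp add: power_int_def scalar_power scalar_inverse)

context sl_roots
begin

section \<open>The action on the function field\<close>

lemma int_det:
  fixes A :: "real ^ 'n ^ 'n"
  assumes "\<And>i j. A $ i $ j \<in> \<int>"
  shows "det A \<in> \<int>"
  unfolding det_def by (intro Ints_sum Ints_mult Ints_prod assms) simp

text \<open>By Cramer's rule the determinant of the Cartan matrix clears all denominators of the form on the weight lattice.\<close>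

lemma form_denom: "form_denom \<alpha> > 0 \<and> (\<forall>\<mu>\<in>P. \<forall>\<nu>\<in>P. real (form_denom \<alpha>) * (\<mu> \<bullet> \<nu>) \<in> \<int>)"
proof -
  define A :: "((real, 'i) vec, 'i) vec" where "A = (\<chi> i j. \<alpha> i \<bullet> \<alpha> j)"
  have comb: "(A *v x) $ i = \<alpha> i \<bullet> (\<Sum>j\<in>UNIV. x $ j *\<^sub>R \<alpha> j)" for x i
    by (simp add: A_def matrix_vector_mult_def inner_sum_right mult.commute)
  have A_int: "A $ i $ j \<in> \<int>" for i j by (simp add: A_def inner_root_Ints simple_root)
  have "det A \<noteq> 0"
  proof -
    have "x = 0" if "A *v x = 0" for x
    proof -
      define y where "y = (\<Sum>j\<in>UNIV. x $ j *\<^sub>R \<alpha> j)"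
      have "y \<bullet> \<alpha> i = 0 \<bullet> \<alpha> i" for i using that comb[of x i] by (simp add: y_def inner_commute)
      then have "y = 0" by (rule eq_if_inner_simple)
      have "x $ i = \<omega> i \<bullet> y" for i
        unfolding y_def by (simp add: inner_sum_right fund_weight_inner if_distrib cong: if_cong)
      then show "x = 0" using \<open>y = 0\<close> by (simp add: vec_eq_iff)
    qed
    then have "inj ((*v) A)" by (simp add: linear_injective_0[OF matrix_vector_mul_linear])
    then show ?thesis by (simp add: invertible_left_inverse matrix_left_invertible_injective flip: invertible_det_nz)
  qed
  obtain z where z: "det A = of_int z" using int_det[OF A_int] by (auto elim: Ints_cases)
  have key: "det A * (\<omega> k \<bullet> \<omega> j) \<in> \<int>" for k j
  proof -
    define x :: "(real, 'i) vec" where "x = (\<chi> j. \<omega> j \<bullet> \<omega> k)"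
    have "(\<Sum>j\<in>UNIV. x $ j *\<^sub>R \<alpha> j) = \<omega> k" by (simp add: x_def flip: simple_expand)
    then have "(A *v x) $ i = (if i = k then 1 else 0)" for i
      using comb[of x i] by (simp add: fund_weight_inner inner_commute[of "\<alpha> i"])
    then have "det (\<chi> i ja. if ja = j then (A *v x) $ i else A $ i $ ja) \<in> \<int>"
      by (intro int_det) (simp add: A_int)
    then have "x $ j * det A \<in> \<int>" by (simp only: cramer_lemma)
    then show ?thesis by (simp add: x_def inner_commute mult.commute)
  qed
  define e where "e = nat \<bar>z\<bar>"
  have e0: "e > 0" using z \<open>det A \<noteq> 0\<close> by (simp add: e_def)
  have eab: "real e = \<bar>det A\<bar>" by (simp add: e_def z)
  have "real e * (\<mu> \<bullet> \<nu>) \<in> \<int>" if "\<mu> \<in> P" "\<nu> \<in> P" for \<mu> \<nu>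
  proof -
    have "det A * (\<mu> \<bullet> \<nu>) = (\<Sum>i\<in>UNIV. \<Sum>j\<in>UNIV. (\<mu> \<bullet> \<alpha> i) * (\<nu> \<bullet> \<alpha> j) * (det A * (\<omega> i \<bullet> \<omega> j)))"
      apply (subst fund_weight_expand[of \<mu>], subst fund_weight_expand[of \<nu>])
      apply (simp add: inner_sum_left inner_sum_right sum_distrib_left mult_ac)
      apply (rule sum.swap)
      done
    also have "\<dots> \<in> \<int>" using that by (intro Ints_sum Ints_mult[OF Ints_mult] key) (auto simp: weight_lattice_iff)
    finally show ?thesis unfolding eab by (simp add: abs_if)
  qed
  with e0 have "\<exists>e. e > 0 \<and> (\<forall>\<mu>\<in>P. \<forall>\<nu>\<in>P. real e * (\<mu> \<bullet> \<nu>) \<in> \<int>)" by blast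
  then show ?thesis unfolding form_denom_def by (rule LeastI_ex)
qed

lemma lookup_wt_of: "Poly_Mapping.lookup (wt_of \<alpha> \<nu>) i = \<lfloor>\<nu> \<bullet> \<alpha> i\<rfloor>"
  by (simp add: wt_of_def lookup_sum lookup_single when_def)

lemma vec_of_inner: "vec_of \<alpha> n \<bullet> \<alpha> i = of_int (Poly_Mapping.lookup n i)"
  by (simp add: vec_of_def inner_sum_left fund_weight_inner if_distrib cong: if_cong)

lemma vec_of_in_P [simp]: "vec_of \<alpha> n \<in> P"
  by (simp add: weight_lattice_iff vec_of_inner)

lemma wt_of_vec_of [simp]: "wt_of \<alpha> (vec_of \<alpha> n) = n"
  by (rule poly_mapping_eqI) (simp add: lookup_wt_of vec_of_inner)

lemma vec_of_wt_of: "\<nu> \<in> P \<Longrightarrow> vec_of \<alpha> (wt_of \<alpha> \<nu>) = \<nu>"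
  by (rule eq_if_inner_simple) (auto simp: lookup_wt_of vec_of_inner weight_lattice_iff elim!: Ints_cases)

lemma vec_of_add: "vec_of \<alpha> (m + n) = vec_of \<alpha> m + vec_of \<alpha> n"
  by (rule eq_if_inner_simple) (simp add: vec_of_inner lookup_add inner_add_left)

lemma wt_of_add: "\<mu> \<in> P \<Longrightarrow> \<nu> \<in> P \<Longrightarrow> wt_of \<alpha> (\<mu> + \<nu>) = wt_of \<alpha> \<mu> + wt_of \<alpha> \<nu>"
  by (metis vec_of_add vec_of_wt_of wt_of_vec_of)

lemma wt_of_0 [simp]: "wt_of \<alpha> 0 = 0"
  by (rule poly_mapping_eqI) (simp add: lookup_wt_of)

lemma wt_of_inj: "\<mu> \<in> P \<Longrightarrow> \<nu> \<in> P \<Longrightarrow> wt_of \<alpha> \<mu> = wt_of \<alpha> \<nu> \<Longrightarrow> \<mu> = \<nu>"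
  by (metis vec_of_wt_of)

text \<open>The exponents on which \<open>q_exp\<close> involves no rounding, so that it is additive.\<close>

definition q_rat :: "real set" where "q_rat = {c. real (form_denom \<alpha>) * c \<in> \<int>}"

lemma q_rat_inner: "\<mu> \<in> P \<Longrightarrow> \<nu> \<in> P \<Longrightarrow> \<mu> \<bullet> \<nu> \<in> q_rat"
  using form_denom by (simp add: q_rat_def)

lemma q_rat_closed: "c \<in> q_rat \<Longrightarrow> d \<in> q_rat \<Longrightarrow> c + d \<in> q_rat" "c \<in> q_rat \<Longrightarrow> - c \<in> q_rat"
  "c \<in> q_rat \<Longrightarrow> d \<in> q_rat \<Longrightarrow> c - d \<in> q_rat"
  "c \<in> \<int> \<Longrightarrow> c \<in> q_rat"
  by (auto simp: q_rat_def distrib_left right_diff_distrib)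

lemma q_exp_add: "c \<in> q_rat \<Longrightarrow> d \<in> q_rat \<Longrightarrow> q_exp \<alpha> (c + d) = q_exp \<alpha> c + q_exp \<alpha> d"
  by (auto simp: q_rat_def q_exp_def distrib_left elim!: Ints_cases simp flip: of_int_add)

lemma q_pow_add: "c \<in> q_rat \<Longrightarrow> d \<in> q_rat \<Longrightarrow> q_pow \<alpha> (c + d) = q_pow \<alpha> c * q_pow \<alpha> d"
  by (simp add: q_pow_def q_exp_add power_int_add q_root_neq_0)

lemma q_pow_0 [simp]: "q_pow \<alpha> 0 = 1"
  by (simp add: q_pow_def q_exp_def)

lemma q_pow_neq_0: "q_pow \<alpha> c \<noteq> 0"
  by (simp add: q_pow_def q_root_neq_0)

lemma two_rho_P: "\<nu> \<in> P \<Longrightarrow> 2 * (\<rho> \<bullet> \<nu>) \<in> \<int>"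
proof -
  assume n: "\<nu> \<in> P"
  have "2 * (\<rho> \<bullet> \<nu>) = (\<Sum>a\<in>pos. a \<bullet> \<nu>)" by (simp add: half_sum_def inner_sum_left)
  also have "\<dots> \<in> \<int>" using inner_P_root[OF n pos_sub] by (intro Ints_sum) (simp add: inner_commute)
  finally show ?thesis .
qed

lemma t_pow_add: "2 * c \<in> \<int> \<Longrightarrow> 2 * d \<in> \<int> \<Longrightarrow> t_pow (c + d) = t_pow c * t_pow d"
  by (auto simp: t_pow_def distrib_left power_int_add v_par_neq_0 elim!: Ints_cases simp flip: of_int_add)

lemma t_pow_neq_0: "t_pow c \<noteq> 0"
  by (simp add: t_pow_def v_par_neq_0)

lemma wex_act_poly_mono:
  "wex_act_poly \<alpha> g = mono_map (\<lambda>n. wt_of \<alpha> (snd g (vec_of \<alpha> n))) (\<lambda>n. q_pow \<alpha> (- (fst g \<bullet> snd g (vec_of \<alpha> n))))"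
  by (rule ext) (simp add: wex_act_poly_def mono_map_def)

lemma wex_act_poly_single:
  "wex_act_poly \<alpha> g (Poly_Mapping.single n c) =
    Poly_Mapping.single (wt_of \<alpha> (snd g (vec_of \<alpha> n))) (c * q_pow \<alpha> (- (fst g \<bullet> snd g (vec_of \<alpha> n))))"
  by (simp add: wex_act_poly_mono mono_map_single)

lemma wex_act_poly_inj: "g \<in> Wex \<Longrightarrow> ring_inj (wex_act_poly \<alpha> g)"
  unfolding wex_act_poly_mono
proof (rule mono_map_ring_inj)
  assume g: "g \<in> Wex"
  note gP = wexD(1)[OF g] and gW = wexD(2)[OF g]
  show "wt_of \<alpha> (snd g (vec_of \<alpha> (m + n))) = wt_of \<alpha> (snd g (vec_of \<alpha> m)) + wt_of \<alpha> (snd g (vec_of \<alpha> n))" for m n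
    by (simp add: vec_of_add W_lin[OF gW] wt_of_add W_P[OF gW])
  show "q_pow \<alpha> (- (fst g \<bullet> snd g (vec_of \<alpha> (m + n)))) =
     q_pow \<alpha> (- (fst g \<bullet> snd g (vec_of \<alpha> m))) * q_pow \<alpha> (- (fst g \<bullet> snd g (vec_of \<alpha> n)))" for m n
    by (subst q_pow_add[symmetric])
       (simp_all add: vec_of_add W_lin[OF gW] inner_add_right q_rat_closed q_rat_inner W_P[OF gW] gP)
  show "inj (\<lambda>n. wt_of \<alpha> (snd g (vec_of \<alpha> n)))"
  proof (rule injI)
    fix m n assume "wt_of \<alpha> (snd g (vec_of \<alpha> m)) = wt_of \<alpha> (snd g (vec_of \<alpha> n))"
    then have "snd g (vec_of \<alpha> m) = snd g (vec_of \<alpha> n)" by (rule wt_of_inj[rotated 2]) (simp_all add: W_P[OF gW])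
    then have "vec_of \<alpha> m = vec_of \<alpha> n" by (metis W_inverse(3)[OF gW])
    then show "m = n" by (metis wt_of_vec_of)
  qed
qed (rule q_pow_neq_0)

lemma wex_act_poly_mult:
  assumes g: "g \<in> Wex" and h: "h \<in> Wex"
  shows "wex_act_poly \<alpha> g (wex_act_poly \<alpha> h f) = wex_act_poly \<alpha> (wex_mult g h) f"
proof -
  note gP = wexD(1)[OF g] and gW = wexD(2)[OF g] and hP = wexD(1)[OF h] and hW = wexD(2)[OF h]
  have "q_pow \<alpha> (- (fst h \<bullet> snd h (vec_of \<alpha> n))) * q_pow \<alpha> (- (fst g \<bullet> snd g (snd h (vec_of \<alpha> n)))) =
     q_pow \<alpha> (- (fst (wex_mult g h) \<bullet> snd (wex_mult g h) (vec_of \<alpha> n)))" for n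
    by (subst q_pow_add[symmetric])
       (simp_all add: wex_mult_def inner_add_left W_isom[OF gW] q_rat_closed q_rat_inner W_P gP gW hP hW algebra_simps)
  then show ?thesis
    by (simp add: wex_act_poly_mono mono_map_comp vec_of_wt_of W_P[OF hW] wex_mult_def)
qed

lemma wex_act_fun_hom: assumes "g \<in> Wex"
  shows "wex_act_fun \<alpha> g (y + z) = wex_act_fun \<alpha> g y + wex_act_fun \<alpha> g z"
    "wex_act_fun \<alpha> g (y * z) = wex_act_fun \<alpha> g y * wex_act_fun \<alpha> g z"
    "wex_act_fun \<alpha> g 1 = 1" "wex_act_fun \<alpha> g 0 = 0" "wex_act_fun \<alpha> g (- z) = - wex_act_fun \<alpha> g z"
    "wex_act_fun \<alpha> g (y - z) = wex_act_fun \<alpha> g y - wex_act_fun \<alpha> g z"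
    "wex_act_fun \<alpha> g (inverse z) = inverse (wex_act_fun \<alpha> g z)"
    "wex_act_fun \<alpha> g (y / z) = wex_act_fun \<alpha> g y / wex_act_fun \<alpha> g z"
  unfolding wex_act_fun_def by (rule fract_ext_hom[OF wex_act_poly_inj[OF assms]])+

lemma wex_act_fun_mult:
  "g \<in> Wex \<Longrightarrow> h \<in> Wex \<Longrightarrow> wex_act_fun \<alpha> g (wex_act_fun \<alpha> h z) = wex_act_fun \<alpha> (wex_mult g h) z"
  unfolding wex_act_fun_def
  by (rule fract_ext_comp) (simp_all add: wex_act_poly_inj wex_mult_in wex_act_poly_mult)

lemma wex_act_fun_one [simp]: "wex_act_fun \<alpha> wex_one z = z"
proof -
  have e: "wex_act_poly \<alpha> wex_one f = f" for f
    by (induction f rule: poly_mapping_induct_single)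
       (simp_all add: wex_act_poly_single wex_one_def, simp add: wex_act_poly_mono mono_map_add)
  show ?thesis
    by (induct z) (simp add: wex_act_fun_def fract_ext_Fract wex_act_poly_inj e)
qed

lemma wex_act_fun_scalar: "g \<in> Wex \<Longrightarrow> wex_act_fun \<alpha> g (scalar c) = scalar c"
  using wexD(2)[of g]
  by (simp add: wex_act_fun_def scalar_def fract_ext_Fract wex_act_poly_inj ring_injD wex_act_poly_single
      vec_of_def W_lin)

lemma wex_act_fun_X:
  assumes g: "g \<in> Wex" and b: "b \<in> aroots"
  shows "wex_act_fun \<alpha> g (X_aff \<alpha> b) = X_aff \<alpha> (wex_act g b)"
proof -
  have D: "fst b \<in> P" "snd b \<in> \<int>" using b root_in_P by (auto simp: aroots_def)
  have "q_pow \<alpha> (snd b) * q_pow \<alpha> (- (fst g \<bullet> snd g (fst b))) = q_pow \<alpha> (snd b - fst g \<bullet> snd g (fst b))"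
    by (subst q_pow_add[symmetric]) (simp_all add: q_rat_closed q_rat_inner W_P wexD[OF g] D)
  then show ?thesis
    by (simp add: wex_act_fun_def X_aff_def fract_ext_Fract wex_act_poly_inj[OF g]
        ring_injD[OF wex_act_poly_inj[OF g]] wex_act_poly_single vec_of_wt_of D wex_act_def)
qed

lemma X_aff_neq_0: "X_aff \<alpha> b \<noteq> 0"
proof -
  have "Poly_Mapping.single (wt_of \<alpha> (fst b)) (q_pow \<alpha> (snd b)) \<noteq> 0"
    by (metis lookup_single_eq lookup_zero q_pow_neq_0)
  then show ?thesis by (simp add: X_aff_def Zero_fract_def eq_fract)
qed

lemma X_aff_neq_1: "b \<in> aroots \<Longrightarrow> X_aff \<alpha> b \<noteq> 1"
proof
  assume b: "b \<in> aroots" and "X_aff \<alpha> b = 1"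
  then have "Poly_Mapping.single (wt_of \<alpha> (fst b)) (q_pow \<alpha> (snd b)) = (1 :: 'i K0P)"
    by (simp add: X_aff_def One_fract_def eq_fract)
  then have "Poly_Mapping.lookup (1 :: 'i K0P) (wt_of \<alpha> (fst b)) \<noteq> 0" by (metis lookup_single_eq q_pow_neq_0)
  then have "wt_of \<alpha> (fst b) = wt_of \<alpha> 0" by (simp add: lookup_one when_def split: if_splits)
  then have "fst b = 0" by (rule wt_of_inj[rotated 2]) (use b in \<open>auto simp: aroots_def root_in_P P_closed\<close>)
  then show False using b zero_not_root by (auto simp: aroots_def)
qed

lemma X_aff_neg: "b \<in> aroots \<Longrightarrow> X_aff \<alpha> (- b) = inverse (X_aff \<alpha> b)"
proof -
  assume b: "b \<in> aroots"
  then have D: "fst b \<in> P" "snd b \<in> \<int>" by (auto simp: aroots_def root_in_P)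
  have "wt_of \<alpha> (fst b) + wt_of \<alpha> (- fst b) = 0" using wt_of_add[of "fst b" "- fst b"] D P_closed by simp
  moreover have "q_pow \<alpha> (snd b) * q_pow \<alpha> (- snd b) = 1"
    by (subst q_pow_add[symmetric]) (simp_all add: q_rat_closed D)
  ultimately have "X_aff \<alpha> b * X_aff \<alpha> (- b) = Fract (Poly_Mapping.single 0 1) 1"
    by (simp add: X_aff_def mult_single)
  then have "X_aff \<alpha> b * X_aff \<alpha> (- b) = 1" by (simp only: single_one One_fract_def[symmetric])
  then show ?thesis by (metis inverse_unique)
qed

end

section \<open>Difference-reflection operators\<close>

text \<open>
  Elements that do not commute have the same order in both lists, because they are sorted by \<open>h\<close>
  there. So the first element of \<open>ys\<close> commutes with all elements that precede it in \<open>xs\<close> and can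
  be moved to the front.
\<close>

lemma foldr_rearrange:
  fixes f :: "'b \<Rightarrow> 's \<Rightarrow> 's" and h :: "'b \<Rightarrow> real"
  assumes "distinct xs" "distinct ys" "set xs = set ys"
    and "sorted_wrt (\<lambda>a b. C a b \<or> h a < h b) xs" "sorted_wrt (\<lambda>a b. C a b \<or> h a < h b) ys"
    and sym: "\<And>a b. C a b \<Longrightarrow> C b a"
    and comm: "\<And>a b z. a \<in> set ys \<Longrightarrow> b \<in> set ys \<Longrightarrow> C a b \<Longrightarrow> S z \<Longrightarrow> f a (f b z) = f b (f a z)"
    and cl: "\<And>a z. a \<in> set ys \<Longrightarrow> S z \<Longrightarrow> S (f a z)" and z: "S z"
  shows "foldr f xs z = foldr f ys z"
  using assms(1-5) comm cl
proof (induction ys arbitrary: xs)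
  case (Cons y ys)
  note prems = Cons.prems
  obtain pre post where xs: "xs = pre @ y # post" using prems(3) by (metis list.set_intros(1) split_list)
  have st: "set (pre @ post) = set ys" using prems(1-3) xs by auto
  have Cy: "C a y" if "a \<in> set pre" for a
  proof -
    have "a \<in> set ys" using st that by auto
    then have "C y a \<or> h y < h a" using prems(5) by simp
    moreover have "C a y \<or> h a < h y" using prems(4) that by (simp add: xs sorted_wrt_append)
    ultimately show ?thesis using sym by auto
  qed
  have S: "set us \<subseteq> set ys \<Longrightarrow> S (foldr f us z)" for us
    by (induction us) (use prems(7) z in auto)
  have "foldr f (us @ y # post) z = f y (foldr f (us @ post) z)" if "set us \<subseteq> set pre" for us
    using that
  proof (induction us)
    case (Cons u us)
    have "foldr f ((u # us) @ y # post) z = f u (f y (foldr f (us @ post) z))" using Cons by simp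
    also have "\<dots> = f y (f u (foldr f (us @ post) z))"
    proof (rule prems(6))
      show "C u y" using Cy Cons.prems by simp
      show "S (foldr f (us @ post) z)" by (rule S) (use Cons.prems st in auto)
      show "u \<in> set (y # ys)" using Cons.prems st by auto
    qed (simp_all add: \<open>\<And>a b z. a \<in> set (y # ys) \<Longrightarrow> b \<in> set (y # ys) \<Longrightarrow> C a b \<Longrightarrow> S z \<Longrightarrow> f a (f b z) = f b (f a z)\<close>)
    finally show ?case by simp
  qed simp
  then have "foldr f xs z = f y (foldr f (pre @ post) z)" using xs by simp
  also have "foldr f (pre @ post) z = foldr f ys z"
  proof (rule Cons.IH)
    show "distinct (pre @ post)" "distinct ys" using prems(1,2) xs by auto
    show "sorted_wrt (\<lambda>a b. C a b \<or> h a < h b) (pre @ post)" using prems(4) by (simp add: xs sorted_wrt_append)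
    show "f a (f b z) = f b (f a z)" if "a \<in> set ys" "b \<in> set ys" "C a b" "S z" for a b z
      by (rule prems(6)) (use that in auto)
    show "S (f a z)" if "a \<in> set ys" "S z" for a z by (rule prems(7)) (use that in auto)
  qed (use st prems in auto)
  finally show ?case by simp
qed simp

text \<open>
  This identity and the next ones are the coefficients of 1 and of the reflection in the two
  products of \<open>T\<close> with its inverse.
\<close>

lemma hecke_inverse_diag:
  fixes X T :: "'f::field"
  assumes "X \<noteq> 0" "X \<noteq> 1" "T \<noteq> 0"
  shows "(T * X - 1) / (X - 1) * ((T * inverse X - 1) / (inverse X - 1) / T) + (1 - T) / (X - 1) * (X * ((1 - T) / (X - 1)) / T) = 1"
proof -
  have x: "X - 1 \<noteq> 0" "1 - X \<noteq> 0" using assms by auto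
  have "(T * inverse X - 1) / (inverse X - 1) = (X - T) / (X - 1)"
    using assms x by (simp add: divide_simps) (simp add: algebra_simps)
  then have "(T * X - 1) / (X - 1) * ((T * inverse X - 1) / (inverse X - 1) / T) + (1 - T) / (X - 1) * (X * ((1 - T) / (X - 1)) / T)
    = ((T * X - 1) * (X - T) + (1 - T) * X * (1 - T)) / (T * ((X - 1) * (X - 1)))"
    using assms x by (simp add: add_divide_distrib mult_ac)
  also have "(T * X - 1) * (X - T) + (1 - T) * X * (1 - T) = T * ((X - 1) * (X - 1))" by algebra
  finally show ?thesis using assms x by simp
qed

lemma hecke_inverse_off:
  fixes X T :: "'f::field"
  assumes "X \<noteq> 0" "X \<noteq> 1" "T \<noteq> 0"
  shows "(T * X - 1) / (X - 1) * (inverse X * ((1 - T) / (inverse X - 1)) / T) + (1 - T) / (X - 1) * ((T * X - 1) / (X - 1) / T) = 0"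
    and "(T * X - 1) / (X - 1) / T * ((1 - T) / (inverse X - 1)) + X * ((1 - T) / (X - 1)) / T * ((T * X - 1) / (X - 1)) = 0"
proof -
  have x: "X - 1 \<noteq> 0" "1 - X \<noteq> 0" using assms by auto
  have e: "inverse X * ((1 - T) / (inverse X - 1)) = - ((1 - T) / (X - 1))"
    "(1 - T) / (inverse X - 1) = - (X * ((1 - T) / (X - 1)))"
    using assms x by (simp_all add: divide_simps) (simp_all add: algebra_simps)
  show "(T * X - 1) / (X - 1) * (inverse X * ((1 - T) / (inverse X - 1)) / T) + (1 - T) / (X - 1) * ((T * X - 1) / (X - 1) / T) = 0"
    unfolding e(1) by (simp add: mult_ac)
  show "(T * X - 1) / (X - 1) / T * ((1 - T) / (inverse X - 1)) + X * ((1 - T) / (X - 1)) / T * ((T * X - 1) / (X - 1)) = 0"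
    unfolding e(2) by (simp add: mult_ac)
qed

context sl_roots
begin

text \<open>
  Membership in the algebra \<open>\<bbbK>\<^sub>0(P) \<rtimes> W\<^sub>e\<^sub>x\<close>. Other elements of the type involve pairs that need
  not act by automorphisms.
\<close>

definition sm :: "('a, 'i) smash \<Rightarrow> bool" where "sm A \<longleftrightarrow> Poly_Mapping.keys A \<subseteq> Wex"

abbreviation smul :: "('a, 'i) smash \<Rightarrow> ('a, 'i) smash \<Rightarrow> ('a, 'i) smash" (infixl "\<odot>" 70) where
  "smul \<equiv> smash_mult \<alpha>"

lemma sm_single: "g \<in> Wex \<Longrightarrow> sm (Poly_Mapping.single g a)"
  by (simp add: sm_def)

lemma sm_add: "sm A \<Longrightarrow> sm B \<Longrightarrow> sm (A + B)"
  using keys_add[of A B] by (auto simp: sm_def)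

lemma sm_induct [consumes 1, case_names single add]:
  assumes A: "sm A" and s: "\<And>g a. g \<in> Wex \<Longrightarrow> Q (Poly_Mapping.single g a)"
    and a: "\<And>A B. sm A \<Longrightarrow> sm B \<Longrightarrow> Q A \<Longrightarrow> Q B \<Longrightarrow> Q (A + B)"
  shows "Q A"
proof -
  have "finite S \<Longrightarrow> S \<subseteq> Wex \<Longrightarrow> sm (\<Sum>k\<in>S. Poly_Mapping.single k (Poly_Mapping.lookup A k)) \<and>
      Q (\<Sum>k\<in>S. Poly_Mapping.single k (Poly_Mapping.lookup A k))" for S
  proof (induction rule: finite_induct)
    case empty
    then show ?case using s[OF wex_one_in, of 0] by (simp add: sm_def)
  next
    case (insert k S)
    then show ?case by (simp add: sm_add sm_single a s)
  qed
  from this[OF finite_keys[of A]] A show ?thesis by (simp add: poly_mapping_sum_single sm_def)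
qed

lemma smash_add_left: "(A + B) \<odot> C = A \<odot> C + B \<odot> C"
  unfolding smash_mult_def
  by (rule setsum_keys_plus_distrib[of "\<lambda>g a. \<Sum>h\<in>Poly_Mapping.keys C. Poly_Mapping.single (wex_mult g h)
       (a * wex_act_fun \<alpha> g (Poly_Mapping.lookup C h))"])
     (simp_all add: distrib_right single_add sum.distrib)

lemma smash_add_right: "sm A \<Longrightarrow> A \<odot> (B + C) = A \<odot> B + A \<odot> C"
  unfolding smash_mult_def sum.distrib[symmetric]
proof (rule sum.cong[OF HOL.refl])
  fix g assume "sm A" "g \<in> Poly_Mapping.keys A"
  then have g: "g \<in> Wex" by (auto simp: sm_def)
  show "(\<Sum>h\<in>Poly_Mapping.keys (B + C). Poly_Mapping.single (wex_mult g h) (Poly_Mapping.lookup A g * wex_act_fun \<alpha> g (Poly_Mapping.lookup (B + C) h))) =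
    (\<Sum>h\<in>Poly_Mapping.keys B. Poly_Mapping.single (wex_mult g h) (Poly_Mapping.lookup A g * wex_act_fun \<alpha> g (Poly_Mapping.lookup B h))) +
    (\<Sum>h\<in>Poly_Mapping.keys C. Poly_Mapping.single (wex_mult g h) (Poly_Mapping.lookup A g * wex_act_fun \<alpha> g (Poly_Mapping.lookup C h)))"
    by (rule setsum_keys_plus_distrib[of "\<lambda>h b. Poly_Mapping.single (wex_mult g h) (Poly_Mapping.lookup A g * wex_act_fun \<alpha> g b)"])
       (simp_all add: wex_act_fun_hom[OF g] distrib_left single_add)
qed

lemma smash_single:
  "g \<in> Wex \<Longrightarrow> Poly_Mapping.single g a \<odot> Poly_Mapping.single h b = Poly_Mapping.single (wex_mult g h) (a * wex_act_fun \<alpha> g b)"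
  by (simp add: smash_mult_def wex_act_fun_hom)

lemma sm_mult: "sm A \<Longrightarrow> sm B \<Longrightarrow> sm (A \<odot> B)"
proof (induction A rule: sm_induct)
  case (single g a)
  from single(2) show ?case
    by (induction B rule: sm_induct) (simp_all add: smash_single single sm_single wex_mult_in smash_add_right sm_add)
qed (simp add: smash_add_left sm_add)

lemma smash_assoc: "sm A \<Longrightarrow> sm B \<Longrightarrow> sm C \<Longrightarrow> A \<odot> B \<odot> C = A \<odot> (B \<odot> C)"
proof (induction A rule: sm_induct)
  case (single g a)
  note g = single(1)
  from single(2,3) show ?case
  proof (induction B rule: sm_induct)
    case (single h b)
    note h = single(1)
    from single(2) show ?case
      by (induction C rule: sm_induct)
         (simp_all add: g h smash_single wex_mult_in wex_mult_assoc wex_act_fun_hom wex_act_fun_mult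
            smash_add_right sm_single sm_mult mult.assoc)
  qed (simp add: g smash_add_left smash_add_right sm_single sm_mult)
qed (simp add: smash_add_left)

lemma sm_one: "sm smash_one"
  by (simp add: smash_one_def sm_single)

lemma smash_one_left: "sm A \<Longrightarrow> smash_one \<odot> A = A"
  by (induction A rule: sm_induct) (simp_all add: smash_one_def smash_single smash_add_right sm_single)

lemma smash_one_right: "sm A \<Longrightarrow> A \<odot> smash_one = A"
  by (induction A rule: sm_induct) (simp_all add: smash_one_def smash_single smash_add_left wex_mult_one_right wex_act_fun_hom)

lemma smash_inverse_eqI:
  assumes "sm A" "sm B" "A \<odot> B = smash_one" "B \<odot> A = smash_one"
  shows "smash_inverse \<alpha> A = B"
  unfolding smash_inverse_def
proof (rule the_equality)
  show "Poly_Mapping.keys B \<subseteq> Wex \<and> A \<odot> B = smash_one \<and> B \<odot> A = smash_one" using assms by (simp add: sm_def)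
  fix C assume C: "Poly_Mapping.keys C \<subseteq> Wex \<and> A \<odot> C = smash_one \<and> C \<odot> A = smash_one"
  then have "sm C" by (simp add: sm_def)
  then show "C = B" using assms C smash_assoc[of C A B] by (simp add: smash_one_left smash_one_right)
qed

definition tr :: "'a \<times> ('a \<Rightarrow> 'a) \<Rightarrow> ('a, 'i) smash" where "tr g = Poly_Mapping.single g 1"

lemma sm_tr: "g \<in> Wex \<Longrightarrow> sm (tr g)" by (simp add: tr_def sm_single)

lemma tr_mult: "g \<in> Wex \<Longrightarrow> h \<in> Wex \<Longrightarrow> tr g \<odot> tr h = tr (wex_mult g h)"
  by (simp add: tr_def smash_single wex_act_fun_hom)

lemma scalar_central: "sm A \<Longrightarrow> smash_scalar c \<odot> A = A \<odot> smash_scalar c"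
  by (induction A rule: sm_induct)
     (simp_all add: smash_scalar_def smash_single smash_add_left smash_add_right sm_single wex_mult_one_right
        wex_act_fun_scalar mult.commute)

lemma sm_scalar: "sm (smash_scalar c)"
  by (simp add: smash_scalar_def sm_single)

lemma smash_scalar_mult: "smash_scalar c \<odot> smash_scalar d = smash_scalar (c * d)"
  by (simp add: smash_scalar_def smash_single scalar_hom)

subsection \<open>The normalised intertwiners \<open>R\<close>\<close>

abbreviation V :: "'i K0Pf" where "V \<equiv> scalar v_par"
abbreviation X :: "'a \<times> real \<Rightarrow> 'i K0Pf" where "X \<equiv> X_aff \<alpha>"

lemma scalar_t: "scalar t_par = (V :: 'i K0Pf)\<^sup>2"
  by (simp add: t_par_def scalar_power)

lemma V_neq_0: "V \<noteq> (0 :: 'i K0Pf)"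
  by (simp add: scalar_eq_0 v_par_neq_0)

definition rdiag :: "'i K0Pf \<Rightarrow> 'i K0Pf" where
  "rdiag Z = (V\<^sup>2 * Z - 1) / (Z - 1) / V"

definition roff :: "bool \<Rightarrow> 'i K0Pf \<Rightarrow> 'i K0Pf" where
  "roff e Z = (if e then 1 else Z) * ((1 - V\<^sup>2) / (Z - 1)) / V"

text \<open>\<open>Rop True b\<close> is \<open>v\<^sup>-\<^sup>1 T s\<close> and \<open>Rop False b\<close> is \<open>v T\<^sup>-\<^sup>1 s\<close>, with \<open>s\<close> the reflection in \<open>b\<close>, when \<open>b\<close> is simple.\<close>

definition Rop :: "bool \<Rightarrow> 'a \<times> real \<Rightarrow> ('a, 'i) smash" where
  "Rop e b = Poly_Mapping.single wex_one (rdiag (X b)) + Poly_Mapping.single (aff_refl b) (roff e (X b))"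

lemma sm_Rop: "b \<in> aroots \<Longrightarrow> sm (Rop e b)"
  by (simp add: Rop_def sm_add sm_single aff_refl_in)

lemma act_V: "g \<in> Wex \<Longrightarrow> wex_act_fun \<alpha> g V = V"
  by (rule wex_act_fun_scalar)

lemma act_rdiag: "g \<in> Wex \<Longrightarrow> wex_act_fun \<alpha> g (rdiag Z) = rdiag (wex_act_fun \<alpha> g Z)"
  by (simp add: rdiag_def wex_act_fun_hom act_V power2_eq_square)

lemma act_roff: "g \<in> Wex \<Longrightarrow> wex_act_fun \<alpha> g (roff e Z) = roff e (wex_act_fun \<alpha> g Z)"
  by (simp add: roff_def wex_act_fun_hom act_V power2_eq_square)

text \<open>
  The coefficients of \<open>R\<close> are functions of \<open>X\<^sup>b\<close> alone, so \<open>R\<close> is equivariant. This allows one to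
  collect the group elements of a word on its right.
\<close>

lemma tr_Rop: "g \<in> Wex \<Longrightarrow> b \<in> aroots \<Longrightarrow> tr g \<odot> Rop e b = Rop e (wex_act g b) \<odot> tr g"
  by (simp add: tr_def Rop_def smash_add_right smash_add_left sm_single smash_single act_rdiag act_roff
      wex_act_fun_X wex_mult_one_right aff_refl_in wex_act_aroots wex_act_fun_hom aff_refl_conj)

text \<open>
  The reflections in orthogonal roots commute, and each fixes the coefficients that belong to
  the other root.
\<close>

lemma Rop_commute:
  assumes b: "b \<in> aroots" "c \<in> aroots" "fst b \<bullet> fst c = 0"
  shows "Rop e b \<odot> Rop e' c = Rop e' c \<odot> Rop e b"
proof -
  have bc: "wex_act (aff_refl b) c = c" and cb: "wex_act (aff_refl c) b = b"
    using assms by (simp_all add: aff_refl_act inner_commute)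
  have "wex_mult (aff_refl c) (aff_refl b) = wex_mult (aff_refl b) (aff_refl c)"
    using aff_refl_conj[OF aff_refl_in[OF b(1)] b(2)] by (simp add: bc)
  then show ?thesis using b
    by (simp add: Rop_def smash_add_right smash_add_left sm_single smash_single aff_refl_in wex_mult_one_right
        act_rdiag act_roff wex_act_fun_X bc cb mult.commute add_ac)
qed

lemma asim_X: "X (asim i) \<noteq> 0" "X (asim i) \<noteq> 1" "wex_act_fun \<alpha> (asr i) (X (asim i)) = inverse (X (asim i))"
  by (simp_all add: X_aff_neq_0 X_aff_neq_1 asim_aroots wex_act_fun_X asr_in asr_self X_aff_neg)

lemma rho_T_eq: "rho_T \<Delta> \<alpha> i =
    Poly_Mapping.single (asr i) ((V\<^sup>2 * X (asim i) - 1) / (X (asim i) - 1)) +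
    Poly_Mapping.single wex_one ((1 - V\<^sup>2) / (X (asim i) - 1))"
  by (simp add: rho_T_def Let_def scalar_t)

text \<open>By \<open>(T - t)(T + 1) = 0\<close> the inverse of \<open>T\<close> is \<open>t\<^sup>-\<^sup>1T + t\<^sup>-\<^sup>1 - 1\<close>.\<close>

lemma inverse_rho_T: "smash_inverse \<alpha> (rho_T \<Delta> \<alpha> i) =
    Poly_Mapping.single (asr i) ((V\<^sup>2 * X (asim i) - 1) / (X (asim i) - 1) / V\<^sup>2) +
    Poly_Mapping.single wex_one (X (asim i) * ((1 - V\<^sup>2) / (X (asim i) - 1)) / V\<^sup>2)" (is "_ = ?B")
proof (rule smash_inverse_eqI)
  have V2: "V\<^sup>2 \<noteq> (0 :: 'i K0Pf)" using V_neq_0 by simp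
  note h = hecke_inverse_diag[OF asim_X(1,2)[of i] V2] hecke_inverse_off[OF asim_X(1,2)[of i] V2]
  have act2: "wex_act_fun \<alpha> (asr i) (V\<^sup>2) = V\<^sup>2" by (simp add: power2_eq_square wex_act_fun_hom act_V asr_in)
  have ss: "wex_mult (asr i) (asr i) = wex_one" by (simp add: aff_refl_sq asim_aroots)
  show "sm (rho_T \<Delta> \<alpha> i)" "sm ?B" by (simp_all add: rho_T_eq sm_add sm_single asr_in)
  show "rho_T \<Delta> \<alpha> i \<odot> ?B = smash_one"
  proof -
    have "rho_T \<Delta> \<alpha> i \<odot> ?B = Poly_Mapping.single wex_one
       ((V\<^sup>2 * X (asim i) - 1) / (X (asim i) - 1) * ((V\<^sup>2 * inverse (X (asim i)) - 1) / (inverse (X (asim i)) - 1) / V\<^sup>2) +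
         (1 - V\<^sup>2) / (X (asim i) - 1) * (X (asim i) * ((1 - V\<^sup>2) / (X (asim i) - 1)) / V\<^sup>2)) +
      Poly_Mapping.single (asr i) ((V\<^sup>2 * X (asim i) - 1) / (X (asim i) - 1) *
         (inverse (X (asim i)) * ((1 - V\<^sup>2) / (inverse (X (asim i)) - 1)) / V\<^sup>2) +
         (1 - V\<^sup>2) / (X (asim i) - 1) * ((V\<^sup>2 * X (asim i) - 1) / (X (asim i) - 1) / V\<^sup>2))"
      by (simp only: rho_T_eq smash_add_left smash_add_right sm_single asr_in wex_one_in sm_add smash_single
           wex_act_fun_hom act2 asim_X(3) ss wex_mult_one_right wex_mult_one(2) wex_act_fun_one single_add add_ac)
    then show ?thesis by (simp only: h single_zero add_0_right smash_one_def)
  qed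
  show "?B \<odot> rho_T \<Delta> \<alpha> i = smash_one"
  proof -
    have "?B \<odot> rho_T \<Delta> \<alpha> i = Poly_Mapping.single wex_one
       ((V\<^sup>2 * X (asim i) - 1) / (X (asim i) - 1) / V\<^sup>2 * ((V\<^sup>2 * inverse (X (asim i)) - 1) / (inverse (X (asim i)) - 1)) +
         X (asim i) * ((1 - V\<^sup>2) / (X (asim i) - 1)) / V\<^sup>2 * ((1 - V\<^sup>2) / (X (asim i) - 1))) +
      Poly_Mapping.single (asr i) ((V\<^sup>2 * X (asim i) - 1) / (X (asim i) - 1) / V\<^sup>2 *
         ((1 - V\<^sup>2) / (inverse (X (asim i)) - 1)) +
         X (asim i) * ((1 - V\<^sup>2) / (X (asim i) - 1)) / V\<^sup>2 * ((V\<^sup>2 * X (asim i) - 1) / (X (asim i) - 1)))"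
      by (simp only: rho_T_eq smash_add_left smash_add_right sm_single asr_in wex_one_in sm_add smash_single
           wex_act_fun_hom act2 asim_X(3) ss wex_mult_one_right wex_mult_one(2) wex_act_fun_one single_add add_ac)
    moreover have "(V\<^sup>2 * X (asim i) - 1) / (X (asim i) - 1) / V\<^sup>2 * ((V\<^sup>2 * inverse (X (asim i)) - 1) / (inverse (X (asim i)) - 1)) +
         X (asim i) * ((1 - V\<^sup>2) / (X (asim i) - 1)) / V\<^sup>2 * ((1 - V\<^sup>2) / (X (asim i) - 1)) = 1"
      using h(1) by (simp only: times_divide_eq_left times_divide_eq_right mult_ac)
    ultimately show ?thesis by (simp only: h single_zero add_0_right smash_one_def)
  qed
qed

definition Tsgn :: "bool \<Rightarrow> 'i option \<Rightarrow> ('a, 'i) smash" where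
  "Tsgn e i = (if e then rho_T \<Delta> \<alpha> i else smash_inverse \<alpha> (rho_T \<Delta> \<alpha> i))"

lemma sm_Tsgn: "sm (Tsgn e i)"
  unfolding Tsgn_def inverse_rho_T unfolding rho_T_eq by (simp add: sm_add sm_single asr_in)

lemma scaled_Tsgn: "smash_scalar (v_par powi (- (if e then 1 else -1))) \<odot> Tsgn e i = Rop e (asim i) \<odot> tr (asr i)"
proof -
  have ss: "wex_mult (asr i) (asr i) = wex_one" by (simp add: aff_refl_sq asim_aroots)
  show ?thesis
  proof (cases e)
    case True
    show ?thesis using True ss
      by (simp add: scalar_inverse Tsgn_def rho_T_eq Rop_def tr_def smash_scalar_def smash_add_left smash_add_right sm_single asr_in
          smash_single wex_act_fun_hom rdiag_def roff_def divide_inverse mult_ac)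
  next
    case False
    have sc: "scalar (v_par powi 1) = (V :: 'i K0Pf)" by simp
    have "V * z / (y * V\<^sup>2) = z / (y * V)" for y z :: "'i K0Pf" using V_neq_0 by (simp add: power2_eq_square)
    then show ?thesis using False ss
      by (simp add: sc Tsgn_def inverse_rho_T Rop_def tr_def smash_scalar_def smash_add_left smash_add_right sm_single asr_in
          smash_single wex_act_fun_hom rdiag_def roff_def)
  qed
qed

lemma sm_foldr_T: "sm (foldr (\<lambda>(i, e) A. Tsgn e i \<odot> A) es smash_one)"
  by (induction es) (auto simp: sm_one sm_mult sm_Tsgn)

lemma sm_foldr_R: "(\<And>b. b \<in> set bs \<Longrightarrow> bb b \<in> aroots) \<Longrightarrow> sm A \<Longrightarrow> sm (foldr (\<lambda>b A. Rop (e b) (bb b) \<odot> A) bs A)"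
  by (induction bs) (auto simp: sm_mult sm_Rop)

text \<open>
  A letter \<open>T\<^sub>i\<^sup>\<plusminus>\<^sup>1\<close> is \<open>R s\<^sub>i\<close> up to a power of \<open>v\<close>. Moving the group element \<open>g\<close> that precedes it to the
  right turns the root \<open>\<alpha>\<^sub>i\<close> of this \<open>R\<close> into \<open>g\<alpha>\<^sub>i\<close>, which is the root of the next wall, and leaves
  \<open>gs\<^sub>i\<close>.
\<close>

lemma word_to_R:
  assumes "g \<in> Wex"
  shows "smash_scalar (v_par powi (- (\<Sum>(i, e)\<leftarrow>es. if e then 1 else -1))) \<odot> (tr g \<odot> foldr (\<lambda>(i, e) A. Tsgn e i \<odot> A) es smash_one)
    = foldr (\<lambda>(b, e) A. Rop e b \<odot> A) (zip (walls g (map fst es)) (map snd es)) (tr (wex_mult g (aword (map fst es))))"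
  using assms
proof (induction es arbitrary: g)
  case Nil
  have "smash_scalar 1 = (smash_one :: ('a, 'i) smash)" by (simp add: smash_scalar_def smash_one_def scalar_hom)
  then show ?case using Nil by (simp add: smash_one_left smash_one_right sm_tr aword_Nil wex_mult_one_right)
next
  case (Cons ie es)
  obtain i e where ie: "ie = (i, e)" by (cases ie)
  let ?rest = "foldr (\<lambda>(i, e) A. Tsgn e i \<odot> A) es smash_one"
  define c1 where "c1 = v_par powi (- (if e then 1 else -1))"
  define c2 where "c2 = v_par powi (- (\<Sum>(i, e)\<leftarrow>es. if e then 1 else -1))"
  have g: "g \<in> Wex" by fact
  have h: "wex_mult g (asr i) \<in> Wex" by (simp add: wex_mult_in g asr_in)
  note S = sm_tr[OF g] sm_tr[OF h] sm_tr[OF asr_in] sm_scalar sm_foldr_T sm_Tsgn sm_mult sm_Rop[OF asim_aroots]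
     sm_Rop[OF wex_act_aroots[OF g asim_aroots]]
  have c: "v_par powi (- (\<Sum>(i, e)\<leftarrow>ie # es. if e then 1 else -1)) = c2 * c1"
    unfolding c1_def c2_def ie by (simp add: power_int_add[symmetric] v_par_neq_0 algebra_simps)
  have "smash_scalar (c2 * c1) \<odot> (tr g \<odot> (Tsgn e i \<odot> ?rest)) = smash_scalar c2 \<odot> (smash_scalar c1 \<odot> (tr g \<odot> (Tsgn e i \<odot> ?rest)))"
    by (simp add: S smash_assoc flip: smash_scalar_mult)
  also have "smash_scalar c1 \<odot> (tr g \<odot> (Tsgn e i \<odot> ?rest)) = (smash_scalar c1 \<odot> tr g) \<odot> (Tsgn e i \<odot> ?rest)"
    by (simp add: S smash_assoc)
  also have "smash_scalar c1 \<odot> tr g = tr g \<odot> smash_scalar c1" by (simp add: scalar_central S)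
  also have "tr g \<odot> smash_scalar c1 \<odot> (Tsgn e i \<odot> ?rest) = tr g \<odot> ((smash_scalar c1 \<odot> Tsgn e i) \<odot> ?rest)"
    by (simp add: S smash_assoc)
  also have "\<dots> = (tr g \<odot> Rop e (asim i)) \<odot> tr (asr i) \<odot> ?rest"
    unfolding c1_def scaled_Tsgn by (simp add: S smash_assoc)
  also have "\<dots> = Rop e (wex_act g (asim i)) \<odot> (tr (wex_mult g (asr i)) \<odot> ?rest)"
    by (simp add: tr_Rop g asim_aroots S smash_assoc flip: tr_mult[OF g asr_in])
  also have "smash_scalar c2 \<odot> \<dots> = Rop e (wex_act g (asim i)) \<odot> (smash_scalar c2 \<odot> (tr (wex_mult g (asr i)) \<odot> ?rest))"
    using scalar_central[OF S(9), of c2 e] by (simp add: S flip: smash_assoc)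
  also have "smash_scalar c2 \<odot> (tr (wex_mult g (asr i)) \<odot> ?rest) =
     foldr (\<lambda>(b, e) A. Rop e b \<odot> A) (zip (walls (wex_mult g (asr i)) (map fst es)) (map snd es))
       (tr (wex_mult (wex_mult g (asr i)) (aword (map fst es))))"
    unfolding c2_def by (rule Cons.IH[OF h])
  finally show ?case unfolding c
    by (simp add: ie aword_Cons wex_mult_assoc g)
qed

lemma rho_Y_word_eq:
  assumes p: "p \<in> Wex"
  shows "rho_Y_word \<Delta> \<alpha> p js = foldr (\<lambda>b A. Rop (- fst b \<in> pos) b \<odot> A) (walls p js) (tr (wex_mult p (aword js)))"
proof -
  define es where "es = map (\<lambda>k. (js ! k, Y_sign \<Delta> \<alpha> p js k = 1)) [0..<length js]"
  have ys: "(if Y_sign \<Delta> \<alpha> p js k = 1 then 1 else -1) = Y_sign \<Delta> \<alpha> p js k" for k by (simp add: Y_sign_def)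
  have 1: "(\<Sum>(i, e)\<leftarrow>es. if e then 1 else -1) = (\<Sum>k<length js. Y_sign \<Delta> \<alpha> p js k)"
    by (simp add: es_def o_def ys interv_sum_list_conv_sum_set_nat atLeast0LessThan)
  have 2: "foldr (\<odot>) (map (\<lambda>k. if Y_sign \<Delta> \<alpha> p js k = 1 then rho_T \<Delta> \<alpha> (js ! k) else smash_inverse \<alpha> (rho_T \<Delta> \<alpha> (js ! k))) [0..<length js]) smash_one
     = foldr (\<lambda>(i, e) A. Tsgn e i \<odot> A) es smash_one"
    by (simp add: es_def foldr_map o_def Tsgn_def)
  have 3: "map fst es = js" by (simp add: es_def o_def map_nth)
  have "zip (walls p js) (map snd es) = map (\<lambda>b. (b, - fst b \<in> pos)) (walls p js)"
  proof (rule nth_equalityI)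
    fix k assume "k < length (zip (walls p js) (map snd es))"
    then have "k < length js" by (simp add: es_def)
    then show "zip (walls p js) (map snd es) ! k = map (\<lambda>b. (b, - fst b \<in> pos)) (walls p js) ! k"
      by (simp add: es_def walls_nth[OF p] Y_sign_def)
  qed (simp add: es_def)
  then show ?thesis
    using word_to_R[OF p, of es] unfolding rho_Y_word_def rho_Pi_def tr_def[symmetric] 1 2 3
    by (simp add: foldr_map o_def)
qed

subsection \<open>\<open>Y\<^sup>\<lambda>\<close> for minuscule \<open>\<lambda>\<close>\<close>

lemma tr_foldr_R:
  assumes "g \<in> Wex" "\<And>b. b \<in> set bs \<Longrightarrow> bb b \<in> aroots" "sm A"
  shows "tr g \<odot> foldr (\<lambda>b A. Rop (e b) (bb b) \<odot> A) bs A
    = foldr (\<lambda>b A. Rop (e b) (wex_act g (bb b)) \<odot> A) bs (tr g \<odot> A)"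
  using assms(2)
proof (induction bs)
  case (Cons b bs)
  let ?F = "foldr (\<lambda>b A. Rop (e b) (bb b) \<odot> A) bs A"
  have b: "bb b \<in> aroots" using Cons by simp
  have sF: "sm ?F" by (rule sm_foldr_R) (use Cons assms in auto)
  have "tr g \<odot> (Rop (e b) (bb b) \<odot> ?F) = (tr g \<odot> Rop (e b) (bb b)) \<odot> ?F"
    by (simp add: smash_assoc sm_tr assms sm_Rop b sF)
  also have "\<dots> = Rop (e b) (wex_act g (bb b)) \<odot> (tr g \<odot> ?F)"
    by (simp add: tr_Rop assms b smash_assoc sm_tr sm_Rop wex_act_aroots sF)
  finally show ?case using Cons by simp
qed simp

text \<open>
  The inverse translation adds \<open>(\<lambda>,a)\<close>, which is 0, 1 or \<open>-1\<close>, to the coefficient of \<open>\<delta>\<close> in the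
  affine root \<open>a + c\<delta>\<close>. It can only make a positive root of this kind negative if \<open>(\<lambda>,a) = -1\<close> and
  \<open>c\<close> is 0 or 1.
\<close>

lemma ainvs_translation:
  assumes "minuscule \<Delta> \<alpha> lam"
  shows "ainvs (winv (lam, id)) = (\<lambda>a. (a, 0)) ` {a\<in>pos. lam \<bullet> a = -1} \<union> (\<lambda>a. (- a, 1)) ` {a\<in>pos. lam \<bullet> a = 1}"
proof -
  have lP: "lam \<in> P" and lv: "a \<in> \<Delta> \<Longrightarrow> lam \<bullet> a \<in> {0,1,-1}" for a using assms by (auto simp: minuscule_def)
  have act: "wex_act (winv (lam, id)) (a, c) = (a, c + lam \<bullet> a)" for a c
    by (simp add: winv_def wex_act_def flip: id_def)
  have mem: "(a, real_of_int c) \<in> apos \<longleftrightarrow> a \<in> \<Delta> \<and> (c > 0 \<or> c = 0 \<and> a \<in> pos)" for a c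
    unfolding aff_pos_roots_def by auto
  have inv: "(a, real_of_int c) \<in> ainvs (winv (lam, id)) \<longleftrightarrow>
     a \<in> \<Delta> \<and> (c > 0 \<or> c = 0 \<and> a \<in> pos) \<and> (of_int c + lam \<bullet> a < 0 \<or> of_int c + lam \<bullet> a = 0 \<and> a \<notin> pos)" for a c
  proof (cases "a \<in> \<Delta>")
    case True
    obtain z where z: "lam \<bullet> a = of_int z" using lv[OF True] by (metis Ints_cases inner_P_root lP True)
    have "- (a, real_of_int c + lam \<bullet> a) = (- a, real_of_int (- (c + z)))" by (simp add: z)
    then have "- (a, real_of_int c + lam \<bullet> a) \<in> apos \<longleftrightarrow> (c + z < 0 \<or> c + z = 0 \<and> a \<notin> pos)"
      using mem[of "- a" "- (c + z)"] True pos_neg[OF True] by auto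
    moreover have "of_int c + lam \<bullet> a < 0 \<longleftrightarrow> c + z < 0" "of_int c + lam \<bullet> a = 0 \<longleftrightarrow> c + z = 0" unfolding z by linarith+
    ultimately show ?thesis using True by (simp add: ainvs_def act mem)
  next
    case False
    then show ?thesis by (simp add: ainvs_def mem)
  qed
  have pD: "a \<in> pos \<Longrightarrow> a \<in> \<Delta> \<and> - a \<notin> pos" for a using pos_neg[of a] pos_sub by auto
  show ?thesis
  proof (intro subset_antisym subsetI)
    fix b :: "'a \<times> real" assume b: "b \<in> ainvs (winv (lam, id))"
    then have "b \<in> apos" by (simp add: ainvs_def)
    then obtain a c where ac: "b = (a, real_of_int c)" unfolding aff_pos_roots_def by blast
    have i: "a \<in> \<Delta>" "c > 0 \<or> c = 0 \<and> a \<in> pos" "of_int c + lam \<bullet> a < 0 \<or> of_int c + lam \<bullet> a = 0 \<and> a \<notin> pos"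
      using b inv unfolding ac by blast+
    have l: "lam \<bullet> a = -1" using i lv[OF i(1)] by auto
    then consider "c = 0" "a \<in> pos" | "c = 1" "a \<notin> pos" using i by force
    then show "b \<in> (\<lambda>a. (a, 0)) ` {a\<in>pos. lam \<bullet> a = -1} \<union> (\<lambda>a. (- a, 1)) ` {a\<in>pos. lam \<bullet> a = 1}"
    proof cases
      case 2
      then have "- a \<in> pos" "lam \<bullet> (- a) = 1" using pos_neg i l by auto
      then show ?thesis using 2 by (intro UnI2 image_eqI[of _ _ "- a"]) (simp_all add: ac)
    qed (use l ac in auto)
  next
    fix b :: "'a \<times> real" assume "b \<in> (\<lambda>a. (a, 0)) ` {a\<in>pos. lam \<bullet> a = -1} \<union> (\<lambda>a. (- a, 1)) ` {a\<in>pos. lam \<bullet> a = 1}"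
    then show "b \<in> ainvs (winv (lam, id))"
      using inv[of _ 0] inv[of _ 1] pD by auto
  qed
qed

lemma ascending_sorted:
  "ascending bs \<Longrightarrow> sorted_wrt (\<lambda>b c. fst b \<bullet> fst c = 0 \<or> aht b < aht c) bs"
  unfolding ascending_def by (erule sorted_wrt_mono_rel[rotated]) auto

text \<open>
  The reduced expression behind \<open>Y\<^sup>\<lambda>\<close> crosses the same walls, also in ascending order, so the two
  products differ by exchanges of commuting factors.
\<close>

lemma rho_Y_ascending:
  assumes lam: "minuscule \<Delta> \<alpha> lam" and bs: "distinct bs" "ascending bs"
    "set bs = (\<lambda>a. (a, 0)) ` {a\<in>pos. lam \<bullet> a = -1} \<union> (\<lambda>a. (- a, 1)) ` {a\<in>pos. lam \<bullet> a = 1}"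
  shows "rho_Y \<Delta> \<alpha> lam = foldr (\<lambda>b A. Rop (- fst b \<in> pos) b \<odot> A) bs (tr (lam, id))"
proof -
  have lP: "lam \<in> P" and lv: "a \<in> \<Delta> \<Longrightarrow> lam \<bullet> a \<in> {0,1,-1}" for a using lam by (auto simp: minuscule_def)
  have tW: "(lam, id) \<in> Wex" by (simp add: wexI lP)
  obtain p0 js0 where "wex_reduced_expr \<Delta> \<alpha> (lam, id) p0 js0" using reduced_expr_exists[OF tW] by blast
  then have "\<exists>c. wex_reduced_expr \<Delta> \<alpha> (lam, id) (fst c) (snd c)" by (intro exI[of _ "(p0, js0)"]) simp
  then have "wex_reduced_expr \<Delta> \<alpha> (lam, id) (fst (SOME c. wex_reduced_expr \<Delta> \<alpha> (lam, id) (fst c) (snd c)))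
     (snd (SOME c. wex_reduced_expr \<Delta> \<alpha> (lam, id) (fst c) (snd c)))" by (rule someI_ex)
  then obtain p js where red: "wex_reduced_expr \<Delta> \<alpha> (lam, id) p js" and Y: "rho_Y \<Delta> \<alpha> lam = rho_Y_word \<Delta> \<alpha> p js"
    unfolding rho_Y_def Let_def by blast
  have p: "p \<in> Wex" "p \<in> wex_Pi \<Delta> \<alpha>" "wex_mult p (aword js) = (lam, id)"
    using red by (auto simp: wex_reduced_expr_def wex_Pi_def)
  note rw = reduced_walls[OF red]
  have st: "set (walls p js) = set bs" using rw(2) ainvs_translation[OF lam] bs(3) by simp
  have mem: "\<exists>a\<in>pos. b = (a, 0) \<and> lam \<bullet> a = -1 \<or> b = (- a, 1) \<and> lam \<bullet> a = 1" if "b \<in> set bs" for b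
    using that bs(3) by auto
  have sub: "set (walls p js) \<subseteq> apos" using rw(2) by (auto simp: ainvs_def)
  have asc: "ascending (walls p js)"
  proof (rule walls_ascending[OF p(2) sub rw(1) lv, of "-1"])
    show "lam \<bullet> fst b = -1" if "b \<in> set (walls p js)" for b using mem[of b] that st by auto
    show "b = c" if "b \<in> set (walls p js)" "c \<in> set (walls p js)" "fst b = fst c" for b c
    proof -
      have "b \<in> set bs" "c \<in> set bs" using that st by simp_all
      then obtain a a' where "a \<in> pos" "b = (a, 0) \<or> b = (- a, 1)" "a' \<in> pos" "c = (a', 0) \<or> c = (- a', 1)"
        using mem by meson
      then show ?thesis using that(3) pos_neg[of a] pos_neg[of a'] pos_sub by auto
    qed
  qed simp_all
  have A: "b \<in> set bs \<Longrightarrow> b \<in> aroots" for b using sub st apos_aroots by blast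
  have "foldr (\<lambda>b A. Rop (- fst b \<in> pos) b \<odot> A) (walls p js) (tr (lam, id)) = foldr (\<lambda>b A. Rop (- fst b \<in> pos) b \<odot> A) bs (tr (lam, id))"
  proof (rule foldr_rearrange[OF rw(1) bs(1) st ascending_sorted[OF asc] ascending_sorted[OF bs(2)], of sm])
    show "Rop (- fst a \<in> pos) a \<odot> (Rop (- fst b \<in> pos) b \<odot> z) = Rop (- fst b \<in> pos) b \<odot> (Rop (- fst a \<in> pos) a \<odot> z)"
      if "a \<in> set bs" "b \<in> set bs" "fst a \<bullet> fst b = 0" "sm z" for a b z
    proof -
      have "a \<in> aroots" "b \<in> aroots" using that A by auto
      then show ?thesis
        using Rop_commute[of a b "- fst a \<in> pos" "- fst b \<in> pos"] that(3,4)
          smash_assoc[OF sm_Rop sm_Rop, of a b z] smash_assoc[OF sm_Rop sm_Rop, of b a z] by metis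
    qed
  qed (simp_all add: inner_commute sm_mult sm_Rop A sm_tr tW)
  then show ?thesis using Y rho_Y_word_eq[OF p(1), of js] p(3) by simp
qed

end

section \<open>Expansions at \<open>v = 0\<close>\<close>

subsection \<open>The embedding of Laurent polynomials\<close>

text \<open>The value at \<open>q\<^bsup>1/e\<^esup>\<close> of a Laurent polynomial.\<close>

definition qe :: "(int \<Rightarrow>\<^sub>0 int) \<Rightarrow> K0" where
  "qe p = (\<Sum>c\<in>Poly_Mapping.keys p. of_int (Poly_Mapping.lookup p c) * q_root powi c)"

lemma qe_add: "qe (p + r) = qe p + qe r"
  unfolding qe_def
  by (rule setsum_keys_plus_distrib[of "\<lambda>c z. of_int z * q_root powi c"]) (simp_all add: distrib_right)

lemma qe_single: "qe (Poly_Mapping.single c z) = of_int z * q_root powi c"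
  by (simp add: qe_def)

lemma qe_0: "qe 0 = 0"
  by (simp add: qe_def)

lemma qe_1: "qe 1 = 1"
  using qe_single[of 0 1] by simp

lemma qe_mult: "qe (p * r) = qe p * qe r"
proof (induction p rule: poly_mapping_induct_single)
  case (single c z)
  show ?case
  proof (induction r rule: poly_mapping_induct_single)
    case (single d y)
    show ?case by (simp add: mult_single qe_single power_int_add q_root_neq_0 mult_ac)
  qed (simp add: qe_add distrib_left)
qed (simp add: qe_add distrib_right)

text \<open>
  Multiplication by \<open>q\<^bsup>N/e\<^esup>\<close> clears the negative exponents. Through this polynomial the
  injectivity of \<open>qe\<close> reduces to that of the embedding of polynomials into fractions.
\<close>

definition qpoly :: "nat \<Rightarrow> (int \<Rightarrow>\<^sub>0 int) \<Rightarrow> rat poly" where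
  "qpoly N p = (\<Sum>c\<in>Poly_Mapping.keys p. monom (of_int (Poly_Mapping.lookup p c)) (nat (c + int N)))"

lemma q_root_pow: "q_root ^ k = Fract [:monom 1 k:] 1"
proof (induction k)
  case 0
  show ?case by (simp add: One_fract_def one_pCons)
next
  case (Suc k)
  have "[:[:0, 1::rat:]:] * [:monom 1 k:] = [:monom 1 (Suc k):]" by (simp add: monom_Suc)
  then show ?case using Suc by (simp add: q_root_def del: mult_pCons_left mult_pCons_right)
qed

lemma v_par_pow: "v_par ^ k = Fract (monom 1 k) 1"
proof (induction k)
  case 0
  show ?case by (simp add: One_fract_def)
next
  case (Suc k)
  have "[:0, 1:] * monom (1::rat poly) k = monom 1 (Suc k)" by (simp add: monom_Suc)
  then show ?case using Suc by (simp add: v_par_def del: mult_pCons_left)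
qed

lemma of_int_K0: "(of_int z :: K0) = Fract [:[:of_int z:]:] 1"
proof -
  have n: "(of_nat k :: K0) = Fract [:[:of_nat k:]:] 1" for k
    by (simp add: of_nat_fract of_nat_poly)
  show ?thesis
    by (cases z rule: int_cases2) (simp_all add: n)
qed

lemma Fract_sum: "finite S \<Longrightarrow> (\<Sum>x\<in>S. Fract (f x) 1) = Fract (\<Sum>x\<in>S. f x) (1::'b::idom)"
  by (induction S rule: finite_induct) (simp_all add: fract_collapse)

lemma qe_shift:
  assumes "\<And>c. c \<in> Poly_Mapping.keys p \<Longrightarrow> c + int N \<ge> 0"
  shows "q_root ^ N * qe p = Fract [:qpoly N p:] 1"
proof -
  have "q_root ^ N * qe p = (\<Sum>c\<in>Poly_Mapping.keys p. Fract [:monom (of_int (Poly_Mapping.lookup p c)) (nat (c + int N)):] 1)"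
    unfolding qe_def sum_distrib_left
  proof (rule sum.cong[OF HOL.refl])
    fix c assume "c \<in> Poly_Mapping.keys p"
    then have c: "c + int N \<ge> 0" by (rule assms)
    have "q_root ^ N * q_root powi c = q_root powi (c + int N)"
      by (simp add: power_int_add q_root_neq_0)
    also have "\<dots> = q_root ^ nat (c + int N)" using c by (simp add: power_int_def)
    also have "\<dots> = Fract [:monom 1 (nat (c + int N)):] 1" by (rule q_root_pow)
    finally have "q_root ^ N * (of_int (Poly_Mapping.lookup p c) * q_root powi c) =
       of_int (Poly_Mapping.lookup p c) * Fract [:monom 1 (nat (c + int N)):] 1" by (simp add: mult_ac)
    also have "\<dots> = Fract [:monom (of_int (Poly_Mapping.lookup p c)) (nat (c + int N)):] 1"
      by (simp add: of_int_K0 smult_monom)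
    finally show "q_root ^ N * (of_int (Poly_Mapping.lookup p c) * q_root powi c) =
       Fract [:monom (of_int (Poly_Mapping.lookup p c)) (nat (c + int N)):] 1" .
  qed
  also have "\<dots> = Fract (\<Sum>c\<in>Poly_Mapping.keys p. [:monom (of_int (Poly_Mapping.lookup p c)) (nat (c + int N)):]) 1"
    by (rule Fract_sum) simp
  also have "(\<Sum>c\<in>Poly_Mapping.keys p. [:monom (of_int (Poly_Mapping.lookup p c)) (nat (c + int N)):]) = [:qpoly N p:]"
  proof -
    have "finite S \<Longrightarrow> (\<Sum>c\<in>S. [:f c:]) = [:\<Sum>c\<in>S. f c:]" for S and f :: "int \<Rightarrow> rat poly"
      by (induction S rule: finite_induct) auto
    then show ?thesis by (simp add: qpoly_def)
  qed
  finally show ?thesis .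
qed

lemma qpoly_eq_0:
  assumes b: "\<And>c. c \<in> Poly_Mapping.keys p \<Longrightarrow> c + int N \<ge> 0" and z: "qpoly N p = 0"
  shows "p = 0"
proof (rule poly_mapping_eqI)
  fix c
  show "Poly_Mapping.lookup p c = Poly_Mapping.lookup 0 c"
  proof (cases "c \<in> Poly_Mapping.keys p")
    case True
    have "poly.coeff (qpoly N p) (nat (c + int N)) =
       (\<Sum>d\<in>Poly_Mapping.keys p. if d = c then of_int (Poly_Mapping.lookup p d) else 0)"
      unfolding qpoly_def coeff_sum
      by (rule sum.cong[OF HOL.refl]) (use b[OF True] b in \<open>auto simp: nat_eq_iff\<close>)
    also have "\<dots> = of_int (Poly_Mapping.lookup p c)" using True by simp
    finally show ?thesis using z by simp
  qed (simp add: in_keys_iff)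
qed

lemma laur_embed_qe: "laur_embed r = (\<Sum>n\<in>Poly_Mapping.keys r. Poly_Mapping.single n (qe (Poly_Mapping.lookup r n)))"
  by (simp add: laur_embed_def qe_def)

lemma laur_embed_add: "laur_embed (r + s) = laur_embed r + laur_embed s"
  unfolding laur_embed_qe
  by (rule setsum_keys_plus_distrib[of "\<lambda>n p. Poly_Mapping.single n (qe p)"]) (simp_all add: qe_add qe_0 single_add)

lemma laur_embed_single: "laur_embed (Poly_Mapping.single n p) = Poly_Mapping.single n (qe p)"
  by (simp add: laur_embed_qe qe_0)

lemma laur_embed_0: "laur_embed 0 = 0"
  by (simp add: laur_embed_qe)

lemma laur_embed_1: "laur_embed 1 = 1"
  using laur_embed_single[of 0 1] by (simp add: qe_1)

lemma laur_embed_mult: "laur_embed (r * s) = laur_embed r * laur_embed s"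
proof (induction r rule: poly_mapping_induct_single)
  case (single c z)
  show ?case
    by (induction s rule: poly_mapping_induct_single)
       (simp_all add: mult_single laur_embed_single qe_mult laur_embed_add distrib_left)
qed (simp add: laur_embed_add distrib_right)

lemma lookup_laur_embed: "Poly_Mapping.lookup (laur_embed r) n = qe (Poly_Mapping.lookup r n)"
  by (induction r rule: poly_mapping_induct_single)
     (simp_all add: laur_embed_single laur_embed_add lookup_single when_def lookup_add qe_add qe_0)

abbreviation emb :: "'i::{finite,linorder} laur poly \<Rightarrow> 'i K0P" where "emb \<equiv> laur_poly_embed"

abbreviation VP :: "'i::{finite,linorder} K0P" where "VP \<equiv> Poly_Mapping.single 0 v_par"

lemma VP_pow: "VP ^ r = Poly_Mapping.single 0 (v_par ^ r)"
  by (induction r) (simp_all add: mult_single)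

lemma emb_sum: "Polynomial.degree A \<le> M \<Longrightarrow> emb A = (\<Sum>r\<le>M. VP ^ r * laur_embed (poly.coeff A r))"
  unfolding laur_poly_embed_def VP_pow
  by (rule sum.mono_neutral_left) (auto simp: laur_embed_0 coeff_eq_0)

lemma emb_pCons: "emb (pCons a p) = laur_embed a + VP * emb p"
proof -
  have "emb (pCons a p) = (\<Sum>r\<le>Suc (Polynomial.degree p). VP ^ r * laur_embed (poly.coeff (pCons a p) r))"
    by (rule emb_sum) (rule degree_pCons_le)
  also have "\<dots> = laur_embed a + VP * emb p"
    by (simp only: sum.atMost_Suc_shift emb_sum[OF order_refl, of p])
       (simp add: sum_distrib_left mult_ac)
  finally show ?thesis .
qed

lemma emb_0: "emb 0 = 0"
  by (simp add: laur_poly_embed_def laur_embed_0)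

lemma emb_add: "emb (p + r) = emb p + emb r"
proof (induction p r rule: poly_induct2)
  case (pCons a p b q)
  then show ?case by (simp add: emb_pCons laur_embed_add algebra_simps)
qed (simp add: emb_0)

lemma emb_smult: "emb (smult c p) = laur_embed c * emb p"
  by (induction p) (simp_all add: emb_0 emb_pCons laur_embed_mult algebra_simps)

lemma emb_mult: "emb (p * r) = emb p * emb r"
  by (induction p) (simp_all add: emb_0 emb_pCons laur_embed_0 emb_add emb_smult algebra_simps)

lemma emb_1: "emb 1 = 1"
  by (simp add: one_pCons emb_pCons emb_0 laur_embed_1)

lemma emb_uminus: "emb (- p) = - emb p"
  using emb_add[of p "- p"] by (simp add: emb_0 eq_neg_iff_add_eq_0 add.commute)

lemma emb_monom: "emb (monom (Poly_Mapping.single n 1) k) = Poly_Mapping.single n (v_par ^ k)"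
  by (induction k) (simp_all add: monom_0 monom_Suc emb_pCons laur_embed_single qe_1 emb_0 laur_embed_0 mult_single)

lemma emb_eq_0:
  assumes "emb A = 0"
  shows "A = 0"
proof -
  define M where "M = Polynomial.degree A"
  have "poly.coeff A r = 0" for r
  proof (rule poly_mapping_eqI)
    fix n
    define p where "p r = Poly_Mapping.lookup (poly.coeff A r) n" for r
    define b where "b = Max (uminus ` insert 0 (\<Union>r\<in>{..M}. Poly_Mapping.keys (p r)))"
    have b: "- b \<le> c" if "c \<in> (\<Union>r\<in>{..M}. Poly_Mapping.keys (p r))" for c
    proof -
      have "- c \<le> b" unfolding b_def by (rule Max_ge) (use that in auto)
      then show ?thesis by simp
    qed
    define N where "N = nat b"
    have bN: "c + int N \<ge> 0" if "r \<le> M" "c \<in> Poly_Mapping.keys (p r)" for c r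
      using b[of c] that by (force simp: N_def)
    have look: "Poly_Mapping.lookup (Poly_Mapping.single 0 k * f) n = k * Poly_Mapping.lookup f n" for k and f :: "'a K0P"
      by (induction f rule: poly_mapping_induct_single)
         (simp_all add: mult_single lookup_single when_def distrib_left lookup_add)
    have "0 = q_root ^ N * Poly_Mapping.lookup (emb A) n" using assms by simp
    also have "Poly_Mapping.lookup (emb A) n = (\<Sum>r\<le>M. v_par ^ r * qe (p r))"
      by (simp add: laur_poly_embed_def lookup_sum look lookup_laur_embed p_def M_def)
    also have "q_root ^ N * \<dots> = (\<Sum>r\<le>M. v_par ^ r * (q_root ^ N * qe (p r)))"
      by (simp add: sum_distrib_left mult_ac)
    also have "\<dots> = (\<Sum>r\<le>M. Fract (monom (qpoly N (p r)) r) 1)"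
    proof (rule sum.cong[OF HOL.refl])
      fix r assume "r \<in> {..M}"
      then have "q_root ^ N * qe (p r) = Fract [:qpoly N (p r):] 1" using bN by (intro qe_shift) auto
      moreover have "monom 1 r * [:qpoly N (p r):] = monom (qpoly N (p r)) r"
        by (subst mult.commute) (simp add: smult_monom)
      ultimately show "v_par ^ r * (q_root ^ N * qe (p r)) = Fract (monom (qpoly N (p r)) r) 1"
        by (simp add: v_par_pow)
    qed
    also have "\<dots> = Fract (\<Sum>r\<le>M. monom (qpoly N (p r)) r) 1" by (rule Fract_sum) simp
    finally have z: "(\<Sum>r\<le>M. monom (qpoly N (p r)) r) = 0"
      by (simp add: Zero_fract_def eq_fract)
    show "Poly_Mapping.lookup (poly.coeff A r) n = Poly_Mapping.lookup 0 n"
    proof (cases "r \<le> M")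
      case True
      have "qpoly N (p r) = poly.coeff (\<Sum>r\<le>M. monom (qpoly N (p r)) r) r" using True by (simp add: coeff_sum)
      then have "qpoly N (p r) = 0" using z by simp
      then have "p r = 0" using qpoly_eq_0 bN[OF True] by blast
      then show ?thesis by (simp add: p_def)
    qed (simp add: M_def coeff_eq_0)
  qed
  then show ?thesis by (simp add: poly_eq_iff)
qed

subsection \<open>Limits\<close>

text \<open>
  A denominator with constant term 1 is invertible as a power series in \<open>v\<close>, so the limit is the
  constant term of the numerator. Fractions of this form are closed under sums and products,
  and the coefficients of all steps can be written in it after multiplication by a power of \<open>v\<close>.
\<close>

definition vlim :: "'i::{finite,linorder} K0Pf \<Rightarrow> 'i laur \<Rightarrow> bool" where
  "vlim f L \<longleftrightarrow> (\<exists>A B. poly.coeff B 0 = 1 \<and> f = Fract (emb A) (emb B) \<and> poly.coeff A 0 = L)"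

lemma emb_neq_0: "poly.coeff B 0 = (1 :: 'i::{finite,linorder} laur) \<Longrightarrow> emb B \<noteq> 0"
  using emb_eq_0[of B] by auto

lemma vlim_embed: "vlim (Fract (emb A) 1) (poly.coeff A 0)"
  unfolding vlim_def by (rule exI[of _ A], rule exI[of _ 1]) (simp add: emb_1)

lemma vlim_0: "vlim 0 0" and vlim_1: "vlim 1 1"
  using vlim_embed[of 0] vlim_embed[of 1] by (simp_all add: emb_0 emb_1 fract_collapse)

lemma vlim_add: "vlim f L \<Longrightarrow> vlim g M \<Longrightarrow> vlim (f + g) (L + M)"
proof -
  assume "vlim f L" "vlim g M"
  then obtain A B C D where AB: "poly.coeff B 0 = 1" "f = Fract (emb A) (emb B)" "poly.coeff A 0 = L"
    and CD: "poly.coeff D 0 = 1" "g = Fract (emb C) (emb D)" "poly.coeff C 0 = M" unfolding vlim_def by metis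
  show ?thesis unfolding vlim_def
    by (rule exI[of _ "A * D + C * B"], rule exI[of _ "B * D"])
       (simp add: AB CD emb_neq_0 emb_add emb_mult coeff_mult_0)
qed

lemma vlim_mult: "vlim f L \<Longrightarrow> vlim g M \<Longrightarrow> vlim (f * g) (L * M)"
proof -
  assume "vlim f L" "vlim g M"
  then obtain A B C D where AB: "poly.coeff B 0 = 1" "f = Fract (emb A) (emb B)" "poly.coeff A 0 = L"
    and CD: "poly.coeff D 0 = 1" "g = Fract (emb C) (emb D)" "poly.coeff C 0 = M" unfolding vlim_def by metis
  show ?thesis unfolding vlim_def
    by (rule exI[of _ "A * C"], rule exI[of _ "B * D"]) (simp add: AB CD emb_mult coeff_mult_0)
qed

lemma vlim_uminus: "vlim f L \<Longrightarrow> vlim (- f) (- L)"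
  unfolding vlim_def by (metis coeff_minus emb_uminus minus_fract)

lemma vlim_diff: "vlim f L \<Longrightarrow> vlim g M \<Longrightarrow> vlim (f - g) (L - M)"
  using vlim_add[of f L "- g" "- M"] vlim_uminus[of g M] by simp

lemma vlim_divide: "vlim f L \<Longrightarrow> vlim g 1 \<Longrightarrow> vlim (f / g) L"
proof -
  assume f: "vlim f L" and "vlim g 1"
  then obtain A B where "poly.coeff B 0 = 1" "g = Fract (emb A) (emb B)" "poly.coeff A 0 = 1" unfolding vlim_def by metis
  then have "vlim (inverse g) 1" unfolding vlim_def by (metis inverse_fract)
  then show ?thesis using vlim_mult[OF f, of "inverse g" 1] by (simp add: divide_inverse)
qed

lemma vlim_power: "vlim f L \<Longrightarrow> vlim (f ^ n) (L ^ n)"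
  by (induction n) (simp_all add: vlim_1 vlim_mult)

lemma vlim_V: "vlim (scalar v_par :: 'i::{finite,linorder} K0Pf) 0"
proof -
  have "emb (monom 1 1) = (VP :: 'i K0P)" using emb_monom[of 0 1] by simp
  moreover have "vlim (Fract (emb (monom 1 1) :: 'i K0P) 1) 0" using vlim_embed[of "monom 1 1"] by simp
  ultimately show ?thesis by (simp only: scalar_def)
qed

lemma vlim_V_pow: "vlim (scalar v_par ^ n) (if n = 0 then 1 else 0)"
  using vlim_power[OF vlim_V, of n] by (simp add: power_0_left)

lemma vlim_single: "vlim (Fract (Poly_Mapping.single n 1) 1) (Poly_Mapping.single n 1)"
  using vlim_embed[of "monom (Poly_Mapping.single n 1) 0"] emb_monom[of n 0] by simp

lemma vlim_has_v_limit: "vlim f L \<Longrightarrow> has_v_limit f L"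
proof -
  assume "vlim f L"
  then obtain A B where AB: "poly.coeff B 0 = 1" "f = Fract (emb A) (emb B)" "poly.coeff A 0 = L" unfolding vlim_def by metis
  define C where "C = fps_right_inverse (fps_of_poly B) 1"
  have BC: "fps_of_poly B * C = 1" unfolding C_def by (rule fps_right_inverse) (simp add: AB)
  have "fps_nth (fps_of_poly B * C) 0 = 1" by (simp only: BC) simp
  then have C0: "fps_nth C 0 = 1" using AB by simp
  define F where "F = fps_to_fls (fps_of_poly A * C)"
  have "fps_to_fls (fps_of_poly B) * F = fps_to_fls (fps_of_poly B * C * fps_of_poly A)"
    by (simp add: F_def fls_times_fps_to_fls mult_ac)
  then have "fps_to_fls (fps_of_poly B) * F = fps_to_fls (fps_of_poly A)" by (simp add: BC)
  moreover have "B \<noteq> 0" using AB by auto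
  ultimately have "v_expansion f F" unfolding v_expansion_def using AB by blast
  moreover have "fls_subdegree F \<ge> 0" unfolding F_def by (rule fls_subdegree_fls_to_fps_gt0)
  moreover have "fls_nth F 0 = L" using C0 AB by (simp add: F_def)
  ultimately show ?thesis unfolding has_v_limit_def by metis
qed

text \<open>
  Two expansions of one fraction solve linear equations that are proportional, since the
  embedding of Laurent polynomials is injective.
\<close>

lemma has_v_limit_unique: "has_v_limit f L \<Longrightarrow> has_v_limit f M \<Longrightarrow> L = M"
proof -
  assume "has_v_limit f L" "has_v_limit f M"
  then obtain F G where F: "v_expansion f F" "L = fls_nth F 0" and G: "v_expansion f G" "M = fls_nth G 0"
    unfolding has_v_limit_def by metis
  let ?i = "\<lambda>A. fps_to_fls (fps_of_poly A)"
  obtain A B where AB: "B \<noteq> 0" "f = Fract (emb A) (emb B)" "?i B * F = ?i A" using F unfolding v_expansion_def by metis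
  obtain C D where CD: "D \<noteq> 0" "f = Fract (emb C) (emb D)" "?i D * G = ?i C" using G unfolding v_expansion_def by metis
  have im: "?i (p * q) = ?i p * ?i q" for p q :: "'a laur poly" by (simp add: fps_of_poly_mult fls_times_fps_to_fls)
  have "emb B \<noteq> 0" "emb D \<noteq> 0" using AB CD emb_eq_0 by blast+
  then have "emb (A * D) = emb (C * B)" using AB CD by (simp add: eq_fract emb_mult)
  then have "emb (A * D - C * B) = 0" using emb_add[of "A * D - C * B" "C * B"] by simp
  then have e: "A * D = C * B" using emb_eq_0 by fastforce
  have "?i B * ?i D * F = ?i (A * D)" using AB(3) by (simp add: im mult_ac flip: AB(3))
  also have "\<dots> = ?i B * ?i D * G" unfolding e by (simp add: im mult_ac flip: CD(3))
  finally have "F = G" using AB(1) CD(1) by simp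
  then show ?thesis using F G by simp
qed

context sl_roots
begin

lemma vlim_laur_X: "vlim (Fract (Poly_Mapping.single (wt_of \<alpha> \<nu>) 1) 1) (laur_X \<alpha> \<nu>)"
  unfolding laur_X_def by (rule vlim_single)

subsection \<open>Limits of the coefficients of a step\<close>

definition FX :: "'a \<Rightarrow> 'i K0Pf" where "FX \<nu> = Fract (Poly_Mapping.single (wt_of \<alpha> \<nu>) 1) 1"

lemma FX_neq_0: "FX \<nu> \<noteq> 0"
proof -
  have "Poly_Mapping.single (wt_of \<alpha> \<nu>) (1::K0) \<noteq> 0" by (metis lookup_single_eq lookup_zero zero_neq_one)
  then show ?thesis by (simp add: FX_def Zero_fract_def eq_fract)
qed

lemma FX_neg: "\<nu> \<in> P \<Longrightarrow> FX (- \<nu>) = inverse (FX \<nu>)"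
proof -
  assume n: "\<nu> \<in> P"
  then have "wt_of \<alpha> \<nu> + wt_of \<alpha> (- \<nu>) = 0" using wt_of_add[of \<nu> "- \<nu>"] P_closed by simp
  then have "FX \<nu> * FX (- \<nu>) = Fract (Poly_Mapping.single 0 1) 1" by (simp add: FX_def mult_single)
  then have "FX \<nu> * FX (- \<nu>) = 1" by (simp only: single_one One_fract_def[symmetric])
  then show ?thesis by (metis inverse_unique)
qed

lemma vlim_FX: "vlim (FX \<nu>) (laur_X \<alpha> \<nu>)"
  unfolding FX_def by (rule vlim_laur_X)

text \<open>
  The image of \<open>X\<^sup>b\<close> under \<open>X\<^sup>\<nu> \<mapsto> t\<^bsup>-(\<rho>,\<nu>)\<^esup>X\<^sup>\<nu>\<close>. As \<open>v \<rightarrow> 0\<close> it tends to infinity when \<open>b\<close> is positive and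
  to 0 when \<open>b\<close> is negative.
\<close>

definition Zb :: "'a \<Rightarrow> 'i K0Pf" where "Zb b = scalar (t_pow (- (\<rho> \<bullet> b))) * FX b"

definition hgt :: "'a \<Rightarrow> int" where "hgt b = \<lfloor>\<rho> \<bullet> b\<rfloor>"

lemma hgt: "b \<in> \<Delta> \<Longrightarrow> \<rho> \<bullet> b = of_int (hgt b)"
  using rho_Ints[of b] by (auto simp: hgt_def elim: Ints_cases)

lemma hgt_neq_0: "b \<in> \<Delta> \<Longrightarrow> hgt b \<noteq> 0"
  using hgt rho_neq_0 by fastforce

lemma hgt_pos: "b \<in> \<Delta> \<Longrightarrow> hgt b > 0 \<longleftrightarrow> b \<in> pos"
  using hgt pos_iff by simp

lemma Zb_powi: "b \<in> \<Delta> \<Longrightarrow> Zb b = V powi (- 2 * hgt b) * FX b"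
proof -
  assume b: "b \<in> \<Delta>"
  have "\<lfloor>2 * - (\<rho> \<bullet> b)\<rfloor> = - 2 * hgt b" unfolding hgt[OF b] by linarith
  then show ?thesis by (simp only: Zb_def t_pow_def scalar_powi)
qed

lemma Zb_pos:
  assumes "b \<in> \<Delta>" "hgt b = int k" "k > 0"
  shows "Zb b = inverse (V ^ (2 * k) * FX (- b))" "Zb b \<noteq> 0" "vlim (1 - V ^ (2 * k) * FX (- b)) 1"
proof -
  have "V powi (- 2 * int k) = inverse (V ^ (2 * k))"
    using power_int_minus[of V "2 * int k"] by (simp add: power_int_def nat_mult_distrib)
  then show e: "Zb b = inverse (V ^ (2 * k) * FX (- b))"
    by (simp add: Zb_powi assms FX_neg root_in_P del: mult_minus_left)
  then show "Zb b \<noteq> 0" using FX_neq_0 V_neq_0 by simp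
  have "vlim (V ^ (2 * k) * FX (- b)) ((if 2 * k = 0 then 1 else 0) * laur_X \<alpha> (- b))"
    by (intro vlim_mult vlim_V_pow vlim_FX)
  then have "vlim (V ^ (2 * k) * FX (- b)) 0" using assms(3) by simp
  from vlim_diff[OF vlim_1 this] show "vlim (1 - V ^ (2 * k) * FX (- b)) 1" by simp
qed

lemma Zb_neg:
  assumes "b \<in> \<Delta>" "hgt b = - int k" "k > 0"
  shows "Zb b = V ^ (2 * k) * FX b" "Zb b \<noteq> 0" "vlim (1 - V ^ (2 * k) * FX b) 1"
proof -
  have "V powi (2 * int k) = V ^ (2 * k)" by (simp add: power_int_def nat_mult_distrib)
  then show e: "Zb b = V ^ (2 * k) * FX b" by (simp add: Zb_powi assms)
  then show "Zb b \<noteq> 0" using FX_neq_0 V_neq_0 by simp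
  have "vlim (V ^ (2 * k) * FX b) ((if 2 * k = 0 then 1 else 0) * laur_X \<alpha> b)"
    by (intro vlim_mult vlim_V_pow vlim_FX)
  then have "vlim (V ^ (2 * k) * FX b) 0" using assms(3) by simp
  from vlim_diff[OF vlim_1 this] show "vlim (1 - V ^ (2 * k) * FX b) 1" by simp
qed

lemma vlim_1_V2: "vlim (1 - V\<^sup>2) 1"
  using vlim_diff[OF vlim_1 vlim_V_pow[of 2]] by simp

lemma vlim_neq_0: "vlim g 1 \<Longrightarrow> g \<noteq> 0"
  using vlim_has_v_limit[of g 1] has_v_limit_unique vlim_has_v_limit[OF vlim_0] by (metis zero_neq_one)

lemma hgt_cases:
  assumes "b \<in> \<Delta>"
  obtains k where "hgt b = int k" "k > 0" | k where "hgt b = - int k" "k > 0"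
  using hgt_neq_0[OF assms] by (cases "hgt b" rule: int_cases3) auto

lemma frac_inverse: 
  fixes U c :: "'f::field"
  assumes "U \<noteq> 0"
  shows "(c * inverse U - 1) / (inverse U - 1) = (c - U) / (1 - U)"
    and "c / (inverse U - 1) = c * U / (1 - U)"
    and "inverse U * (c / (inverse U - 1)) = c / (1 - U)"
proof -
  have e: "inverse U - 1 = (1 - U) / U" "c * inverse U - 1 = (c - U) / U" using assms by (simp_all add: field_simps)
  show "(c * inverse U - 1) / (inverse U - 1) = (c - U) / (1 - U)" "c / (inverse U - 1) = c * U / (1 - U)"
    "inverse U * (c / (inverse U - 1)) = c / (1 - U)" unfolding e using assms by simp_all
qed

lemma frac_flip: "a / (u - 1) = - (a / (1 - u))" for a u :: "'f::field"
proof -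
  have "u - 1 = - (1 - u)" by simp
  then show ?thesis by (simp only: minus_divide_right)
qed

text \<open>
  For \<open>k = (\<rho>,b) > 0\<close> the expression is \<open>(1 - v\<^bsup>2k-2\<^esup>X\<^sup>-\<^sup>b) / (1 - v\<^sup>2\<^sup>kX\<^sup>-\<^sup>b)\<close>, so the monomial only
  survives if \<open>k = 1\<close>. For negative \<open>b\<close> it is the quotient of two terms that tend to 1.
\<close>

lemma vlim_stay:
  assumes b: "b \<in> \<Delta>"
  shows "vlim (V powi (- sgn (hgt b)) * rdiag (Zb b)) (if hgt b = 1 then 1 - laur_X \<alpha> (- b) else 1)"
proof (cases rule: hgt_cases[OF b])
  case (1 k)
  note Z = Zb_pos[OF b 1]
  let ?U = "V ^ (2 * k) * FX (- b)"
  have U0: "?U \<noteq> 0" using V_neq_0 FX_neq_0 by simp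
  have k: "2 * k = 2 + (2 * k - 2)" using 1 by simp
  have "V powi (- sgn (hgt b)) * rdiag (Zb b) = (V\<^sup>2 - ?U) / (1 - ?U) / V\<^sup>2"
    unfolding Z(1) rdiag_def frac_inverse(1)[OF U0] using 1
    by (simp add: power_int_minus power2_eq_square divide_inverse mult_ac)
  also have "\<dots> = (1 - V ^ (2 * k - 2) * FX (- b)) / (1 - ?U)"
  proof -
    have "V\<^sup>2 - ?U = V\<^sup>2 * (1 - V ^ (2 * k - 2) * FX (- b))"
      by (subst k, subst power_add) (simp add: algebra_simps)
    then show ?thesis using V_neq_0 by simp
  qed
  finally have e: "V powi (- sgn (hgt b)) * rdiag (Zb b) = (1 - V ^ (2 * k - 2) * FX (- b)) / (1 - ?U)" .
  have "vlim (V ^ (2 * k - 2) * FX (- b)) ((if 2 * k - 2 = 0 then 1 else 0) * laur_X \<alpha> (- b))"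
    by (intro vlim_mult vlim_V_pow vlim_FX)
  then have "vlim (1 - V ^ (2 * k - 2) * FX (- b)) (1 - (if 2 * k - 2 = 0 then 1 else 0) * laur_X \<alpha> (- b))"
    by (rule vlim_diff[OF vlim_1])
  moreover have "(1 - (if 2 * k - 2 = 0 then 1 else 0) * laur_X \<alpha> (- b)) = (if hgt b = 1 then 1 - laur_X \<alpha> (- b) else 1)"
    using 1 by auto
  ultimately show ?thesis unfolding e using vlim_divide[OF _ Z(3)] by simp
next
  case (2 k)
  note Z = Zb_neg[OF b 2]
  let ?U = "V ^ (2 * k) * FX b"
  have "V powi (- sgn (hgt b)) * rdiag (Zb b) = (V\<^sup>2 * ?U - 1) / (?U - 1)"
    using 2 V_neq_0 by (simp add: Z(1) rdiag_def)
  also have "\<dots> = (1 - V\<^sup>2 * ?U) / (1 - ?U)" by (simp only: frac_flip minus_divide_left minus_diff_eq)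
  finally have e: "V powi (- sgn (hgt b)) * rdiag (Zb b) = (1 - V\<^sup>2 * ?U) / (1 - ?U)" .
  have "vlim (V\<^sup>2 * ?U) ((if (2::nat) = 0 then 1 else 0) * ((if 2 * k = 0 then 1 else 0) * laur_X \<alpha> b))"
    by (intro vlim_mult vlim_V_pow vlim_FX)
  then have "vlim (V\<^sup>2 * ?U) 0" by simp
  from vlim_diff[OF vlim_1 this] have "vlim (1 - V\<^sup>2 * ?U) 1" by simp
  then show ?thesis unfolding e using vlim_divide[OF _ Z(3)] 2 by simp
qed

text \<open>
  Here and in the next lemma the coefficient is \<open>\<plusminus>(1 - v\<^sup>2) / (1 - U)\<close> times a power of \<open>v\<close> and
  possibly a monomial, where \<open>U\<close> is the one of \<open>Z\<close> and \<open>Z\<^sup>-\<^sup>1\<close> that tends to 0.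
\<close>

lemma vlim_move_minus:
  assumes b: "b \<in> \<Delta>"
  shows "vlim (V powi (if hgt b > 0 then 1 else 1 + 2 * hgt b) * roff False (Zb b)) (if hgt b > 0 then 1 else - laur_X \<alpha> b)"
proof (cases rule: hgt_cases[OF b])
  case (1 k)
  note Z = Zb_pos[OF b 1]
  let ?U = "V ^ (2 * k) * FX (- b)"
  have U0: "?U \<noteq> 0" using V_neq_0 FX_neq_0 by simp
  have "V powi (if hgt b > 0 then 1 else 1 + 2 * hgt b) * roff False (Zb b) = (1 - V\<^sup>2) / (1 - ?U)"
    using 1 V_neq_0 unfolding roff_def Z(1) if_False frac_inverse(3)[OF U0] by simp
  then show ?thesis using vlim_divide[OF vlim_1_V2 Z(3)] 1 by simp
next
  case (2 k)
  note Z = Zb_neg[OF b 2]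
  let ?U = "V ^ (2 * k) * FX b"
  have "1 - ?U \<noteq> 0" using Z(3) by (rule vlim_neq_0)
  have m: "(1 - V\<^sup>2) / (?U - 1) = - ((1 - V\<^sup>2) / (1 - ?U))"
    by (rule frac_flip)
  have p: "V powi (1 + 2 * hgt b) * V ^ (2 * k) = V"
  proof -
    have "V powi (1 + 2 * hgt b) * V powi (2 * int k) = V powi 1"
      using V_neq_0 by (simp add: 2 flip: power_int_add)
    then show ?thesis by (simp add: power_int_def[of V "2 * int k"] nat_mult_distrib)
  qed
  have "V powi (1 + 2 * hgt b) * roff False (Zb b) = (V powi (1 + 2 * hgt b) * V ^ (2 * k)) * (FX b * (- ((1 - V\<^sup>2) / (1 - ?U)))) / V"
    unfolding roff_def Z(1) if_False m by (simp add: mult_ac)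
  also have "\<dots> = - FX b * (1 - V\<^sup>2) / (1 - ?U)" unfolding p using V_neq_0 by simp
  finally have e: "V powi (1 + 2 * hgt b) * roff False (Zb b) = - FX b * (1 - V\<^sup>2) / (1 - ?U)" .
  have "vlim (- FX b * (1 - V\<^sup>2) / (1 - ?U)) (- laur_X \<alpha> b * 1)"
    by (intro vlim_divide[OF _ Z(3)] vlim_mult vlim_uminus vlim_FX vlim_1_V2)
  then show ?thesis using e 2 by simp
qed

lemma vlim_move_plus:
  assumes b: "b \<in> \<Delta>"
  shows "vlim (V powi (if hgt b > 0 then 1 - 2 * hgt b else 1) * roff True (Zb b)) (if hgt b > 0 then laur_X \<alpha> (- b) else - 1)"
proof (cases rule: hgt_cases[OF b])
  case (1 k)
  note Z = Zb_pos[OF b 1]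
  let ?U = "V ^ (2 * k) * FX (- b)"
  have U0: "?U \<noteq> 0" using V_neq_0 FX_neq_0 by simp
  have p: "V powi (1 - 2 * hgt b) * V ^ (2 * k) = V"
  proof -
    have "V powi (1 - 2 * hgt b) * V powi (2 * int k) = V powi 1"
      using V_neq_0 by (simp add: 1 flip: power_int_add)
    then show ?thesis by (simp add: power_int_def[of V "2 * int k"] nat_mult_distrib)
  qed
  have "V powi (1 - 2 * hgt b) * roff True (Zb b) = (V powi (1 - 2 * hgt b) * V ^ (2 * k)) * (FX (- b) * (1 - V\<^sup>2) / (1 - ?U)) / V"
    unfolding roff_def Z(1) if_True frac_inverse(2)[OF U0] by (simp add: mult_ac)
  also have "\<dots> = FX (- b) * (1 - V\<^sup>2) / (1 - ?U)" unfolding p using V_neq_0 by simp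
  finally have e: "V powi (1 - 2 * hgt b) * roff True (Zb b) = FX (- b) * (1 - V\<^sup>2) / (1 - ?U)" .
  have "vlim (FX (- b) * (1 - V\<^sup>2) / (1 - ?U)) (laur_X \<alpha> (- b) * 1)"
    by (intro vlim_divide[OF _ Z(3)] vlim_mult vlim_FX vlim_1_V2)
  then show ?thesis using e 1 by simp
next
  case (2 k)
  note Z = Zb_neg[OF b 2]
  let ?U = "V ^ (2 * k) * FX b"
  have m: "(1 - V\<^sup>2) / (?U - 1) = - ((1 - V\<^sup>2) / (1 - ?U))"
    by (rule frac_flip)
  have "V powi 1 * roff True (Zb b) = - ((1 - V\<^sup>2) / (1 - ?U))"
    unfolding roff_def Z(1) if_True m using V_neq_0 by simp
  then show ?thesis using vlim_uminus[OF vlim_divide[OF vlim_1_V2 Z(3)]] 2 by simp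
qed

section \<open>The matrix representation\<close>

lemma rho_shift_mono: "rho_shift_poly \<Delta> \<alpha> = mono_map (\<lambda>n. n) (\<lambda>n. t_pow (- (\<rho> \<bullet> vec_of \<alpha> n)))"
  by (rule ext) (simp add: rho_shift_poly_def mono_map_def)

lemma rho_shift_single: "rho_shift_poly \<Delta> \<alpha> (Poly_Mapping.single n c) = Poly_Mapping.single n (c * t_pow (- (\<rho> \<bullet> vec_of \<alpha> n)))"
  by (simp add: rho_shift_mono mono_map_single)

lemma rho_shift_inj: "ring_inj (rho_shift_poly \<Delta> \<alpha>)"
  unfolding rho_shift_mono
proof (rule mono_map_ring_inj)
  show "t_pow (- (\<rho> \<bullet> vec_of \<alpha> (m + n))) = t_pow (- (\<rho> \<bullet> vec_of \<alpha> m)) * t_pow (- (\<rho> \<bullet> vec_of \<alpha> n))" for m n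
    using two_rho_P[of "vec_of \<alpha> m"] two_rho_P[of "vec_of \<alpha> n"]
    by (subst t_pow_add[symmetric]) (simp_all add: vec_of_add inner_add_right)
qed (simp_all add: t_pow_neq_0)

text \<open>The map that the matrix representation applies to coefficients in row \<open>v\<close>.\<close>

definition sig :: "('a \<Rightarrow> 'a) \<Rightarrow> 'i K0Pf \<Rightarrow> 'i K0Pf" where
  "sig v f = fract_ext (rho_shift_poly \<Delta> \<alpha>) (wex_act_fun \<alpha> (0, inv v) f)"

lemma fin_in: "u \<in> W \<Longrightarrow> (0, u) \<in> Wex"
  by (simp add: wexI P_closed)

lemma inv_in: "v \<in> W \<Longrightarrow> (0, inv v) \<in> Wex"
  by (simp add: fin_in W_inverse)

lemma sig_hom: assumes "v \<in> W"
  shows "sig v (y + z) = sig v y + sig v z" "sig v (y * z) = sig v y * sig v z" "sig v 1 = 1" "sig v 0 = 0"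
    "sig v (y - z) = sig v y - sig v z" "sig v (y / z) = sig v y / sig v z"
  by (simp_all add: sig_def wex_act_fun_hom[OF inv_in[OF assms]] fract_ext_hom[OF rho_shift_inj])

lemma rho_shift_scalar: "fract_ext (rho_shift_poly \<Delta> \<alpha>) (scalar c) = scalar c"
  by (simp add: scalar_def fract_ext_Fract rho_shift_inj ring_injD[OF rho_shift_inj] rho_shift_single
      vec_of_def t_pow_def)

lemma sig_scalar: "v \<in> W \<Longrightarrow> sig v (scalar c) = scalar c"
  by (simp add: sig_def wex_act_fun_scalar inv_in rho_shift_scalar)

lemma sig_X: "v \<in> W \<Longrightarrow> b \<in> \<Delta> \<Longrightarrow> sig v (X (b, 0)) = Zb (inv v b)"
proof -
  assume v: "v \<in> W" and b: "b \<in> \<Delta>"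
  have "(b, 0) \<in> aroots" using b by (simp add: aroots_def)
  then have "sig v (X (b, 0)) = fract_ext (rho_shift_poly \<Delta> \<alpha>) (X (inv v b, 0))"
    by (simp add: sig_def wex_act_fun_X inv_in v wex_act_def)
  also have "\<dots> = Zb (inv v b)"
    using W_root[OF W_inverse(1)[OF v] b]
    by (simp add: X_aff_def fract_ext_Fract rho_shift_inj ring_injD[OF rho_shift_inj] Zb_def FX_def scalar_def
      rho_shift_single vec_of_wt_of root_in_P mult_single)
  finally show ?thesis .
qed

lemma sig_rdiag: "v \<in> W \<Longrightarrow> sig v (rdiag Z) = rdiag (sig v Z)"
  by (simp add: rdiag_def sig_hom sig_scalar power2_eq_square)

lemma sig_roff: "v \<in> W \<Longrightarrow> sig v (roff e Z) = roff e (sig v Z)"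
  by (simp add: roff_def sig_hom sig_scalar power2_eq_square)

lemma sig_act: "v \<in> W \<Longrightarrow> u \<in> W \<Longrightarrow> sig v (wex_act_fun \<alpha> (0, u) f) = sig (inv u \<circ> v) f"
proof -
  assume v: "v \<in> W" and u: "u \<in> W"
  have i: "inv (inv u \<circ> v) = inv v \<circ> u"
    unfolding W_inv_prod[OF W_inverse(1)[OF u] v] inv_inv_eq[OF W_inverse(4)[OF u]] by (rule HOL.refl)
  have m: "wex_mult (0, inv v) (0, u) = (0, inv v \<circ> u)"
    using W_lin(5)[OF W_inverse(1)[OF v]] by (simp add: wex_mult_def)
  show ?thesis unfolding sig_def wex_act_fun_mult[OF inv_in[OF v] fin_in[OF u]] m i by (rule HOL.refl)
qed

lemma ring_inj_comp: assumes "ring_inj \<phi>" "ring_inj \<psi>" shows "ring_inj (\<lambda>x. \<phi> (\<psi> x))"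
  unfolding ring_inj_def ring_injD[OF assms(1)] ring_injD[OF assms(2)] by simp

lemma tr_in: "\<mu> \<in> P \<Longrightarrow> (\<mu>, id) \<in> Wex"
  by (simp add: wexI)

lemma act_tr_poly: "wex_act_poly \<alpha> (\<mu>, id) = mono_map (\<lambda>n. n) (\<lambda>n. q_pow \<alpha> (- (\<mu> \<bullet> vec_of \<alpha> n)))"
  by (simp add: wex_act_poly_mono)

lemma sig_act_tr:
  assumes v: "v \<in> W" and lam: "lam \<in> P"
  shows "sig v (wex_act_fun \<alpha> (lam, id) f) = wex_act_fun \<alpha> (inv v lam, id) (sig v f)"
proof -
  let ?m = "inv v lam"
  have m: "?m \<in> P" using W_P[OF W_inverse(1)[OF v] lam] .
  have e: "wex_mult (0, inv v) (lam, id) = wex_mult (?m, id) (0, inv v)" by (simp add: wex_mult_def)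
  have c: "fract_ext (rho_shift_poly \<Delta> \<alpha>) (wex_act_fun \<alpha> (?m, id) z) = wex_act_fun \<alpha> (?m, id) (fract_ext (rho_shift_poly \<Delta> \<alpha>) z)" for z
  proof -
    have i: "ring_inj (\<lambda>x. rho_shift_poly \<Delta> \<alpha> (wex_act_poly \<alpha> (?m, id) x))"
      by (rule ring_inj_comp[OF rho_shift_inj wex_act_poly_inj[OF tr_in[OF m]]])
    have ee: "wex_act_poly \<alpha> (?m, id) (rho_shift_poly \<Delta> \<alpha> x) = rho_shift_poly \<Delta> \<alpha> (wex_act_poly \<alpha> (?m, id) x)" for x
      by (simp add: act_tr_poly rho_shift_mono mono_map_comp mult.commute)
    have "fract_ext (rho_shift_poly \<Delta> \<alpha>) (fract_ext (wex_act_poly \<alpha> (?m, id)) z) =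
        fract_ext (\<lambda>x. rho_shift_poly \<Delta> \<alpha> (wex_act_poly \<alpha> (?m, id) x)) z"
      by (rule fract_ext_comp[OF rho_shift_inj wex_act_poly_inj[OF tr_in[OF m]] i]) (rule HOL.refl)
    moreover have "fract_ext (wex_act_poly \<alpha> (?m, id)) (fract_ext (rho_shift_poly \<Delta> \<alpha>) z) =
        fract_ext (\<lambda>x. rho_shift_poly \<Delta> \<alpha> (wex_act_poly \<alpha> (?m, id) x)) z"
      by (rule fract_ext_comp[OF wex_act_poly_inj[OF tr_in[OF m]] rho_shift_inj i]) (rule ee)
    ultimately show ?thesis unfolding wex_act_fun_def by (rule trans[OF _ sym])
  qed
  have swap: "wex_act_fun \<alpha> (0, inv v) (wex_act_fun \<alpha> (lam, id) f) = wex_act_fun \<alpha> (?m, id) (wex_act_fun \<alpha> (0, inv v) f)"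
    unfolding wex_act_fun_mult[OF inv_in[OF v] tr_in[OF lam]] wex_act_fun_mult[OF tr_in[OF m] inv_in[OF v]] e
      by (rule HOL.refl)
  show ?thesis unfolding sig_def swap by (rule c)
qed

abbreviation kap :: "('a, 'i) smash \<Rightarrow> ('a \<Rightarrow> 'a) \<Rightarrow> ('a \<Rightarrow> 'a) \<Rightarrow> ('a, 'i) qtorus" where "kap \<equiv> kappa \<Delta> \<alpha>"

lemma kappa_sig: "kap A v w = (\<Sum>g\<in>Poly_Mapping.keys A. if v = snd g \<circ> w
    then Poly_Mapping.single (inv v (fst g)) (sig v (Poly_Mapping.lookup A g) * scalar (t_pow (\<rho> \<bullet> inv v (fst g)))) else 0)"
  unfolding kappa_def sig_def
  by (rule sum.cong[OF HOL.refl]) (unfold split_beta prod.collapse, rule HOL.refl)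

lemma if_add_zero: "(if c then a + b else 0) = (if c then a else 0) + (if c then b else (0 :: 'z::monoid_add))"
  by simp

lemma kappa_add: assumes v: "v \<in> W" shows "kap (A + B) v w = kap A v w + kap B v w"
  unfolding kappa_sig
proof (rule setsum_keys_plus_distrib[of "\<lambda>g a. if v = snd g \<circ> w
    then Poly_Mapping.single (inv v (fst g)) (sig v a * scalar (t_pow (\<rho> \<bullet> inv v (fst g)))) else 0"])
qed (unfold sig_hom(1)[OF v] sig_hom(4)[OF v] distrib_right single_add mult_zero_left single_zero if_add_zero if_cancel, rule HOL.refl, rule HOL.refl)

lemma kappa_single: assumes v: "v \<in> W"
  shows "kap (Poly_Mapping.single (\<mu>, u) f) v w = (if v = u \<circ> w
    then Poly_Mapping.single (inv v \<mu>) (sig v f * scalar (t_pow (\<rho> \<bullet> inv v \<mu>))) else 0)"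
proof (cases "f = 0")
  case True
  show ?thesis unfolding kappa_sig True sig_hom(4)[OF v] by simp
next
  case False
  then have k: "Poly_Mapping.keys (Poly_Mapping.single (\<mu>, u) f) = {(\<mu>, u)}" by simp
  have "kap (Poly_Mapping.single (\<mu>, u) f) v w = (\<Sum>g\<in>{(\<mu>, u)}. if v = snd g \<circ> w
    then Poly_Mapping.single (inv v (fst g)) (sig v (Poly_Mapping.lookup (Poly_Mapping.single (\<mu>, u) f) g) * scalar (t_pow (\<rho> \<bullet> inv v (fst g)))) else 0)"
    unfolding kappa_sig k
      by (rule HOL.refl)
  then show ?thesis by (simp only: sum.insert finite.emptyI empty_iff not_False_eq_True sum.empty add_0_right fst_conv snd_conv lookup_single_eq)
qed

lemma kappa_fin_mult:
  assumes v: "v \<in> W" and u: "u \<in> W" and A: "sm A"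
  shows "kap (Poly_Mapping.single (0, u) c \<odot> A) v w = Poly_Mapping.single 0 (sig v c) * kap A (inv u \<circ> v) w"
  using A
proof (induction A rule: sm_induct)
  case (single g f)
  obtain \<mu> u' where g: "g = (\<mu>, u')" "u' \<in> W" using single by (auto simp: wex_def)
  have iv: "inv u \<circ> v \<in> W" using u v W_comp W_inverse by blast
  have e: "v = u \<circ> u' \<circ> w \<longleftrightarrow> inv u \<circ> v = u' \<circ> w"
    using W_inv_comp[OF u] by (metis comp_assoc id_comp)
  have i: "inv (inv u \<circ> v) \<mu> = inv v (u \<mu>)"
    unfolding W_inv_prod[OF W_inverse(1)[OF u] v] inv_inv_eq[OF W_inverse(4)[OF u]] by simp
  have p: "Poly_Mapping.single (0, u) c \<odot> Poly_Mapping.single (\<mu>, u') f =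
      Poly_Mapping.single (u \<mu>, u \<circ> u') (c * wex_act_fun \<alpha> (0, u) f)"
    by (simp add: smash_single fin_in u wex_mult_def)
  show ?case
    unfolding g(1) p kappa_single[OF v] kappa_single[OF iv] e i sig_hom(2)[OF v] sig_act[OF v u]
    by (simp add: mult_single mult.assoc)
next
  case (add A B)
  have iv: "inv u \<circ> v \<in> W" using u v W_comp W_inverse by blast
  show ?case
    unfolding smash_add_right[OF sm_single[OF fin_in[OF u]]] kappa_add[OF v] kappa_add[OF iv] distrib_left add.IH
      by (rule HOL.refl)
qed

text \<open>
  Row \<open>v\<close> of the product only involves the rows \<open>v\<close> and \<open>s\<^sub>bv\<close> of \<open>A\<close>. This is the recursion that
  produces the walks.
\<close>

lemma kappa_Rop:
  assumes v: "v \<in> W" and b: "b \<in> \<Delta>" and A: "sm A"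
  shows "kap (Rop e (b, 0) \<odot> A) v w = Poly_Mapping.single 0 (rdiag (Zb (inv v b))) * kap A v w
    + Poly_Mapping.single 0 (roff e (Zb (inv v b))) * kap A (refl b \<circ> v) w"
proof -
  have r: "aff_refl (b, 0) = (0, refl b)" by (simp add: aff_refl_def)
  have i: "inv (refl b) = refl b" by (rule inv_unique_comp) (simp_all add: refl_inv_comp b)
  have iid: "inv id \<circ> v = v" by simp
  show ?thesis
    by (simp add: Rop_def r wex_one_def smash_add_left kappa_add v kappa_fin_mult[OF v _ A] refl_in_W b i
        sig_rdiag sig_roff sig_X)
qed

lemma kappa_one: assumes v: "v \<in> W" shows "kap smash_one v w = (if v = w then 1 else 0)"
proof -
  have "inv v 0 = 0" using W_lin(5)[OF W_inverse(1)[OF v]] .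
  note i0 = this
  show ?thesis
    unfolding smash_one_def wex_one_def kappa_single[OF v] sig_hom(3)[OF v] i0
    by (simp add: t_pow_def scalar_hom)
qed

text \<open>Elements without translations; their matrix entries are concentrated at \<open>t\<^sub>0\<close>.\<close>

definition sm0 :: "('a, 'i) smash \<Rightarrow> bool" where "sm0 A \<longleftrightarrow> Poly_Mapping.keys A \<subseteq> {0} \<times> W"

lemma sm0_sm: "sm0 A \<Longrightarrow> sm A"
  using fin_in by (auto simp: sm0_def sm_def)

lemma sm0_single: "u \<in> W \<Longrightarrow> sm0 (Poly_Mapping.single (0, u) a)"
  by (simp add: sm0_def)

lemma sm0_add: "sm0 A \<Longrightarrow> sm0 B \<Longrightarrow> sm0 (A + B)"
  using keys_add[of A B] by (auto simp: sm0_def)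

lemma sm0_induct [consumes 1, case_names single add]:
  assumes A: "sm0 A" and s: "\<And>u a. u \<in> W \<Longrightarrow> Q (Poly_Mapping.single (0, u) a)"
    and a: "\<And>A B. sm0 A \<Longrightarrow> sm0 B \<Longrightarrow> Q A \<Longrightarrow> Q B \<Longrightarrow> Q (A + B)"
  shows "Q A"
proof -
  have "finite S \<Longrightarrow> S \<subseteq> {0} \<times> W \<Longrightarrow> sm0 (\<Sum>k\<in>S. Poly_Mapping.single k (Poly_Mapping.lookup A k)) \<and>
      Q (\<Sum>k\<in>S. Poly_Mapping.single k (Poly_Mapping.lookup A k))" for S
  proof (induction rule: finite_induct)
    case empty
    then show ?case using s[OF id_in_W, of 0] by (simp add: sm0_def)
  next
    case (insert k S)
    then obtain u where "k = (0, u)" "u \<in> W" by auto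
    then show ?case using insert by (simp add: sm0_add sm0_single a s)
  qed
  from this[OF finite_keys[of A]] A show ?thesis by (simp add: poly_mapping_sum_single sm0_def)
qed

lemma sm0_mult: "sm0 A \<Longrightarrow> sm0 B \<Longrightarrow> sm0 (A \<odot> B)"
proof (induction A rule: sm0_induct)
  case (single u a)
  from single(2) show ?case
  proof (induction B rule: sm0_induct)
    case (single u' b)
    then show ?case using \<open>u \<in> W\<close> by (simp add: smash_single fin_in wex_mult_def W_lin W_comp sm0_single)
  next
    case (add B C)
    then show ?case using \<open>u \<in> W\<close> by (simp add: smash_add_right sm_single fin_in sm0_add)
  qed
qed (simp add: smash_add_left sm0_add)

lemma kappa_tr_mult:
  assumes v: "v \<in> W" and lam: "lam \<in> P" and A: "sm0 A"
  shows "kap (tr (lam, id) \<odot> A) v w = Poly_Mapping.single (inv v lam)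
    (wex_act_fun \<alpha> (inv v lam, id) (Poly_Mapping.lookup (kap A v w) 0) * scalar (t_pow (\<rho> \<bullet> inv v lam)))"
  using A
proof (induction A rule: sm0_induct)
  case (single u f)
  have i0: "inv v 0 = 0" using W_lin(5)[OF W_inverse(1)[OF v]] .
  have t1: "scalar (t_pow 0) = 1" by (simp add: t_pow_def scalar_hom)
  have iP: "(inv v lam, id) \<in> Wex" using W_P[OF W_inverse(1)[OF v] lam] by (rule tr_in)
  have p: "tr (lam, id) \<odot> Poly_Mapping.single (0, u) f = Poly_Mapping.single (lam, u) (wex_act_fun \<alpha> (lam, id) f)"
    unfolding tr_def smash_single[OF tr_in[OF lam]] by (simp add: wex_mult_def)
  show ?case
  proof (cases "v = u \<circ> w")
    case True
    show ?thesis
      unfolding p kappa_single[OF v] if_P[OF True] i0 sig_act_tr[OF v lam] inner_zero_right t1 mult_1_right lookup_single_eq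
      by (rule HOL.refl)
  next
    case False
    show ?thesis
      unfolding p kappa_single[OF v] if_not_P[OF False] lookup_zero wex_act_fun_hom(4)[OF iP] mult_zero_left single_zero
      by (rule HOL.refl)
  qed
next
  case (add A B)
  have iP: "(inv v lam, id) \<in> Wex" using W_P[OF W_inverse(1)[OF v] lam] by (rule tr_in)
  show ?case
    unfolding smash_add_right[OF sm_tr[OF tr_in[OF lam]]] kappa_add[OF v] add.IH lookup_add wex_act_fun_hom(1)[OF iP]
      distrib_right single_add
      by (rule HOL.refl)
qed

lemma trans_act_mono: "trans_act \<alpha> \<mu> = mono_map (\<lambda>n. n) (\<lambda>n. Poly_Mapping.single (q_exp \<alpha> (- (\<mu> \<bullet> vec_of \<alpha> n))) 1)"
  by (rule ext) (simp add: trans_act_def mono_map_def)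

lemma trans_act_hom: "trans_act \<alpha> \<mu> (f + g) = trans_act \<alpha> \<mu> f + trans_act \<alpha> \<mu> g" "trans_act \<alpha> \<mu> 0 = 0" "trans_act \<alpha> \<mu> 1 = 1"
proof -
  show "trans_act \<alpha> \<mu> (f + g) = trans_act \<alpha> \<mu> f + trans_act \<alpha> \<mu> g" by (simp add: trans_act_mono mono_map_add)
  show "trans_act \<alpha> \<mu> 0 = 0" by (simp add: trans_act_def)
  have "trans_act \<alpha> \<mu> (Poly_Mapping.single 0 1) = Poly_Mapping.single 0 1"
    unfolding trans_act_mono mono_map_single by (simp add: vec_of_def q_exp_def)
  then show "trans_act \<alpha> \<mu> 1 = 1" by simp
qed

lemma laur_embed_trans_act: "laur_embed (trans_act \<alpha> \<mu> r) = wex_act_poly \<alpha> (\<mu>, id) (laur_embed r)"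
proof (induction r rule: poly_mapping_induct_single)
  case (single k c)
  show ?case
    unfolding trans_act_mono act_tr_poly mono_map_single laur_embed_single qe_mult qe_single q_pow_def by simp
next
  case (add f g)
  show ?case unfolding trans_act_hom(1) laur_embed_add add.IH unfolding act_tr_poly mono_map_add
      by (rule HOL.refl)
qed

lemma emb_trans_act: "emb (map_poly (trans_act \<alpha> \<mu>) A) = wex_act_poly \<alpha> (\<mu>, id) (emb A)"
proof (induction A)
  case 0
  show ?case unfolding map_poly_0 emb_0 act_tr_poly by (simp add: mono_map_def)
next
  case (pCons a p)
  have VPfix: "wex_act_poly \<alpha> (\<mu>, id) VP = VP" unfolding act_tr_poly mono_map_single by (simp add: vec_of_def)
  have mult: "wex_act_poly \<alpha> (\<mu>, id) (VP * z) = VP * wex_act_poly \<alpha> (\<mu>, id) z" for z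
  proof (induction z rule: poly_mapping_induct_single)
    case (single k c)
    show ?case unfolding act_tr_poly mult_single mono_map_single by (simp add: mult_ac)
  next
    case (add f g)
    then show ?case unfolding distrib_left act_tr_poly mono_map_add by simp
  qed
  have s: "map_poly (trans_act \<alpha> \<mu>) (pCons a p) = pCons (trans_act \<alpha> \<mu> a) (map_poly (trans_act \<alpha> \<mu>) p)"
    by (rule map_poly_pCons) (rule trans_act_hom(2))
  have ad: "wex_act_poly \<alpha> (\<mu>, id) (y + z) = wex_act_poly \<alpha> (\<mu>, id) y + wex_act_poly \<alpha> (\<mu>, id) z" for y z
    unfolding act_tr_poly by (rule mono_map_add)
  show ?case unfolding s emb_pCons laur_embed_trans_act pCons.IH ad mult
      by (rule HOL.refl)
qed

text \<open>
  A translation acts on embedded Laurent polynomials without affecting \<open>v\<close>, so it preserves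
  presentations as fractions with denominator of constant term 1.
\<close>

lemma vlim_translate:
  assumes \<mu>: "\<mu> \<in> P" and f: "vlim f L"
  shows "vlim (wex_act_fun \<alpha> (\<mu>, id) f) (trans_act \<alpha> \<mu> L)"
proof -
  obtain A B where AB: "poly.coeff B 0 = 1" "f = Fract (emb A) (emb B)" "poly.coeff A 0 = L" using f unfolding vlim_def by metis
  have "wex_act_fun \<alpha> (\<mu>, id) f = Fract (emb (map_poly (trans_act \<alpha> \<mu>) A)) (emb (map_poly (trans_act \<alpha> \<mu>) B))"
    unfolding AB(2) wex_act_fun_def emb_trans_act
    by (rule fract_ext_Fract[OF wex_act_poly_inj[OF tr_in[OF \<mu>]] emb_neq_0[OF AB(1)]])
  then show ?thesis unfolding vlim_def
    by (intro exI[of _ "map_poly (trans_act \<alpha> \<mu>) A"] exI[of _ "map_poly (trans_act \<alpha> \<mu>) B"])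
       (simp add: AB coeff_map_poly trans_act_hom)
qed

section \<open>Signs, lengths and edges of the quantum Bruhat graph\<close>

definition sg :: "('a \<Rightarrow> 'a) \<Rightarrow> 'a \<Rightarrow> int" where "sg v c = (if inv v c \<in> pos then 1 else -1)"

lemma inv_root: "v \<in> W \<Longrightarrow> c \<in> \<Delta> \<Longrightarrow> inv v c \<in> \<Delta>"
  by (rule W_root[OF W_inverse(1)])

lemma inv_lin: "v \<in> W \<Longrightarrow> inv v (- c) = - inv v c" "v \<in> W \<Longrightarrow> inv v (c + d) = inv v c + inv v d"
  "v \<in> W \<Longrightarrow> inv v (c - d) = inv v c - inv v d"
  using W_lin[OF W_inverse(1)] by auto

lemma sg_neg: "v \<in> W \<Longrightarrow> c \<in> \<Delta> \<Longrightarrow> sg v (- c) = - sg v c"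
  using pos_neg[OF inv_root] by (simp add: sg_def inv_lin)

lemma sg_sgn: "v \<in> W \<Longrightarrow> c \<in> \<Delta> \<Longrightarrow> sg v c = sgn (hgt (inv v c))"
  using hgt_pos[OF inv_root] hgt_neq_0[OF inv_root] by (auto simp: sg_def sgn_if)

text \<open>Of every pair \<open>c, -c\<close> exactly one root lies in \<open>v\<Delta>\<^sup>+\<close>, and the sign of \<open>v\<^sup>-\<^sup>1c\<close> tells which.\<close>

lemma sum_odd_reindex:
  fixes \<phi> :: "'a \<Rightarrow> 'r::ring_1"
  assumes v: "v \<in> W" and odd: "\<And>c. c \<in> \<Delta> \<Longrightarrow> \<phi> (- c) = - \<phi> c"
  shows "(\<Sum>a\<in>pos. \<phi> (v a)) = (\<Sum>c\<in>pos. of_int (sg v c) * \<phi> c)"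
proof (rule sum.reindex_bij_witness[of _ "\<lambda>c. if inv v c \<in> pos then inv v c else - inv v c"
      "\<lambda>a. if v a \<in> pos then v a else - v a"])
  fix a assume a: "a \<in> pos"
  have aD: "a \<in> \<Delta>" "v a \<in> \<Delta>" using a pos_sub W_root[OF v] by auto
  have na: "- a \<notin> pos" using pos_neg[OF aD(1)] a by simp
  show "(if inv v (if v a \<in> pos then v a else - v a) \<in> pos then inv v (if v a \<in> pos then v a else - v a)
      else - inv v (if v a \<in> pos then v a else - v a)) = a"
    using a na by (simp add: inv_lin[OF v] W_inverse(3)[OF v])
  show "(if v a \<in> pos then v a else - v a) \<in> pos" using pos_neg[OF aD(2)] by simp
  show "of_int (sg v (if v a \<in> pos then v a else - v a)) * \<phi> (if v a \<in> pos then v a else - v a) = \<phi> (v a)"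
    using a na odd[OF aD(2)] by (simp add: sg_def inv_lin[OF v] W_inverse(3)[OF v])
next
  fix c assume c: "c \<in> pos"
  have cD: "c \<in> \<Delta>" "inv v c \<in> \<Delta>" using c pos_sub inv_root[OF v] by auto
  have nc: "- c \<notin> pos" using pos_neg[OF cD(1)] c by simp
  show "(if v (if inv v c \<in> pos then inv v c else - inv v c) \<in> pos then v (if inv v c \<in> pos then inv v c else - inv v c)
     else - v (if inv v c \<in> pos then inv v c else - inv v c)) = c"
    using c nc by (simp add: W_lin[OF v] W_inverse(2)[OF v])
  show "(if inv v c \<in> pos then inv v c else - inv v c) \<in> pos" using pos_neg[OF cD(2)] by simp
qed

lemma len_sum_sg:
  assumes v: "v \<in> W"
  shows "2 * int (len \<alpha> v) = int (card pos) - (\<Sum>c\<in>pos. sg v c)"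
proof -
  define \<phi> :: "'a \<Rightarrow> int" where "\<phi> c = (if c \<in> pos then 1 else -1)" for c
  have "(\<Sum>a\<in>pos. \<phi> (v a)) = (\<Sum>c\<in>pos. of_int (sg v c) * \<phi> c)"
    by (rule sum_odd_reindex[OF v]) (use pos_neg in \<open>auto simp: \<phi>_def\<close>)
  also have "\<dots> = (\<Sum>c\<in>pos. sg v c)" by (rule sum.cong[OF HOL.refl]) (simp add: \<phi>_def)
  finally have 1: "(\<Sum>a\<in>pos. \<phi> (v a)) = (\<Sum>c\<in>pos. sg v c)" .
  have "(\<Sum>a\<in>pos. \<phi> (v a)) = (\<Sum>a\<in>pos. 1 - (if a \<in> invs v then 2 else 0))"
    by (rule sum.cong[OF HOL.refl]) (simp add: \<phi>_def invs_def)
  also have "\<dots> = int (card pos) - 2 * int (card (invs v))"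
  proof -
    have "pos \<inter> invs v = invs v" by (auto simp: invs_def)
    then show ?thesis by (simp add: sum_subtractf sum.If_cases finite_pos)
  qed
  finally show ?thesis using 1 len_invs[OF v] by simp
qed

definition split_at :: "'a \<Rightarrow> 'a set" where "split_at b = {a\<in>pos. b - a \<in> pos}"

lemma finite_split_at: "finite (split_at b)"
  by (simp add: split_at_def finite_pos)

lemma split_at_inner: "b \<in> \<Delta> \<Longrightarrow> a \<in> split_at b \<Longrightarrow> a \<bullet> b = 1"
  using diff_root_inner[of b a] pos_sub by (auto simp: split_at_def inner_commute)

lemma refl_neg_cases:
  assumes b: "b \<in> pos" and a: "a \<in> pos"
  shows "refl b a \<notin> pos \<longleftrightarrow> a = b \<or> a \<in> split_at b"
proof -
  have D: "b \<in> \<Delta>" "a \<in> \<Delta>" using a b pos_sub by auto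
  have rD: "refl b a \<in> \<Delta>" using refl_in D by blast
  have r: "refl b a = a - (a \<bullet> b) *\<^sub>R b" using D by (simp add: refl_root)
  have ha: "\<rho> \<bullet> a > 0" "\<rho> \<bullet> b > 0" using a b pos_iff D by auto
  show ?thesis
  proof (cases rule: inner_root_cases[OF D(2,1)])
    case 1
    then have "refl b a = - a" using D root_norm refl_root[of a a] by (simp add: scaleR_2)
    then show ?thesis using a pos_neg[OF D(2)] 1 by simp
  next
    case 2
    then have "refl b a = a - b" by (simp add: r)
    then have "refl b a \<notin> pos \<longleftrightarrow> b - a \<in> pos" using pos_neg[OF rD] by simp
    moreover have "a \<noteq> b" using 2 root_norm[OF D(1)] by auto
    ultimately show ?thesis using a by (simp add: split_at_def)
  next
    case 3
    then have "a \<noteq> b" "a \<notin> split_at b" using root_norm[OF D(1)] split_at_inner[OF D(1)] by auto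
    then show ?thesis using a 3 by (simp add: r)
  next
    case 4
    then have "a \<noteq> b" "a \<notin> split_at b" using root_norm[OF D(1)] split_at_inner[OF D(1)] by auto
    moreover have "refl b a \<in> pos" using pos_iff[OF rD] ha 4 by (simp add: r inner_add_right)
    ultimately show ?thesis by simp
  next
    case 5
    then show ?thesis using a b pos_neg[OF D(2)] by simp
  qed
qed

lemma inv_refl_comp: "v \<in> W \<Longrightarrow> b \<in> \<Delta> \<Longrightarrow> inv (refl b \<circ> v) c = inv v (refl b c)"
proof -
  assume v: "v \<in> W" and b: "b \<in> \<Delta>"
  have "inv (refl b) = refl b" by (rule inv_unique_comp) (simp_all add: refl_inv_comp b)
  then show ?thesis using W_inv_prod[OF refl_in_W[OF b] v] by simp
qed

lemma refl_comp_in: "v \<in> W \<Longrightarrow> b \<in> \<Delta> \<Longrightarrow> refl b \<circ> v \<in> W"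
  using W_comp refl_in_W by blast

lemma sg_refl: "v \<in> W \<Longrightarrow> b \<in> \<Delta> \<Longrightarrow> sg (refl b \<circ> v) c = sg v (refl b c)"
  unfolding sg_def inv_refl_comp by (rule HOL.refl)

text \<open>
  The positive roots that \<open>s\<^sub>b\<close> makes negative are \<open>b\<close> and those that can be completed to \<open>b\<close> by
  another positive root. All others are permuted by \<open>s\<^sub>b\<close> and cancel from the difference.
\<close>

lemma len_diff:
  assumes v: "v \<in> W" and b: "b \<in> pos"
  shows "int (len \<alpha> (refl b \<circ> v)) - int (len \<alpha> v) = sg v b + (\<Sum>a\<in>split_at b. sg v a)"
proof -
  have bD: "b \<in> \<Delta>" using b pos_sub by blast
  let ?s = "refl b"
  define N where "N = {a\<in>pos. ?s a \<notin> pos}"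
  have fN: "finite N" by (simp add: N_def finite_pos)
  have ss: "?s (?s a) = a" for a by (rule refl_inv[OF bD])
  have rn: "?s (- a) = - ?s a" for a by (simp add: refl_root[OF bD])
  have rD: "a \<in> pos \<Longrightarrow> ?s a \<in> \<Delta>" for a using refl_in[OF bD] pos_sub by blast
  define sN where "sN = (\<Sum>a\<in>N. sg v a)"
  define sM where "sM = (\<Sum>a\<in>pos - N. sg v a)"
  have e0: "2 * (int (len \<alpha> (?s \<circ> v)) - int (len \<alpha> v)) = (\<Sum>a\<in>pos. sg v a) - (\<Sum>a\<in>pos. sg v (?s a))"
    using len_sum_sg[OF v] len_sum_sg[OF refl_comp_in[OF v bD]] by (simp add: sg_refl[OF v bD])
  have e1: "(\<Sum>a\<in>pos. sg v a) = sN + sM"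
    unfolding sN_def sM_def by (subst add.commute, rule sum.subset_diff) (auto simp: N_def finite_pos)
  have "(\<Sum>a\<in>pos. sg v (?s a)) = (\<Sum>a\<in>N. sg v (?s a)) + (\<Sum>a\<in>pos - N. sg v (?s a))"
    by (subst add.commute, rule sum.subset_diff) (auto simp: N_def finite_pos)
  moreover have "(\<Sum>a\<in>pos - N. sg v (?s a)) = sM" unfolding sM_def
    by (rule sum.reindex_bij_witness[of _ ?s ?s]) (auto simp: N_def ss)
  moreover have "(\<Sum>a\<in>N. sg v (?s a)) = (\<Sum>a\<in>N. - sg v a)"
  proof (rule sum.reindex_bij_witness[of _ "\<lambda>a. - ?s a" "\<lambda>a. - ?s a"])
    fix a assume a: "a \<in> N"
    then have aD: "a \<in> pos" "?s a \<in> \<Delta>" "?s a \<notin> pos" using rD by (auto simp: N_def)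
    show "- ?s (- ?s a) = a" by (simp add: rn ss)
    show "- ?s a \<in> N" using aD pos_neg[OF aD(2)] pos_neg[OF pos_sub[OF aD(1)]] by (simp add: N_def rn ss)
    show "- sg v (- ?s a) = sg v (?s a)" by (simp add: sg_neg[OF v aD(2)])
    show "- ?s (- ?s a) = a" "- ?s a \<in> N" by fact+
  qed
  ultimately have e2: "(\<Sum>a\<in>pos. sg v (?s a)) = - sN + sM" unfolding sN_def sum_negf by simp
  have "int (len \<alpha> (?s \<circ> v)) - int (len \<alpha> v) = (\<Sum>a\<in>N. sg v a)"
  proof -
    define A B where "A = int (len \<alpha> (?s \<circ> v))" and "B = int (len \<alpha> v)"
    have "2 * (A - B) = sN + sM - (- sN + sM)" using e0 unfolding e1 e2 A_def B_def .
    then have "A - B = sN" by simp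
    then show ?thesis unfolding A_def B_def sN_def .
  qed
  also have "N = insert b (split_at b)"
    using refl_neg_cases[OF b] b by (auto simp: N_def split_at_def)
  also have "b \<notin> split_at b" using split_at_inner[OF bD, of b] root_norm[OF bD] by auto
  then have "(\<Sum>a\<in>insert b (split_at b). sg v a) = sg v b + (\<Sum>a\<in>split_at b. sg v a)"
    by (simp add: finite_split_at)
  finally show ?thesis .
qed

text \<open>
  In \<open>2(\<rho>,b) = \<Sum>(a,b)\<close> the roots that \<open>s\<^sub>b\<close> keeps positive cancel, \<open>b\<close> contributes 2, and every other
  root contributes 1.
\<close>

lemma len_refl:
  assumes b: "b \<in> pos"
  shows "real (len \<alpha> (refl b)) = 2 * (\<rho> \<bullet> b) - 1"
proof -
  have bD: "b \<in> \<Delta>" using b pos_sub by blast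
  let ?s = "refl b"
  have "int (len \<alpha> (refl b \<circ> id)) - int (len \<alpha> id) = sg id b + (\<Sum>a\<in>split_at b. sg id a)"
    by (rule len_diff[OF id_in_W b])
  moreover have "sg id a = 1" if "a \<in> pos" for a using that by (simp add: sg_def)
  moreover have "len \<alpha> id = 0" using len_le[of "[]"] by simp
  ultimately have l: "len \<alpha> ?s = Suc (card (split_at b))" using b by (simp add: split_at_def)
  define N where "N = {a\<in>pos. ?s a \<notin> pos}"
  have "(\<Sum>a\<in>pos - N. a \<bullet> b) = (\<Sum>a\<in>pos - N. - (a \<bullet> b))"
  proof (rule sum.reindex_bij_witness[of _ ?s ?s])
    show "- (?s a \<bullet> b) = a \<bullet> b" for a using bD by (simp add: refl_root inner_diff_left root_norm)
  qed (auto simp: N_def refl_inv[OF bD])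
  then have z: "(\<Sum>a\<in>pos - N. a \<bullet> b) = 0" by (simp add: sum_negf)
  have N: "N = insert b (split_at b)" using refl_neg_cases[OF b] b by (auto simp: N_def split_at_def)
  have nb: "b \<notin> split_at b" using split_at_inner[OF bD, of b] root_norm[OF bD] by auto
  have "2 * (\<rho> \<bullet> b) = (\<Sum>a\<in>pos. a \<bullet> b)" by (simp add: half_sum_def inner_sum_left)
  also have "\<dots> = (\<Sum>a\<in>pos - N. a \<bullet> b) + (\<Sum>a\<in>N. a \<bullet> b)"
    by (rule sum.subset_diff) (auto simp: N_def finite_pos)
  also have "(\<Sum>a\<in>N. a \<bullet> b) = 2 + real (card (split_at b))"
    using nb by (simp add: N finite_split_at root_norm[OF bD] split_at_inner[OF bD])
  finally show ?thesis using z l by simp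
qed

text \<open>
  The images under \<open>v\<^sup>-\<^sup>1\<close> of \<open>a\<close> and \<open>b - a\<close> have the positive sum \<open>v\<^sup>-\<^sup>1b\<close>, so they are not both
  negative, and the contributions of \<open>a\<close> and \<open>b - a\<close> to the length difference have a nonnegative
  sum.
\<close>

lemma len_up:
  assumes v: "v \<in> W" and b: "b \<in> pos" and s: "inv v b \<in> pos"
  shows "len \<alpha> (refl b \<circ> v) > len \<alpha> v"
proof -
  have "(\<Sum>a\<in>split_at b. sg v (b - a)) = (\<Sum>a\<in>split_at b. sg v a)"
    by (rule sum.reindex_bij_witness[of _ "\<lambda>a. b - a" "\<lambda>a. b - a"]) (auto simp: split_at_def)
  then have "2 * (\<Sum>a\<in>split_at b. sg v a) = (\<Sum>a\<in>split_at b. sg v a + sg v (b - a))"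
    by (simp add: sum.distrib)
  also have "\<dots> \<ge> 0"
  proof (rule sum_nonneg)
    fix a assume a: "a \<in> split_at b"
    have D: "inv v a \<in> \<Delta>" "inv v (b - a) \<in> \<Delta>" using a inv_root[OF v] pos_sub by (auto simp: split_at_def)
    have "\<rho> \<bullet> inv v a + \<rho> \<bullet> inv v (b - a) = \<rho> \<bullet> inv v b"
      by (simp add: inv_lin[OF v] inner_diff_right)
    moreover have "\<rho> \<bullet> inv v b > 0" using s pos_iff pos_sub by blast
    ultimately have "inv v a \<in> pos \<or> inv v (b - a) \<in> pos"
      using pos_iff[OF D(1)] pos_iff[OF D(2)] by linarith
    then show "0 \<le> sg v a + sg v (b - a)" by (auto simp: sg_def)
  qed
  finally show ?thesis using len_diff[OF v b] s by (simp add: sg_def)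
qed

text \<open>
  The second bound comes from \<open>v = (s\<^sub>bv)s\<^sub>c\<close> with the positive root \<open>c = -v\<^sup>-\<^sup>1b\<close>, whose reflection
  has length \<open>2(\<rho>,c) - 1\<close>.
\<close>

lemma len_down:
  assumes v: "v \<in> W" and b: "b \<in> pos" and s: "inv v b \<notin> pos"
  shows "len \<alpha> (refl b \<circ> v) < len \<alpha> v"
    and "real (len \<alpha> v) \<le> real (len \<alpha> (refl b \<circ> v)) + (- 2 * (\<rho> \<bullet> inv v b) - 1)"
proof -
  have bD: "b \<in> \<Delta>" using b pos_sub by blast
  let ?v = "refl b \<circ> v"
  have vW: "?v \<in> W" using refl_comp_in[OF v bD] .
  have rb: "refl b b = - b" by (simp add: refl_root bD root_norm scaleR_2)
  have p: "- inv v b \<in> pos" using s pos_neg[OF inv_root[OF v bD]] by simp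
  have "inv ?v b \<in> pos" unfolding inv_refl_comp[OF v bD] rb inv_lin(1)[OF v] by (rule p)
  from len_up[OF vW b this] have "len \<alpha> (refl b \<circ> (refl b \<circ> v)) > len \<alpha> (refl b \<circ> v)" .
  moreover have "refl b \<circ> (refl b \<circ> v) = v" by (rule ext) (simp add: refl_inv[OF bD])
  ultimately show "len \<alpha> (refl b \<circ> v) < len \<alpha> v" by simp
  have e: "v = ?v \<circ> refl (- inv v b)"
  proof -
    have "refl b \<circ> v = v \<circ> refl (inv v b)"
      using W_refl_conj[OF v inv_root[OF v bD]] by (simp add: W_inverse(2)[OF v])
    then have "?v \<circ> refl (inv v b) = v \<circ> (refl (inv v b) \<circ> refl (inv v b))" by (simp only: comp_assoc)
    also have "\<dots> = v" unfolding refl_inv_comp[OF inv_root[OF v bD]] by simp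
    finally show ?thesis by (simp only: refl_neg)
  qed
  have "len \<alpha> v \<le> len \<alpha> ?v + len \<alpha> (refl (- inv v b))"
    using len_comp_le[OF vW refl_in_W[OF pos_sub[OF p]]] e by simp
  then show "real (len \<alpha> v) \<le> real (len \<alpha> (refl b \<circ> v)) + (- 2 * (\<rho> \<bullet> inv v b) - 1)"
    using len_refl[OF p] by simp
qed

lemma bruhat_less_len: "bruhat_less \<Delta> \<alpha> u u' \<Longrightarrow> len \<alpha> u < len \<alpha> u'"
  unfolding bruhat_less_def by (induction rule: tranclp_induct) auto

lemma left_right_refl:
  assumes v: "v \<in> W" and b: "b \<in> \<Delta>"
  shows "refl b \<circ> v = v \<circ> refl (inv v b)"
  using W_refl_conj[OF v inv_root[OF v b]] by (simp add: W_inverse(2)[OF v])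

text \<open>
  Edges of the quantum Bruhat graph are labelled by positive roots, and \<open>c\<close> and \<open>-c\<close> have the same
  reflection.
\<close>

definition absr :: "'a \<Rightarrow> 'a" where "absr c = (if c \<in> pos then c else - c)"

lemma absr: "c \<in> \<Delta> \<Longrightarrow> absr c \<in> pos" "refl (absr c) = refl c"
  using pos_neg[of c] by (auto simp: absr_def refl_neg)

lemma right_refl_inj:
  assumes v: "v \<in> W" and a: "a \<in> pos" and c: "c \<in> \<Delta>" and e: "v \<circ> refl a = v \<circ> refl c"
  shows "a = absr c"
proof -
  have D: "a \<in> \<Delta>" "absr c \<in> \<Delta>" using a absr(1)[OF c] pos_sub by auto
  have "refl a a = refl (absr c) a"
    using e absr(2) W_inverse(3)[OF v] by (metis comp_apply)
  then have "- a = a - (a \<bullet> absr c) *\<^sub>R absr c" using D by (simp add: refl_root root_norm scaleR_2)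
  then have "2 *\<^sub>R a = (a \<bullet> absr c) *\<^sub>R absr c" by (simp add: scaleR_2 algebra_simps)
  then have "2 * (a \<bullet> a) = (a \<bullet> absr c) * (absr c \<bullet> a)" by (metis inner_scaleR_left)
  then have "(a \<bullet> absr c)\<^sup>2 = 4" using D root_norm by (simp add: power2_eq_square inner_commute)
  then show ?thesis
    using a absr(1)[OF c] pos_neg[OF D(1)]
    by (cases rule: inner_root_cases[OF D]) (auto simp: power2_eq_square)
qed

lemma qbg_edge_iff:
  assumes v: "v \<in> W" and b: "b \<in> \<Delta>"
  shows "qbg_edge \<Delta> \<alpha> v (refl b \<circ> v) \<longleftrightarrow>
    len \<alpha> (refl b \<circ> v) = len \<alpha> v + 1 \<or> real (len \<alpha> (refl b \<circ> v)) = real (len \<alpha> v) - 2 * (\<rho> \<bullet> absr (inv v b)) + 1"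
proof -
  let ?c = "inv v b"
  have c: "?c \<in> \<Delta>" by (rule inv_root[OF v b])
  have e: "refl b \<circ> v = v \<circ> refl ?c" by (rule left_right_refl[OF v b])
  have "(\<exists>a\<in>pos. refl b \<circ> v = v \<circ> refl a \<and> Q a) \<longleftrightarrow> Q (absr ?c)" for Q
  proof
    assume "\<exists>a\<in>pos. refl b \<circ> v = v \<circ> refl a \<and> Q a"
    then obtain a where a: "a \<in> pos" "refl b \<circ> v = v \<circ> refl a" "Q a" by blast
    have "a = absr ?c" by (rule right_refl_inj[OF v a(1) c]) (use a(2) e in \<open>rule trans[OF sym]\<close>)
    then show "Q (absr ?c)" using a by simp
  next
    assume "Q (absr ?c)"
    moreover have "refl b \<circ> v = v \<circ> refl (absr ?c)" unfolding absr(2) by (rule e)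
    ultimately show "\<exists>a\<in>pos. refl b \<circ> v = v \<circ> refl a \<and> Q a" using absr(1)[OF c] by blast
  qed
  note ex = this
  show ?thesis unfolding qbg_edge_def ex using v by simp
qed

lemma bruhat_left_refl:
  assumes v: "v \<in> W" and b: "b \<in> \<Delta>"
  shows "len \<alpha> v < len \<alpha> (refl b \<circ> v) \<Longrightarrow> bruhat_less \<Delta> \<alpha> v (refl b \<circ> v)"
    and "len \<alpha> (refl b \<circ> v) < len \<alpha> v \<Longrightarrow> bruhat_less \<Delta> \<alpha> (refl b \<circ> v) v"
proof -
  have up: "bruhat_less \<Delta> \<alpha> v (refl b \<circ> v)" if "v \<in> W" "len \<alpha> v < len \<alpha> (refl b \<circ> v)" for v
  proof -
    have "refl b \<circ> v = v \<circ> refl (absr (inv v b))" unfolding absr(2) by (rule left_right_refl[OF that(1) b])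
    then show ?thesis unfolding bruhat_less_def
      using that absr(1)[OF inv_root[OF that(1) b]] by (intro tranclp.r_into_trancl) blast
  qed
  show "len \<alpha> v < len \<alpha> (refl b \<circ> v) \<Longrightarrow> bruhat_less \<Delta> \<alpha> v (refl b \<circ> v)" using up v by blast
  have e: "refl b \<circ> (refl b \<circ> v) = v" by (rule ext) (simp add: refl_inv[OF b])
  show "len \<alpha> (refl b \<circ> v) < len \<alpha> v \<Longrightarrow> bruhat_less \<Delta> \<alpha> (refl b \<circ> v) v"
    using up[OF refl_comp_in[OF v b]] unfolding e .
qed

text \<open>
  The first summand on the right is the power of \<open>v\<close> that makes the off-diagonal coefficient of
  a step converge. The excess \<open>d\<close> is nonnegative by the two bounds on lengths, and they are
  attained on the two kinds of edges.
\<close>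

lemma move_exponent:
  assumes v: "v \<in> W" and b: "b \<in> pos"
  obtains d :: nat where
    "int (len \<alpha> (refl b \<circ> v)) - int (len \<alpha> v) = (if hgt (inv v b) > 0 then 1 else 1 + 2 * hgt (inv v b)) + int d"
    "d = 0 \<longleftrightarrow> qbg_edge \<Delta> \<alpha> v (refl b \<circ> v)"
    "bruhat_less \<Delta> \<alpha> (refl b \<circ> v) v \<longleftrightarrow> \<not> hgt (inv v b) > 0"
    "bruhat_less \<Delta> \<alpha> v (refl b \<circ> v) \<longleftrightarrow> hgt (inv v b) > 0"
proof -
  have bD: "b \<in> \<Delta>" using b pos_sub by blast
  let ?c = "inv v b" and ?v = "refl b \<circ> v"
  have cD: "?c \<in> \<Delta>" by (rule inv_root[OF v bD])
  have hc: "\<rho> \<bullet> ?c = of_int (hgt ?c)" by (rule hgt[OF cD])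
  note edge = qbg_edge_iff[OF v bD]
  show thesis
  proof (cases "?c \<in> pos")
    case True
    then have h: "hgt ?c > 0" using hgt_pos[OF cD] by simp
    have up: "len \<alpha> ?v > len \<alpha> v" by (rule len_up[OF v b True])
    have "real (len \<alpha> ?v) \<noteq> real (len \<alpha> v) - 2 * (\<rho> \<bullet> absr ?c) + 1"
      using up True pos_height[OF True] by (simp add: absr_def)
    then have ed: "qbg_edge \<Delta> \<alpha> v ?v \<longleftrightarrow> len \<alpha> ?v = len \<alpha> v + 1" using edge by simp
    show thesis
    proof (rule that[of "nat (int (len \<alpha> ?v) - int (len \<alpha> v) - 1)"])
      show "bruhat_less \<Delta> \<alpha> ?v v \<longleftrightarrow> \<not> hgt ?c > 0" using bruhat_less_len[of ?v v] up h by auto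
      show "bruhat_less \<Delta> \<alpha> v ?v \<longleftrightarrow> hgt ?c > 0" using bruhat_left_refl(1)[OF v bD up] h by simp
      show "nat (int (len \<alpha> ?v) - int (len \<alpha> v) - 1) = 0 \<longleftrightarrow> qbg_edge \<Delta> \<alpha> v ?v" unfolding ed using up by auto
      show "int (len \<alpha> ?v) - int (len \<alpha> v) = (if hgt ?c > 0 then 1 else 1 + 2 * hgt ?c) + int (nat (int (len \<alpha> ?v) - int (len \<alpha> v) - 1))"
        using up h by simp
    qed
  next
    case False
    then have h: "hgt ?c < 0" using hgt_pos[OF cD] hgt_neq_0[OF cD] by linarith
    have dn: "len \<alpha> ?v < len \<alpha> v" and le: "real (len \<alpha> v) \<le> real (len \<alpha> ?v) + (- 2 * (\<rho> \<bullet> ?c) - 1)"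
      by (rule len_down[OF v b False])+
    have le': "int (len \<alpha> v) \<le> int (len \<alpha> ?v) + (- 2 * hgt ?c - 1)"
      using le unfolding hc by linarith
    have "real (len \<alpha> ?v) = real (len \<alpha> v) - 2 * (\<rho> \<bullet> absr ?c) + 1 \<longleftrightarrow> int (len \<alpha> ?v) = int (len \<alpha> v) + 2 * hgt ?c + 1"
      using False hc by (simp add: absr_def) linarith
    then have ed: "qbg_edge \<Delta> \<alpha> v ?v \<longleftrightarrow> int (len \<alpha> ?v) = int (len \<alpha> v) + 2 * hgt ?c + 1" using edge dn by simp
    show thesis
    proof (rule that[of "nat (int (len \<alpha> ?v) - int (len \<alpha> v) - 1 - 2 * hgt ?c)"])
      show "bruhat_less \<Delta> \<alpha> v ?v \<longleftrightarrow> hgt ?c > 0" using bruhat_less_len[of v ?v] dn h by auto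
      show "bruhat_less \<Delta> \<alpha> ?v v \<longleftrightarrow> \<not> hgt ?c > 0" using bruhat_left_refl(2)[OF v bD dn] h by simp
      show "nat (int (len \<alpha> ?v) - int (len \<alpha> v) - 1 - 2 * hgt ?c) = 0 \<longleftrightarrow> qbg_edge \<Delta> \<alpha> v ?v" unfolding ed using le' by auto
      show "int (len \<alpha> ?v) - int (len \<alpha> v) = (if hgt ?c > 0 then 1 else 1 + 2 * hgt ?c) +
          int (nat (int (len \<alpha> ?v) - int (len \<alpha> v) - 1 - 2 * hgt ?c))"
        using le' h by simp
    qed
  qed
qed

text \<open>
  Of every pair of positive roots with sum \<open>b\<close> the set contains the one that lies on the level
  of \<open>b\<close>, and all its other elements are orthogonal to \<open>b\<close>.
\<close>

definition step_set :: "'a \<Rightarrow> 'a set \<Rightarrow> 'a \<Rightarrow> bool" where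
  "step_set lam S b \<longleftrightarrow> finite S \<and> S \<subseteq> \<Delta> \<and> b \<in> pos \<and> (\<forall>c\<in>S. c \<bullet> b = 0 \<or> c \<bullet> b = 1) \<and>
     {c\<in>S. c \<bullet> b = 1} = {a\<in>split_at b. lam \<bullet> a = lam \<bullet> b}"

text \<open>
  The reflection in \<open>b\<close> fixes the elements of \<open>S\<close> that are orthogonal to \<open>b\<close> and maps the other
  elements \<open>a\<close> to \<open>-(b - a)\<close>. So the sum changes by the signs of all pairs \<open>a, b - a\<close>, and with the
  sign of \<open>b\<close> these make up the length difference.
\<close>

lemma step_set_sign:
  assumes lam: "\<And>a. a \<in> \<Delta> \<Longrightarrow> lam \<bullet> a \<in> {0,1,-1}" and nz: "lam \<bullet> b \<noteq> 0"
    and S: "step_set lam S b" and v: "v \<in> W"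
  shows "(\<Sum>c\<in>S. sg v c) - (\<Sum>c\<in>S. sg (refl b \<circ> v) c) = int (len \<alpha> (refl b \<circ> v)) - int (len \<alpha> v) - sg v b"
proof -
  have b: "b \<in> pos" "b \<in> \<Delta>" and fS: "finite S" and SD: "S \<subseteq> \<Delta>" and in01: "\<And>c. c \<in> S \<Longrightarrow> c \<bullet> b = 0 \<or> c \<bullet> b = 1"
    and S1: "{c\<in>S. c \<bullet> b = 1} = {a\<in>split_at b. lam \<bullet> a = lam \<bullet> b}"
    using S pos_sub by (auto simp: step_set_def)
  define D where "D = {a\<in>split_at b. lam \<bullet> a = lam \<bullet> b}"
  have fD: "finite D" by (simp add: D_def finite_split_at)
  have split: "split_at b = D \<union> (\<lambda>a. b - a) ` D" "D \<inter> (\<lambda>a. b - a) ` D = {}"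
  proof -
    have lv: "lam \<bullet> a = lam \<bullet> b \<and> lam \<bullet> (b - a) = 0 \<or> lam \<bullet> a = 0 \<and> lam \<bullet> (b - a) = lam \<bullet> b" if "a \<in> split_at b" for a
      using that lam[of a] lam[of "b - a"] lam[of b] b nz pos_sub by (auto simp: split_at_def inner_diff_right)
    have sw: "b - a \<in> split_at b" if "a \<in> split_at b" for a using that by (simp add: split_at_def)
    show "split_at b = D \<union> (\<lambda>a. b - a) ` D"
    proof (intro subset_antisym subsetI)
      fix a assume a: "a \<in> split_at b"
      show "a \<in> D \<union> (\<lambda>a. b - a) ` D"
      proof (cases "lam \<bullet> a = lam \<bullet> b")
        case False
        then have "b - a \<in> D" using lv[OF a] sw[OF a] by (simp add: D_def)
        then show ?thesis by (intro UnI2 image_eqI[of _ _ "b - a"]) simp_all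
      qed (simp add: D_def a)
    qed (use sw in \<open>auto simp: D_def\<close>)
    show "D \<inter> (\<lambda>a. b - a) ` D = {}" using nz by (auto simp: D_def inner_diff_right)
  qed
  have "(\<Sum>a\<in>split_at b. sg v a) = (\<Sum>a\<in>D. sg v a) + (\<Sum>a\<in>(\<lambda>a. b - a) ` D. sg v a)"
    unfolding split(1) by (rule sum.union_disjoint) (use fD split(2) in auto)
  also have "(\<Sum>a\<in>(\<lambda>a. b - a) ` D. sg v a) = (\<Sum>a\<in>D. sg v (b - a))"
    by (subst sum.reindex) (auto simp: inj_on_def)
  finally have 1: "(\<Sum>a\<in>split_at b. sg v a) = (\<Sum>a\<in>D. sg v a + sg v (b - a))" by (simp add: sum.distrib)
  have "(\<Sum>c\<in>S. sg v c) - (\<Sum>c\<in>S. sg (refl b \<circ> v) c) = (\<Sum>c\<in>S. sg v c - sg v (refl b c))"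
    unfolding sg_refl[OF v b(2)] by (simp add: sum_subtractf)
  also have "\<dots> = (\<Sum>c\<in>{c\<in>S. c \<bullet> b = 1}. sg v c - sg v (refl b c))"
  proof (rule sum.mono_neutral_right)
    show "\<forall>c\<in>S - {c\<in>S. c \<bullet> b = 1}. sg v c - sg v (refl b c) = 0"
    proof
      fix c assume c: "c \<in> S - {c\<in>S. c \<bullet> b = 1}"
      then have "c \<bullet> b = 0" using in01[of c] by auto
      then show "sg v c - sg v (refl b c) = 0" by (simp add: refl_root[OF b(2)])
    qed
  qed (use fS in auto)
  also have "{c\<in>S. c \<bullet> b = 1} = D" using S1 by (simp add: D_def)
  also have "(\<Sum>c\<in>D. sg v c - sg v (refl b c)) = (\<Sum>a\<in>D. sg v a + sg v (b - a))"
  proof (rule sum.cong[OF HOL.refl])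
    fix a assume "a \<in> D"
    then have a: "a \<in> split_at b" by (simp add: D_def)
    then have "refl b a = - (b - a)" using split_at_inner[OF b(2) a] by (simp add: refl_root[OF b(2)])
    moreover have "b - a \<in> \<Delta>" using a pos_sub by (auto simp: split_at_def)
    ultimately show "sg v a - sg v (refl b a) = sg v a + sg v (b - a)" using sg_neg[OF v, of "b - a"] by simp
  qed
  finally have f: "(\<Sum>c\<in>S. sg v c) - (\<Sum>c\<in>S. sg (refl b \<circ> v) c) = (\<Sum>a\<in>D. sg v a + sg v (b - a))" .
  show ?thesis unfolding f using len_diff[OF v b(1)] unfolding 1 by linarith
qed

section \<open>The root sequence of a minuscule weight\<close>

text \<open>The finite counterpart of \<open>walls\<close>.\<close>

fun fwalls :: "('a \<Rightarrow> 'a) \<Rightarrow> 'i list \<Rightarrow> 'a list" where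
  "fwalls u [] = []"
| "fwalls u (j # js) = u (\<alpha> j) # fwalls (u \<circ> refl (\<alpha> j)) js"

lemma length_fwalls [simp]: "length (fwalls u js) = length js"
  by (induction js arbitrary: u) auto

lemma fwalls_nth: "k < length js \<Longrightarrow> fwalls u js ! k = u (word_prod \<alpha> (take k js) (\<alpha> (js ! k)))"
proof (induction js arbitrary: u k)
  case (Cons j js)
  then show ?case by (cases k) simp_all
qed simp

lemma walls_fwalls: "u \<in> W \<Longrightarrow> walls (0, u) (map Some js) = map (\<lambda>a. (a, 0)) (fwalls u js)"
proof (induction js arbitrary: u)
  case (Cons j js)
  have s: "asr (Some j) = (0, refl (\<alpha> j))" by (simp add: aff_refl_def aff_simple_def)
  have m: "wex_mult (0, u) (asr (Some j)) = (0, u \<circ> refl (\<alpha> j))" unfolding s by (simp add: wex_mult_def W_lin[OF Cons.prems])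
  have a: "wex_act (0, u) (asim (Some j)) = (u (\<alpha> j), 0)" by (simp add: wex_act_def aff_simple_def)
  have "u \<circ> refl (\<alpha> j) \<in> W" by (rule W_comp[OF Cons.prems simple_refl_in_W])
  from Cons.IH[OF this] show ?case by (simp only: list.map walls.simps fwalls.simps m a)
qed simp

lemma aword_Some: "aword (map Some js) = (0, word_prod \<alpha> js)"
proof (induction js)
  case Nil
  show ?case unfolding list.map aword_Nil word_prod_Nil wex_one_def by (rule HOL.refl)
next
  case (Cons j js)
  have s: "asr (Some j) = (0, refl (\<alpha> j))" by (simp add: aff_refl_def aff_simple_def)
  have z: "refl (\<alpha> j) 0 = 0" by (simp add: refl_root[OF simple_root])
  show ?case
    unfolding list.map aword_Cons Cons s wex_mult_def fst_conv snd_conv z word_prod_Cons add_0_right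
    by (rule HOL.refl)
qed

lemma ainvs_fin: "u \<in> W \<Longrightarrow> ainvs (0, u) = (\<lambda>a. (a, 0)) ` invs u"
proof (intro subset_antisym subsetI)
  assume u: "u \<in> W"
  have act: "- wex_act (0, u) (a, c) = (- u a, - c)" for a c by (simp add: wex_act_def)
  have mem: "(a, real_of_int c) \<in> apos \<longleftrightarrow> a \<in> \<Delta> \<and> (c > 0 \<or> c = 0 \<and> a \<in> pos)" for a c
    unfolding aff_pos_roots_def by auto
  fix b :: "'a \<times> real"
  {
    assume b: "b \<in> ainvs (0, u)"
    then have "b \<in> apos" by (simp add: ainvs_def)
    then obtain a c where ac: "b = (a, real_of_int c)" unfolding aff_pos_roots_def by blast
    have 1: "a \<in> \<Delta> \<and> (c > 0 \<or> c = 0 \<and> a \<in> pos)" using b mem by (simp add: ac ainvs_def)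
    have "- wex_act (0, u) b = (- u a, real_of_int (- c))" unfolding ac act by simp
    then have "(- u a, real_of_int (- c)) \<in> apos" using b by (simp add: ainvs_def)
    then have "- c > 0 \<or> - c = 0 \<and> - u a \<in> pos" using mem by blast
    then have "c = 0" "a \<in> pos" "u a \<notin> pos" using 1 pos_neg[OF W_root[OF u]] by auto
    then show "b \<in> (\<lambda>a. (a, 0)) ` invs u" by (auto simp: ac invs_def)
  }
  assume "b \<in> (\<lambda>a. (a, 0)) ` invs u"
  then obtain a where a: "b = (a, real_of_int 0)" "a \<in> pos" "u a \<notin> pos" by (auto simp: invs_def)
  have "- u a \<in> pos" using a pos_neg[OF W_root[OF u pos_sub]] by simp
  then have "(- u a, real_of_int 0) \<in> apos" using mem pos_sub by blast
  moreover have "- wex_act (0, u) b = (- u a, real_of_int 0)" unfolding a act by simp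
  ultimately show "b \<in> ainvs (0, u)" using a mem[of a 0] pos_sub[OF a(2)] by (simp add: ainvs_def)
qed

text \<open>
  The word is also a reduced affine word, whose walls are the inversions of the inverse
  element and lie on a single level of \<open>\<lambda>\<close>, so \<open>walls_ascending\<close> applies.
\<close>

lemma fwalls_reduced:
  assumes red: "len \<alpha> (word_prod \<alpha> js) = length js"
    and lam: "\<And>a. a \<in> \<Delta> \<Longrightarrow> lam \<bullet> a \<in> {0,1,-1}" and \<kappa>: "\<kappa> = 1 \<or> \<kappa> = -1"
    and iv: "invs (inv (word_prod \<alpha> js)) = {a\<in>pos. lam \<bullet> a = \<kappa>}"
  shows "distinct (fwalls id js)" "set (fwalls id js) = {a\<in>pos. lam \<bullet> a = \<kappa>}"
    "sorted_wrt (\<lambda>a b. a \<bullet> b = 0 \<or> (a \<bullet> b = 1 \<and> \<rho> \<bullet> a < \<rho> \<bullet> b)) (fwalls id js)"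
proof -
  let ?u = "word_prod \<alpha> js" and ?js = "map Some js"
  have one: "wex_one \<in> wex_Pi \<Delta> \<alpha>"
  proof -
    have "ainvs wex_one = {}" unfolding wex_one_def ainvs_fin[OF id_in_W] by (simp add: invs_def)
    then show ?thesis by (simp add: wex_Pi_def wex_len_ainvs)
  qed
  have w1: "walls wex_one ?js = map (\<lambda>a. (a, 0)) (fwalls id js)"
    unfolding wex_one_def by (rule walls_fwalls[OF id_in_W])
  have "wex_len \<Delta> \<alpha> (0, ?u) = length js"
    using red len_invs[OF word_in_W[of js]] by (simp add: wex_len_ainvs ainvs_fin[OF word_in_W] card_image inj_on_def)
  then have r: "wex_reduced_expr \<Delta> \<alpha> (0, ?u) wex_one ?js"
    using one by (simp add: wex_reduced_expr_def aword_Some)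
  have wi: "winv (0, ?u) = (0, inv ?u)" using W_lin(5)[OF W_inverse(1)[OF word_in_W]] by (simp add: winv_def)
  note rw = reduced_walls[OF r]
  have st: "set (walls wex_one ?js) = (\<lambda>a. (a, 0)) ` {a\<in>pos. lam \<bullet> a = \<kappa>}"
    unfolding rw(2) wi ainvs_fin[OF W_inverse(1)[OF word_in_W]] iv by (rule HOL.refl)
  show d: "distinct (fwalls id js)" using rw(1) unfolding w1 by (simp add: distinct_map)
  show "set (fwalls id js) = {a\<in>pos. lam \<bullet> a = \<kappa>}"
    using st unfolding w1 set_map by (simp add: inj_image_eq_iff inj_on_def)
  have sub: "set (walls wex_one ?js) \<subseteq> apos" unfolding rw(2) by (auto simp: ainvs_def)
  have "ascending (walls wex_one ?js)"
  proof (rule walls_ascending[OF one sub rw(1) lam _ \<kappa>])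
    have ex: "snd b = 0 \<and> lam \<bullet> fst b = \<kappa>" if b: "b \<in> set (walls wex_one ?js)" for b
    proof -
      obtain a where "b = (a, 0)" "lam \<bullet> a = \<kappa>" using b unfolding st by blast
      then show ?thesis by simp
    qed
    show "lam \<bullet> fst b = \<kappa>" if "b \<in> set (walls wex_one ?js)" for b
      by (rule conjunct2[OF ex[OF that]])
    show "b = c" if "b \<in> set (walls wex_one ?js)" "c \<in> set (walls wex_one ?js)" "fst b = fst c" for b c
      by (rule prod_eqI[OF that(3)]) (simp only: conjunct1[OF ex[OF that(1)]] conjunct1[OF ex[OF that(2)]])
  qed
  then show "sorted_wrt (\<lambda>a b. a \<bullet> b = 0 \<or> (a \<bullet> b = 1 \<and> \<rho> \<bullet> a < \<rho> \<bullet> b)) (fwalls id js)"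
    unfolding w1 ascending_def sorted_wrt_map by (simp add: aht_def)
qed

lemma root_beta_fwalls: "map (root_beta \<alpha> l j) (rev [1..<l+1]) = fwalls id (map j (rev [1..<l+1]))"
proof (rule nth_equalityI)
  fix k assume "k < length (map (root_beta \<alpha> l j) (rev [1..<l+1]))"
  then have k: "k < l" by (simp del: upt_Suc)
  have n: "rev [1..<l+1] ! k = l - k" using k by (simp add: rev_nth del: upt_Suc)
  have t: "take k (rev [1..<l+1]) = rev [l - k + 1..<l+1]"
      using k by (simp add: take_rev drop_upt Suc_diff_le add.commute del: upt_Suc)
  have len: "k < length (rev [1..<l+1])" using k by (simp del: upt_Suc)
  have "map (root_beta \<alpha> l j) (rev [1..<l+1]) ! k = word_prod \<alpha> (map j (rev [l - k + 1..<l+1])) (\<alpha> (j (l - k)))"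
    unfolding nth_map[OF len] n root_beta_def by (rule HOL.refl)
  also have "\<dots> = fwalls id (map j (rev [1..<l+1])) ! k"
  proof -
    have "k < length (map j (rev [1..<l+1]))" using len by (simp only: length_map)
    note fwalls_nth[OF this, of id]
    then show ?thesis unfolding take_map t nth_map[OF len] n id_apply by (rule HOL.sym)
  qed
  finally show "map (root_beta \<alpha> l j) (rev [1..<l+1]) ! k = fwalls id (map j (rev [1..<l+1])) ! k" .
qed (simp del: upt_Suc)

lemma root_gamma_beta: "root_gamma \<alpha> m i s = root_beta \<alpha> m i s"
  by (simp add: root_gamma_def root_beta_def)

lemma root_gamma_fwalls: "map (root_gamma \<alpha> m i) [1..<m+1] = rev (fwalls id (map i (rev [1..<m+1])))"
  unfolding root_beta_fwalls[symmetric] root_gamma_beta by (simp add: rev_map del: upt_Suc)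

text \<open>
  If \<open>b\<close> is the sum of two positive roots, then one of them lies on the level of \<open>b\<close> and the other
  on level 0. The former is an element of the list with inner product 1 with \<open>b\<close> and of smaller
  height, so it comes before \<open>b\<close>.
\<close>

lemma sorted_step_set:
  assumes lam: "\<And>a. a \<in> \<Delta> \<Longrightarrow> lam \<bullet> a \<in> {0,1,-1}"
    and L: "distinct L" "set L = {a\<in>pos. lam \<bullet> a = \<kappa>}"
      "sorted_wrt (\<lambda>a b. a \<bullet> b = 0 \<or> (a \<bullet> b = 1 \<and> \<rho> \<bullet> a < \<rho> \<bullet> b)) L"
    and split: "L = pre @ b # post"
  shows "step_set lam (set pre) b"
proof -
  have b: "b \<in> pos" "lam \<bullet> b = \<kappa>" using L split by auto
  have bD: "b \<in> \<Delta>" using b pos_sub by blast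
  have pre: "a \<in> pos" "lam \<bullet> a = \<kappa>" "a \<bullet> b = 0 \<or> (a \<bullet> b = 1 \<and> \<rho> \<bullet> a < \<rho> \<bullet> b)" if "a \<in> set pre" for a
  proof -
    have "a \<in> set L" using that split by simp
    then show "a \<in> pos" "lam \<bullet> a = \<kappa>" using L(2) by auto
    show "a \<bullet> b = 0 \<or> (a \<bullet> b = 1 \<and> \<rho> \<bullet> a < \<rho> \<bullet> b)" using L(3) that unfolding split sorted_wrt_append by auto
  qed
  have "{c\<in>set pre. c \<bullet> b = 1} = {a\<in>split_at b. lam \<bullet> a = lam \<bullet> b}"
  proof (intro subset_antisym subsetI)
    fix a assume "a \<in> {c\<in>set pre. c \<bullet> b = 1}"
    then have a: "a \<in> set pre" "a \<bullet> b = 1" by auto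
    then have h: "\<rho> \<bullet> a < \<rho> \<bullet> b" and ap: "a \<in> pos" and la: "lam \<bullet> a = \<kappa>" using pre[OF a(1)] by auto
    have "b - a \<in> \<Delta>" using diff_root[OF bD pos_sub[OF ap]] a by (simp add: inner_commute)
    then have "b - a \<in> pos" using pos_iff h by (simp add: inner_diff_right)
    then show "a \<in> {a\<in>split_at b. lam \<bullet> a = lam \<bullet> b}" using ap la b by (simp add: split_at_def)
  next
    fix a assume "a \<in> {a\<in>split_at b. lam \<bullet> a = lam \<bullet> b}"
    then have a: "a \<in> pos" "b - a \<in> pos" "lam \<bullet> a = \<kappa>" and sa: "a \<in> split_at b" using b by (auto simp: split_at_def)
    have i: "a \<bullet> b = 1" by (rule split_at_inner[OF bD sa])
    have "\<rho> \<bullet> a < \<rho> \<bullet> b" using a(2) pos_iff[OF pos_sub[OF a(2)]] by (simp add: inner_diff_right)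
    have "a \<in> set L" using a L(2) by simp
    moreover have "a \<noteq> b" using i root_norm[OF bD] by auto
    moreover have "a \<notin> set post"
    proof
      assume "a \<in> set post"
      then have "b \<bullet> a = 0 \<or> (b \<bullet> a = 1 \<and> \<rho> \<bullet> b < \<rho> \<bullet> a)" using L(3) unfolding split sorted_wrt_append by auto
      then show False using i \<open>\<rho> \<bullet> a < \<rho> \<bullet> b\<close> by (auto simp: inner_commute)
    qed
    ultimately show "a \<in> {c\<in>set pre. c \<bullet> b = 1}" using split i by simp
  qed
  then show ?thesis unfolding step_set_def using b pre pos_sub by blast
qed

subsection \<open>Minimal representatives\<close>

lemma pos_if_nonneg:
  assumes u: "u \<in> W" and b: "b \<in> pos" and c: "\<And>i. \<omega> i \<bullet> b = 0 \<or> u (\<alpha> i) \<in> pos"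
  shows "u b \<in> pos"
proof -
  have bD: "b \<in> \<Delta>" using b pos_sub by blast
  have uD: "u b \<in> \<Delta>" by (rule W_root[OF u bD])
  have lin: "linear u" by (rule W_linear[OF u])
  have "u b = u (\<Sum>i\<in>UNIV. (\<omega> i \<bullet> b) *\<^sub>R \<alpha> i)" by (simp flip: simple_expand)
  then have "\<rho> \<bullet> u b = (\<Sum>i\<in>UNIV. (\<omega> i \<bullet> b) * (\<rho> \<bullet> u (\<alpha> i)))"
    by (simp add: linear_sum[OF lin] linear_cmul[OF lin] inner_sum_right)
  also have "\<dots> \<ge> 0"
  proof (rule sum_nonneg)
    fix i
    have "\<omega> i \<bullet> b \<in> \<nat>" using pos_in_nonneg_span[OF b] nonneg_span_iff by blast
    then have "\<omega> i \<bullet> b \<ge> 0" by (auto elim: Nats_cases)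
    moreover have "\<rho> \<bullet> u (\<alpha> i) > 0" if "u (\<alpha> i) \<in> pos" using that pos_iff pos_sub by blast
    ultimately show "0 \<le> (\<omega> i \<bullet> b) * (\<rho> \<bullet> u (\<alpha> i))" using c[of i] by (auto intro: mult_nonneg_nonneg less_imp_le)
  qed
  finally show ?thesis using pos_iff[OF uD] rho_neq_0[OF uD] by linarith
qed

lemma pos_if_level: "b \<in> \<Delta> \<Longrightarrow> \<omega> k \<bullet> b > 0 \<Longrightarrow> b \<in> pos"
proof (rule ccontr)
  assume b: "b \<in> \<Delta>" "\<omega> k \<bullet> b > 0" "b \<notin> pos"
  then have "- b \<in> pos" using pos_neg by blast
  then have "\<omega> k \<bullet> (- b) \<in> \<nat>" using pos_in_nonneg_span nonneg_span_iff by blast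
  then have "\<omega> k \<bullet> (- b) \<ge> 0" by (auto elim!: Nats_cases)
  then show False using b by simp
qed

text \<open>
  Positive roots orthogonal to \<open>\<varpi>\<^sub>k\<close> are combinations of the other simple roots with nonnegative
  coefficients.
\<close>

lemma level_sign:
  assumes u: "u \<in> W" and J: "\<And>i. i \<noteq> k \<Longrightarrow> u (\<alpha> i) \<in> pos" and b: "b \<in> \<Delta>" "\<omega> k \<bullet> b = 0"
  shows "u b \<in> pos \<longleftrightarrow> b \<in> pos"
proof -
  have 1: "u c \<in> pos" if "c \<in> pos" "\<omega> k \<bullet> c = 0" for c
    by (rule pos_if_nonneg[OF u that(1)]) (use that(2) J in metis)
  show ?thesis
  proof (cases "b \<in> pos")
    case False
    then have "- b \<in> pos" using pos_neg[OF b(1)] by simp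
    then have "- u b \<in> pos" using 1[of "- b"] b by (simp add: W_lin[OF u])
    then show ?thesis using False pos_neg[OF W_root[OF u b(1)]] by simp
  qed (use 1 b in simp)
qed

lemma parabolic_W: "p \<in> parabolic \<alpha> J \<Longrightarrow> p \<in> W"
  by (auto simp: parabolic_def weyl_def)

lemma parabolic_fix: "p \<in> parabolic \<alpha> (UNIV - {k}) \<Longrightarrow> p (\<omega> k) = \<omega> k"
proof -
  have "word_prod \<alpha> js (\<omega> k) = \<omega> k" if "set js \<subseteq> UNIV - {k}" for js
    using that
  proof (induction js)
    case (Cons j js)
    then have "\<omega> k \<bullet> \<alpha> j = 0" by (simp add: fund_weight_inner)
    then have "refl (\<alpha> j) (\<omega> k) = \<omega> k" by (simp add: refl_root[OF simple_root])
    then show ?case using Cons by simp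
  qed simp
  then show "p \<in> parabolic \<alpha> (UNIV - {k}) \<Longrightarrow> ?thesis" by (auto simp: parabolic_def)
qed

lemma min_reps_pos:
  assumes "u \<in> min_reps \<alpha> J" "i \<in> J"
  shows "u (\<alpha> i) \<in> pos"
proof (rule ccontr)
  assume n: "u (\<alpha> i) \<notin> pos"
  have u: "u \<in> W" using assms by (simp add: min_reps_def)
  have "refl (\<alpha> i) \<in> parabolic \<alpha> J" unfolding parabolic_def
    by (rule image_eqI[of _ _ "[i]"]) (use assms in auto)
  then have "len \<alpha> u \<le> len \<alpha> (u \<circ> refl (\<alpha> i))" using assms by (simp add: min_reps_def)
  then show False
    using card_invs_simple_neg[OF u n] len_invs[OF u] len_invs[OF W_comp[OF u simple_refl_in_W[of i]]] by simp
qed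

lemma parabolic_comp: "p \<in> parabolic \<alpha> J \<Longrightarrow> q \<in> parabolic \<alpha> J \<Longrightarrow> p \<circ> q \<in> parabolic \<alpha> J"
proof -
  assume "p \<in> parabolic \<alpha> J" "q \<in> parabolic \<alpha> J"
  then obtain js ks where "js \<in> lists J" "ks \<in> lists J" "p = word_prod \<alpha> js" "q = word_prod \<alpha> ks" by (auto simp: parabolic_def)
  then have "p \<circ> q = word_prod \<alpha> (js @ ks)" "js @ ks \<in> lists J" by (auto simp: word_prod_append)
  then show ?thesis unfolding parabolic_def by blast
qed

text \<open>
  A representative of minimal length exists in every coset. For uniqueness let \<open>aw = b\<close> with
  minimal \<open>a\<close> and \<open>b\<close> and with \<open>w\<close> in the parabolic subgroup. If \<open>w\<close> is not the identity, it makes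
  some \<open>\<alpha>\<^sub>i\<close> of this subgroup negative, and then \<open>b\<alpha>\<^sub>i = a(w\<alpha>\<^sub>i)\<close> is negative too, although \<open>b\<close> keeps
  these simple roots positive.
\<close>

lemma min_rep_props:
  assumes u: "u \<in> W"
  shows "min_rep \<alpha> (UNIV - {k}) u \<in> min_reps \<alpha> (UNIV - {k})"
    "\<exists>p\<in>parabolic \<alpha> (UNIV - {k}). min_rep \<alpha> (UNIV - {k}) u = u \<circ> p"
proof -
  let ?J = "UNIV - {k}"
  have idp: "id \<in> parabolic \<alpha> ?J" unfolding parabolic_def by (rule image_eqI[of _ _ "[]"]) auto
  define Q where "Q n \<longleftrightarrow> (\<exists>p\<in>parabolic \<alpha> ?J. len \<alpha> (u \<circ> p) = n)" for n
  have "Q (len \<alpha> u)" unfolding Q_def by (rule bexI[OF _ idp]) simp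
  then have "Q (LEAST n. Q n)" by (rule LeastI)
  then obtain p where p: "p \<in> parabolic \<alpha> ?J" "len \<alpha> (u \<circ> p) = (LEAST n. Q n)" unfolding Q_def by blast
  have "len \<alpha> (u \<circ> p) \<le> len \<alpha> (u \<circ> p \<circ> q)" if "q \<in> parabolic \<alpha> ?J" for q
  proof -
    have "p \<circ> q \<in> parabolic \<alpha> ?J" by (rule parabolic_comp[OF p(1) that])
    then have "Q (len \<alpha> (u \<circ> (p \<circ> q)))" unfolding Q_def by blast
    then have "(LEAST n. Q n) \<le> len \<alpha> (u \<circ> (p \<circ> q))" by (rule Least_le)
    then show ?thesis unfolding p(2) comp_assoc .
  qed
  then have mr: "u \<circ> p \<in> min_reps \<alpha> ?J" using W_comp[OF u parabolic_W[OF p(1)]] by (simp add: min_reps_def)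
  have uniq: "a = b" if a: "a \<in> min_reps \<alpha> ?J" "a = u \<circ> q" and b: "b \<in> min_reps \<alpha> ?J" "b = u \<circ> r"
    and qr: "q \<in> parabolic \<alpha> ?J" "r \<in> parabolic \<alpha> ?J" for a b q r
  proof -
    have W: "a \<in> W" "b \<in> W" "q \<in> W" "r \<in> W" using a b qr parabolic_W by (auto simp: min_reps_def)
    obtain js where js: "set js \<subseteq> ?J" "q = word_prod \<alpha> js" using qr by (auto simp: parabolic_def)
    obtain ks where ks: "set ks \<subseteq> ?J" "r = word_prod \<alpha> ks" using qr by (auto simp: parabolic_def)
    let ?w = "word_prod \<alpha> (rev js @ ks)"
    have "a \<circ> ?w = u \<circ> (q \<circ> word_prod \<alpha> (rev js)) \<circ> r"
      unfolding a word_prod_append ks(2)[symmetric] by (simp only: comp_assoc)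
    also have "q \<circ> word_prod \<alpha> (rev js) = id" using word_prod_rev[of "rev js"] by (simp add: js)
    finally have e: "a \<circ> ?w = b" unfolding b by (simp only: comp_id)
    have wfix: "?w (\<omega> k) = \<omega> k"
      by (rule parabolic_fix) (use js ks in \<open>auto simp: parabolic_def intro!: imageI\<close>)
    have "?w = id"
    proof (rule ccontr)
      assume "?w \<noteq> id"
      then obtain i where i: "i \<in> set (rev js @ ks)" "?w (\<alpha> i) \<notin> pos" using word_ends_negative by blast
      then have iJ: "i \<noteq> k" using js ks by auto
      have D: "?w (\<alpha> i) \<in> \<Delta>" by (rule W_root[OF word_in_W simple_root])
      have "\<omega> k \<bullet> ?w (\<alpha> i) = ?w (\<omega> k) \<bullet> ?w (\<alpha> i)" by (simp only: wfix)
      also have "\<dots> = 0" unfolding W_isom[OF word_in_W] using iJ by (simp add: fund_weight_inner)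
      finally have "a (?w (\<alpha> i)) \<in> pos \<longleftrightarrow> ?w (\<alpha> i) \<in> pos"
        by (intro level_sign[OF W(1) _ D, of k] min_reps_pos[OF a(1)]) simp_all
      moreover have "b (\<alpha> i) \<in> pos" by (rule min_reps_pos[OF b(1)]) (use iJ in simp)
      ultimately show False using i(2) e by (metis comp_apply)
    qed
    then show "a = b" using e by (simp only: comp_id)
  qed
  have "min_rep \<alpha> ?J u = u \<circ> p" unfolding min_rep_def
  proof (rule the_equality)
    show "u \<circ> p \<in> min_reps \<alpha> ?J \<and> u \<circ> p \<in> (\<lambda>p. u \<circ> p) ` parabolic \<alpha> ?J" using mr p(1) by blast
    show "u' = u \<circ> p" if "u' \<in> min_reps \<alpha> ?J \<and> u' \<in> (\<lambda>p. u \<circ> p) ` parabolic \<alpha> ?J" for u'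
      using that uniq[of u' _ "u \<circ> p" p] mr p(1) by blast
  qed
  then show "min_rep \<alpha> ?J u \<in> min_reps \<alpha> ?J" "\<exists>p\<in>parabolic \<alpha> ?J. min_rep \<alpha> ?J u = u \<circ> p" using mr p(1) by auto
qed

text \<open>
  An element of maximal length makes all simple roots negative, hence all positive roots. Two
  such elements differ by an element that keeps all positive roots positive.
\<close>

lemma longest_props: "longest \<alpha> \<in> W" "b \<in> pos \<Longrightarrow> longest \<alpha> b \<notin> pos"
proof -
  have bound: "len \<alpha> u \<le> card pos" if "u \<in> W" for u
    unfolding len_invs[OF that] by (rule card_mono[OF finite_pos]) (simp add: invs_def)
  obtain w0 where w0: "w0 \<in> W" "\<And>u. u \<in> W \<Longrightarrow> len \<alpha> u \<le> len \<alpha> w0"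
    using ex_has_greatest_nat[of "\<lambda>u. u \<in> W" id "len \<alpha>" "Suc (card pos)"] bound by (metis id_in_W le_imp_less_Suc)
  have neg: "u b \<notin> pos" if u: "u \<in> W" "\<And>u'. u' \<in> W \<Longrightarrow> len \<alpha> u' \<le> len \<alpha> u" and b: "b \<in> pos" for u b
  proof -
    have s: "u (\<alpha> i) \<notin> pos" for i
    proof
      assume "u (\<alpha> i) \<in> pos"
      then have "len \<alpha> (u \<circ> refl (\<alpha> i)) = Suc (len \<alpha> u)"
        using card_invs_simple_pos[OF u(1)] len_invs[OF u(1)] len_invs[OF W_comp[OF u(1) simple_refl_in_W[of i]]] by simp
      then show False using u(2)[OF W_comp[OF u(1) simple_refl_in_W[of i]]] by simp
    qed
    have "linear (\<lambda>x. - (\<rho> \<bullet> u x))"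
      by (rule linearI) (simp_all add: W_lin[OF u(1)] inner_add_right)
    moreover have "0 \<le> - (\<rho> \<bullet> u (\<alpha> i))" for i
      using s[of i] pos_iff[OF W_root[OF u(1) simple_root[of i]]] by simp
    ultimately have "0 \<le> - (\<rho> \<bullet> u b)" by (rule nonneg_span_functional[OF _ _ pos_in_nonneg_span[OF b]])
    then show ?thesis using pos_iff[OF W_root[OF u(1) pos_sub[OF b]]] by simp
  qed
  have nw: "w0 b \<notin> pos" if "b \<in> pos" for b by (rule neg[OF w0(1) _ that]) (rule w0(2))
  have "longest \<alpha> = w0" unfolding longest_def
  proof (rule the_equality)
    show "w0 \<in> W \<and> (\<forall>u'\<in>W. len \<alpha> u' \<le> len \<alpha> w0)" using w0 by blast
    fix u assume u: "u \<in> W \<and> (\<forall>u'\<in>W. len \<alpha> u' \<le> len \<alpha> u)"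
    then have uW: "u \<in> W" by blast
    have "inv w0 \<circ> u = id"
    proof (rule W_pos_id[OF W_comp[OF W_inverse(1)[OF w0(1)] uW]])
      fix a assume a: "a \<in> pos"
      have aD: "u a \<in> \<Delta>" using W_root[OF uW] a pos_sub by blast
      have "u a \<notin> pos" by (rule neg[OF uW _ a]) (use u in blast)
      then have na: "- u a \<in> pos" using pos_neg[OF aD] by simp
      have "inv w0 (- u a) \<notin> pos"
      proof
        assume "inv w0 (- u a) \<in> pos"
        then have "w0 (inv w0 (- u a)) \<notin> pos" by (rule nw)
        then show False using na by (simp add: W_inverse(2)[OF w0(1)])
      qed
      then show "(inv w0 \<circ> u) a \<in> pos" using pos_neg[OF inv_root[OF w0(1) aD]] by (simp add: inv_lin(1)[OF w0(1)])
    qed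
    then show "u = w0" using W_inverse(2)[OF w0(1)] by (metis comp_apply id_apply ext)
  qed
  then show "longest \<alpha> \<in> W" "b \<in> pos \<Longrightarrow> longest \<alpha> b \<notin> pos" using w0(1) nw by simp_all
qed

lemma card_invs_inv: "u \<in> W \<Longrightarrow> card (invs (inv u)) = card (invs u)"
proof -
  assume u: "u \<in> W"
  show ?thesis
    by (rule bij_betw_same_card[of "\<lambda>a. - inv u a"], rule bij_betwI[of _ _ _ "\<lambda>a. - u a"])
       (auto simp: invs_def W_inverse[OF u] inv_lin[OF u] W_lin[OF u] pos_neg[OF inv_root[OF u]]
          pos_neg[OF W_root[OF u]] pos_neg pos_sub)
qed

text \<open>
  Minimal representatives keep the signs of the roots orthogonal to \<open>\<varpi>\<^sub>k\<close>, and \<open>yx\<close>, which differs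
  from the longest element by the stabiliser of \<open>\<varpi>\<^sub>k\<close>, makes the roots on level 1 of \<open>\<varpi>\<^sub>k\<close> negative.
  So the signs after applying \<open>x\<close> and \<open>yx\<close> can be read off from the levels. The lengths add up
  because the roots on level 1 of \<open>\<lambda>\<close> are the \<open>\<gamma>\<^sub>s\<close> and the \<open>-\<beta>\<^sub>r\<close>.
\<close>

lemma minuscule_levels:
  assumes mn: "minuscule \<Delta> \<alpha> (\<omega> k)" and x: "x \<in> min_reps \<alpha> (UNIV - {k})" and lam: "lam = x (\<omega> k)"
    and y: "y \<in> W" and z: "min_rep \<alpha> (UNIV - {k}) (longest \<alpha>) = y \<circ> x"
  shows "minuscule \<Delta> \<alpha> lam" "x \<in> W"
    "invs (inv x) = {a\<in>pos. lam \<bullet> a = -1}" "invs y = {a\<in>pos. lam \<bullet> a = 1}"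
    "len \<alpha> (y \<circ> x) = len \<alpha> x + len \<alpha> y"
proof -
  let ?J = "UNIV - {k}"
  show xW: "x \<in> W" using x by (simp add: min_reps_def)
  have om: "\<omega> k \<bullet> a \<in> {0,1,-1}" if "a \<in> \<Delta>" for a using mn that by (simp add: minuscule_def)
  have lx: "lam \<bullet> a = \<omega> k \<bullet> inv x a" for a by (simp add: lam W_adjoint[OF xW])
  show "minuscule \<Delta> \<alpha> lam"
    unfolding minuscule_def using W_P[OF xW fund_weight_in_P] om inv_root[OF xW] lx by (simp add: lam)
  let ?z = "y \<circ> x"
  have zW: "?z \<in> W" by (rule W_comp[OF y xW])
  have zm: "?z \<in> min_reps \<alpha> ?J" using min_rep_props(1)[OF longest_props(1), of k] z by simp
  obtain p where p: "p \<in> parabolic \<alpha> ?J" "?z = longest \<alpha> \<circ> p" using min_rep_props(2)[OF longest_props(1), of k] z by auto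
  have xs: "x b \<in> pos \<longleftrightarrow> b \<in> pos" if "b \<in> \<Delta>" "\<omega> k \<bullet> b = 0" for b
    by (rule level_sign[OF xW min_reps_pos[OF x] that]) simp
  have zs: "?z b \<in> pos \<longleftrightarrow> b \<in> pos" if "b \<in> \<Delta>" "\<omega> k \<bullet> b = 0" for b
    by (rule level_sign[OF zW min_reps_pos[OF zm] that]) simp
  have z1: "?z b \<notin> pos" if "b \<in> \<Delta>" "\<omega> k \<bullet> b = 1" for b
  proof -
    have pW: "p \<in> W" by (rule parabolic_W[OF p(1)])
    have "\<omega> k \<bullet> p b = p (\<omega> k) \<bullet> p b" by (simp only: parabolic_fix[OF p(1)])
    also have "\<dots> = 1" unfolding W_isom[OF pW] by (rule that(2))
    finally have "p b \<in> pos" by (intro pos_if_level[OF W_root[OF pW that(1)], of k]) simp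
    then show ?thesis unfolding p(2) comp_apply by (rule longest_props(2))
  qed
  have zm1: "?z b \<in> pos" if "b \<in> \<Delta>" "\<omega> k \<bullet> b = -1" for b
    using z1[of "- b"] that pos_neg[OF W_root[OF zW that(1)]] W_lin(3)[OF zW, of b] by simp
  have lev1: "b \<in> pos" if "b \<in> \<Delta>" "\<omega> k \<bullet> b = 1" for b
    by (rule pos_if_level[OF that(1), of k]) (simp add: that)
  have levm1: "b \<notin> pos" if "b \<in> \<Delta>" "\<omega> k \<bullet> b = -1" for b
    using lev1[of "- b"] that pos_neg[OF that(1)] by simp
  show ix: "invs (inv x) = {a\<in>pos. lam \<bullet> a = -1}"
  proof -
    have "inv x a \<notin> pos \<longleftrightarrow> lam \<bullet> a = -1" if "a \<in> pos" for a
    proof -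
      have bD: "inv x a \<in> \<Delta>" using inv_root[OF xW] pos_sub[OF that] by blast
      have xb: "x (inv x a) = a" by (rule W_inverse(2)[OF xW])
      show ?thesis using om[OF bD] xs[OF bD] lev1[OF bD] levm1[OF bD] that unfolding lx xb by auto
    qed
    then show ?thesis unfolding invs_def by blast
  qed
  show iy: "invs y = {a\<in>pos. lam \<bullet> a = 1}"
  proof -
    have "y a \<notin> pos \<longleftrightarrow> lam \<bullet> a = 1" if "a \<in> pos" for a
    proof -
      have bD: "inv x a \<in> \<Delta>" using inv_root[OF xW] pos_sub[OF that] by blast
      have xb: "x (inv x a) = a" by (rule W_inverse(2)[OF xW])
      have zb: "?z (inv x a) = y a" by (simp add: xb)
      show ?thesis using om[OF bD] xs[OF bD] zs[OF bD] z1[OF bD] zm1[OF bD] that unfolding lx zb xb by auto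
    qed
    then show ?thesis unfolding invs_def by blast
  qed
  show "len \<alpha> (y \<circ> x) = len \<alpha> x + len \<alpha> y"
  proof -
    have iz: "invs ?z = {b\<in>\<Delta>. \<omega> k \<bullet> b = 1}"
    proof -
      have "b \<in> pos \<and> ?z b \<notin> pos \<longleftrightarrow> \<omega> k \<bullet> b = 1" if "b \<in> \<Delta>" for b
        using om[OF that] zs[OF that] z1[OF that] lev1[OF that] levm1[OF that] by auto
      then show ?thesis unfolding invs_def using pos_sub by blast
    qed
    have "card {b\<in>\<Delta>. \<omega> k \<bullet> b = 1} = card {a\<in>\<Delta>. lam \<bullet> a = 1}"
      by (rule bij_betw_same_card[of x], rule bij_betwI[of _ _ _ "inv x"])
         (auto simp: lx W_inverse[OF xW] W_root[OF xW] inv_root[OF xW])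
    also have "{a\<in>\<Delta>. lam \<bullet> a = 1} = {a\<in>pos. lam \<bullet> a = 1} \<union> uminus ` {a\<in>pos. lam \<bullet> a = -1}" (is "_ = ?A \<union> ?B")
    proof (intro subset_antisym subsetI)
      fix a assume a: "a \<in> {a\<in>\<Delta>. lam \<bullet> a = 1}"
      show "a \<in> ?A \<union> ?B"
      proof (cases "a \<in> pos")
        case False
        then have "- a \<in> {a\<in>pos. lam \<bullet> a = -1}" using a pos_neg by auto
        then show ?thesis by (intro UnI2 image_eqI[of _ _ "- a"]) simp_all
      qed (use a in simp)
    qed (use pos_sub in auto)
    also have "card (?A \<union> ?B) = card ?A + card ?B"
      by (rule card_Un_disjoint) (use finite_pos pos_neg pos_sub in auto)
    also have "card ?B = card {a\<in>pos. lam \<bullet> a = -1}" by (rule card_image) (simp add: inj_on_def)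
    finally have "len \<alpha> (y \<circ> x) = card (invs y) + card (invs (inv x))"
      unfolding len_invs[OF zW] iz ix iy .
    moreover have "card (invs (inv x)) = len \<alpha> x" using card_invs_inv[OF xW] len_invs[OF xW] by simp
    ultimately show ?thesis using len_invs[OF y] by simp
  qed
qed

section \<open>Limits along a walk\<close>

text \<open>
  The factor of \<open>g\<^sup>+\<close>, or of \<open>g\<^sup>-\<close> if \<open>e\<close> is false, that belongs to the step from \<open>v\<close> to \<open>u\<close> with root \<open>b\<close>.
\<close>

definition step_coeff :: "bool \<Rightarrow> ('a \<Rightarrow> 'a) \<Rightarrow> ('a \<Rightarrow> 'a) \<Rightarrow> 'a \<Rightarrow> 'i laur" where
  "step_coeff e v u b =
     (if e then
        (if u = v \<and> \<rho> \<bullet> inv v b = -1 then 1 - laur_X \<alpha> (inv v b)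
         else if bruhat_less \<Delta> \<alpha> u v then laur_X \<alpha> (inv v b)
         else if bruhat_less \<Delta> \<alpha> v u then -1 else 1)
      else
        (if u = v \<and> \<rho> \<bullet> inv v b = 1 then 1 - laur_X \<alpha> (- inv v b)
         else if bruhat_less \<Delta> \<alpha> u v then - laur_X \<alpha> (inv v b) else 1))"

text \<open>The roots \<open>\<gamma>\<^sub>s\<close> enter \<open>Y\<^sup>\<lambda>\<close> with the opposite sign.\<close>

abbreviation wall :: "bool \<Rightarrow> 'a \<Rightarrow> 'a \<times> real" where
  "wall e b \<equiv> ((if e then - b else b), 0)"

lemma hgt_neg: "c \<in> \<Delta> \<Longrightarrow> hgt (- c) = - hgt c"
  using hgt[of c] hgt[of "- c"] neg_root[of c] by simp

lemma refl_comp_neq: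
  assumes v: "v \<in> W" and b: "b \<in> pos"
  shows "refl b \<circ> v \<noteq> v"
  using len_up[OF v b] len_down(1)[OF v b] by force

lemma vlim_stay_step:
  assumes v: "v \<in> W" and b: "b \<in> pos"
  shows "vlim (V powi (if e then sg v b else - sg v b) * rdiag (Zb (inv v (fst (wall e b))))) (step_coeff e v v b)"
proof -
  have bD: "b \<in> \<Delta>" using b pos_sub by blast
  let ?c = "inv v b"
  have c: "?c \<in> \<Delta>" by (rule inv_root[OF v bD])
  have nc: "- ?c \<in> \<Delta>" using c by (rule neg_root)
  have irr: "\<not> bruhat_less \<Delta> \<alpha> v v" using bruhat_less_len[of v v] by auto
  have h: "\<rho> \<bullet> ?c = 1 \<longleftrightarrow> hgt ?c = 1" "\<rho> \<bullet> ?c = -1 \<longleftrightarrow> hgt (- ?c) = 1"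
    unfolding hgt[OF c] hgt_neg[OF c] by linarith+
  have s: "sg v b = - sgn (hgt (- ?c))" unfolding sg_sgn[OF v bD] hgt_neg[OF c] by simp
  show ?thesis
  proof (cases e)
    case True
    have "step_coeff e v v b = (if hgt (- ?c) = 1 then 1 - laur_X \<alpha> (- (- ?c)) else 1)"
      unfolding step_coeff_def h using True irr by simp
    then show ?thesis using vlim_stay[OF nc] True by (simp add: s inv_lin[OF v])
  next
    case False
    have "step_coeff e v v b = (if hgt ?c = 1 then 1 - laur_X \<alpha> (- ?c) else 1)"
      unfolding step_coeff_def h using False irr by simp
    then show ?thesis using vlim_stay[OF c] False by (simp add: sg_sgn[OF v bD])
  qed
qed

text \<open>
  The excess \<open>d\<close> leaves a factor \<open>v\<^sup>d\<close>, which removes the step from the limit unless it is an edge.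
\<close>

lemma vlim_move_step:
  assumes v: "v \<in> W" and b: "b \<in> pos"
  shows "vlim (V powi (int (len \<alpha> (refl b \<circ> v)) - int (len \<alpha> v)) * roff e (Zb (inv v (fst (wall e b)))))
    (if qbg_edge \<Delta> \<alpha> v (refl b \<circ> v) then step_coeff e v (refl b \<circ> v) b else 0)"
proof -
  have bD: "b \<in> \<Delta>" using b pos_sub by blast
  define c where "c = inv v b"
  define u where "u = refl b \<circ> v"
  have c: "c \<in> \<Delta>" unfolding c_def by (rule inv_root[OF v bD])
  have nc: "- c \<in> \<Delta>" using c by (rule neg_root)
  have neq: "u \<noteq> v" unfolding u_def by (rule refl_comp_neq[OF v b])
  obtain d where d: "int (len \<alpha> u) - int (len \<alpha> v) = (if hgt c > 0 then 1 else 1 + 2 * hgt c) + int d"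
      "d = 0 \<longleftrightarrow> qbg_edge \<Delta> \<alpha> v u" "bruhat_less \<Delta> \<alpha> u v \<longleftrightarrow> \<not> hgt c > 0" "bruhat_less \<Delta> \<alpha> v u \<longleftrightarrow> hgt c > 0"
    unfolding c_def u_def by (rule move_exponent[OF v b])
  define k where "k = (if hgt c > 0 then 1 else 1 + 2 * hgt c)"
  have k': "(if hgt (- c) > 0 then 1 - 2 * hgt (- c) else 1) = k"
    using hgt_neq_0[OF c] unfolding k_def hgt_neg[OF c] by auto
  have lim: "vlim (V powi k * roff e (Zb (inv v (fst (wall e b))))) (step_coeff e v u b)"
  proof (cases e)
    case True
    have "step_coeff e v u b = (if hgt (- c) > 0 then laur_X \<alpha> (- (- c)) else -1)"
      unfolding step_coeff_def d c_def[symmetric] hgt_neg[OF c] using True neq hgt_neq_0[OF c] by auto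
    then show ?thesis using vlim_move_plus[OF nc] True unfolding k' by (simp add: c_def inv_lin[OF v])
  next
    case False
    have "step_coeff e v u b = (if hgt c > 0 then 1 else - laur_X \<alpha> c)"
      unfolding step_coeff_def d c_def[symmetric] using False neq by auto
    then show ?thesis using vlim_move_minus[OF c] False unfolding k_def by (simp add: c_def)
  qed
  have V0: "V \<noteq> 0" by (rule V_neq_0)
  have pw: "V ^ d * V powi k = V powi (k + int d)"
    using power_int_add[of V k "int d"] V0 by (simp only: power_int_of_nat mult.commute simp_thms)
  have "vlim (V ^ d * (V powi k * roff e (Zb (inv v (fst (wall e b)))))) ((if d = 0 then 1 else 0) * step_coeff e v u b)"
    by (rule vlim_mult[OF vlim_V_pow lim])
  also have "(if d = 0 then 1 else 0) * step_coeff e v u b = (if d = 0 then step_coeff e v u b else 0)" by simp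
  finally show ?thesis
    unfolding u_def[symmetric] d(1) k_def[symmetric] d(2)[symmetric] mult.assoc[symmetric] pw .
qed

text \<open>
  The recursion over the steps that is satisfied both by the limits of matrix entries and by
  sums over quantum walks.
\<close>

fun walk_sum :: "bool \<Rightarrow> (('a \<Rightarrow> 'a) \<Rightarrow> 'i laur) \<Rightarrow> 'a list \<Rightarrow> ('a \<Rightarrow> 'a) \<Rightarrow> 'i laur" where
  "walk_sum e T [] v = T v"
| "walk_sum e T (b # bs) v = step_coeff e v v b * walk_sum e T bs v
     + (if qbg_edge \<Delta> \<alpha> v (refl b \<circ> v) then step_coeff e v (refl b \<circ> v) b * walk_sum e T bs (refl b \<circ> v) else 0)"

abbreviation Rprod :: "bool \<Rightarrow> 'a list \<Rightarrow> ('a, 'i) smash \<Rightarrow> ('a, 'i) smash" where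
  "Rprod e bs A \<equiv> foldr (\<lambda>b A. Rop e (wall e b) \<odot> A) bs A"

lemma wall_in: "b \<in> pos \<Longrightarrow> wall e b \<in> aroots"
  using pos_sub[of b] neg_root[of b] by (auto simp: aroots_def intro: exI[of _ 0])

lemma lookup_single_0_mult: "Poly_Mapping.lookup (Poly_Mapping.single 0 a * f) \<mu> = a * Poly_Mapping.lookup (f :: ('a, 'i) qtorus) \<mu>"
  by (induction f rule: poly_mapping_induct_single)
     (simp_all add: mult_single lookup_single when_def distrib_left lookup_add)

text \<open>
  The exponent \<open>N\<close> may depend on the remaining roots and on the position. The hypothesis \<open>step\<close>
  says that between two positions it changes by what the limits of the coefficients for
  staying and for moving absorb.
\<close>

lemma walk_limit:
  assumes Q: "sm Q"
    and base: "\<And>v. v \<in> W \<Longrightarrow> vlim (V powi N [] v * Poly_Mapping.lookup (kap Q v w) \<mu>) (T v)"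
    and step: "\<And>pre b bs v. L = pre @ b # bs \<Longrightarrow> v \<in> W \<Longrightarrow> b \<in> pos \<and>
      N (b # bs) v = (if e then sg v b else - sg v b) + N bs v \<and>
      N (b # bs) v = (int (len \<alpha> (refl b \<circ> v)) - int (len \<alpha> v)) + N bs (refl b \<circ> v)"
    and v: "v \<in> W" and L: "L = pre @ bs"
  shows "vlim (V powi N bs v * Poly_Mapping.lookup (kap (Rprod e bs Q) v w) \<mu>) (walk_sum e T bs v)"
  using v L
proof (induction bs arbitrary: v pre)
  case Nil
  then show ?case using base by simp
next
  case (Cons b bs)
  have v: "v \<in> W" by fact
  note st = step[OF Cons.prems(2) v]
  have b: "b \<in> pos" and n1: "N (b # bs) v = (if e then sg v b else - sg v b) + N bs v"
    and n2: "N (b # bs) v = (int (len \<alpha> (refl b \<circ> v)) - int (len \<alpha> v)) + N bs (refl b \<circ> v)"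
    using st by blast+
  have bD: "b \<in> \<Delta>" using b pos_sub by blast
  have fD: "fst (wall e b) \<in> \<Delta>" using bD neg_root by simp
  have pos': "c \<in> pos" if c: "c \<in> set bs" for c
  proof -
    obtain p q where "bs = p @ c # q" using split_list[OF c] by blast
    then have "L = (pre @ b # p) @ c # q" using Cons.prems(2) by simp
    then show ?thesis using step v by blast
  qed
  let ?A = "Rprod e bs Q" and ?u = "refl b \<circ> v"
  have sA: "sm ?A" by (rule sm_foldr_R[OF _ Q]) (use pos' wall_in in blast)
  have uW: "?u \<in> W" by (rule refl_comp_in[OF v bD])
  have r: "refl (fst (wall e b)) = refl b" by (cases e) (simp_all add: refl_neg)
  have w: "(fst (wall e b), 0) = wall e b" by simp
  have L2: "L = (pre @ [b]) @ bs" using Cons.prems(2) by simp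
  define f g where "f = Poly_Mapping.lookup (kap ?A v w) \<mu>" and "g = Poly_Mapping.lookup (kap ?A ?u w) \<mu>"
  define D E where "D = rdiag (Zb (inv v (fst (wall e b))))" and "E = roff e (Zb (inv v (fst (wall e b))))"
  have f: "vlim (V powi N bs v * f) (walk_sum e T bs v)" unfolding f_def by (rule Cons.IH[OF v L2])
  have g: "vlim (V powi N bs ?u * g) (walk_sum e T bs ?u)" unfolding g_def by (rule Cons.IH[OF uW L2])
  have V0: "V \<noteq> 0" by (rule V_neq_0)
  have K: "Poly_Mapping.lookup (kap (Rprod e (b # bs) Q) v w) \<mu> = D * f + E * g"
    using kappa_Rop[OF v fD sA, of e w] unfolding w r
    by (simp only: foldr.simps comp_apply lookup_add lookup_single_0_mult f_def g_def D_def E_def)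
  have 1: "V powi N (b # bs) v * (D * f) = (V powi (if e then sg v b else - sg v b) * D) * (V powi N bs v * f)"
    unfolding n1 by (simp add: power_int_add V0 mult_ac)
  have 2: "V powi N (b # bs) v * (E * g) = (V powi (int (len \<alpha> ?u) - int (len \<alpha> v)) * E) * (V powi N bs ?u * g)"
    unfolding n2 by (simp add: power_int_add V0 mult_ac)
  have 3: "(if qbg_edge \<Delta> \<alpha> v ?u then step_coeff e v ?u b * walk_sum e T bs ?u else 0)
    = (if qbg_edge \<Delta> \<alpha> v ?u then step_coeff e v ?u b else 0) * walk_sum e T bs ?u" by simp
  show ?case unfolding K distrib_left 1 2 walk_sum.simps 3 unfolding D_def E_def
    by (rule vlim_add[OF vlim_mult[OF vlim_stay_step[OF v b] f] vlim_mult[OF vlim_move_step[OF v b] g]])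
qed

section \<open>Quantum walks as lists\<close>

fun walks :: "'a list \<Rightarrow> ('a \<Rightarrow> 'a) \<Rightarrow> ('a \<Rightarrow> 'a) list set" where
  "walks [] v = {[]}"
| "walks (b # bs) v = Cons v ` walks bs v \<union>
     (if qbg_edge \<Delta> \<alpha> v (refl b \<circ> v) then Cons (refl b \<circ> v) ` walks bs (refl b \<circ> v) else {})"

fun walk_coeff :: "bool \<Rightarrow> 'a list \<Rightarrow> ('a \<Rightarrow> 'a) \<Rightarrow> ('a \<Rightarrow> 'a) list \<Rightarrow> 'i laur" where
  "walk_coeff e (b # bs) v (u # ws) = step_coeff e v u b * walk_coeff e bs u ws"
| "walk_coeff e _ v _ = 1"

lemma finite_walks: "finite (walks bs v)"
  by (induction bs arbitrary: v) auto

lemma length_walks: "ws \<in> walks bs v \<Longrightarrow> length ws = length bs"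
  by (induction bs arbitrary: v ws) (auto split: if_splits)

lemma walks_W: "v \<in> W \<Longrightarrow> set bs \<subseteq> pos \<Longrightarrow> ws \<in> walks bs v \<Longrightarrow> set ws \<subseteq> W"
proof (induction bs arbitrary: v ws)
  case (Cons b bs)
  have v: "v \<in> W" and b: "b \<in> pos" and bs: "set bs \<subseteq> pos" using Cons.prems by auto
  have u: "refl b \<circ> v \<in> W" using refl_comp_in[OF v pos_sub[OF b]] .
  obtain z zs where z: "ws = z # zs" "zs \<in> walks bs z" "z = v \<or> z = refl b \<circ> v" 
    using Cons.prems(3) by (auto split: if_splits)
  have zW: "z \<in> W" using z(3) v u by blast
  show ?case using Cons.IH[OF zW bs z(2)] zW by (simp add: z(1))
qed simp

text \<open>Staying and moving lead to different positions, so no walk is counted twice.\<close>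

lemma sum_walks_Cons:
  assumes v: "v \<in> W" and b: "b \<in> pos"
  shows "(\<Sum>ws\<in>walks (b # bs) v. h ws) = (\<Sum>ws\<in>walks bs v. h (v # ws)) +
    (if qbg_edge \<Delta> \<alpha> v (refl b \<circ> v) then (\<Sum>ws\<in>walks bs (refl b \<circ> v). h ((refl b \<circ> v) # ws)) else 0)"
proof (cases "qbg_edge \<Delta> \<alpha> v (refl b \<circ> v)")
  case True
  let ?u = "refl b \<circ> v"
  have disj: "Cons y ` A \<inter> Cons z ` B = {}" if "y \<noteq> z" for y z :: "'a \<Rightarrow> 'a" and A B using that by auto
  have "walks (b # bs) v = Cons v ` walks bs v \<union> Cons ?u ` walks bs ?u" using True by simp
  moreover have "Cons v ` walks bs v \<inter> Cons ?u ` walks bs ?u = {}" by (rule disj) (use refl_comp_neq[OF v b] in \<open>rule not_sym\<close>)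
  ultimately have "(\<Sum>ws\<in>walks (b # bs) v. h ws) = (\<Sum>ws\<in>Cons v ` walks bs v. h ws) + (\<Sum>ws\<in>Cons ?u ` walks bs ?u. h ws)"
    using finite_walks by (simp only: sum.union_disjoint finite_imageI)
  moreover have "(\<Sum>ws\<in>Cons z ` walks bs z. h ws) = (\<Sum>ws\<in>walks bs z. h (z # ws))" for z
    by (subst sum.reindex) (simp_all add: inj_on_def)
  ultimately show ?thesis using True by simp
next
  case False
  have "walks (b # bs) v = Cons v ` walks bs v" using False by simp
  moreover have "(\<Sum>ws\<in>Cons v ` walks bs v. h ws) = (\<Sum>ws\<in>walks bs v. h (v # ws))"
    by (subst sum.reindex) (simp_all add: inj_on_def)
  ultimately show ?thesis using False by (simp only: if_False add_0_right)
qed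

lemma walk_sum_eq:
  assumes "v \<in> W" "set bs \<subseteq> pos"
  shows "walk_sum e T bs v = (\<Sum>ws\<in>walks bs v. walk_coeff e bs v ws * T (last (v # ws)))"
  using assms
proof (induction bs arbitrary: v)
  case (Cons b bs)
  have v: "v \<in> W" and b: "b \<in> pos" and bs: "set bs \<subseteq> pos" using Cons.prems by auto
  have u: "refl b \<circ> v \<in> W" using refl_comp_in[OF v pos_sub[OF b]] .
  have l: "last (v # z # ws) = last (z # ws)" for z ws by simp
  show ?case
    unfolding sum_walks_Cons[OF v b] walk_sum.simps Cons.IH[OF v bs] Cons.IH[OF u bs] walk_coeff.simps l
      sum_distrib_left mult.assoc by (rule HOL.refl)
qed simp

lemma sum_walks_append:
  assumes "v \<in> W" "set bs \<subseteq> pos"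
  shows "(\<Sum>ws\<in>walks (bs @ cs) v. h ws) = (\<Sum>us\<in>walks bs v. \<Sum>ts\<in>walks cs (last (v # us)). h (us @ ts))"
  using assms
proof (induction bs arbitrary: v h)
  case (Cons b bs)
  have v: "v \<in> W" and b: "b \<in> pos" and bs: "set bs \<subseteq> pos" using Cons.prems by auto
  have u: "refl b \<circ> v \<in> W" using refl_comp_in[OF v pos_sub[OF b]] .
  have l: "last (v # z # ws) = last (z # ws)" for z ws by simp
  show ?case
    unfolding append_Cons sum_walks_Cons[OF v b] l Cons.IH[OF v bs, of "\<lambda>ws. h (v # ws)"]
      Cons.IH[OF u bs, of "\<lambda>ws. h ((refl b \<circ> v) # ws)"] by (rule HOL.refl)
qed simp

lemma quantum_walks_Cons:
  "u # ws \<in> quantum_walks \<Delta> \<alpha> (Suc n) \<eta> v \<longleftrightarrow>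
     u \<in> W \<and> (u = v \<or> u = refl (\<eta> 1) \<circ> v \<and> qbg_edge \<Delta> \<alpha> v u) \<and> ws \<in> quantum_walks \<Delta> \<alpha> n (\<lambda>t. \<eta> (Suc t)) u"
proof -
  let ?Q = "\<lambda>\<eta> v ws t. (v # ws) ! t = (v # ws) ! (t - 1) \<or>
        ((v # ws) ! t = refl (\<eta> t) \<circ> (v # ws) ! (t - 1) \<and> qbg_edge \<Delta> \<alpha> ((v # ws) ! (t - 1)) ((v # ws) ! t))"
  have "{1..Suc n} = insert 1 (Suc ` {1..n})" by (auto simp: image_iff)
  then have 1: "(\<forall>t\<in>{1..Suc n}. ?Q \<eta> v (u # ws) t) \<longleftrightarrow> ?Q \<eta> v (u # ws) 1 \<and> (\<forall>t\<in>{1..n}. ?Q \<eta> v (u # ws) (Suc t))"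
    by (simp only: ball_simps)
  have 2: "(\<forall>t\<in>{1..n}. ?Q \<eta> v (u # ws) (Suc t)) \<longleftrightarrow> (\<forall>t\<in>{1..n}. ?Q (\<lambda>t. \<eta> (Suc t)) u ws t)"
  proof (rule ball_cong[OF HOL.refl])
    fix t assume "t \<in> {1..n}"
    then obtain s where s: "t = Suc s" by (cases t) auto
    show "?Q \<eta> v (u # ws) (Suc t) \<longleftrightarrow> ?Q (\<lambda>t. \<eta> (Suc t)) u ws t"
      unfolding s nth_Cons_Suc diff_Suc_1 by (rule HOL.refl)
  qed
  have 3: "?Q \<eta> v (u # ws) 1 \<longleftrightarrow> u = v \<or> u = refl (\<eta> 1) \<circ> v \<and> qbg_edge \<Delta> \<alpha> v u"
    unfolding One_nat_def nth_Cons_Suc diff_self_eq_0 nth_Cons_0 by (rule HOL.refl)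
  have 4: "length (u # ws) = Suc n \<longleftrightarrow> length ws = n" "set (u # ws) \<subseteq> W \<longleftrightarrow> u \<in> W \<and> set ws \<subseteq> W" by simp_all
  have g: "A \<and> (B \<and> C) \<and> D \<and> E \<longleftrightarrow> B \<and> D \<and> A \<and> C \<and> E" for A B C D E by blast
  show ?thesis unfolding quantum_walks_def mem_Collect_eq 1 2 3 4 by (rule g)
qed

lemma quantum_walks_eq:
  assumes "v \<in> W" "set bs \<subseteq> pos" "\<And>t. t < length bs \<Longrightarrow> \<eta> (Suc t) = bs ! t"
  shows "quantum_walks \<Delta> \<alpha> (length bs) \<eta> v = walks bs v"
  using assms
proof (induction bs arbitrary: v \<eta>)
  case Nil
  then show ?case by (auto simp: quantum_walks_def)
next
  case (Cons b bs)
  have v: "v \<in> W" and b: "b \<in> pos" and bs: "set bs \<subseteq> pos" using Cons.prems by auto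
  have u: "refl b \<circ> v \<in> W" using refl_comp_in[OF v pos_sub[OF b]] .
  have e1: "\<eta> 1 = b" using Cons.prems(3)[of 0] by simp
  have eS: "\<eta> (Suc (Suc t)) = bs ! t" if "t < length bs" for t using Cons.prems(3)[of "Suc t"] that by simp
  have IH: "quantum_walks \<Delta> \<alpha> (length bs) (\<lambda>t. \<eta> (Suc t)) z = walks bs z" if "z \<in> W" for z
    by (rule Cons.IH[OF that bs eS])
  show ?case
  proof (intro subset_antisym subsetI)
    fix ws assume ws: "ws \<in> quantum_walks \<Delta> \<alpha> (length (b # bs)) \<eta> v"
    then have "length ws = Suc (length bs)" by (simp add: quantum_walks_def)
    then obtain z zs where z: "ws = z # zs" by (cases ws) auto
    have zz: "z \<in> W" "z = v \<or> z = refl b \<circ> v \<and> qbg_edge \<Delta> \<alpha> v z" "zs \<in> quantum_walks \<Delta> \<alpha> (length bs) (\<lambda>t. \<eta> (Suc t)) z"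
      using ws unfolding z list.size(4) add_Suc_right add_0_right quantum_walks_Cons e1 by blast+
    have "zs \<in> walks bs z" using zz(3) IH[OF zz(1)] by simp
    then show "ws \<in> walks (b # bs) v" using zz(2) unfolding z by auto
  next
    fix ws assume "ws \<in> walks (b # bs) v"
    then obtain z zs where z: "ws = z # zs" "zs \<in> walks bs z" "z = v \<or> z = refl b \<circ> v \<and> qbg_edge \<Delta> \<alpha> v z"
      by (auto split: if_splits)
    have zW: "z \<in> W" using z(3) v u by blast
    show "ws \<in> quantum_walks \<Delta> \<alpha> (length (b # bs)) \<eta> v"
      unfolding z list.size(4) add_Suc_right add_0_right quantum_walks_Cons e1 using zW z IH[OF zW] by simp
  qed
qed

lemma walk_coeff_prod:
  "length ws = length bs \<Longrightarrow> walk_coeff e bs v ws = (\<Prod>t\<in>{1..length bs}. step_coeff e ((v # ws) ! (t - 1)) ((v # ws) ! t) (bs ! (t - 1)))"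
proof (induction bs arbitrary: v ws)
  case (Cons b bs)
  then obtain u us where ws: "ws = u # us" "length us = length bs" by (cases ws) auto
  let ?f = "\<lambda>t. step_coeff e ((v # ws) ! (t - 1)) ((v # ws) ! t) ((b # bs) ! (t - 1))"
  have "(\<Prod>t\<in>{1..length (b # bs)}. ?f t) = ?f 1 * (\<Prod>t\<in>{Suc 1..Suc (length bs)}. ?f t)"
    unfolding list.size(4) add_Suc_right add_0_right by (rule prod.atLeast_Suc_atMost) simp
  also have "(\<Prod>t\<in>{Suc 1..Suc (length bs)}. ?f t) = (\<Prod>t\<in>{1..length bs}. ?f (Suc t))"
    by (rule prod.shift_bounds_cl_Suc_ivl)
  also have "\<dots> = (\<Prod>t\<in>{1..length bs}. step_coeff e ((u # us) ! (t - 1)) ((u # us) ! t) (bs ! (t - 1)))"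
  proof (rule prod.cong[OF HOL.refl])
    fix t assume "t \<in> {1..length bs}"
    then obtain s where s: "t = Suc s" by (cases t) auto
    show "?f (Suc t) = step_coeff e ((u # us) ! (t - 1)) ((u # us) ! t) (bs ! (t - 1))"
      unfolding s ws(1) nth_Cons_Suc diff_Suc_1 by (rule HOL.refl)
  qed
  also have "\<dots> = walk_coeff e bs u us" by (rule Cons.IH[OF ws(2), symmetric])
  also have "?f 1 = step_coeff e v u b" by (simp add: ws(1))
  finally show ?case unfolding ws(1) walk_coeff.simps by (rule HOL.sym)
qed simp

subsection \<open>Arithmetic of the \<open>q\<close>-Heisenberg algebra\<close>

lemma heis_mult_single: "heis_mult \<alpha> (Poly_Mapping.single \<mu> f) (Poly_Mapping.single \<nu> g)
  = (Poly_Mapping.single (\<mu> + \<nu>) (f * trans_act \<alpha> \<mu> g) :: ('a, 'i) heis)"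
  by (cases "f = 0"; cases "g = 0") (simp_all add: heis_mult_def trans_act_hom)

lemma trans_act_0: "trans_act \<alpha> 0 f = f"
proof (induction f rule: poly_mapping_induct_single)
  case (single n c)
  show ?case unfolding trans_act_mono mono_map_single by (simp add: q_exp_def)
qed (simp add: trans_act_hom)

lemma heis_walk: "heis_mult \<alpha> (heis_mult \<alpha> (heis_fun f) (heis_t \<mu>)) (heis_fun g)
  = (Poly_Mapping.single \<mu> (f * trans_act \<alpha> \<mu> g) :: ('a, 'i) heis)"
  unfolding heis_fun_def heis_t_def heis_mult_single trans_act_0 by simp

lemma trans_act_sum: "trans_act \<alpha> \<mu> (\<Sum>x\<in>S. f x) = (\<Sum>x\<in>S. trans_act \<alpha> \<mu> (f x))"
  by (induction S rule: infinite_finite_induct) (simp_all add: trans_act_hom)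

section \<open>The limit of \<open>Y\<^sup>\<lambda>\<close>\<close>

context
  fixes lam :: 'a and \<beta>s \<gamma>s :: "'a list"
  assumes mn: "minuscule \<Delta> \<alpha> lam"
    and b: "distinct \<beta>s" "set \<beta>s = {a\<in>pos. lam \<bullet> a = -1}"
      "sorted_wrt (\<lambda>a b. a \<bullet> b = 0 \<or> (a \<bullet> b = 1 \<and> \<rho> \<bullet> a < \<rho> \<bullet> b)) \<beta>s"
    and c: "distinct (rev \<gamma>s)" "set (rev \<gamma>s) = {a\<in>pos. lam \<bullet> a = 1}"
      "sorted_wrt (\<lambda>a b. a \<bullet> b = 0 \<or> (a \<bullet> b = 1 \<and> \<rho> \<bullet> a < \<rho> \<bullet> b)) (rev \<gamma>s)"
begin

lemma lamP: "lam \<in> P" and lam_values: "a \<in> \<Delta> \<Longrightarrow> lam \<bullet> a \<in> {0,1,-1}"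
  using mn by (auto simp: minuscule_def)

text \<open>
  A pair \<open>\<beta>, \<gamma>\<close> that is not orthogonal has inner product \<open>-1\<close>, and since the height of the root
  \<open>\<beta> + \<gamma>\<close> is at most that of \<open>\<theta>\<close>, the affine root \<open>\<delta> - \<gamma>\<close> is higher than \<open>\<beta>\<close>. So the given order is
  ascending. Pulling \<open>t\<^sub>\<lambda>\<close> to the left then turns \<open>\<delta> - \<gamma>\<close> into \<open>-\<gamma>\<close>.
\<close>

lemma rho_Y_canonical: "rho_Y \<Delta> \<alpha> lam = Rprod False \<beta>s (tr (lam, id) \<odot> Rprod True \<gamma>s smash_one)"
proof -
  let ?bs = "map (\<lambda>b. (b, 0::real)) \<beta>s @ map (\<lambda>c. (- c, 1::real)) \<gamma>s"
  have tW: "(lam, id) \<in> Wex" by (simp add: wexI lamP)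
  have B: "\<beta> \<in> pos" "\<beta> \<in> \<Delta>" "lam \<bullet> \<beta> = -1" if "\<beta> \<in> set \<beta>s" for \<beta> using that b(2) pos_sub by auto
  have C: "\<gamma> \<in> pos" "\<gamma> \<in> \<Delta>" "lam \<bullet> \<gamma> = 1" if "\<gamma> \<in> set \<gamma>s" for \<gamma> using that c(2) pos_sub by auto
  have d: "distinct ?bs" using b(1) c(1) by (auto simp: distinct_map inj_on_def)
  have st: "set ?bs = (\<lambda>a. (a, 0)) ` {a\<in>pos. lam \<bullet> a = -1} \<union> (\<lambda>a. (- a, 1)) ` {a\<in>pos. lam \<bullet> a = 1}"
    using b(2) c(2) by (simp only: set_append set_map set_rev)
  have cross: "\<beta> \<bullet> (- \<gamma>) = 0 \<or> \<beta> \<bullet> (- \<gamma>) = 1 \<and> aht (\<beta>, 0) < aht (- \<gamma>, 1)"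
    if "\<beta> \<in> set \<beta>s" "\<gamma> \<in> set \<gamma>s" for \<beta> \<gamma>
  proof -
    note B = B[OF that(1)] and C = C[OF that(2)]
    have "\<beta> - \<gamma> \<notin> \<Delta>" using lam_values[of "\<beta> - \<gamma>"] B C by (auto simp: inner_diff_right)
    then have n1: "\<beta> \<bullet> \<gamma> \<noteq> 1" using diff_root[OF B(2) C(2)] by blast
    have n2: "\<gamma> \<noteq> \<beta>"
    proof
      assume "\<gamma> = \<beta>"
      then show False using B(3) C(3) by simp
    qed
    have n3: "\<gamma> \<noteq> - \<beta>"
    proof
      assume "\<gamma> = - \<beta>"
      then have "- \<beta> \<in> pos" using C(1) by simp
      then show False using B(1) pos_neg[OF B(2)] by blast
    qed
    have "\<beta> \<bullet> \<gamma> = 0 \<or> \<beta> \<bullet> \<gamma> = -1"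
      by (rule inner_root_cases[OF B(2) C(2)]) (use n1 n2 n3 in blast)+
    moreover have "aht (\<beta>, 0) < aht (- \<gamma>, 1)" if "\<beta> \<bullet> \<gamma> = -1"
      using rho_le_highest[OF add_root[OF B(2) C(2) that]] by (simp add: aht_def inner_add_right)
    ultimately show ?thesis by auto
  qed
  have asc: "ascending ?bs"
    unfolding ascending_def sorted_wrt_append sorted_wrt_map
  proof (intro conjI ballI)
    show "sorted_wrt (\<lambda>x y. fst (x, 0::real) \<bullet> fst (y, 0::real) = 0 \<or> fst (x, 0::real) \<bullet> fst (y, 0::real) = 1 \<and> aht (x, 0) < aht (y, 0)) \<beta>s"
      using b(3) by (simp add: aht_def)
    show "sorted_wrt (\<lambda>x y. fst (- x, 1::real) \<bullet> fst (- y, 1::real) = 0 \<or> fst (- x, 1::real) \<bullet> fst (- y, 1::real) = 1 \<and> aht (- x, 1) < aht (- y, 1)) \<gamma>s"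
      using c(3) by (simp add: aht_def sorted_wrt_rev inner_commute)
    fix x y assume "x \<in> set (map (\<lambda>b. (b, 0::real)) \<beta>s)" "y \<in> set (map (\<lambda>c. (- c, 1::real)) \<gamma>s)"
    then obtain \<beta> \<gamma> where "\<beta> \<in> set \<beta>s" "x = (\<beta>, 0)" "\<gamma> \<in> set \<gamma>s" "y = (- \<gamma>, 1)" by auto
    then show "fst x \<bullet> fst y = 0 \<or> fst x \<bullet> fst y = 1 \<and> aht x < aht y" using cross[of \<beta> \<gamma>] by simp
  qed
  have 1: "foldr (\<lambda>b A. Rop (- fst b \<in> pos) b \<odot> A) (map (\<lambda>b. (b, 0)) \<beta>s) A = Rprod False \<beta>s A" for A
    unfolding foldr_map
  proof (rule foldr_cong[OF HOL.refl HOL.refl])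
    fix \<beta> A assume "\<beta> \<in> set \<beta>s"
    then have "- \<beta> \<notin> pos" using B pos_neg by blast
    then show "((\<lambda>b A. Rop (- fst b \<in> pos) b \<odot> A) \<circ> (\<lambda>b. (b, 0))) \<beta> A = Rop False (wall False \<beta>) \<odot> A" by simp
  qed
  have 2: "foldr (\<lambda>b A. Rop (- fst b \<in> pos) b \<odot> A) (map (\<lambda>c. (- c, 1)) \<gamma>s) A
     = foldr (\<lambda>c A. Rop True (wex_act (lam, id) (wall True c)) \<odot> A) \<gamma>s A" for A
    unfolding foldr_map
  proof (rule foldr_cong[OF HOL.refl HOL.refl])
    fix \<gamma> A assume g: "\<gamma> \<in> set \<gamma>s"
    have "wex_act (lam, id) (wall True \<gamma>) = (- \<gamma>, 1)" using C[OF g] by (simp add: wex_act_def)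
    then show "((\<lambda>b A. Rop (- fst b \<in> pos) b \<odot> A) \<circ> (\<lambda>c. (- c, 1))) \<gamma> A = Rop True (wex_act (lam, id) (wall True \<gamma>)) \<odot> A"
      using C[OF g] by simp
  qed
  have "tr (lam, id) \<odot> Rprod True \<gamma>s smash_one
      = foldr (\<lambda>c A. Rop True (wex_act (lam, id) (wall True c)) \<odot> A) \<gamma>s (tr (lam, id) \<odot> smash_one)"
    by (rule tr_foldr_R[OF tW _ sm_one]) (rule wall_in, rule C(1))
  also have "tr (lam, id) \<odot> smash_one = tr (lam, id)" by (rule smash_one_right[OF sm_tr[OF tW]])
  finally have 3: "tr (lam, id) \<odot> Rprod True \<gamma>s smash_one
      = foldr (\<lambda>c A. Rop True (wex_act (lam, id) (wall True c)) \<odot> A) \<gamma>s (tr (lam, id))" .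
  show ?thesis unfolding rho_Y_ascending[OF mn d asc st] foldr_append 1 2 3 by (rule HOL.refl)
qed

text \<open>
  The exponent is the sum of the signs of the roots that are still to come. In the sorted
  order, which is that of \<open>rev \<gamma>s\<close>, these precede the root of the current step.
\<close>

lemma plus_limit:
  assumes v: "v \<in> W"
  shows "vlim (V powi (\<Sum>c\<in>set \<gamma>s. sg v c) * Poly_Mapping.lookup (kap (Rprod True \<gamma>s smash_one) v w) 0)
    (walk_sum True (\<lambda>u. if u = w then 1 else 0) \<gamma>s v)"
proof (rule walk_limit[where Q = smash_one and N = "\<lambda>bs v. \<Sum>c\<in>set bs. sg v c" and w = w and \<mu> = 0
      and T = "\<lambda>u. if u = w then 1 else 0" and L = \<gamma>s and pre = "[]" and e = True, OF sm_one _ _ v])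
  show "vlim (V powi (\<Sum>c\<in>set []. sg v c) * Poly_Mapping.lookup (kap smash_one v w) 0) (if v = w then 1 else 0)"
    if "v \<in> W" for v
    unfolding kappa_one[OF that] by (simp add: vlim_0 vlim_1)
  fix pre b bs v assume L: "\<gamma>s = pre @ b # bs" and v: "v \<in> W"
  have rL: "rev \<gamma>s = rev bs @ b # rev pre" using L by simp
  have "step_set lam (set (rev bs)) b" by (rule sorted_step_set[OF _ c rL]) (rule lam_values)
  then have S: "step_set lam (set bs) b" by simp
  have "b \<in> set (rev \<gamma>s)" using L by simp
  then have bp: "b \<in> pos" "lam \<bullet> b \<noteq> 0" unfolding c(2) by simp_all
  have nb: "b \<notin> set bs" using c(1) L by auto
  have e: "(\<Sum>c\<in>set (b # bs). sg u c) = sg u b + (\<Sum>c\<in>set bs. sg u c)" for u using nb by simp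
  have ch: "(\<Sum>c\<in>set bs. sg v c) - (\<Sum>c\<in>set bs. sg (refl b \<circ> v) c) = int (len \<alpha> (refl b \<circ> v)) - int (len \<alpha> v) - sg v b"
    by (rule step_set_sign[OF _ bp(2) S v]) (rule lam_values)
  show "b \<in> pos \<and> (\<Sum>c\<in>set (b # bs). sg v c) = (if True then sg v b else - sg v b) + (\<Sum>c\<in>set bs. sg v c) \<and>
      (\<Sum>c\<in>set (b # bs). sg v c) = int (len \<alpha> (refl b \<circ> v)) - int (len \<alpha> v) + (\<Sum>c\<in>set bs. sg (refl b \<circ> v) c)"
    unfolding e if_True by (intro conjI bp(1) HOL.refl) (use ch in linarith)
qed simp

lemma sm0_Rprod: "set bs \<subseteq> pos \<Longrightarrow> sm0 (Rprod e bs smash_one)"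
proof (induction bs)
  case Nil
  then show ?case by (simp add: smash_one_def wex_one_def sm0_single id_in_W)
next
  case (Cons b bs)
  have "refl (fst (wall e b)) \<in> W" using Cons.prems pos_sub neg_root refl_in_W by simp
  then have "sm0 (Rop e (wall e b))"
    unfolding Rop_def aff_refl_def wex_one_def by (intro sm0_add) (simp_all add: sm0_single id_in_W)
  then show ?case using Cons by (simp add: sm0_mult)
qed

text \<open>
  The left-hand side is the sum of \<open>(\<lambda>,c)\<close> over all \<open>c\<close> in \<open>v\<Delta>\<^sup>+\<close>, and up to sign only the roots on
  the levels 1 and \<open>-1\<close> contribute.
\<close>

lemma two_rho_sign:
  assumes v: "v \<in> W"
  shows "\<lfloor>2 * (\<rho> \<bullet> inv v lam)\<rfloor> = (\<Sum>c\<in>set \<gamma>s. sg v c) - (\<Sum>c\<in>set \<beta>s. sg v c)"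
proof -
  have "2 * (\<rho> \<bullet> inv v lam) = (\<Sum>a\<in>pos. a \<bullet> inv v lam)" by (simp add: half_sum_def inner_sum_left)
  also have "\<dots> = (\<Sum>a\<in>pos. lam \<bullet> v a)" by (simp add: W_adjoint[OF v, symmetric] inner_commute)
  also have "\<dots> = (\<Sum>c\<in>pos. of_int (sg v c) * (lam \<bullet> c))" by (rule sum_odd_reindex[OF v]) simp
  also have "\<dots> = (\<Sum>c\<in>set \<gamma>s \<union> set \<beta>s. of_int (sg v c) * (lam \<bullet> c))"
  proof (rule sum.mono_neutral_right[OF finite_pos])
    show "set \<gamma>s \<union> set \<beta>s \<subseteq> pos" using b(2) c(2) by auto
    show "\<forall>a\<in>pos - (set \<gamma>s \<union> set \<beta>s). of_int (sg v a) * (lam \<bullet> a) = 0"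
      using b(2) c(2) lam_values pos_sub by fastforce
  qed
  also have "\<dots> = (\<Sum>c\<in>set \<gamma>s. of_int (sg v c) * (lam \<bullet> c)) + (\<Sum>c\<in>set \<beta>s. of_int (sg v c) * (lam \<bullet> c))"
    by (rule sum.union_disjoint[OF finite_set finite_set]) (use b(2) c(2) in auto)
  also have "(\<Sum>c\<in>set \<gamma>s. of_int (sg v c) * (lam \<bullet> c)) = (\<Sum>c\<in>set \<gamma>s. of_int (sg v c))"
    by (rule sum.cong) (use c(2) in auto)
  also have "(\<Sum>c\<in>set \<beta>s. of_int (sg v c) * (lam \<bullet> c)) = (\<Sum>c\<in>set \<beta>s. - of_int (sg v c))"
    by (rule sum.cong) (use b(2) in auto)
  finally have "2 * (\<rho> \<bullet> inv v lam) = of_int ((\<Sum>c\<in>set \<gamma>s. sg v c) - (\<Sum>c\<in>set \<beta>s. sg v c))"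
    by (simp add: sum_negf)
  then show ?thesis by (simp only: floor_of_int)
qed

text \<open>
  The power of \<open>v\<close> that comes with the translation turns the exponent that belongs to the \<open>\<gamma>\<^sub>s\<close>
  into the one that belongs to the \<open>\<beta>\<^sub>r\<close>.
\<close>

lemma translation_limit:
  assumes v: "v \<in> W"
  shows "vlim (V powi (\<Sum>c\<in>set \<beta>s. sg v c) * Poly_Mapping.lookup (kap (tr (lam, id) \<odot> Rprod True \<gamma>s smash_one) v w) \<mu>)
    (if inv v lam = \<mu> then trans_act \<alpha> (inv v lam) (walk_sum True (\<lambda>u. if u = w then 1 else 0) \<gamma>s v) else 0)"
proof -
  have "set \<gamma>s \<subseteq> pos" using c(2) by auto
  note K = kappa_tr_mult[OF v lamP sm0_Rprod[OF this]]
  let ?m = "inv v lam"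
  define f where "f = Poly_Mapping.lookup (kap (Rprod True \<gamma>s smash_one) v w) 0"
  define A B where "A = (\<Sum>c\<in>set \<beta>s. sg v c)" and "B = (\<Sum>c\<in>set \<gamma>s. sg v c)"
  have m: "?m \<in> P" using W_P[OF W_inverse(1)[OF v] lamP] .
  have mW: "(?m, id) \<in> Wex" by (rule tr_in[OF m])
  have V0: "V \<noteq> 0" by (rule V_neq_0)
  have t: "scalar (t_pow (\<rho> \<bullet> ?m)) = V powi (B - A)"
    unfolding t_pow_def two_rho_sign[OF v] scalar_powi A_def B_def by (rule HOL.refl)
  have VB: "wex_act_fun \<alpha> (?m, id) (V powi B) = V powi B"
    unfolding scalar_powi[symmetric] by (rule wex_act_fun_scalar[OF mW])
  have "V powi A * (wex_act_fun \<alpha> (?m, id) f * V powi (B - A)) = V powi (A + (B - A)) * wex_act_fun \<alpha> (?m, id) f"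
    by (simp only: power_int_add V0 mult_ac simp_thms)
  also have "\<dots> = wex_act_fun \<alpha> (?m, id) (V powi B * f)"
    by (simp add: wex_act_fun_hom[OF mW] VB)
  finally have e: "V powi A * (wex_act_fun \<alpha> (?m, id) f * V powi (B - A)) = wex_act_fun \<alpha> (?m, id) (V powi B * f)" .
  have lim: "vlim (wex_act_fun \<alpha> (?m, id) (V powi B * f)) (trans_act \<alpha> ?m (walk_sum True (\<lambda>u. if u = w then 1 else 0) \<gamma>s v))"
    unfolding B_def f_def by (rule vlim_translate[OF m plus_limit[OF v]])
  show ?thesis
    unfolding K t f_def[symmetric] A_def[symmetric]
    using lim e by (cases "?m = \<mu>") (simp_all add: lookup_single_eq lookup_single_not_eq vlim_0)
qed

text \<open>
  In this part the exponent is the sum of the signs of the roots that have been passed, so it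
  is 0 at the start of a walk.
\<close>

lemma Y_limit:
  assumes v: "v \<in> W"
  shows "vlim (Poly_Mapping.lookup (kap (rho_Y \<Delta> \<alpha> lam) v w) \<mu>)
    (walk_sum False (\<lambda>u. if inv u lam = \<mu> then trans_act \<alpha> (inv u lam) (walk_sum True (\<lambda>u'. if u' = w then 1 else 0) \<gamma>s u) else 0) \<beta>s v)"
proof -
  let ?Q = "tr (lam, id) \<odot> Rprod True \<gamma>s smash_one"
  let ?T = "\<lambda>u. if inv u lam = \<mu> then trans_act \<alpha> (inv u lam) (walk_sum True (\<lambda>u'. if u' = w then 1 else 0) \<gamma>s u) else 0"
  have tW: "(lam, id) \<in> Wex" by (simp add: wexI lamP)
  have gp: "set \<gamma>s \<subseteq> pos" using c(2) by auto
  have sQ: "sm ?Q" by (rule sm_mult[OF sm_tr[OF tW] sm0_sm[OF sm0_Rprod[OF gp]]])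
  have "vlim (V powi (\<Sum>c\<in>set \<beta>s - set \<beta>s. sg v c) * Poly_Mapping.lookup (kap (Rprod False \<beta>s ?Q) v w) \<mu>) (walk_sum False ?T \<beta>s v)"
  proof (rule walk_limit[where Q = ?Q and N = "\<lambda>bs v. \<Sum>c\<in>set \<beta>s - set bs. sg v c" and w = w and \<mu> = \<mu>
        and T = ?T and L = \<beta>s and pre = "[]" and e = False, OF sQ _ _ v])
    show "vlim (V powi (\<Sum>c\<in>set \<beta>s - set []. sg v c) * Poly_Mapping.lookup (kap ?Q v w) \<mu>) (?T v)"
      if "v \<in> W" for v
      using translation_limit[OF that, of w \<mu>] by (simp only: list.set Diff_empty)
    fix pre b bs v assume L: "\<beta>s = pre @ b # bs" and v: "v \<in> W"
    have S: "step_set lam (set pre) b" by (rule sorted_step_set[OF _ b L]) (rule lam_values)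
    have "b \<in> set \<beta>s" using L by simp
    then have bp: "b \<in> pos" "lam \<bullet> b \<noteq> 0" unfolding b(2) by simp_all
    have bD: "b \<in> \<Delta>" using bp pos_sub by blast
    have s1: "set \<beta>s - set (b # bs) = set pre" "set \<beta>s - set bs = insert b (set pre)" "b \<notin> set pre"
      using b(1) unfolding L by auto
    have e: "(\<Sum>c\<in>set \<beta>s - set bs. sg u c) = sg u b + (\<Sum>c\<in>set pre. sg u c)" for u unfolding s1(2) using s1(3) by simp
    have n: "sg (refl b \<circ> v) b = - sg v b"
    proof -
      have "refl b b = - b" using root_norm[OF bD] by (simp add: refl_def scaleR_2)
      then show ?thesis unfolding sg_refl[OF v bD] using sg_neg[OF v bD] by simp
    qed
    have ch: "(\<Sum>c\<in>set pre. sg v c) - (\<Sum>c\<in>set pre. sg (refl b \<circ> v) c) = int (len \<alpha> (refl b \<circ> v)) - int (len \<alpha> v) - sg v b"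
    by (rule step_set_sign[OF _ bp(2) S v]) (rule lam_values)
    show "b \<in> pos \<and> (\<Sum>c\<in>set \<beta>s - set (b # bs). sg v c) = (if False then sg v b else - sg v b) + (\<Sum>c\<in>set \<beta>s - set bs. sg v c) \<and>
        (\<Sum>c\<in>set \<beta>s - set (b # bs). sg v c) = int (len \<alpha> (refl b \<circ> v)) - int (len \<alpha> v) + (\<Sum>c\<in>set \<beta>s - set bs. sg (refl b \<circ> v) c)"
      unfolding e s1(1) n if_False by (intro conjI bp(1)) (use ch in linarith)+
  qed simp
  then show ?thesis unfolding rho_Y_canonical by simp
qed

end

section \<open>The expansion over quantum walks\<close>

lemma word_sequence_reduced:
  assumes lam: "minuscule \<Delta> \<alpha> lam" and u: "u \<in> W" "u = word_prod \<alpha> js" "length js = len \<alpha> u"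
    and \<kappa>: "\<kappa> = 1 \<or> \<kappa> = -1" and iv: "invs (inv u) = {a\<in>pos. lam \<bullet> a = \<kappa>}"
  shows "distinct (fwalls id js)" "set (fwalls id js) = {a\<in>pos. lam \<bullet> a = \<kappa>}"
    "sorted_wrt (\<lambda>a b. a \<bullet> b = 0 \<or> (a \<bullet> b = 1 \<and> \<rho> \<bullet> a < \<rho> \<bullet> b)) (fwalls id js)"
proof -
  have lv: "lam \<bullet> a \<in> {0,1,-1}" if "a \<in> \<Delta>" for a using lam that by (simp add: minuscule_def)
  have red: "len \<alpha> (word_prod \<alpha> js) = length js" using u by simp
  have iv': "invs (inv (word_prod \<alpha> js)) = {a\<in>pos. lam \<bullet> a = \<kappa>}" using iv u by simp
  note F = fwalls_reduced[OF red _ \<kappa> iv']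
  show "distinct (fwalls id js)" "set (fwalls id js) = {a\<in>pos. lam \<bullet> a = \<kappa>}"
    "sorted_wrt (\<lambda>a b. a \<bullet> b = 0 \<or> (a \<bullet> b = 1 \<and> \<rho> \<bullet> a < \<rho> \<bullet> b)) (fwalls id js)"
    by (rule F, rule lv, assumption)+
qed

lemma g_minus_walk:
  assumes "length us = length bs" "\<And>t. t < length bs \<Longrightarrow> \<eta> (Suc t) = bs ! t"
  shows "g_minus \<Delta> \<alpha> (length bs) \<eta> v (us @ ts) = walk_coeff False bs v us"
  unfolding g_minus_def walk_coeff_prod[OF assms(1)]
proof (rule prod.cong[OF HOL.refl])
  fix t assume t: "t \<in> {1..length bs}"
  then obtain s where s: "t = Suc s" "s < length bs" by (cases t) auto
  have 1: "(v # us @ ts) ! t = (v # us) ! t" "(v # us @ ts) ! (t - 1) = (v # us) ! (t - 1)"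
    using s assms(1) by (simp_all add: nth_append nth_Cons split: nat.split)
  have 2: "\<eta> t = bs ! (t - 1)" using assms(2)[OF s(2)] s(1) by simp
  show "(let w' = (v # us @ ts) ! (t - 1); w'' = (v # us @ ts) ! t; b = inv w' (\<eta> t) in
     if w'' = w' \<and> \<rho> \<bullet> b = 1 then 1 - laur_X \<alpha> (- b)
     else if bruhat_less \<Delta> \<alpha> w'' w' then - laur_X \<alpha> b
     else 1) = step_coeff False ((v # us) ! (t - 1)) ((v # us) ! t) (bs ! (t - 1))"
    unfolding Let_def 1 2 step_coeff_def if_False by (rule HOL.refl)
qed

lemma g_plus_walk:
  assumes "length us = l" "length ts = length cs" "\<And>t. t < length cs \<Longrightarrow> \<eta> (Suc (l + t)) = cs ! t"
  shows "g_plus \<Delta> \<alpha> l (l + length cs) \<eta> v (us @ ts) = walk_coeff True cs (last (v # us)) ts"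
proof -
  let ?f = "\<lambda>t. let w' = (v # us @ ts) ! (t - 1); w'' = (v # us @ ts) ! t; b = inv w' (\<eta> t) in
     if w'' = w' \<and> \<rho> \<bullet> b = -1 then 1 - laur_X \<alpha> b
     else if bruhat_less \<Delta> \<alpha> w'' w' then laur_X \<alpha> b
     else if bruhat_less \<Delta> \<alpha> w' w'' then -1 else 1"
  have nth: "(v # us @ ts) ! (l + s) = (last (v # us) # ts) ! s" for s
  proof -
    have "v # us @ ts = butlast (v # us) @ (last (v # us) # ts)" using append_butlast_last_id[of "v # us"] by simp
    moreover have "length (butlast (v # us)) = l" unfolding length_butlast using assms(1) by simp
    ultimately show ?thesis by (metis nth_append_length_plus)
  qed
  have "g_plus \<Delta> \<alpha> l (l + length cs) \<eta> v (us @ ts) = (\<Prod>t\<in>{l<..l + length cs}. ?f t)"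
    unfolding g_plus_def by (rule HOL.refl)
  also have "\<dots> = (\<Prod>t\<in>{1..length cs}. step_coeff True ((last (v # us) # ts) ! (t - 1)) ((last (v # us) # ts) ! t) (cs ! (t - 1)))"
  proof (rule prod.reindex_bij_witness[of _ "\<lambda>t. l + t" "\<lambda>t. t - l"])
    fix t assume "t \<in> {l<..l + length cs}"
    then obtain s where s: "t = l + Suc s" "s < length cs" by (auto dest!: less_imp_Suc_add)
    have 1: "(v # us @ ts) ! t = (last (v # us) # ts) ! (t - l)" unfolding s nth by simp
    have 2: "(v # us @ ts) ! (t - 1) = (last (v # us) # ts) ! (t - l - 1)" using nth[of s] by (simp add: s)
    have 3: "\<eta> t = cs ! (t - l - 1)" using assms(3)[OF s(2)] by (simp add: s)
    show "step_coeff True ((last (v # us) # ts) ! (t - l - 1)) ((last (v # us) # ts) ! (t - l)) (cs ! (t - l - 1)) = ?f t"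
      unfolding Let_def 1 2 3 step_coeff_def if_True by (rule HOL.refl)
  qed auto
  also have "\<dots> = walk_coeff True cs (last (v # us)) ts" by (rule walk_coeff_prod[OF assms(2), symmetric])
  finally show ?thesis .
qed

text \<open>
  Each walk is split after its step \<open>l\<close>, where \<open>g\<^sup>-\<close> ends, the translation acts and \<open>g\<^sup>+\<close> begins. Both
  sides are then compared entry by entry, with the entries on the left determined by the
  uniqueness of limits.
\<close>

lemma walk_expansion:
  assumes mn: "minuscule \<Delta> \<alpha> (\<omega> k)" and x: "x \<in> min_reps \<alpha> (UNIV - {k})" and lam: "lam = x (\<omega> k)"
    and y: "y \<in> W" and z: "min_rep \<alpha> (UNIV - {k}) (longest \<alpha>) = y \<circ> x"
    and l: "l = len \<alpha> x" and m: "m = len \<alpha> y" and n: "n = len \<alpha> (y \<circ> x)"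
    and xw: "x = word_prod \<alpha> (map j (rev [1..<l+1]))" and yw: "y = word_prod \<alpha> (map i [1..<m+1])"
    and \<eta>: "\<eta> = root_seq \<alpha> l j m i" and w: "w \<in> W"
  shows "matrix_row \<alpha> (rho0_Y \<Delta> \<alpha> lam) w =
    (\<Sum>ws\<in>quantum_walks \<Delta> \<alpha> n \<eta> w.
       Poly_Mapping.single ((w # ws) ! n)
         (heis_mult \<alpha>
           (heis_mult \<alpha> (heis_fun (g_minus \<Delta> \<alpha> l \<eta> w ws)) (heis_t (inv ((w # ws) ! l) lam)))
           (heis_fun (g_plus \<Delta> \<alpha> l n \<eta> w ws))))" (is "_ = ?R")
proof -
  note lev = minuscule_levels[OF mn x lam y z]
  let ?js = "map j (rev [1..<l+1])" and ?is = "map i (rev [1..<m+1])"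
  define \<beta>s where "\<beta>s = fwalls id ?js"
  define \<gamma>s where "\<gamma>s = rev (fwalls id ?is)"
  have lb: "length \<beta>s = l" and lc: "length \<gamma>s = m" by (simp_all add: \<beta>s_def \<gamma>s_def del: upt_Suc)
  have nlm: "n = l + m" using n lev(5) l m by simp
  have lj: "length ?js = len \<alpha> x" using l by (simp del: upt_Suc)
  have k: "(-1 :: real) = 1 \<or> (-1 :: real) = -1" "(1 :: real) = 1 \<or> (1 :: real) = -1" by simp_all
  note b = word_sequence_reduced[OF lev(1) lev(2) xw lj k(1) lev(3), folded \<beta>s_def]
  have iy: "inv y = word_prod \<alpha> ?is"
  proof (rule inv_unique_comp)
    have r: "?is = rev (map i [1..<m+1])" by (simp add: rev_map del: upt_Suc)
    show "word_prod \<alpha> ?is \<circ> y = id" unfolding r yw by (rule word_prod_rev)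
    show "y \<circ> word_prod \<alpha> ?is = id" unfolding r yw using word_prod_rev[of "rev (map i [1..<m+1])"] by (simp only: rev_rev_ident)
  qed
  have li: "length ?is = len \<alpha> (inv y)"
    using m card_invs_inv[OF y] len_invs[OF y] len_invs[OF W_inverse(1)[OF y]] by (simp del: upt_Suc)
  have ii: "inv (inv y) = y" by (rule inv_inv_eq[OF W_inverse(4)[OF y]])
  have iv: "invs (inv (inv y)) = {a\<in>pos. lam \<bullet> a = 1}" unfolding ii by (rule lev(4))
  have rg: "rev \<gamma>s = fwalls id ?is" by (simp only: \<gamma>s_def rev_rev_ident)
  note c = word_sequence_reduced[OF lev(1) W_inverse(1)[OF y] iy li k(2) iv, folded rg]
  have bp: "set \<beta>s \<subseteq> pos" "set \<gamma>s \<subseteq> pos" using b(2) c(2) unfolding set_rev by auto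
  have bc: "set (\<beta>s @ \<gamma>s) \<subseteq> pos" using bp by simp
  have \<eta>s: "\<eta> (Suc t) = (\<beta>s @ \<gamma>s) ! t" for t
    unfolding \<eta> root_seq_def root_beta_fwalls root_gamma_fwalls \<beta>s_def \<gamma>s_def diff_Suc_1 by (rule HOL.refl)
  have end_nth: "(z # us @ ts) ! length us = last (z # us)" for z :: "'a \<Rightarrow> 'a" and us ts
    using last_conv_nth[of "z # us"] nth_append[of "z # us" ts "length us"] by simp
  define H where "H u v = (Poly_Mapping.single (inv u lam) v :: ('a, 'i) heis)" for u v
  define C where "C us ts = walk_coeff False \<beta>s w us *
      trans_act \<alpha> (inv (last (w # us)) lam) (walk_coeff True \<gamma>s (last (w # us)) ts)" for us ts
  have "quantum_walks \<Delta> \<alpha> n \<eta> w = walks (\<beta>s @ \<gamma>s) w"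
    using quantum_walks_eq[OF w bc \<eta>s] by (simp add: lb lc nlm)
  then have "?R = (\<Sum>ws\<in>walks (\<beta>s @ \<gamma>s) w. Poly_Mapping.single ((w # ws) ! n)
         (heis_mult \<alpha>
           (heis_mult \<alpha> (heis_fun (g_minus \<Delta> \<alpha> l \<eta> w ws)) (heis_t (inv ((w # ws) ! l) lam)))
           (heis_fun (g_plus \<Delta> \<alpha> l n \<eta> w ws))))" by (simp only:)
  also have "\<dots> = (\<Sum>us\<in>walks \<beta>s w. \<Sum>ts\<in>walks \<gamma>s (last (w # us)).
      Poly_Mapping.single (last (last (w # us) # ts)) (H (last (w # us)) (C us ts)))"
    unfolding sum_walks_append[OF w bp(1)]
  proof (intro sum.cong HOL.refl)
    fix us ts assume us: "us \<in> walks \<beta>s w" and ts: "ts \<in> walks \<gamma>s (last (w # us))"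
    have lu: "length us = l" and lt: "length ts = m" using length_walks[OF us] length_walks[OF ts] lb lc by simp_all
    have n1: "(w # us @ ts) ! l = last (w # us)" unfolding end_nth[of w us ts, unfolded lu] by (rule HOL.refl)
    have n2: "(w # us @ ts) ! n = last (last (w # us) # ts)"
    proof -
      have "length (us @ ts) = n" by (simp add: nlm lu lt)
      then have "(w # us @ ts) ! n = last (w # us @ ts)" using end_nth[of w "us @ ts" "[]"] by simp
      then show ?thesis by simp
    qed
    have g1: "g_minus \<Delta> \<alpha> l \<eta> w (us @ ts) = walk_coeff False \<beta>s w us"
      using g_minus_walk[of us \<beta>s \<eta> w ts] lu by (simp add: lb \<eta>s nth_append)
    have g2: "g_plus \<Delta> \<alpha> l n \<eta> w (us @ ts) = walk_coeff True \<gamma>s (last (w # us)) ts"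
      using g_plus_walk[of us l ts \<gamma>s \<eta> w] lu lt by (simp add: lc lb \<eta>s nth_append nlm)
    show "Poly_Mapping.single ((w # us @ ts) ! n)
         (heis_mult \<alpha>
           (heis_mult \<alpha> (heis_fun (g_minus \<Delta> \<alpha> l \<eta> w (us @ ts))) (heis_t (inv ((w # us @ ts) ! l) lam)))
           (heis_fun (g_plus \<Delta> \<alpha> l n \<eta> w (us @ ts)))) =
       Poly_Mapping.single (last (last (w # us) # ts)) (H (last (w # us)) (C us ts))"
      unfolding n1 n2 g1 g2 heis_walk H_def C_def by (rule HOL.refl)
  qed
  finally have R: "?R = (\<Sum>us\<in>walks \<beta>s w. \<Sum>ts\<in>walks \<gamma>s (last (w # us)).
      Poly_Mapping.single (last (last (w # us) # ts)) (H (last (w # us)) (C us ts)))" .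
  have uW: "last (w # us) \<in> W" if us: "us \<in> walks \<beta>s w" for us
    using walks_W[OF w bp(1) us] w by (cases us rule: rev_cases) auto
  have lim: "vlim (Poly_Mapping.lookup (kap (rho_Y \<Delta> \<alpha> lam) w w') \<mu>) (Poly_Mapping.lookup (Poly_Mapping.lookup ?R w') \<mu>)" for w' \<mu>
  proof -
    let ?\<delta> = "\<lambda>u. if u = w' then 1 else (0 :: 'i laur)"
    have "Poly_Mapping.lookup (Poly_Mapping.lookup ?R w') \<mu> = (\<Sum>us\<in>walks \<beta>s w. \<Sum>ts\<in>walks \<gamma>s (last (w # us)).
       if inv (last (w # us)) lam = \<mu> then C us ts * ?\<delta> (last (last (w # us) # ts)) else 0)"
      unfolding R lookup_sum by (intro sum.cong HOL.refl) (simp add: H_def lookup_single when_def)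
    also have "\<dots> = (\<Sum>us\<in>walks \<beta>s w. walk_coeff False \<beta>s w us * (if inv (last (w # us)) lam = \<mu>
        then trans_act \<alpha> (inv (last (w # us)) lam) (walk_sum True ?\<delta> \<gamma>s (last (w # us))) else 0))"
    proof (rule sum.cong[OF HOL.refl])
      fix us assume us: "us \<in> walks \<beta>s w"
      define u where "u = last (w # us)"
      have t: "trans_act \<alpha> (inv u lam) (f * ?\<delta> v) = trans_act \<alpha> (inv u lam) f * ?\<delta> v" for f v
        by (simp add: trans_act_hom)
      have "walk_sum True ?\<delta> \<gamma>s u = (\<Sum>ts\<in>walks \<gamma>s u. walk_coeff True \<gamma>s u ts * ?\<delta> (last (u # ts)))"
        unfolding u_def by (rule walk_sum_eq[OF uW[OF us] bp(2)])
      then have "walk_coeff False \<beta>s w us * trans_act \<alpha> (inv u lam) (walk_sum True ?\<delta> \<gamma>s u)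
        = (\<Sum>ts\<in>walks \<gamma>s u. C us ts * ?\<delta> (last (u # ts)))"
        unfolding C_def u_def[symmetric] by (simp only: trans_act_sum t sum_distrib_left mult.assoc)
      then show "(\<Sum>ts\<in>walks \<gamma>s (last (w # us)). if inv (last (w # us)) lam = \<mu> then C us ts * ?\<delta> (last (last (w # us) # ts)) else 0)
        = walk_coeff False \<beta>s w us * (if inv (last (w # us)) lam = \<mu>
        then trans_act \<alpha> (inv (last (w # us)) lam) (walk_sum True ?\<delta> \<gamma>s (last (w # us))) else 0)"
        unfolding u_def[symmetric] by (cases "inv u lam = \<mu>") (simp_all only: if_True if_False simp_thms mult_zero_right sum.neutral_const)
    qed
    also have "\<dots> = walk_sum False (\<lambda>u. if inv u lam = \<mu> then trans_act \<alpha> (inv u lam) (walk_sum True ?\<delta> \<gamma>s u) else 0) \<beta>s w"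
      by (rule walk_sum_eq[OF w bp(1), symmetric])
    finally show ?thesis using Y_limit[OF lev(1) b c w, of w' \<mu>] by (simp only:)
  qed
  have rho0: "rho0_Y \<Delta> \<alpha> lam w w' = Poly_Mapping.lookup ?R w'" for w'
    unfolding rho0_Y_def
  proof (rule the_equality)
    show "entry_has_v_limit (kap (rho_Y \<Delta> \<alpha> lam) w w') (Poly_Mapping.lookup ?R w')"
      unfolding entry_has_v_limit_def using vlim_has_v_limit[OF lim] by blast
    fix h assume h: "entry_has_v_limit (kap (rho_Y \<Delta> \<alpha> lam) w w') h"
    show "h = Poly_Mapping.lookup ?R w'"
    proof (rule poly_mapping_eqI)
      fix \<mu>
      have "has_v_limit (Poly_Mapping.lookup (kap (rho_Y \<Delta> \<alpha> lam) w w') \<mu>) (Poly_Mapping.lookup h \<mu>)"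
        using h unfolding entry_has_v_limit_def by blast
      from has_v_limit_unique[OF this vlim_has_v_limit[OF lim]]
      show "Poly_Mapping.lookup h \<mu> = Poly_Mapping.lookup (Poly_Mapping.lookup ?R w') \<mu>" .
    qed
  qed
  have "Poly_Mapping.lookup ?R v = 0" if v: "v \<notin> W" for v
    unfolding R lookup_sum
  proof (intro sum.neutral ballI)
    fix us ts assume us: "us \<in> walks \<beta>s w" and ts: "ts \<in> walks \<gamma>s (last (w # us))"
    have "last (last (w # us) # ts) \<in> W"
      using walks_W[OF uW[OF us] bp(2) ts] uW[OF us] by (cases ts rule: rev_cases) auto
    then have "last (last (w # us) # ts) \<noteq> v" using v by blast
    then show "Poly_Mapping.lookup (Poly_Mapping.single (last (last (w # us) # ts)) (H (last (w # us)) (C us ts))) v = 0"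
      by (rule lookup_single_not_eq)
  qed
  note out = this
  show ?thesis
  proof (rule poly_mapping_eqI)
    fix v
    have "Poly_Mapping.lookup (matrix_row \<alpha> (rho0_Y \<Delta> \<alpha> lam) w) v = (\<Sum>v'\<in>W. if v' = v then Poly_Mapping.lookup ?R v' else 0)"
      unfolding matrix_row_def lookup_sum rho0 by (rule sum.cong) (simp_all add: lookup_single when_def)
    also have "\<dots> = Poly_Mapping.lookup ?R v"
      using out[of v] by (simp add: finite_W sum.delta)
    finally show "Poly_Mapping.lookup (matrix_row \<alpha> (rho0_Y \<Delta> \<alpha> lam) w) v = Poly_Mapping.lookup ?R v" .
  qed
qed

end

theorem theorem3p7:
  fixes \<Delta> :: "'a::euclidean_space set"
    and \<alpha> :: "'i::{finite,linorder} \<Rightarrow> 'a"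
    and k :: 'i and J :: "'i set"
    and x y w :: "'a \<Rightarrow> 'a" and lam :: 'a
    and l m n :: nat and i j :: "nat \<Rightarrow> 'i" and \<eta> :: "nat \<Rightarrow> 'a"
  assumes "root_system \<Delta>" and "irreducible_roots \<Delta>" and "simply_laced \<Delta>"
    and "simple_system \<Delta> \<alpha>" and "\<not> type_E8 \<alpha>"
    and "minuscule \<Delta> \<alpha> (fund_weight \<alpha> k)"
    and "J = UNIV - {k}"
    and "x \<in> min_reps \<alpha> J"
    and "lam = x (fund_weight \<alpha> k)"
    and "y \<in> weyl \<alpha>" and "min_rep \<alpha> J (longest \<alpha>) = y \<circ> x"
    and "l = len \<alpha> x" and "m = len \<alpha> y" and "n = len \<alpha> (min_rep \<alpha> J (longest \<alpha>))"
    and "x = word_prod \<alpha> (map j (rev [1..<l+1]))"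
    and "y = word_prod \<alpha> (map i [1..<m+1])"
    and "\<eta> = root_seq \<alpha> l j m i"
    and "w \<in> weyl \<alpha>"
  shows "matrix_row \<alpha> (rho0_Y \<Delta> \<alpha> lam) w =
    (\<Sum>ws\<in>quantum_walks \<Delta> \<alpha> n \<eta> w.
       Poly_Mapping.single ((w # ws) ! n)
         (heis_mult \<alpha>
           (heis_mult \<alpha> (heis_fun (g_minus \<Delta> \<alpha> l \<eta> w ws)) (heis_t (inv ((w # ws) ! l) lam)))
           (heis_fun (g_plus \<Delta> \<alpha> l n \<eta> w ws))))"
proof -
  interpret sl_roots \<Delta> \<alpha> by unfold_locales fact+
  note J = \<open>J = UNIV - {k}\<close>
  have n: "n = len \<alpha> (y \<circ> x)"
    using \<open>n = len \<alpha> (min_rep \<alpha> J (longest \<alpha>))\<close> \<open>min_rep \<alpha> J (longest \<alpha>) = y \<circ> x\<close> by (simp only:)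
  show ?thesis
    by (rule walk_expansion[of k x lam y l m n j i \<eta> w, folded J]) (fact assms n)+
qed

end
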